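(* Let $V,\mathcal A,V_1,V_2,\kappa,\rho,(\beta_m),(\eta_m)$ satisfy all the standing assumptions listed in the context, let $(\Xi,(W,\|\cdot\|_W))\in SL_{V_2}(V)$ and let $x:\Omega\to V$ be an independent initial value leading to extinction. Put $$\nu:=\frac{1}{\mathbb E(\alpha_{e_{\overline x}(1)})}\,\mathbb E\left(\int_0^{\alpha_{e_{\overline x}(1)}}\Xi(\mathbb X_{\overline x}(\tau))\,d\tau\right)\in W .$$ Then $$\lim_{t\to\infty}\frac1t\int_0^t\Xi(\mathbb X_x(\tau))\,d\tau=\nu$$ almost surely, with convergence in the norm of $(W,\|\cdot\|_W)$. Moreover, if $(W,\|\cdot\|_W)$ is of type $2$, then $$\lim_{t\to\infty}\frac1{\sqrt t}\left(\int_0^t\Xi(\mathbb X_x(\tau))\,d\tau-t\nu\right)=Z$$ in distribution, as elements of $(W,\|\cdot\|_W)$, where $Z\sim N_W(0,Q)$ and $$Q:=\mathrm{Cov}_W\left(\sqrt{\tfrac{1}{\mathbb E(\alpha_{e_{\overline x}(1)})}}\int_0^{\alpha_{e_{\overline x}(1)}}\big(\Xi(\mathbb X_{\overline x}(\tau))-\nu\big)\,d\tau\right).$$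
   Context: Conventions. $(\Omega,\mathcal F,\mathbb P)$ is a complete probability space; all Banach spaces are real; $\mathfrak B(\cdot)$ is the Borel $\sigma$-algebra; for a separable Banach space $U$, $\mathcal M(\Omega;U)$ is the set of $\mathcal F$-$\mathfrak B(U)$-measurable maps $\Omega\to U$; $(\cdot)_+=\max(\cdot,0)$; $\mathbb N=\{1,2,\dots\}$; integrals of vector-valued functions are Bochner integrals. Semigroup. $(V,\|\cdot\|_V)$ is a separable Banach space and $\mathcal A:D(\mathcal A)\to 2^V$ is a multi-valued, densely defined ($\overline{D(\mathcal A)}=V$), m-accretive operator, i.e. $\|u_1-u_2\|_V\le\|u_1-u_2+\alpha(\hat u_1-\hat u_2)\|_V$ for all $\alpha>0$, $\hat u_i\in\mathcal A u_i$, and $R(\mathrm{Id}+\alpha\mathcal A)=V$ for all $\alpha>0$. $T_{\mathcal A}(\cdot)u:[0,\infty)\to V$ is the unique mild solution of $0\in v'(t)+\mathcal Av(t)$, $v(0)=u$ (equivalently $T_{\mathcal A}(t)u=\lim_k(\mathrm{Id}+\frac tk\mathcal A)^{-k}u$); $(T_{\mathcal A}(t))_{t\ge0}$ is a jointly continuous contractive semigroup on $V$. Spaces. $V_1,V_2\subseteq V$ are separable Banach spaces with continuous injections into $V$, such that: $T_{\mathcal A}(t)V_i\subseteq V_i$ for all $t\ge0$, $i=1,2$; there are constants $\kappa\in(0,\infty)$, $\rho\in(0,1)$ with $\|T_{\mathcal A}(t)v\|_{V_1}^\rho\le(-\kappa t+\|v\|_{V_1}^\rho)_+$ for all $t\ge0$,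 $v\in V_1$; and $\|T_{\mathcal A}(t)v\|_{V_2}\le\|v\|_{V_2}$ for all $t\ge0$, $v\in V_2$. (Norms $\|\cdot\|_{V_i}$ of random variables lying a.s. in $V_i$ are set to $0$ off $V_i$.) Noise. $(\eta_m)_{m\in\mathbb N}\subseteq\mathcal M(\Omega;V)$ and $(\beta_m)_{m\in\mathbb N}$, $\beta_m:\Omega\to(0,\infty)$ measurable, are i.i.d. sequences, independent of each other, with: $\eta_m\in V_1\cap V_2$ a.s.; $\mathbb E\|\eta_m\|_{V_2}^4<\infty$; for some $\hat\varepsilon>0$, $\mathbb E\|\eta_m\|_{V_1}^{\rho(11+\hat\varepsilon)}<\infty$ and $\mathbb E\beta_m^{11+\hat\varepsilon}<\infty$; and $-\kappa\mathbb E\beta_m+\mathbb E\|\eta_m\|_{V_1}^\rho<0$. Put $\alpha_0:=0$, $\alpha_m:=\sum_{k=1}^m\beta_k$. Process. For $x\in\mathcal M(\Omega;V)$: $X_{x,0}:=x$, $X_{x,m}:=T_{\mathcal A}(\beta_m)X_{x,m-1}+\eta_m$ ($m\in\mathbb N$), and $\mathbb X_x(t):=\sum_{m=0}^\infty T_{\mathcal A}((t-\alpha_m)_+)(X_{x,m})\,1_{[\alpha_m,\alpha_{m+1})}(t)$, $t\ge0$. Initial values. $x:\Omega\to V$ is an independent initial value leading to extinction if $x\in\mathcal M(\Omega;V)$, $x\in V_1\cap V_2$ a.s., $\mathbb E\|x\|_{V_1}^{2\rho}<\infty$, and $x$ is jointly independent of $(\beta_m)_m$ and $(\eta_m)_m$.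 Its extinction times are $e_x(1):=\min\{m\in\mathbb N:T_{\mathcal A}(\beta_m)X_{x,m-1}=0\}$ and $e_x(n):=\min\{m\in\mathbb N: m>e_x(n-1),\ T_{\mathcal A}(\beta_m)X_{x,m-1}=0\}$ for $n\ge2$ ($\min\emptyset=\infty$). They are a.s. finite, and $\alpha_{e_x(n)}$ denotes $\omega\mapsto\alpha_{e_x(n)(\omega)}(\omega)$ (defined a.s.). $\overline x\in\mathcal M(\Omega;V)$ denotes a random variable with the same distribution as $\eta_1$ which is jointly independent of $(\eta_m)_m$ and $(\beta_m)_m$; it is also an independent initial value leading to extinction. Functionals. $(\Xi,(W,\|\cdot\|_W))\in SL_{V_2}(V)$ means: $(W,\|\cdot\|_W)$ is a separable Banach space, $\Xi:V\to W$ is $\mathfrak B(V)$-$\mathfrak B(W)$-measurable, and there are $c_1,c_2\in[0,\infty)$ with $\|\Xi(v)\|_W\le c_1\|v\|_{V_2}+c_2$ for all $v\in V_2$. The integrals $\int_0^t\Xi(\mathbb X_x(\tau))d\tau$ exist for all $t\ge0$ outside a $\mathbb P$-null set. Gaussian notions. A separable Banach space $U$ is of type $2$ if there is $C>0$ with $\mathbb E\|\sum_{k=1}^nX_k\|_U^2\le C\sum_{k=1}^n\mathbb E\|X_k\|_U^2$ for all $n$ and all independent centered $X_1,\dots,X_n\in L^2(\Omega;U)$. $Y\in\mathcal M(\Omega;U)$ is Gaussian if $\langle Y,\psi\rangle$ is Gaussian (constants allowed) for all $\psi\in U'$. For $Y\in L^2(\Omega;U)$, $\mathrm{Cov}_U(Y)(\psi_1,\psi_2):=\mathbb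 E(\langle Y-\mathbb EY,\psi_1\rangle\langle Y-\mathbb EY,\psi_2\rangle)$, $\psi_1,\psi_2\in U'$. $Y\sim N_U(\mu,Q)$ means $Y$ is Gaussian with mean $\mu$ and covariance $Q$. Convergence in distribution in $U$ means convergence of $\mathbb Ef(\cdot)$ for all bounded continuous $f:U\to\mathbb R$. *)

theory Defs
  imports "HOL-Probability.Probability"
begin

text \<open>A multi-valued operator is a map into sets; its domain consists of the points
  with nonempty value.\<close>

definition op_domain :: "('v \<Rightarrow> 'v set) \<Rightarrow> 'v set" where
  "op_domain A = {u. A u \<noteq> {}}"

definition accretive :: "('v::real_normed_vector \<Rightarrow> 'v set) \<Rightarrow> bool" where
  "accretive A \<longleftrightarrow>
     (\<forall>\<alpha>>0. \<forall>u1 u2. \<forall>w1\<in>A u1. \<forall>w2\<in>A u2.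
        norm (u1 - u2) \<le> norm (u1 - u2 + \<alpha> *\<^sub>R (w1 - w2)))"

definition m_accretive :: "('v::real_normed_vector \<Rightarrow> 'v set) \<Rightarrow> bool" where
  "m_accretive A \<longleftrightarrow>
     accretive A \<and> (\<forall>\<alpha>>0. \<forall>u. \<exists>v. \<exists>w\<in>A v. v + \<alpha> *\<^sub>R w = u)"

text \<open>\<open>resolvent A \<alpha>\<close> is \<open>(Id + \<alpha> A)\<^sup>-\<^sup>1\<close>; for m-accretive \<open>A\<close> and \<open>\<alpha> > 0\<close> it is an
  everywhere defined single-valued map.\<close>

definition resolvent :: "('v::real_normed_vector \<Rightarrow> 'v set) \<Rightarrow> real \<Rightarrow> 'v \<Rightarrow> 'v" where
  "resolvent A \<alpha> u = (THE v. \<exists>w\<in>A v. v + \<alpha> *\<^sub>R w = u)"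

text \<open>The semigroup generated by \<open>-A\<close>, given by the exponential formula for the mild solution of
  \<open>0 \<in> v'(t) + A v(t)\<close>, \<open>v(0) = u\<close>. Time \<open>0\<close> is separate because \<open>resolvent A 0\<close> is the
  identity only on the domain of \<open>A\<close>.\<close>

definition semigroup_of :: "('v::real_normed_vector \<Rightarrow> 'v set) \<Rightarrow> real \<Rightarrow> 'v \<Rightarrow> 'v" where
  "semigroup_of A t u =
     (if t \<le> 0 then u else lim (\<lambda>k. (resolvent A (t / real k) ^^ k) u))"

text \<open>A Banach space \<open>V\<^sub>i\<close> embedded into \<open>V\<close> is a Banach space type with an injective
  bounded linear map \<open>j\<close> into \<open>V\<close>; as a subset of \<open>V\<close> it is \<open>range j\<close>. The norm
  of \<open>V\<^sub>i\<close>, seen on \<open>V\<close>, is set to \<open>0\<close> off \<open>range j\<close>.\<close>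

definition embedding :: "('u::real_normed_vector \<Rightarrow> 'v::real_normed_vector) \<Rightarrow> bool" where
  "embedding j \<longleftrightarrow> bounded_linear j \<and> inj j"

definition sub_norm :: "('u::real_normed_vector \<Rightarrow> 'v) \<Rightarrow> 'v \<Rightarrow> real" where
  "sub_norm j v = (if v \<in> range j then norm (inv j v) else 0)"

text \<open>The library's \<open>indep_var\<close> needs both random variables to have the same value type,
  so independence is stated for the generated sigma-algebras.\<close>

definition indep_rvs ::
  "'a measure \<Rightarrow> 'b measure \<Rightarrow> ('a \<Rightarrow> 'b) \<Rightarrow> 'c measure \<Rightarrow> ('a \<Rightarrow> 'c) \<Rightarrow> bool" where
  "indep_rvs M N X K Y \<longleftrightarrow>
     X \<in> M \<rightarrow>\<^sub>M N \<and> Y \<in> M \<rightarrow>\<^sub>M K \<and>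
     prob_space.indep_set M {X -` S \<inter> space M | S. S \<in> sets N} {Y -` S \<inter> space M | S. S \<in> sets K}"

text \<open>Sequences are indexed by \<open>1, 2, \<dots>\<close>; the entry at \<open>0\<close> is never used.\<close>

definition iid_seq :: "'a measure \<Rightarrow> (nat \<Rightarrow> 'a \<Rightarrow> 'b::topological_space) \<Rightarrow> bool" where
  "iid_seq M Y \<longleftrightarrow>
     prob_space.indep_vars M (\<lambda>_. borel) Y {1..} \<and>
     (\<forall>m\<ge>1. distr M borel (Y m) = distr M borel (Y 1))"

abbreviation seq_space :: "(nat \<Rightarrow> 'b::topological_space) measure" where
  "seq_space \<equiv> PiM {1..} (\<lambda>_. borel)"

definition seq_rv :: "(nat \<Rightarrow> 'a \<Rightarrow> 'b) \<Rightarrow> 'a \<Rightarrow> nat \<Rightarrow> 'b" where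
  "seq_rv Y \<omega> = (\<lambda>m\<in>{1..}. Y m \<omega>)"

definition arrival :: "(nat \<Rightarrow> 'a \<Rightarrow> real) \<Rightarrow> nat \<Rightarrow> 'a \<Rightarrow> real" where
  "arrival \<beta> m \<omega> = (\<Sum>k=1..m. \<beta> k \<omega>)"

primrec chain ::
  "('v::real_normed_vector \<Rightarrow> 'v set) \<Rightarrow> (nat \<Rightarrow> 'a \<Rightarrow> real) \<Rightarrow> (nat \<Rightarrow> 'a \<Rightarrow> 'v) \<Rightarrow> ('a \<Rightarrow> 'v)
   \<Rightarrow> nat \<Rightarrow> 'a \<Rightarrow> 'v" where
  "chain A \<beta> \<eta> x 0 \<omega> = x \<omega>"
| "chain A \<beta> \<eta> x (Suc m) \<omega> =
     semigroup_of A (\<beta> (Suc m) \<omega>) (chain A \<beta> \<eta> x m \<omega>) + \<eta> (Suc m) \<omega>"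

definition process ::
  "('v::real_normed_vector \<Rightarrow> 'v set) \<Rightarrow> (nat \<Rightarrow> 'a \<Rightarrow> real) \<Rightarrow> (nat \<Rightarrow> 'a \<Rightarrow> 'v) \<Rightarrow> ('a \<Rightarrow> 'v)
   \<Rightarrow> real \<Rightarrow> 'a \<Rightarrow> 'v" where
  "process A \<beta> \<eta> x t \<omega> =
     (\<Sum>m. indicator {arrival \<beta> m \<omega> ..< arrival \<beta> (Suc m) \<omega>} t *\<^sub>R
           semigroup_of A (max (t - arrival \<beta> m \<omega>) 0) (chain A \<beta> \<eta> x m \<omega>))"

text \<open>The infimum of the empty set is \<open>\<infinity>\<close>.\<close>

definition first_extinction ::
  "('v::real_normed_vector \<Rightarrow> 'v set) \<Rightarrow> (nat \<Rightarrow> 'a \<Rightarrow> real) \<Rightarrow> (nat \<Rightarrow> 'a \<Rightarrow> 'v) \<Rightarrow> ('a \<Rightarrow> 'v)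
   \<Rightarrow> 'a \<Rightarrow> enat" where
  "first_extinction A \<beta> \<eta> x \<omega> =
     Inf {enat m | m. m \<ge> 1 \<and> semigroup_of A (\<beta> m \<omega>) (chain A \<beta> \<eta> x (m - 1) \<omega>) = 0}"

text \<open>The arrival time with the first extinction index; it is meaningful only where that index
  is finite.\<close>

definition extinction_time ::
  "('v::real_normed_vector \<Rightarrow> 'v set) \<Rightarrow> (nat \<Rightarrow> 'a \<Rightarrow> real) \<Rightarrow> (nat \<Rightarrow> 'a \<Rightarrow> 'v) \<Rightarrow> ('a \<Rightarrow> 'v)
   \<Rightarrow> 'a \<Rightarrow> real" where
  "extinction_time A \<beta> \<eta> x \<omega> = arrival \<beta> (the_enat (first_extinction A \<beta> \<eta> x \<omega>)) \<omega>"

text \<open>Joint independence of the two noise sequences means independence of the pair.\<close>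

definition indep_of_noise ::
  "'a measure \<Rightarrow> (nat \<Rightarrow> 'a \<Rightarrow> real) \<Rightarrow> (nat \<Rightarrow> 'a \<Rightarrow> 'v::topological_space) \<Rightarrow> ('a \<Rightarrow> 'v) \<Rightarrow> bool" where
  "indep_of_noise M \<beta> \<eta> x \<longleftrightarrow>
     indep_rvs M borel x (seq_space \<Otimes>\<^sub>M seq_space) (\<lambda>\<omega>. (seq_rv \<beta> \<omega>, seq_rv \<eta> \<omega>))"

definition extinction_initial_value ::
  "'a measure \<Rightarrow> ('u1::real_normed_vector \<Rightarrow> 'v::real_normed_vector) \<Rightarrow>
   ('u2::real_normed_vector \<Rightarrow> 'v) \<Rightarrow> real \<Rightarrow> (nat \<Rightarrow> 'a \<Rightarrow> real) \<Rightarrow> (nat \<Rightarrow> 'a \<Rightarrow> 'v) \<Rightarrow> ('a \<Rightarrow> 'v) \<Rightarrow> bool" where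
  "extinction_initial_value M j1 j2 \<rho> \<beta> \<eta> x \<longleftrightarrow>
     x \<in> borel_measurable M \<and>
     (AE \<omega> in M. x \<omega> \<in> range j1 \<inter> range j2) \<and>
     integrable M (\<lambda>\<omega>. sub_norm j1 (x \<omega>) powr (2 * \<rho>)) \<and>
     indep_of_noise M \<beta> \<eta> x"

text \<open>The class \<open>SL\<close> of functionals of at most linear growth in the norm of the embedded space.\<close>

definition sublinear_functional ::
  "('u::real_normed_vector \<Rightarrow> 'v::topological_space) \<Rightarrow> ('v \<Rightarrow> 'w::real_normed_vector) \<Rightarrow> bool" where
  "sublinear_functional j \<Xi> \<longleftrightarrow>
     \<Xi> \<in> borel_measurable borel \<and>
     (\<exists>c1\<ge>0. \<exists>c2\<ge>0. \<forall>v\<in>range j. norm (\<Xi> v) \<le> c1 * sub_norm j v + c2)"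

definition L2_rv :: "'a measure \<Rightarrow> ('a \<Rightarrow> 'u::real_normed_vector) \<Rightarrow> bool" where
  "L2_rv M Y \<longleftrightarrow> Y \<in> borel_measurable M \<and> integrable M (\<lambda>\<omega>. (norm (Y \<omega>))\<^sup>2)"

text \<open>The constant \<open>C\<close> refers to independent variables on the given probability space \<open>M\<close>.\<close>

definition type_2 :: "'a measure \<Rightarrow> 'u::{banach, second_countable_topology} itself \<Rightarrow> bool" where
  "type_2 M U \<longleftrightarrow>
     (\<exists>C>0. \<forall>n. \<forall>X :: nat \<Rightarrow> 'a \<Rightarrow> 'u.
        prob_space.indep_vars M (\<lambda>_. borel) X {1..n} \<longrightarrow>
        (\<forall>k\<in>{1..n}. L2_rv M (X k) \<and> (LINT \<omega>|M. X k \<omega>) = 0) \<longrightarrow>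
        (LINT \<omega>|M. (norm (\<Sum>k=1..n. X k \<omega>))\<^sup>2) \<le> C * (\<Sum>k=1..n. LINT \<omega>|M. (norm (X k \<omega>))\<^sup>2))"

definition real_gaussian :: "'a measure \<Rightarrow> ('a \<Rightarrow> real) \<Rightarrow> bool" where
  "real_gaussian M Y \<longleftrightarrow>
     Y \<in> borel_measurable M \<and>
     ((\<exists>c. AE \<omega> in M. Y \<omega> = c) \<or>
      (\<exists>\<mu> \<sigma>. \<sigma> > 0 \<and> distributed M lborel Y (normal_density \<mu> \<sigma>)))"

definition gaussian :: "'a measure \<Rightarrow> ('a \<Rightarrow> 'u::real_normed_vector) \<Rightarrow> bool" where
  "gaussian M Y \<longleftrightarrow>
     Y \<in> borel_measurable M \<and>
     (\<forall>\<psi> :: 'u \<Rightarrow>\<^sub>L real. real_gaussian M (\<lambda>\<omega>. blinfun_apply \<psi> (Y \<omega>)))"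

definition Cov ::
  "'a measure \<Rightarrow> ('a \<Rightarrow> 'u::{banach, second_countable_topology}) \<Rightarrow> ('u \<Rightarrow>\<^sub>L real) \<Rightarrow> ('u \<Rightarrow>\<^sub>L real) \<Rightarrow> real" where
  "Cov M Y \<psi>1 \<psi>2 =
     (LINT \<omega>|M. blinfun_apply \<psi>1 (Y \<omega> - (LINT \<omega>'|M. Y \<omega>')) *
                blinfun_apply \<psi>2 (Y \<omega> - (LINT \<omega>'|M. Y \<omega>')))"

definition normal_rv ::
  "'a measure \<Rightarrow> ('a \<Rightarrow> 'u::{banach, second_countable_topology}) \<Rightarrow> 'u \<Rightarrow>
   (('u \<Rightarrow>\<^sub>L real) \<Rightarrow> ('u \<Rightarrow>\<^sub>L real) \<Rightarrow> real) \<Rightarrow> bool" where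
  "normal_rv M Y \<mu> Q \<longleftrightarrow> gaussian M Y \<and> L2_rv M Y \<and> (LINT \<omega>|M. Y \<omega>) = \<mu> \<and> Cov M Y = Q"

text \<open>Convergence in distribution as \<open>t \<rightarrow> \<infinity>\<close>; the limit may live on another probability space.\<close>

definition converges_in_distr ::
  "'a measure \<Rightarrow> (real \<Rightarrow> 'a \<Rightarrow> 'u::topological_space) \<Rightarrow> 'b measure \<Rightarrow> ('b \<Rightarrow> 'u) \<Rightarrow> bool" where
  "converges_in_distr M Y N Z \<longleftrightarrow>
     (\<forall>f :: 'u \<Rightarrow> real. continuous_on UNIV f \<longrightarrow> bounded (range f) \<longrightarrow>
        ((\<lambda>t. LINT \<omega>|M. f (Y t \<omega>)) \<longlongrightarrow> (LINT \<omega>|N. f (Z \<omega>))) at_top)"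

end

theory Submission
 imports Defs "HOL-Library.Discrete_Functions"
begin

text \<open>At an extinction the Markov chain is renewed, so the path splits into a first cycle and i.i.d. cycles
 that are distributed like the path from \<open>xbar\<close> up to its first extinction. While the chain has not died
 out, the \<open>\<rho>\<close>-th power of its norm in the first embedded space is dominated by a random walk with
 negative drift; a tenth moment estimate bounds the tail of the cycle length by \<open>C / k\<^sup>5\<close>, and Hoelder's
 inequality turns this into fourth moments of the duration of a cycle and of the noise collected in it.
 Hence the integral over one cycle and its fluctuations inside the cycle are square integrable. The strong
 law follows from the renewal reward theorem. For the central limit theorem in a space of type 2, the
 type 2 inequality reduces convergence to finite rank approximations of the cycle integrals, and, through
 Ottaviani's inequality, allows to replace the random number of cycles by a deterministic one (Anscombe).
 Joint measurability of the semigroup comes from continuity of the resolvents in the exponential formula,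
 measurability of the embedded norms from the Lusin--Souslin theorem.\<close>

section \<open>Measurability of the semigroup\<close>

text \<open>The initial value is absorbed into the noise: \<open>noise\<close> pairs the jump
  \<open>\<eta> m\<close> (for \<open>m = 0\<close> the initial value) with the waiting time
  \<open>\<beta> (Suc m)\<close> after it, and \<open>walk\<close> records the value just before a
  jump. It starts at 0, so extinction is a return to 0, the same functionals of a sequence describe
  \<open>x\<close> and \<open>xbar\<close>, and after a return only the shifted sequence matters.
  For \<open>xbar\<close> the whole sequence is i.i.d., for \<open>x\<close> only from index 1 on,
  which is why the first cycle is split off. The type 2 constant belongs to the given space
  \<open>M\<close>, while the limit lives on a product of standard normals: second moment bounds are
  proved on \<open>M\<close> and carried over by truncation and Fatou's lemma, and the Gaussian
  limit is built as an almost sure limit of finite sums. A cycle integral is bounded by a product of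
  duration and load, so its square needs fourth moments of both. With weights
  \<open>k powr (- a)\<close>, Hoelder's inequality needs \<open>a > 1\<close> and, for a tail of
  order \<open>1 / k ^ 5\<close>, also \<open>3 * a < 4\<close>; a tail of order
  \<open>1 / k ^ 4\<close> would leave no room, so the tenth moment is the first even one that
  works.\<close>

lemma resolvent_eqI:
 assumes "accretive A" "\<alpha> > 0" "w \<in> A v" "v + \<alpha> *\<^sub>R w = u"
 shows "resolvent A \<alpha> u = v"
 unfolding resolvent_def
proof (rule the_equality)
 fix v' assume "\<exists>w\<in>A v'. v' + \<alpha> *\<^sub>R w = u"
 then obtain w' where w': "w' \<in> A v'" "v' + \<alpha> *\<^sub>R w' = u" by blast
 have "norm (v' - v) \<le> norm (v' - v + \<alpha> *\<^sub>R (w' - w))"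
  using assms w'(1) unfolding accretive_def by blast
 also have "v' - v + \<alpha> *\<^sub>R (w' - w) = 0"
  using w'(2) assms(4) by (simp add: algebra_simps)
 finally show "v' = v" by simp
qed (use assms in blast)

text \<open>Quantitative form of the resolvent identity. Accretivity at the parameter
  \<open>a\<close> gives nonexpansiveness in \<open>u\<close>; the element of \<open>A v'\<close> is
  the Yosida quotient \<open>(u' - v') / b\<close>, and its norm measures the cost of changing the
  parameter.\<close>

lemma resolvent_dist_le:
 assumes "m_accretive A" "a > 0" "b > 0"
 shows "norm (resolvent A a u - resolvent A b u')
  \<le> norm (u - u') + \<bar>a - b\<bar> / b * norm (u' - resolvent A b u')"
proof -
 have acc: "accretive A" using assms by (simp add: m_accretive_def)
 obtain v w where vw: "w \<in> A v" "v + a *\<^sub>R w = u"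
  using assms(1,2) unfolding m_accretive_def by metis
 obtain v' w' where vw': "w' \<in> A v'" "v' + b *\<^sub>R w' = u'"
  using assms(1,3) unfolding m_accretive_def by metis
 have r: "resolvent A a u = v" "resolvent A b u' = v'"
  using resolvent_eqI[OF acc] assms vw vw' by blast+
 have w': "w' = (1 / b) *\<^sub>R (u' - v')"
  using vw'(2) assms(3) by (auto simp: algebra_simps)
 have "norm (v - v') \<le> norm (v - v' + a *\<^sub>R (w - w'))"
  using acc assms(2) vw(1) vw'(1) unfolding accretive_def by blast
 also have "v - v' + a *\<^sub>R (w - w') = (u - u') + (b - a) *\<^sub>R w'"
  unfolding vw(2)[symmetric] vw'(2)[symmetric] by (simp add: algebra_simps)
 also have "norm \<dots> \<le> norm (u - u') + norm ((b - a) *\<^sub>R w')"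
  by (rule norm_triangle_ineq)
 also have "norm ((b - a) *\<^sub>R w') = \<bar>a - b\<bar> / b * norm (u' - v')"
  unfolding w' using assms(3) by (simp add: abs_minus_commute)
 finally show ?thesis unfolding r .
qed

text \<open>Joint continuity in parameter and point is required, because the exponential formula is
  read as a function of time and point at once and the resolvents in it are iterated.\<close>

lemma continuous_on_resolvent:
 fixes A :: "'v::real_normed_vector \<Rightarrow> 'v set"
 assumes "m_accretive A"
 shows "continuous_on ({0<..} \<times> UNIV) (\<lambda>p. resolvent A (fst p) (snd p))"
 unfolding continuous_on_def
proof
 fix p :: "real \<times> 'v" assume "p \<in> {0<..} \<times> UNIV"
 then have b: "fst p > 0" by auto
 let ?F = "at p within {0<..} \<times> UNIV"
 let ?K = "norm (snd p - resolvent A (fst p) (snd p))"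
 have t: "((\<lambda>q. q) \<longlongrightarrow> p) ?F" by (rule tendsto_ident_at)
 have "((\<lambda>q. norm (snd q - snd p) + \<bar>fst q - fst p\<bar> / fst p * ?K) \<longlongrightarrow>
   norm (snd p - snd p) + \<bar>fst p - fst p\<bar> / fst p * ?K) ?F"
  using b by (intro tendsto_intros tendsto_fst[OF t] tendsto_snd[OF t]) auto
 then have 0: "((\<lambda>q. norm (snd q - snd p) + \<bar>fst q - fst p\<bar> / fst p * ?K) \<longlongrightarrow> 0) ?F"
  by simp
 have "((\<lambda>q. resolvent A (fst q) (snd q) - resolvent A (fst p) (snd p)) \<longlongrightarrow> 0) ?F"
 proof (rule Lim_null_comparison[OF _ 0])
  show "\<forall>\<^sub>F q in ?F. norm (resolvent A (fst q) (snd q) - resolvent A (fst p) (snd p))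
    \<le> norm (snd q - snd p) + \<bar>fst q - fst p\<bar> / fst p * ?K"
   unfolding eventually_at_filter
   using resolvent_dist_le[OF assms _ b] by (intro always_eventually) (auto simp del: times_divide_eq_left)
 qed
 then show "((\<lambda>p. resolvent A (fst p) (snd p)) \<longlongrightarrow> resolvent A (fst p) (snd p)) ?F"
  using Lim_null by blast
qed

lemma semigroup_of_measurable:
 fixes A :: "'v::{banach, second_countable_topology} \<Rightarrow> 'v set"
 assumes "m_accretive A"
 shows "(\<lambda>p. semigroup_of A (fst p) (snd p)) \<in> borel_measurable borel"
proof -
 have iter: "continuous_on ({0<..} \<times> UNIV) (\<lambda>p. ((resolvent A (fst p / real k)) ^^ n) (snd p))"
  if "k > 0" for k n
 proof (induction n)
  case 0
  show ?case by (auto intro!: continuous_intros)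
 next
  case (Suc n)
  have "continuous_on ({0<..} \<times> UNIV)
    (\<lambda>p. (fst p / real k, ((resolvent A (fst p / real k)) ^^ n) (snd p)))"
   using that by (intro continuous_intros Suc) auto
  from continuous_on_compose2[OF continuous_on_resolvent[OF assms] this]
  show ?case using that by (auto simp: image_subset_iff)
 qed
 have iter0: "continuous_on ({0<..} \<times> UNIV) (\<lambda>p. ((resolvent A (fst p / real k)) ^^ k) (snd p))" for k
  using iter[of k k] by (cases "k = 0") (auto intro!: continuous_intros)
 let ?S = "{0::real<..} \<times> (UNIV :: 'v set)"
 have S: "?S \<in> sets borel" by (intro borel_open open_Times) auto
 \<comment> \<open>The iterates are continuous for positive times; the cut-off extends them to
   measurable maps on the whole space, to which the measurability of pointwise limits
   applies.\<close>
 have m[measurable]: "(\<lambda>p. indicator ?S p *\<^sub>R ((resolvent A (fst p / real k)) ^^ k) (snd p))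
   \<in> borel_measurable borel" for k
  by (rule borel_measurable_continuous_on_indicator[OF S iter0])
 have "(\<lambda>p. lim (\<lambda>k. indicator ?S p *\<^sub>R ((resolvent A (fst p / real k)) ^^ k) (snd p)))
   \<in> borel_measurable borel"
  by (intro borel_measurable_lim_metric m)
 note this[measurable]
 have *: "(\<lambda>p. semigroup_of A (fst p) (snd p)) =
   (\<lambda>p. if fst p \<le> 0 then snd p else
    lim (\<lambda>k. indicator ?S p *\<^sub>R ((resolvent A (fst p / real k)) ^^ k) (snd p)))"
  by (auto simp: semigroup_of_def fun_eq_iff indicator_def mem_Times_iff)
 have [measurable]: "fst \<in> borel_measurable (borel :: (real \<times> 'v) measure)"
   "snd \<in> borel_measurable (borel :: (real \<times> 'v) measure)"
  by (auto intro!: borel_measurable_continuous_onI continuous_intros)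
 have "Measurable.pred borel (\<lambda>p :: real \<times> 'v. fst p \<le> 0)"
  by measurable
 then show ?thesis unfolding * by (intro measurable_If) auto
qed

section \<open>The Lusin--Souslin theorem\<close>

definition borel_separated :: "'b::topological_space set \<Rightarrow> 'b set \<Rightarrow> bool" where
 "borel_separated P Q \<longleftrightarrow> (\<exists>B\<in>sets borel. P \<subseteq> B \<and> Q \<inter> B = {})"

text \<open>The separating set is a union over \<open>i\<close> of intersections over
  \<open>j\<close>. Contraposed, this drives the constructions below: if two countable unions cannot
  be separated, then some pair of pieces cannot be separated either.\<close>

lemma borel_separated_UN:
 fixes P Q :: "nat \<Rightarrow> 'b::topological_space set"
 assumes "\<And>i j. borel_separated (P i) (Q j)"
 shows "borel_separated (\<Union>i. P i) (\<Union>j. Q j)"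
proof -
 obtain B where B: "\<And>i j. B i j \<in> sets borel" "\<And>i j. P i \<subseteq> B i j" "\<And>i j. Q j \<inter> B i j = {}"
  using assms unfolding borel_separated_def by metis
 have "(\<Union>i. \<Inter>j. B i j) \<in> sets borel" using B(1)
  by (intro sets.countable_UN' sets.countable_INT'' ballI) (auto simp: countableI_type)
 moreover have "(\<Union>i. P i) \<subseteq> (\<Union>i. \<Inter>j. B i j)" using B(2) by blast
 moreover have "(\<Union>j. Q j) \<inter> (\<Union>i. \<Inter>j. B i j) = {}" using B(3) by blast
 ultimately show ?thesis unfolding borel_separated_def by blast
qed

lemma ex_dense_sequence:
 obtains d :: "nat \<Rightarrow> 'a::{metric_space, second_countable_topology}"
 where "\<And>e. e > 0 \<Longrightarrow> (\<Union>i. cball (d i) e) = UNIV"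
proof -
 obtain D :: "'a set" where D: "countable D" "\<And>X. open X \<Longrightarrow> X \<noteq> {} \<Longrightarrow> \<exists>d\<in>D. d \<in> X"
  by (erule countable_dense_setE)
 have ne: "D \<noteq> {}" using D(2)[of UNIV] by auto
 show ?thesis
 proof (rule that[of "from_nat_into D"])
  fix e :: real assume e: "e > 0"
  have "x \<in> (\<Union>i. cball (from_nat_into D i) e)" for x
  proof -
   obtain d where "d \<in> D" "d \<in> ball x e" using D(2)[of "ball x e"] e by auto
   moreover obtain i where "from_nat_into D i = d"
    using from_nat_into_surj[OF D(1) \<open>d \<in> D\<close>] by blast
   ultimately show ?thesis by (auto simp: dist_commute intro!: exI[of _ i] less_imp_le)
  qed
  then show "(\<Union>i. cball (from_nat_into D i) e) = UNIV" by blast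
 qed
qed

lemma image_cover:
 assumes "(\<Union>i. C i) = UNIV"
 shows "(\<Union>i. f ` (Y \<inter> C i)) = f ` Y"
proof -
 have "f ` Y = f ` (Y \<inter> (\<Union>i. C i))" using assms by simp
 also have "\<dots> = (\<Union>i. f ` (Y \<inter> C i))" by (simp only: Int_UN_distrib image_UN)
 finally show ?thesis by simp
qed

text \<open>Lusin's separation argument by contradiction. An inseparable pair is cut into ever
  smaller inseparable pairs, which shrink to two points with different images; by continuity an open
  set then separates a late pair after all.\<close>

lemma lusin_separation_closed:
 fixes f :: "'a::{complete_space, second_countable_topology} \<Rightarrow> 'b::t2_space"
 assumes f: "continuous_on UNIV f" and PQ: "closed P" "closed Q" and dj: "f ` P \<inter> f ` Q = {}"
 shows "borel_separated (f ` P) (f ` Q)"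
proof (rule ccontr)
 assume not: "\<not> borel_separated (f ` P) (f ` Q)"
 obtain d :: "nat \<Rightarrow> 'a" where d: "\<And>e. e > 0 \<Longrightarrow> (\<Union>i. cball (d i) e) = UNIV"
  by (rule ex_dense_sequence) blast
 \<comment> \<open>The radius condition is imposed from level 1 on, so that the pair
   \<open>(P, Q)\<close> itself can serve at level 0.\<close>
 define bad where "bad n X \<longleftrightarrow> closed (fst X) \<and> closed (snd X) \<and> fst X \<subseteq> P \<and> snd X \<subseteq> Q \<and>
   \<not> borel_separated (f ` fst X) (f ` snd X) \<and>
   (n > 0 \<longrightarrow> (\<exists>p q. fst X \<subseteq> cball p (1 / real n) \<and> snd X \<subseteq> cball q (1 / real n)))"
  for n :: nat and X :: "'a set \<times> 'a set"
 define sub where "sub n X Y \<longleftrightarrow> fst Y \<subseteq> fst X \<and> snd Y \<subseteq> snd X"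
  for n :: nat and X Y :: "'a set \<times> 'a set"
 have "\<exists>X. \<forall>n. bad n (X n) \<and> sub n (X n) (X (Suc n))"
 proof (rule dependent_nat_choice)
  show "\<exists>X. bad 0 X" using not PQ by (intro exI[of _ "(P, Q)"]) (simp add: bad_def)
  fix X n assume X: "bad n X"
  have "\<exists>i j. \<not> borel_separated (f ` (fst X \<inter> cball (d i) (1 / real (Suc n))))
    (f ` (snd X \<inter> cball (d j) (1 / real (Suc n))))"
  proof (rule ccontr)
   assume "\<not> ?thesis"
   then have "borel_separated (\<Union>i. f ` (fst X \<inter> cball (d i) (1 / real (Suc n))))
    (\<Union>j. f ` (snd X \<inter> cball (d j) (1 / real (Suc n))))"
    by (intro borel_separated_UN) blast
   then have "borel_separated (f ` fst X) (f ` snd X)"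
    by (simp add: image_cover[OF d] del: of_nat_Suc)
   with X show False unfolding bad_def by blast
  qed
  then obtain i j where ij: "\<not> borel_separated (f ` (fst X \<inter> cball (d i) (1 / real (Suc n))))
    (f ` (snd X \<inter> cball (d j) (1 / real (Suc n))))" by blast
  let ?Y = "(fst X \<inter> cball (d i) (1 / real (Suc n)), snd X \<inter> cball (d j) (1 / real (Suc n)))"
  have "\<exists>p q. fst ?Y \<subseteq> cball p (1 / real (Suc n)) \<and> snd ?Y \<subseteq> cball q (1 / real (Suc n))"
   by (intro exI[of _ "d i"] exI[of _ "d j"]) auto
  moreover have "closed (fst ?Y)" "closed (snd ?Y)" "fst ?Y \<subseteq> P" "snd ?Y \<subseteq> Q"
   using X unfolding bad_def by auto
  ultimately have "bad (Suc n) ?Y" using ij unfolding bad_def by simp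
  moreover have "sub n X ?Y" unfolding sub_def by simp
  ultimately show "\<exists>Y. bad (Suc n) Y \<and> sub n X Y" by blast
 qed
 then obtain X where X: "\<And>n. bad n (X n)" "\<And>n. sub n (X n) (X (Suc n))" by blast
 have small: "\<exists>n. \<forall>x\<in>S n. \<forall>y\<in>S n. dist x y < e"
  if S: "\<And>n. n > 0 \<Longrightarrow> \<exists>p. S n \<subseteq> cball p (1 / real n)" and "e > 0" for e and S :: "nat \<Rightarrow> 'a set"
 proof -
  obtain n where n: "2 / e < real n" using reals_Archimedean2 by blast
  moreover have "0 < 2 / e" using \<open>e > 0\<close> by simp
  ultimately have n0: "0 < real n" by linarith
  then have n: "n > 0" "2 / real n < e" using n \<open>e > 0\<close> by (simp_all add: field_simps)
  obtain p where "S n \<subseteq> cball p (1 / real n)" using S[OF n(1)] by blast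
  then have d: "dist p x \<le> 1 / real n" if "x \<in> S n" for x using that by auto
  then have dd: "dist x y \<le> 1 / real n + 1 / real n" if "x \<in> S n" "y \<in> S n" for x y
   using d[OF that(1)] d[OF that(2)] dist_triangle3[of x y p] by linarith
  show ?thesis
  proof (intro exI[of _ n] ballI)
   fix x y assume "x \<in> S n" "y \<in> S n"
   from dd[OF this] n(2) show "dist x y < e" by simp
  qed
 qed
 \<comment> \<open>The empty set is separated from everything, so inseparable pieces are nonempty
   and Cantor's intersection theorem applies to both sequences.\<close>
 have ne: "fst (X n) \<noteq> {}" "snd (X n) \<noteq> {}" for n
 proof -
  have "borel_separated {} (f ` snd (X n))" "borel_separated (f ` fst (X n)) {}"
   unfolding borel_separated_def by (intro bexI[of _ "{}"] bexI[of _ UNIV]; simp)+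
  moreover have "\<not> borel_separated (f ` fst (X n)) (f ` snd (X n))" using X(1) by (simp add: bad_def)
  ultimately show "fst (X n) \<noteq> {}" "snd (X n) \<noteq> {}" by auto
 qed
 have mono: "fst (X n) \<subseteq> fst (X m)" "snd (X n) \<subseteq> snd (X m)" if "m \<le> n" for m n
  using that X(2) unfolding sub_def by (induction rule: dec_induct) blast+
 have cl: "closed (fst (X n))" "closed (snd (X n))" for n using X(1)[of n] by (auto simp: bad_def)
 have sm: "\<exists>n. \<forall>x\<in>fst (X n). \<forall>y\<in>fst (X n). dist x y < e"
  "\<exists>n. \<forall>x\<in>snd (X n). \<forall>y\<in>snd (X n). dist x y < e" if "e > 0" for e
  using that X(1) by (intro small; force simp: bad_def)+
 obtain p where p: "\<And>n. p \<in> fst (X n)"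
  using decreasing_closed_nest[of "\<lambda>n. fst (X n)", OF cl(1) ne(1) mono(1) sm(1)] by blast
 obtain q where q: "\<And>n. q \<in> snd (X n)"
  using decreasing_closed_nest[of "\<lambda>n. snd (X n)", OF cl(2) ne(2) mono(2) sm(2)] by blast
 have "f p \<noteq> f q" using p[of 0] q[of 0] X(1)[of 0] dj unfolding bad_def by blast
 then obtain U W where UW: "open U" "open W" "f p \<in> U" "f q \<in> W" "U \<inter> W = {}"
  using hausdorff by metis
 have nb: "\<exists>e>0. ball x e \<subseteq> f -` U" if "open U" "f x \<in> U" for U x
  using that f open_vimage[of U f] by (metis open_contains_ball vimage_eq)
 obtain e1 where e1: "e1 > 0" "ball p e1 \<subseteq> f -` U" using nb UW by blast
 obtain e2 where e2: "e2 > 0" "ball q e2 \<subseteq> f -` W" using nb UW by blast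
 obtain n1 where "\<forall>x\<in>fst (X n1). \<forall>y\<in>fst (X n1). dist x y < e1"
  using sm(1)[OF e1(1)] by blast
 then have n1: "fst (X n1) \<subseteq> ball p e1" using p by auto
 obtain n2 where "\<forall>x\<in>snd (X n2). \<forall>y\<in>snd (X n2). dist x y < e2"
  using sm(2)[OF e2(1)] by blast
 then have n2: "snd (X n2) \<subseteq> ball q e2" using q by auto
 let ?n = "max n1 n2"
 have "fst (X ?n) \<subseteq> f -` U" using mono(1)[of n1 ?n] n1 e1(2) by (meson max.cobounded1 order_trans)
 moreover have "snd (X ?n) \<subseteq> f -` W" using mono(2)[of n2 ?n] n2 e2(2) by (meson max.cobounded2 order_trans)
 ultimately have "f ` fst (X ?n) \<subseteq> U" "f ` snd (X ?n) \<inter> U = {}" using UW(5) by blast+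
 then have "borel_separated (f ` fst (X ?n)) (f ` snd (X ?n))"
  unfolding borel_separated_def by (intro bexI[of _ U] conjI) (use UW(1) in simp_all)
 then show False using X(1) unfolding bad_def by blast
qed

lemma fsigma_in_sequence:
 assumes "fsigma_in euclidean P"
 shows "\<exists>S. (\<forall>k::nat. closed (S k)) \<and> P = (\<Union>k. S k)"
proof -
 obtain C where C: "\<forall>n::nat. closedin euclidean (C n)" "\<Union> (range C) = P"
  using assms unfolding fsigma_in_ascending by (elim exE conjE)
 have "\<forall>n. closed (C n)" using C(1) unfolding closed_closedin .
 with C(2) show ?thesis by metis
qed

text \<open>Intersecting all pairwise separators yields disjoint hulls. The hulls are kept inside
  the closures of the \<open>P i\<close> so that a point lying in hulls of ever smaller pieces is a
  limit of their images.\<close>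

lemma disjoint_borel_hulls:
 fixes P :: "nat \<Rightarrow> 'b::topological_space set"
 assumes "\<And>i j. i \<noteq> j \<Longrightarrow> borel_separated (P i) (P j)"
 shows "\<exists>E. (\<forall>i. E i \<in> sets borel \<and> P i \<subseteq> E i \<and> E i \<subseteq> closure (P i)) \<and>
   (\<forall>i j. i \<noteq> j \<longrightarrow> E i \<inter> E j = {})"
proof -
 define B where "B i j = (SOME B. B \<in> sets borel \<and> P i \<subseteq> B \<and> P j \<inter> B = {})" for i j
 have B: "B i j \<in> sets borel \<and> P i \<subseteq> B i j \<and> P j \<inter> B i j = {}" if "i \<noteq> j" for i j
  unfolding B_def by (rule someI_ex) (rule assms[OF that, unfolded borel_separated_def Bex_def])
 \<comment> \<open>The separators of the ordered pairs \<open>(i, j)\<close> and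
   \<open>(j, i)\<close> are chosen independently; using \<open>B i j\<close> together with the
   complement of \<open>B j i\<close> makes the two hulls disjoint nevertheless.\<close>
 define H where "H i j = (if j = i then UNIV else B i j \<inter> - B j i)" for i j
 define E where "E i = closure (P i) \<inter> (\<Inter>j. H i j)" for i
 have "H i j \<in> sets borel" for i j using B[of i j] B[of j i] by (auto simp: H_def)
 then have "E i \<in> sets borel" for i
  unfolding E_def by (intro sets.Int sets.countable_INT'') auto
 moreover have "P i \<subseteq> E i" for i
 proof -
  have "P i \<subseteq> H i j" for j
   using B[of i j] B[of j i] unfolding H_def by (cases "j = i") auto
  then show ?thesis unfolding E_def using closure_subset[of "P i"] by blast
 qed
 moreover have "E i \<inter> E j = {}" if "i \<noteq> j" for i j
 proof -
  have "E i \<subseteq> H i j" "E j \<subseteq> H j i" unfolding E_def by blast+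
  then show ?thesis using that unfolding H_def by auto
 qed
 moreover have "E i \<subseteq> closure (P i)" for i unfolding E_def by blast
 ultimately show ?thesis by blast
qed

text \<open>The pieces at level \<open>n\<close> form a countable partition of \<open>C\<close> with
 mesh tending to \<open>0\<close>; the images of the pieces of one level are separated by disjoint Borel sets.\<close>

lemma lusin_souslin:
 fixes f :: "'a::{complete_space, second_countable_topology} \<Rightarrow> 'b::metric_space"
 assumes f: "continuous_on UNIV f" "inj f" and C: "closed C"
 shows "f ` C \<in> sets borel"
proof -
 obtain d :: "nat \<Rightarrow> 'a" where d: "\<And>e. e > 0 \<Longrightarrow> (\<Union>i. cball (d i) e) = UNIV"
  by (rule ex_dense_sequence) blast
 define r where "r n = 1 / real (Suc n)" for n
 have r: "r n > 0" for n by (simp add: r_def)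
 \<comment> \<open>Disjointified balls are differences of closed sets, hence F-sigma sets; this is
   enough, since separation passes from closed sets to countable unions.\<close>
 define K where "K n i = cball (d i) (r n) \<inter> - (\<Union>j<i. cball (d j) (r n))" for n i
 have K_cover: "\<exists>i. x \<in> K n i" for x n
 proof -
  have ex: "\<exists>i. x \<in> cball (d i) (r n)" using d[OF r[of n]] by blast
  define i where "i = (LEAST i. x \<in> cball (d i) (r n))"
  have "x \<in> cball (d i) (r n)" unfolding i_def using ex by (rule LeastI_ex)
  moreover have "x \<notin> cball (d j) (r n)" if "j < i" for j
   using that unfolding i_def by (rule not_less_Least)
  ultimately have "x \<in> K n i" unfolding K_def by blast
  then show ?thesis by blast
 qed
 have K_less: "K n i \<inter> K n j = {}" if "i < j" for n i j
  using that unfolding K_def by blast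
 have K_disj: "K n i \<inter> K n j = {}" if "i \<noteq> j" for n i j
  using K_less[of i j n] K_less[of j i n] that by (cases "i < j") auto
 have K_F: "fsigma_in euclidean (K n i)" for n i
 proof -
  have "closed (\<Union>j<i. cball (d j) (r n))" by (intro closed_UN) auto
  then have "fsigma_in euclidean (- (\<Union>j<i. cball (d j) (r n)))"
   by (intro open_imp_fsigma_in metrizable_space_euclidean)
    (simp only: open_openin[symmetric] open_Compl)
  moreover have "fsigma_in euclidean (cball (d i) (r n))"
   by (rule closed_imp_fsigma_in) simp
  ultimately show ?thesis unfolding K_def by (intro fsigma_in_Int)
 qed
 \<comment> \<open>An index of level \<open>n + 1\<close> encodes the pair of its parent piece and
   the number of the small ball, so every piece has a unique parent
   \<open>fst (prod_decode i)\<close>.\<close>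
 define D where "D = rec_nat (\<lambda>i. C \<inter> K 0 i)
  (\<lambda>n X i. X (fst (prod_decode i)) \<inter> K (Suc n) (snd (prod_decode i)))"
 have D0: "D 0 i = C \<inter> K 0 i" for i by (simp add: D_def)
 have DS: "D (Suc n) i = D n (fst (prod_decode i)) \<inter> K (Suc n) (snd (prod_decode i))" for n i
  by (simp add: D_def)
 have D_F: "fsigma_in euclidean (D n i)" for n i
  using C by (induction n arbitrary: i) (simp_all add: D0 DS fsigma_in_Int K_F closed_imp_fsigma_in)
 have D_C: "D n i \<subseteq> C" for n i by (induction n arbitrary: i) (auto simp: D0 DS)
 have D_small: "D n i \<subseteq> cball (d (if n = 0 then i else snd (prod_decode i))) (r n)" for n i
  by (cases n) (auto simp: D0 DS K_def)
 have D_cover: "\<exists>i. x \<in> D n i" if "x \<in> C" for x n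
 proof (induction n)
  case 0 then show ?case using K_cover[of x 0] that by (auto simp: D0)
 next
  case (Suc n)
  obtain i j where "x \<in> D n i" "x \<in> K (Suc n) j" using Suc K_cover by blast
  then show ?case by (intro exI[of _ "prod_encode (i, j)"]) (simp add: DS)
 qed
 have D_disj: "D n i \<inter> D n j = {}" if "i \<noteq> j" for n i j
  using that
 proof (induction n arbitrary: i j)
  case 0 then show ?case using K_disj[of i j 0] by (auto simp: D0)
 next
  case (Suc n)
  then have "prod_decode i \<noteq> prod_decode j" by (metis prod_decode_inverse)
  then have "fst (prod_decode i) \<noteq> fst (prod_decode j) \<or> snd (prod_decode i) \<noteq> snd (prod_decode j)"
   by (simp add: prod_eq_iff)
  then show ?case using Suc.IH K_disj unfolding DS by blast
 qed
 \<comment> \<open>Injectivity enters here: disjoint pieces have disjoint images, and closed parts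
   of them are separated by \<open>lusin_separation_closed\<close>.\<close>
 have sep: "borel_separated (f ` D n i) (f ` D n j)" if "i \<noteq> j" for n i j
 proof -
  obtain S where S: "\<forall>k::nat. closed (S k)" "D n i = (\<Union>k. S k)"
   using fsigma_in_sequence[OF D_F[of n i]] by (elim exE conjE)
  obtain T where T: "\<forall>k::nat. closed (T k)" "D n j = (\<Union>k. T k)"
   using fsigma_in_sequence[OF D_F[of n j]] by (elim exE conjE)
  have dj: "f ` S k \<inter> f ` T l = {}" for k l
  proof -
   have "S k \<inter> T l = {}" using D_disj[OF that, of n] S(2) T(2) by blast
   then show ?thesis using f(2) by (simp add: image_Int[symmetric])
  qed
  have "borel_separated (\<Union>k. f ` S k) (\<Union>l. f ` T l)"
   by (rule borel_separated_UN, rule lusin_separation_closed[OF f(1) S(1)[rule_format] T(1)[rule_format] dj])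
  then show ?thesis unfolding S(2) T(2) image_UN .
 qed
 have "\<exists>E. \<forall>n. (\<forall>i. E n i \<in> sets borel \<and> f ` D n i \<subseteq> E n i \<and> E n i \<subseteq> closure (f ` D n i)) \<and>
   (\<forall>i j. i \<noteq> j \<longrightarrow> E n i \<inter> E n j = {})"
  by (rule choice, rule allI, rule disjoint_borel_hulls, rule sep)
 then obtain E where E':
  "\<And>n. (\<forall>i. E n i \<in> sets borel \<and> f ` D n i \<subseteq> E n i \<and> E n i \<subseteq> closure (f ` D n i)) \<and>
   (\<forall>i j. i \<noteq> j \<longrightarrow> E n i \<inter> E n j = {})" by (elim exE) (rule that, erule spec)
 have E: "E n i \<in> sets borel" "f ` D n i \<subseteq> E n i"
   "E n i \<subseteq> closure (f ` D n i)" "i \<noteq> j \<Longrightarrow> E n i \<inter> E n j = {}" for n i j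
  using E'[of n] by simp_all
 \<comment> \<open>\<open>G n i\<close> intersects the hulls along the branch from level 0 down to
   \<open>i\<close>; the image is then recovered as a countable intersection of countable unions of
   these sets.\<close>
 define G where "G = rec_nat (\<lambda>i. E 0 i) (\<lambda>n X i. X (fst (prod_decode i)) \<inter> E (Suc n) i)"
 have G0: "G 0 i = E 0 i" for i by (simp add: G_def)
 have GS: "G (Suc n) i = G n (fst (prod_decode i)) \<inter> E (Suc n) i" for n i by (simp add: G_def)
 have G_borel: "G n i \<in> sets borel" for n i
  by (induction n arbitrary: i) (auto simp: G0 GS E)
 have G_sup: "f ` D n i \<subseteq> G n i" for n i
 proof (induction n arbitrary: i)
  case (Suc n)
  show ?case using Suc[of "fst (prod_decode i)"] E(2)[of "Suc n" i] unfolding GS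
   by (auto simp: DS)
 qed (use E in \<open>auto simp: G0\<close>)
 have G_E: "G n i \<subseteq> E n i" for n i by (cases n) (auto simp: G0 GS)
 have "f ` C = (\<Inter>n. \<Union>i. G n i)"
 proof (intro equalityI subsetI)
  fix y assume "y \<in> f ` C"
  then obtain x where x: "x \<in> C" "y = f x" by blast
  have "\<exists>i. y \<in> G n i" for n using D_cover[OF x(1), of n] G_sup[of n] x(2) by blast
  then show "y \<in> (\<Inter>n. \<Union>i. G n i)" by blast
 next
  fix y assume "y \<in> (\<Inter>n. \<Union>i. G n i)"
  then have "\<forall>n. \<exists>i. y \<in> G n i" by blast
  then have ex: "\<exists>i. y \<in> G n i" for n by blast
  define i where "i n = (SOME i. y \<in> G n i)" for n
  have i: "y \<in> G n (i n)" for n unfolding i_def using ex by (rule someI_ex)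
  \<comment> \<open>The point \<open>y\<close> lies in the hull chosen at level \<open>n\<close> and
    in that of the parent of the next choice. Hulls of one level are disjoint, so the choices form a
    single branch.\<close>
  have step: "fst (prod_decode (i (Suc n))) = i n" for n
  proof (rule ccontr)
   assume "fst (prod_decode (i (Suc n))) \<noteq> i n"
   moreover have "y \<in> G n (fst (prod_decode (i (Suc n))))" using i[of "Suc n"] by (simp add: GS)
   ultimately show False using E(4)[of "fst (prod_decode (i (Suc n)))" "i n" n] G_E i[of n] by blast
  qed
  have dec: "D n (i n) \<subseteq> D m (i m)" if "m \<le> n" for m n
   using that by (induction rule: dec_induct) (auto simp: DS step)
  have y_cl: "y \<in> closure (f ` D n (i n))" for n using i[of n] G_E E(3) by blast
  have small: "\<exists>n. \<forall>x\<in>closure (D n (i n)). \<forall>z\<in>closure (D n (i n)). dist x z < e" if "e > 0" for e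
  proof -
   obtain n where "inverse (real (Suc n)) < e / 2"
    using reals_Archimedean[of "e / 2"] half_gt_zero[OF \<open>e > 0\<close>] by blast
   then have n: "r n < e / 2" by (simp add: r_def inverse_eq_divide)
   obtain p where "closure (D n (i n)) \<subseteq> cball p (r n)"
    using closure_mono[OF D_small[of n "i n"]] by auto
   then have d: "dist p x \<le> r n" if "x \<in> closure (D n (i n))" for x using that by auto
   then have dd: "dist x z \<le> r n + r n" if "x \<in> closure (D n (i n))" "z \<in> closure (D n (i n))" for x z
    using d[OF that(1)] d[OF that(2)] dist_triangle3[of x z p] by linarith
   show ?thesis
   proof (intro exI[of _ n] ballI)
    fix x z assume "x \<in> closure (D n (i n))" "z \<in> closure (D n (i n))"
    from dd[OF this] n show "dist x z < e" by simp
   qed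
  qed
  have ne: "closure (D n (i n)) \<noteq> {}" for n using y_cl[of n] by force
  have dec': "closure (D n (i n)) \<subseteq> closure (D m (i m))" if "m \<le> n" for m n
   using dec[OF that] by (rule closure_mono)
  obtain x where x: "\<And>n. x \<in> closure (D n (i n))"
   using decreasing_closed_nest[of "\<lambda>n. closure (D n (i n))", OF closed_closure ne dec' small] by blast
  \<comment> \<open>The limit point may leave the pieces, of which only the closures are nested, but
    it cannot leave the closed set \<open>C\<close>.\<close>
  have "x \<in> C" using x[of 0] closure_mono[OF D_C[of 0 "i 0"]] C by (auto simp: closure_closed)
  moreover have "dist (f x) y \<le> e" if e: "e > 0" for e
  proof -
   have "isCont f x" using f(1) by (simp add: continuous_on_eq_continuous_at)
   then obtain s where s: "s > 0" "\<And>z. dist z x < s \<Longrightarrow> dist (f z) (f x) < e"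
    using e unfolding continuous_at_eps_delta by blast
   obtain n where n: "\<forall>x\<in>closure (D n (i n)). \<forall>z\<in>closure (D n (i n)). dist x z < s"
    using small[OF s(1)] by blast
   have "f ` D n (i n) \<subseteq> cball (f x) e"
   proof
    fix z assume "z \<in> f ` D n (i n)"
    then obtain w where w: "w \<in> D n (i n)" "z = f w" by blast
    then have "dist w x < s" using n x[of n] closure_subset by blast
    then show "z \<in> cball (f x) e" using s(2) w(2) by (force simp: dist_commute)
   qed
   then have "closure (f ` D n (i n)) \<subseteq> cball (f x) e" by (rule closure_minimal) simp
   with y_cl[of n] show ?thesis by auto
  qed
  then have "f x = y" by (metis dense_ge dist_le_zero_iff)
  ultimately show "y \<in> f ` C" by blast
 qed
 also have "\<dots> \<in> sets borel" using G_borel by auto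
 finally show ?thesis .
qed

lemma range_embedding_borel:
 fixes j :: "'u::{banach, second_countable_topology} \<Rightarrow> 'v::real_normed_vector"
 assumes "embedding j"
 shows "range j \<in> sets borel"
 using assms by (intro lusin_souslin) (auto simp: embedding_def linear_continuous_on)

text \<open>For \<open>a >= 0\<close> a sublevel set is the image of a closed ball under the
  injective map \<open>j\<close>, together with the complement of the range, where the norm was set
  to 0. Both are Borel by \<open>lusin_souslin\<close>.\<close>

lemma sub_norm_measurable:
 fixes j :: "'u::{banach, second_countable_topology} \<Rightarrow> 'v::real_normed_vector"
 assumes "embedding j"
 shows "sub_norm j \<in> borel_measurable borel"
proof -
 have j: "inj j" "continuous_on UNIV j"
  using assms by (auto simp: embedding_def linear_continuous_on)
 have "{v. sub_norm j v \<le> a} \<in> sets borel" for a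
 proof (cases "a < 0")
  case True
  then have "{v. sub_norm j v \<le> a} = {}"
   by (auto simp: sub_norm_def split: if_splits) (meson norm_ge_zero not_le order.strict_trans1)
  then show ?thesis by simp
 next
  case False
  then have "{v. sub_norm j v \<le> a} = j ` cball 0 a \<union> - range j"
   using j(1) by (auto simp: sub_norm_def split: if_splits)
  then show ?thesis using lusin_souslin[OF j(2,1), of "cball 0 a"] range_embedding_borel[OF assms] by auto
 qed
 then show ?thesis by (intro borel_measurable_iff_le[THEN iffD2]) (auto simp: space_borel)
qed

section \<open>Strong laws of large numbers\<close>

text \<open>Indexed from 0 and with an arbitrary measurable target, in contrast to
  \<open>iid_seq\<close>, so that it also applies to functionals of whole cycles.\<close>

definition iid :: "'a measure \<Rightarrow> 'b measure \<Rightarrow> (nat \<Rightarrow> 'a \<Rightarrow> 'b) \<Rightarrow> bool" where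
 "iid M S X \<longleftrightarrow> prob_space.indep_vars M (\<lambda>_. S) X UNIV \<and> (\<forall>n. distr M S (X n) = distr M S (X 0))"

context prob_space
begin

lemma iid_measurable: "iid M S X \<Longrightarrow> X n \<in> M \<rightarrow>\<^sub>M S"
 unfolding iid_def indep_vars_def by blast

lemma iid_indep: "iid M S X \<Longrightarrow> indep_vars (\<lambda>_. S) X UNIV"
 unfolding iid_def by blast

lemma iid_compose:
 assumes "iid M S X" "g \<in> S \<rightarrow>\<^sub>M T"
 shows "iid M T (\<lambda>n \<omega>. g (X n \<omega>))"
proof -
 have "distr M T (\<lambda>\<omega>. g (X n \<omega>)) = distr (distr M S (X n)) T g" for n
  using assms iid_measurable[OF assms(1)] by (subst distr_distr) (auto simp: comp_def)
 then show ?thesis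
  using assms indep_vars_compose2[OF iid_indep[OF assms(1)], of "\<lambda>_. g" "\<lambda>_. T"]
  unfolding iid_def by metis
qed

lemma iid_integrable:
 fixes g :: "'b \<Rightarrow> 'c::{banach, second_countable_topology}"
 assumes "iid M S X" "g \<in> borel_measurable S"
 shows "integrable M (\<lambda>\<omega>. g (X n \<omega>)) \<longleftrightarrow> integrable M (\<lambda>\<omega>. g (X 0 \<omega>))"
 using assms integrable_distr_eq[OF iid_measurable[OF assms(1)] assms(2)]
 unfolding iid_def by metis

lemma iid_integral:
 fixes g :: "'b \<Rightarrow> 'c::{banach, second_countable_topology}"
 assumes "iid M S X" "g \<in> borel_measurable S"
 shows "(LINT \<omega>|M. g (X n \<omega>)) = (LINT \<omega>|M. g (X 0 \<omega>))"
 using assms integral_distr[OF iid_measurable[OF assms(1)] assms(2)]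
 unfolding iid_def by metis

lemma iid_nn_integral:
 assumes "iid M S X" "g \<in> borel_measurable S"
 shows "(\<integral>\<^sup>+\<omega>. g (X n \<omega>) \<partial>M) = (\<integral>\<^sup>+\<omega>. g (X 0 \<omega>) \<partial>M)"
proof -
 have "(\<integral>\<^sup>+\<omega>. g (X n \<omega>) \<partial>M) = (\<integral>\<^sup>+y. g y \<partial>distr M S (X n))" for n
  using assms(2) iid_measurable[OF assms(1)] by (subst nn_integral_distr) auto
 then show ?thesis using assms(1) unfolding iid_def by metis
qed

lemma iid_centered_sum_square:
 fixes X :: "nat \<Rightarrow> 'a \<Rightarrow> real"
 assumes X: "iid M borel X" and sq: "integrable M (\<lambda>\<omega>. (X 0 \<omega>)\<^sup>2)" and mean: "expectation (X 0) = 0"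
 shows "integrable M (\<lambda>\<omega>. (\<Sum>k<n. X k \<omega>)\<^sup>2) \<and>
  expectation (\<lambda>\<omega>. (\<Sum>k<n. X k \<omega>)\<^sup>2) = real n * expectation (\<lambda>\<omega>. (X 0 \<omega>)\<^sup>2)"
proof (induction n)
 case (Suc n)
 note [measurable] = iid_measurable[OF X]
 let ?S = "\<lambda>\<omega>. \<Sum>k<n. X k \<omega>"
 have sqn: "integrable M (\<lambda>\<omega>. (X k \<omega>)\<^sup>2)" for k
  using sq iid_integrable[OF X, of "\<lambda>x. x\<^sup>2" k] by simp
 have int: "integrable M (X k)" for k
  by (rule square_integrable_imp_integrable[OF _ sqn]) simp
 have mean0: "expectation (X k) = 0" for k
  using iid_integral[OF X, of "\<lambda>x. x" k] mean by simp
 have ind: "indep_var borel (X n) borel ?S"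
  by (rule indep_vars_sum) (auto intro: indep_vars_subset[OF iid_indep[OF X]])
 have intS: "integrable M ?S" using int by simp
 have prod: "integrable M (\<lambda>\<omega>. X n \<omega> * ?S \<omega>)" "expectation (\<lambda>\<omega>. X n \<omega> * ?S \<omega>) = 0"
  using indep_var_integrable[OF ind int intS] indep_var_lebesgue_integral[OF ind int intS] mean0 by simp_all
 have eq: "(\<Sum>k<Suc n. X k \<omega>)\<^sup>2 = (?S \<omega>)\<^sup>2 + (2 * (X n \<omega> * ?S \<omega>) + (X n \<omega>)\<^sup>2)" for \<omega>
  by (simp add: power2_eq_square algebra_simps)
 show ?case unfolding eq using Suc prod sqn iid_integral[OF X, of "\<lambda>x. x\<^sup>2" n]
  by (simp add: algebra_simps)
qed simp

end

text \<open>Integrated form of the Borel-Cantelli lemma: the series of the \<open>f n\<close> has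
  finite integral, hence converges almost everywhere, and its terms tend to 0.\<close>

lemma AE_tendsto_0_of_summable_nn_integral:
 fixes f :: "nat \<Rightarrow> 'a \<Rightarrow> real"
 assumes [measurable]: "\<And>n. f n \<in> borel_measurable M" and nn: "\<And>n \<omega>. f n \<omega> \<ge> 0"
  and fin: "(\<Sum>n. \<integral>\<^sup>+\<omega>. ennreal (f n \<omega>) \<partial>M) < \<infinity>"
 shows "AE \<omega> in M. (\<lambda>n. f n \<omega>) \<longlonglongrightarrow> 0"
proof -
 have "(\<integral>\<^sup>+\<omega>. (\<Sum>n. ennreal (f n \<omega>)) \<partial>M) = (\<Sum>n. \<integral>\<^sup>+\<omega>. ennreal (f n \<omega>) \<partial>M)"
  by (rule nn_integral_suminf) measurable
 then have "AE \<omega> in M. (\<Sum>n. ennreal (f n \<omega>)) \<noteq> \<infinity>"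
  using fin by (intro nn_integral_noteq_infinite) auto
 then show ?thesis
 proof eventually_elim
  case (elim \<omega>)
  then have "summable (\<lambda>n. f n \<omega>)"
   using nn by (intro summable_suminf_not_top) (auto simp: top_unique)
  then show ?case by (rule summable_LIMSEQ_zero)
 qed
qed

lemma summable_nn_integral_finite:
 assumes "\<And>n. integrable M (f n)" "\<And>n \<omega>. f n \<omega> \<ge> 0" "summable (\<lambda>n. LINT \<omega>|M. f n \<omega>)"
 shows "(\<Sum>n. \<integral>\<^sup>+\<omega>. ennreal (f n \<omega>) \<partial>M) < \<infinity>"
proof -
 have "(\<Sum>n. \<integral>\<^sup>+\<omega>. ennreal (f n \<omega>) \<partial>M) = (\<Sum>n. ennreal (LINT \<omega>|M. f n \<omega>))"
  using assms by (intro suminf_cong nn_integral_eq_integral) auto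
 also have "\<dots> = ennreal (\<Sum>n. LINT \<omega>|M. f n \<omega>)"
  using assms by (intro suminf_ennreal2) (auto intro!: integral_nonneg_AE)
 finally show ?thesis by simp
qed

text \<open>A nonnegative nondecreasing sequence is controlled by its values at the squares because
 consecutive squares have quotient tending to \<open>1\<close>.\<close>

lemma mono_averages_from_squares:
 fixes S :: "nat \<Rightarrow> real"
 assumes mono: "mono S" and nn: "\<And>n. S n \<ge> 0"
  and lim: "(\<lambda>j. S (j\<^sup>2) / real (j\<^sup>2)) \<longlonglongrightarrow> m"
 shows "(\<lambda>n. S n / real n) \<longlonglongrightarrow> m"
proof -
 let ?q = "floor_sqrt"
 have q: "filterlim ?q at_top sequentially"
  unfolding filterlim_at_top
  by (metis eventually_sequentially floor_sqrt_inverse_power2 mono_floor_sqrt' mono_def)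
 have q1: "filterlim (\<lambda>n. Suc (?q n)) at_top sequentially"
  by (rule filterlim_compose[OF filterlim_Suc q])
 have r1: "(\<lambda>j. (real j / real (Suc j))\<^sup>2) \<longlonglongrightarrow> 1\<^sup>2"
  by (intro tendsto_power LIMSEQ_n_over_Suc_n)
 have r2: "(\<lambda>j. (real (Suc j) / real j)\<^sup>2) \<longlonglongrightarrow> 1\<^sup>2"
  by (intro tendsto_power LIMSEQ_Suc_n_over_n)
 \<comment> \<open>The squares of \<open>?q n\<close> and of \<open>Suc (?q n)\<close> enclose
   \<open>n\<close>; the extra factors, which tend to 1, exchange the denominators of the averages
   at these squares for the opposite end of the enclosing interval.\<close>
 have lo: "(\<lambda>n. S ((?q n)\<^sup>2) / real ((?q n)\<^sup>2) * (real (?q n) / real (Suc (?q n)))\<^sup>2) \<longlonglongrightarrow> m * 1\<^sup>2"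
  by (intro tendsto_mult filterlim_compose[OF lim q] filterlim_compose[OF r1 q])
 have up: "(\<lambda>n. S ((Suc (?q n))\<^sup>2) / real ((Suc (?q n))\<^sup>2) * (real (Suc (?q n)) / real (?q n))\<^sup>2) \<longlonglongrightarrow> m * 1\<^sup>2"
  by (intro tendsto_mult filterlim_compose[OF lim q1] filterlim_compose[OF r2 q])
 show ?thesis
 proof (rule tendsto_sandwich)
  show "(\<lambda>n. S ((?q n)\<^sup>2) / real ((?q n)\<^sup>2) * (real (?q n) / real (Suc (?q n)))\<^sup>2) \<longlonglongrightarrow> m"
   using lo by simp
  show "(\<lambda>n. S ((Suc (?q n))\<^sup>2) / real ((Suc (?q n))\<^sup>2) * (real (Suc (?q n)) / real (?q n))\<^sup>2) \<longlonglongrightarrow> m"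
   using up by simp
  show "\<forall>\<^sub>F n in sequentially. S ((?q n)\<^sup>2) / real ((?q n)\<^sup>2) * (real (?q n) / real (Suc (?q n)))\<^sup>2 \<le> S n / real n"
   using eventually_gt_at_top[of 0]
  proof eventually_elim
   case (elim n)
   have *: "(?q n)\<^sup>2 \<le> n" "n \<le> (Suc (?q n))\<^sup>2" "?q n > 0"
    using elim Suc_floor_sqrt_power2_gt[of n] by auto
   have "real n \<le> (real (Suc (?q n)))\<^sup>2" using *(2) by (metis of_nat_le_iff of_nat_power)
   then have "S ((?q n)\<^sup>2) / (real (Suc (?q n)))\<^sup>2 \<le> S n / real n"
    using elim nn monoD[OF mono *(1)] by (intro frac_le) auto
   then show ?case using *(3) by (simp add: power_divide)
  qed
  show "\<forall>\<^sub>F n in sequentially. S n / real n \<le> S ((Suc (?q n))\<^sup>2) / real ((Suc (?q n))\<^sup>2) * (real (Suc (?q n)) / real (?q n))\<^sup>2"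
   using eventually_gt_at_top[of 0]
  proof eventually_elim
   case (elim n)
   have *: "(?q n)\<^sup>2 \<le> n" "n \<le> (Suc (?q n))\<^sup>2" "?q n > 0"
    using elim Suc_floor_sqrt_power2_gt[of n] by auto
   have "(real (?q n))\<^sup>2 \<le> real n" using *(1) by (metis of_nat_le_iff of_nat_power)
   then have "S n / real n \<le> S ((Suc (?q n))\<^sup>2) / (real (?q n))\<^sup>2"
    using *(3) nn monoD[OF mono *(2)] by (intro frac_le) auto
   then show ?case using *(3) by (simp add: power_divide del: of_nat_Suc)
  qed
 qed
qed

context prob_space
begin

text \<open>Along the squares \<open>N = j ^ 2\<close> the averages have variance
  \<open>v / N\<close>, which is summable in \<open>j\<close>. Nonnegativity makes the partial sums
  monotone, which fills the gaps between the squares.\<close>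

lemma slln_nonneg:
 fixes X :: "nat \<Rightarrow> 'a \<Rightarrow> real"
 assumes X: "iid M borel X" and nn: "\<And>n \<omega>. X n \<omega> \<ge> 0"
  and sq: "integrable M (\<lambda>\<omega>. (X 0 \<omega>)\<^sup>2)"
 shows "AE \<omega> in M. (\<lambda>n. (\<Sum>k<n. X k \<omega>) / real n) \<longlonglongrightarrow> expectation (X 0)"
proof -
 note [measurable] = iid_measurable[OF X]
 have sqn: "integrable M (\<lambda>\<omega>. (X n \<omega>)\<^sup>2)" for n
  using sq iid_integrable[OF X, of "\<lambda>x. x\<^sup>2" n] by simp
 have int: "integrable M (X n)" for n
  by (rule square_integrable_imp_integrable[OF _ sqn]) simp
 define m where "m = expectation (X 0)"
 have Em: "expectation (X n) = m" for n
  using iid_integral[OF X, of "\<lambda>x. x" n] by (simp add: m_def)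
 define v where "v = expectation (\<lambda>\<omega>. (X 0 \<omega> - m)\<^sup>2)"
 define S where "S n \<omega> = (\<Sum>k<n. X k \<omega>)" for n \<omega>
 have [measurable]: "S n \<in> borel_measurable M" for n unfolding S_def by measurable
 have X': "iid M borel (\<lambda>n \<omega>. X n \<omega> - m)"
  by (rule iid_compose[OF X, of "\<lambda>x. x - m"]) simp
 have "integrable M (\<lambda>\<omega>. (X 0 \<omega> - m)\<^sup>2)"
  unfolding power2_diff using sq int by auto
 moreover have "expectation (\<lambda>\<omega>. X 0 \<omega> - m) = 0" using int by (simp add: m_def prob_space)
 moreover have "(\<Sum>k<n. X k \<omega> - m) = S n \<omega> - real n * m" for n \<omega>
  by (simp add: S_def sum_subtractf)
 ultimately have SqS: "integrable M (\<lambda>\<omega>. (S n \<omega> - real n * m)\<^sup>2)"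
  "expectation (\<lambda>\<omega>. (S n \<omega> - real n * m)\<^sup>2) = real n * v" for n
  using iid_centered_sum_square[OF X', of n] by (simp_all add: v_def)
 have "AE \<omega> in M. (\<lambda>j. ((S (Suc j ^ 2) \<omega> - real (Suc j ^ 2) * m) / real (Suc j ^ 2))\<^sup>2) \<longlonglongrightarrow> 0"
 proof (rule AE_tendsto_0_of_summable_nn_integral[OF _ _ summable_nn_integral_finite])
  fix j
  show i: "integrable M (\<lambda>\<omega>. ((S (Suc j ^ 2) \<omega> - real (Suc j ^ 2) * m) / real (Suc j ^ 2))\<^sup>2)"
   unfolding power_divide by (rule integrable_divide, rule SqS(1))
 next
  have "(LINT \<omega>|M. ((S N \<omega> - real N * m) / real N)\<^sup>2) = v * inverse (real N)" for N
  proof -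
   have "(LINT \<omega>|M. ((S N \<omega> - real N * m) / real N)\<^sup>2) = (LINT \<omega>|M. (S N \<omega> - real N * m)\<^sup>2) / (real N)\<^sup>2"
    unfolding power_divide by simp
   also have "\<dots> = v * inverse (real N)"
    unfolding SqS(2) by (simp add: power2_eq_square field_simps)
   finally show ?thesis .
  qed
  note this[of "Suc j ^ 2" for j]
  then show "summable (\<lambda>j. LINT \<omega>|M. ((S (Suc j ^ 2) \<omega> - real (Suc j ^ 2) * m) / real (Suc j ^ 2))\<^sup>2)"
   using summable_mult[OF inverse_squares_sums[THEN sums_summable], of v] by (simp add: inverse_eq_divide)
 qed auto
 then show ?thesis
 proof eventually_elim
  case (elim \<omega>)
  have "(\<lambda>j. \<bar>(S (Suc j ^ 2) \<omega> - real (Suc j ^ 2) * m) / real (Suc j ^ 2)\<bar>) \<longlonglongrightarrow> 0"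
   using tendsto_real_sqrt[OF elim] by simp
  then have "(\<lambda>j. (S (Suc j ^ 2) \<omega> - real (Suc j ^ 2) * m) / real (Suc j ^ 2)) \<longlonglongrightarrow> 0"
   by (rule tendsto_rabs_zero_cancel)
  then have "(\<lambda>j. (S (Suc j ^ 2) \<omega> - real (Suc j ^ 2) * m) / real (Suc j ^ 2) + m) \<longlonglongrightarrow> 0 + m"
   by (intro tendsto_intros)
  moreover have "(S (Suc j ^ 2) \<omega> - real (Suc j ^ 2) * m) / real (Suc j ^ 2) + m = S (Suc j ^ 2) \<omega> / real (Suc j ^ 2)" for j
   by (simp add: field_simps del: of_nat_Suc of_nat_power)
  ultimately have "(\<lambda>j. S (Suc j ^ 2) \<omega> / real (Suc j ^ 2)) \<longlonglongrightarrow> m" by simp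
  then have "(\<lambda>j. S (j ^ 2) \<omega> / real (j ^ 2)) \<longlonglongrightarrow> m"
   by (rule LIMSEQ_imp_Suc)
  moreover have "mono (\<lambda>n. S n \<omega>)"
   unfolding S_def mono_def using nn by (auto intro!: sum_mono2)
  moreover have "S n \<omega> \<ge> 0" for n unfolding S_def using nn by (auto intro!: sum_nonneg)
  ultimately have "(\<lambda>n. S n \<omega> / real n) \<longlonglongrightarrow> m"
   by (intro mono_averages_from_squares)
  then show ?case by (simp add: S_def m_def)
 qed
qed

end

lemma simple_approximation:
 obtains s :: "nat \<Rightarrow> 'w \<Rightarrow> 'w::{real_normed_vector, second_countable_topology}"
 where "\<And>j. s j \<in> borel_measurable borel" "\<And>j. finite (range (s j))"
  "\<And>w. (\<lambda>j. s j w) \<longlonglongrightarrow> w" "\<And>j w. norm (s j w) \<le> 2 * norm w"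
proof -
 have "(\<lambda>w::'w. w) \<in> borel_measurable borel" by simp
 from borel_measurable_implies_sequence_metric[OF this, of 0] obtain s where
  s: "\<And>i. simple_function borel (s i)" "\<And>w::'w. (\<lambda>i. s i w) \<longlonglongrightarrow> w"
    "\<And>i w::'w. dist (s i w) 0 \<le> 2 * dist w 0"
  by auto
 show ?thesis
  by (rule that[of s]) (use s in \<open>auto simp: simple_function_def borel_measurable_simple_function\<close>)
qed

lemma simple_function_sum:
 assumes "finite (range s)"
 shows "s w = (\<Sum>u\<in>range s. indicator (s -` {u}) w *\<^sub>R (u :: 'w::real_normed_vector))"
proof -
 have "(\<Sum>u\<in>range s. indicator (s -` {u}) w *\<^sub>R u) = (\<Sum>u\<in>range s. if u = s w then u else 0)"
  by (intro sum.cong) (auto simp: indicator_def)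
 also have "\<dots> = s w" using assms by simp
 finally show ?thesis by simp
qed

context prob_space
begin

text \<open>Reduction to the scalar law. The averages of the simple functions \<open>s j\<close> of
  \<open>Y\<close> are finite combinations of empirical frequencies, and the averages of the errors
  \<open>norm (Y k - s j (Y k))\<close> tend to \<open>d j\<close>, which is small for large
  \<open>j\<close>.\<close>

lemma slln_banach:
 fixes Y :: "nat \<Rightarrow> 'a \<Rightarrow> 'w::{banach, second_countable_topology}"
 assumes Y: "iid M borel Y" and sq: "integrable M (\<lambda>\<omega>. (norm (Y 0 \<omega>))\<^sup>2)"
 shows "AE \<omega> in M. (\<lambda>n. (1 / real n) *\<^sub>R (\<Sum>k<n. Y k \<omega>)) \<longlonglongrightarrow> expectation (Y 0)"
proof -
 note [measurable] = iid_measurable[OF Y]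
 obtain s :: "nat \<Rightarrow> 'w \<Rightarrow> 'w" where [measurable]: "\<And>j. s j \<in> borel_measurable borel"
  and s: "\<And>j. finite (range (s j))" "\<And>w. (\<lambda>j. s j w) \<longlonglongrightarrow> w" "\<And>j w. norm (s j w) \<le> 2 * norm w"
  by (rule simple_approximation) blast
 have int_norm: "integrable M (\<lambda>\<omega>. norm (Y 0 \<omega>))"
  by (rule square_integrable_imp_integrable[OF _ sq]) simp
 then have int: "integrable M (Y 0)" by (simp add: integrable_norm_iff)
 have int_s: "integrable M (\<lambda>\<omega>. s j (Y 0 \<omega>))" for j
  by (rule Bochner_Integration.integrable_bound[of M "\<lambda>\<omega>. 2 * norm (Y 0 \<omega>)"]) (use int_norm s in auto)
 have diff_le: "norm (w - s j w) \<le> 3 * norm w" for w j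
  using norm_triangle_ineq4[of w "s j w"] s(3)[of j w] by simp
 define d where "d j = (LINT \<omega>|M. norm (Y 0 \<omega> - s j (Y 0 \<omega>)))" for j
 have "d \<longlonglongrightarrow> (LINT \<omega>|M. 0)"
  unfolding d_def
 proof (rule integral_dominated_convergence[where w="\<lambda>\<omega>. 3 * norm (Y 0 \<omega>)"])
  show "AE \<omega> in M. (\<lambda>j. norm (Y 0 \<omega> - s j (Y 0 \<omega>))) \<longlonglongrightarrow> 0"
  proof (intro AE_I2)
   fix \<omega>
   have "(\<lambda>j. norm (Y 0 \<omega> - s j (Y 0 \<omega>))) \<longlonglongrightarrow> norm (Y 0 \<omega> - Y 0 \<omega>)"
    by (intro tendsto_intros s)
   then show "(\<lambda>j. norm (Y 0 \<omega> - s j (Y 0 \<omega>))) \<longlonglongrightarrow> 0" by simp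
  qed
 qed (use int_norm diff_le in auto)
 then have d: "d \<longlonglongrightarrow> 0" by simp
 have A: "AE \<omega> in M. \<forall>j. (\<lambda>n. (\<Sum>k<n. norm (Y k \<omega> - s j (Y k \<omega>))) / real n) \<longlonglongrightarrow> d j"
  unfolding AE_all_countable
 proof
  fix j
  show "AE \<omega> in M. (\<lambda>n. (\<Sum>k<n. norm (Y k \<omega> - s j (Y k \<omega>))) / real n) \<longlonglongrightarrow> d j"
   unfolding d_def
  proof (rule slln_nonneg[where X="\<lambda>k \<omega>. norm (Y k \<omega> - s j (Y k \<omega>))"])
   show "iid M borel (\<lambda>k \<omega>. norm (Y k \<omega> - s j (Y k \<omega>)))"
    by (rule iid_compose[OF Y, of "\<lambda>w. norm (w - s j w)"]) measurable
   show "integrable M (\<lambda>\<omega>. (norm (Y 0 \<omega> - s j (Y 0 \<omega>)))\<^sup>2)"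
   proof (rule Bochner_Integration.integrable_bound[of M "\<lambda>\<omega>. 9 * (norm (Y 0 \<omega>))\<^sup>2"])
    show "AE \<omega> in M. norm ((norm (Y 0 \<omega> - s j (Y 0 \<omega>)))\<^sup>2) \<le> norm (9 * (norm (Y 0 \<omega>))\<^sup>2)"
     using power_mono[OF diff_le norm_ge_zero, of _ j 2] by (auto simp: power_mult_distrib)
   qed (use sq in auto)
  qed auto
 qed
 have B: "AE \<omega> in M. \<forall>j. \<forall>u\<in>range (s j).
   (\<lambda>n. (\<Sum>k<n. indicator (s j -` {u}) (Y k \<omega>)) / real n) \<longlonglongrightarrow>
   (LINT \<omega>|M. indicator (s j -` {u}) (Y 0 \<omega>) :: real)"
  unfolding AE_all_countable
 proof
  fix j
  have "AE \<omega> in M. (\<lambda>n. (\<Sum>k<n. indicator (s j -` {u}) (Y k \<omega>)) / real n) \<longlonglongrightarrow>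
   (LINT \<omega>|M. indicator (s j -` {u}) (Y 0 \<omega>) :: real)" for u
  proof (rule slln_nonneg[where X="\<lambda>k \<omega>. indicator (s j -` {u}) (Y k \<omega>)"])
   have m[measurable]: "s j -` {u} \<in> sets borel"
    using measurable_sets[of "s j" borel borel "{u}"] by simp
   show "iid M borel (\<lambda>k \<omega>. indicator (s j -` {u}) (Y k \<omega>) :: real)"
    by (rule iid_compose[OF Y, of "indicator (s j -` {u})"]) measurable
   show "integrable M (\<lambda>\<omega>. (indicator (s j -` {u}) (Y 0 \<omega>) :: real)\<^sup>2)"
    by (rule integrable_const_bound[where B=1]) (auto simp: indicator_def)
  qed auto
  then show "AE \<omega> in M. \<forall>u\<in>range (s j).
   (\<lambda>n. (\<Sum>k<n. indicator (s j -` {u}) (Y k \<omega>)) / real n) \<longlonglongrightarrow>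
   (LINT \<omega>|M. indicator (s j -` {u}) (Y 0 \<omega>) :: real)"
   by (intro AE_ball_countable[THEN iffD2] countable_finite s ballI)
 qed
 have Es: "(LINT \<omega>|M. s j (Y 0 \<omega>)) =
   (\<Sum>u\<in>range (s j). (LINT \<omega>|M. indicator (s j -` {u}) (Y 0 \<omega>)) *\<^sub>R u)" for j
 proof -
  have m[measurable]: "s j -` {u} \<in> sets borel" for u
    using measurable_sets[of "s j" borel borel "{u}"] by simp
  have i: "integrable M (\<lambda>\<omega>. indicator (s j -` {u}) (Y 0 \<omega>) :: real)" for u
   by (rule integrable_const_bound[where B=1]) (auto simp: indicator_def)
  show ?thesis
   by (subst simple_function_sum[OF s(1)]) (simp add: i)
 qed
 have ed: "norm (expectation (Y 0) - (LINT \<omega>|M. s j (Y 0 \<omega>))) \<le> d j" for j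
  unfolding d_def Bochner_Integration.integral_diff[OF int int_s, symmetric]
  by (rule integral_norm_bound)
 from A B show ?thesis
 proof eventually_elim
  case (elim \<omega>)
  have C: "(\<lambda>n. (1 / real n) *\<^sub>R (\<Sum>k<n. s j (Y k \<omega>))) \<longlonglongrightarrow> (LINT \<omega>|M. s j (Y 0 \<omega>))" for j
  proof -
   have "(1 / real n) *\<^sub>R (\<Sum>k<n. s j (Y k \<omega>)) =
    (\<Sum>u\<in>range (s j). ((\<Sum>k<n. indicator (s j -` {u}) (Y k \<omega>)) / real n) *\<^sub>R u)" for n
   proof -
    have "(\<Sum>k<n. s j (Y k \<omega>)) = (\<Sum>k<n. \<Sum>u\<in>range (s j). indicator (s j -` {u}) (Y k \<omega>) *\<^sub>R u)"
     by (rule sum.cong[OF refl], rule simple_function_sum[OF s(1)])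
    also have "\<dots> = (\<Sum>u\<in>range (s j). (\<Sum>k<n. indicator (s j -` {u}) (Y k \<omega>)) *\<^sub>R u)"
     unfolding scaleR_sum_left by (rule sum.swap)
    finally show ?thesis by (simp only: scaleR_sum_right scaleR_scaleR) (simp add: mult.commute)
   qed
   then show ?thesis unfolding Es using elim(2) by (auto intro!: tendsto_sum tendsto_scaleR)
  qed
  show ?case
  proof (rule metric_LIMSEQ_I)
   fix e :: real assume e: "e > 0"
   obtain j where j: "d j < e / 4" using order_tendstoD(2)[OF d, of "e / 4"] e
    by (auto simp: eventually_sequentially)
   have "\<forall>\<^sub>F n in sequentially. (\<Sum>k<n. norm (Y k \<omega> - s j (Y k \<omega>))) / real n < e / 4"
    using elim(1) j by (intro order_tendstoD(2)[of _ "d j"]) auto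
   moreover have "\<forall>\<^sub>F n in sequentially.
     dist ((1 / real n) *\<^sub>R (\<Sum>k<n. s j (Y k \<omega>))) (LINT \<omega>|M. s j (Y 0 \<omega>)) < e / 4"
    using C[of j] e by (intro tendstoD) auto
   ultimately have "\<forall>\<^sub>F n in sequentially.
     dist ((1 / real n) *\<^sub>R (\<Sum>k<n. Y k \<omega>)) (expectation (Y 0)) < e"
   proof eventually_elim
    case (elim n)
    have "norm ((1 / real n) *\<^sub>R (\<Sum>k<n. Y k \<omega>) - (1 / real n) *\<^sub>R (\<Sum>k<n. s j (Y k \<omega>)))
     = norm (\<Sum>k<n. Y k \<omega> - s j (Y k \<omega>)) / real n"
     by (simp add: sum_subtractf scaleR_diff_right[symmetric])
    also have "\<dots> \<le> (\<Sum>k<n. norm (Y k \<omega> - s j (Y k \<omega>))) / real n"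
     by (intro divide_right_mono norm_sum) auto
    finally have 1: "dist ((1 / real n) *\<^sub>R (\<Sum>k<n. Y k \<omega>)) ((1 / real n) *\<^sub>R (\<Sum>k<n. s j (Y k \<omega>))) < e / 4"
     unfolding dist_norm using elim(1) by (rule le_less_trans)
    have "dist (LINT \<omega>|M. s j (Y 0 \<omega>)) (expectation (Y 0)) < e / 4"
     using ed[of j] j by (simp add: dist_norm norm_minus_commute)
    with 1 elim(2) show ?case
     using dist_triangle[of "(1 / real n) *\<^sub>R (\<Sum>k<n. Y k \<omega>)" "expectation (Y 0)" "(LINT \<omega>|M. s j (Y 0 \<omega>))"]
      dist_triangle[of "(1 / real n) *\<^sub>R (\<Sum>k<n. Y k \<omega>)" "(LINT \<omega>|M. s j (Y 0 \<omega>))" "(1 / real n) *\<^sub>R (\<Sum>k<n. s j (Y k \<omega>))"] e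
     by linarith
   qed
   then show "\<exists>no. \<forall>n\<ge>no. dist ((1 / real n) *\<^sub>R (\<Sum>k<n. Y k \<omega>)) (expectation (Y 0)) < e"
    by (simp add: eventually_sequentially)
  qed
 qed
qed

text \<open>For every factor \<open>Suc K\<close> the probabilities that
  \<open>Suc K * (B n)^2\<close> reaches \<open>n + 1\<close> are summable, since they add up to at
  most a second moment. In the renewal argument this makes the fluctuation inside the running cycle
  negligible at the scale of the central limit theorem.\<close>

lemma iid_square_over_n:
 fixes B :: "nat \<Rightarrow> 'a \<Rightarrow> real"
 assumes B: "iid M borel B" and sq: "integrable M (\<lambda>\<omega>. (B 0 \<omega>)\<^sup>2)"
 shows "AE \<omega> in M. (\<lambda>n. (B n \<omega>)\<^sup>2 / real n) \<longlonglongrightarrow> 0"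
proof -
 note [measurable] = iid_measurable[OF B]
 \<comment> \<open>Layer-cake count: at most \<open>\<lfloor>y\<rfloor>\<close> of the thresholds 1,
   2, 3, ... lie below \<open>y\<close>.\<close>
 have cnt: "(\<Sum>n. indicator {real (Suc n)..} y :: ennreal) \<le> ennreal y" if "y \<ge> 0" for y :: real
 proof (rule suminf_le_const)
  fix N
  have "(\<Sum>n<N. indicator {real (Suc n)..} y :: real) = real (card {n. n < N \<and> real (Suc n) \<le> y})"
   by (simp add: indicator_def of_bool_def sum.If_cases Int_def)
  also have "{n. n < N \<and> real (Suc n) \<le> y} \<subseteq> {..<nat \<lfloor>y\<rfloor>}"
   using that by (auto simp: le_nat_floor Suc_le_eq[symmetric])
  then have "real (card {n. n < N \<and> real (Suc n) \<le> y}) \<le> real (card {..<nat \<lfloor>y\<rfloor>})"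
   by (intro of_nat_mono card_mono) auto
  also have "\<dots> \<le> y" using that by simp
  finally have "ennreal (\<Sum>n<N. indicator {real (Suc n)..} y) \<le> ennreal y" by (rule ennreal_leI)
  then show "(\<Sum>n<N. indicator {real (Suc n)..} y) \<le> ennreal y"
   by (simp add: sum_ennreal[symmetric] ennreal_indicator del: sum_ennreal)
 qed simp
 have "AE \<omega> in M. \<forall>K. (\<lambda>n. indicator {real (Suc n)..} (real (Suc K) * (B n \<omega>)\<^sup>2) :: real) \<longlonglongrightarrow> 0"
  unfolding AE_all_countable
 proof
  fix K :: nat
  show "AE \<omega> in M. (\<lambda>n. indicator {real (Suc n)..} (real (Suc K) * (B n \<omega>)\<^sup>2) :: real) \<longlonglongrightarrow> 0"
  proof (rule AE_tendsto_0_of_summable_nn_integral)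
   have "(\<Sum>n. \<integral>\<^sup>+\<omega>. ennreal (indicator {real (Suc n)..} (real (Suc K) * (B n \<omega>)\<^sup>2)) \<partial>M) =
    (\<Sum>n. \<integral>\<^sup>+\<omega>. ennreal (indicator {real (Suc n)..} (real (Suc K) * (B 0 \<omega>)\<^sup>2)) \<partial>M)"
    by (intro suminf_cong iid_nn_integral[OF B]) measurable
   also have "\<dots> = (\<integral>\<^sup>+\<omega>. (\<Sum>n. indicator {real (Suc n)..} (real (Suc K) * (B 0 \<omega>)\<^sup>2)) \<partial>M)"
    by (subst nn_integral_suminf[symmetric]) (auto simp: ennreal_indicator)
   also have "\<dots> \<le> (\<integral>\<^sup>+\<omega>. ennreal (real (Suc K) * (B 0 \<omega>)\<^sup>2) \<partial>M)"
    by (intro nn_integral_mono cnt) auto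
   also have "\<dots> = ennreal (LINT \<omega>|M. real (Suc K) * (B 0 \<omega>)\<^sup>2)"
    using sq by (intro nn_integral_eq_integral) auto
   finally show "(\<Sum>n. \<integral>\<^sup>+\<omega>. ennreal (indicator {real (Suc n)..} (real (Suc K) * (B n \<omega>)\<^sup>2)) \<partial>M) < \<infinity>"
    by (simp add: top.not_eq_extremum order_le_less_trans)
  qed auto
 qed
 then show ?thesis
 proof eventually_elim
  case (elim \<omega>)
  show ?case
  proof (rule metric_LIMSEQ_I)
   fix e :: real assume e: "e > 0"
   obtain K where K: "inverse (real (Suc K)) < e / 2" using reals_Archimedean[of "e / 2"] e by auto
   have "\<forall>\<^sub>F n in sequentially. (indicator {real (Suc n)..} (real (Suc K) * (B n \<omega>)\<^sup>2) :: real) < 1"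
    using elim by (intro order_tendstoD(2)[of _ 0]) auto
   then have "\<forall>\<^sub>F n in sequentially. dist ((B n \<omega>)\<^sup>2 / real n) 0 < e"
    using eventually_gt_at_top[of 0]
   proof eventually_elim
    case (elim n)
    then have "real (Suc K) * (B n \<omega>)\<^sup>2 < real (Suc n)" by (auto simp: indicator_def split: if_splits)
    then have "(B n \<omega>)\<^sup>2 < inverse (real (Suc K)) * real (Suc n)"
     by (simp add: field_simps)
    also have "\<dots> \<le> e / 2 * (2 * real n)"
     using K elim(2) e by (intro mult_mono) auto
    finally show ?case using elim(2) by (simp add: dist_real_def field_simps)
   qed
   then show "\<exists>no. \<forall>n\<ge>no. dist ((B n \<omega>)\<^sup>2 / real n) 0 < e" by (simp add: eventually_sequentially)
  qed
 qed
qed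

end

section \<open>The central limit theorem in spaces of type 2\<close>

function gram_schmidt :: "'a measure \<Rightarrow> (nat \<Rightarrow> 'a \<Rightarrow> real) \<Rightarrow> nat \<Rightarrow> 'a \<Rightarrow> real" where
 "gram_schmidt M h n = (\<lambda>\<omega>. h n \<omega> - (\<Sum>k<n.
   (LINT x|M. h n x * gram_schmidt M h k x) / (LINT x|M. gram_schmidt M h k x * gram_schmidt M h k x)
    * gram_schmidt M h k \<omega>))"
 by pat_completeness auto
termination by (relation "Wellfounded.measure (\<lambda>(M, h, n). n)") auto

declare gram_schmidt.simps [simp del]

definition bounded_rv :: "'a measure \<Rightarrow> ('a \<Rightarrow> real) \<Rightarrow> bool" where
 "bounded_rv M f \<longleftrightarrow> f \<in> borel_measurable M \<and> (\<exists>c. \<forall>\<omega>. \<bar>f \<omega>\<bar> \<le> c)"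

lemma bounded_rv_measurable: "bounded_rv M f \<Longrightarrow> f \<in> borel_measurable M"
 by (simp add: bounded_rv_def)

lemma bounded_rv_add:
 assumes "bounded_rv M f" "bounded_rv M g" shows "bounded_rv M (\<lambda>\<omega>. f \<omega> + g \<omega>)"
proof -
 obtain c d where "\<And>\<omega>. \<bar>f \<omega>\<bar> \<le> c" "\<And>\<omega>. \<bar>g \<omega>\<bar> \<le> d" using assms by (auto simp: bounded_rv_def)
 then have "\<bar>f \<omega> + g \<omega>\<bar> \<le> c + d" for \<omega> by (meson abs_triangle_ineq add_mono order_trans)
 then show ?thesis using assms by (auto simp: bounded_rv_def)
qed

lemma bounded_rv_mult:
 assumes "bounded_rv M f" "bounded_rv M g" shows "bounded_rv M (\<lambda>\<omega>. f \<omega> * g \<omega>)"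
proof -
 obtain c d where cd: "\<And>\<omega>. \<bar>f \<omega>\<bar> \<le> c" "\<And>\<omega>. \<bar>g \<omega>\<bar> \<le> d" using assms by (auto simp: bounded_rv_def)
 then have "\<bar>f \<omega> * g \<omega>\<bar> \<le> c * d" for \<omega>
  unfolding abs_mult by (intro mult_mono) (auto intro: order_trans[OF abs_ge_zero])
 then show ?thesis using assms by (auto simp: bounded_rv_def)
qed

lemma bounded_rv_const: "bounded_rv M (\<lambda>_. c)"
 by (auto simp: bounded_rv_def)

lemma bounded_rv_sum:
 assumes "\<And>i. i \<in> I \<Longrightarrow> bounded_rv M (f i)" shows "bounded_rv M (\<lambda>\<omega>. \<Sum>i\<in>I. f i \<omega>)"
 using assms by (induction I rule: infinite_finite_induct) (auto intro: bounded_rv_add bounded_rv_const)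

lemma (in prob_space) bounded_rv_integrable: "bounded_rv M f \<Longrightarrow> integrable M f"
proof -
 assume "bounded_rv M f"
 then obtain c where "f \<in> borel_measurable M" "\<And>\<omega>. \<bar>f \<omega>\<bar> \<le> c" by (auto simp: bounded_rv_def)
 then show ?thesis by (intro integrable_const_bound[where B=c]) auto
qed

lemma bounded_rv_gram_schmidt:
 assumes "\<And>n. bounded_rv M (h n)"
 shows "bounded_rv M (gram_schmidt M h n)"
proof (induction n rule: less_induct)
 case (less n)
 have *: "gram_schmidt M h n = (\<lambda>\<omega>. h n \<omega> + (\<Sum>k<n.
   (- ((LINT x|M. h n x * gram_schmidt M h k x) / (LINT x|M. gram_schmidt M h k x * gram_schmidt M h k x)))
    * gram_schmidt M h k \<omega>))"
  by (subst gram_schmidt.simps) (simp add: sum_negf)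
 show ?case
  unfolding * by (intro bounded_rv_add bounded_rv_sum bounded_rv_mult bounded_rv_const assms less) auto
qed

text \<open>By strong induction the earlier vectors are mutually orthogonal, which reduces the
  projection sum to the single term with index \<open>m\<close>; its coefficient is made to cancel
  the inner product with \<open>h n\<close>.\<close>

lemma (in prob_space) gram_schmidt_orthogonal:
 assumes h: "\<And>n. bounded_rv M (h n)" and "m < n"
 shows "(LINT x|M. gram_schmidt M h n x * gram_schmidt M h m x) = 0"
 using assms(2)
proof (induction n arbitrary: m rule: less_induct)
 case (less n)
 let ?e = "gram_schmidt M h"
 define c where "c k = (LINT x|M. h n x * ?e k x) / (LINT x|M. ?e k x * ?e k x)" for k
 note e = bounded_rv_gram_schmidt[OF h]
 have int: "integrable M (\<lambda>x. ?e i x * ?e j x)" "integrable M (\<lambda>x. h i x * ?e j x)" for i j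
  by (intro bounded_rv_integrable bounded_rv_mult e h)+
 have orth: "(LINT x|M. ?e k x * ?e m x) = 0" if "k < n" "k \<noteq> m" for k
  using that less.IH[of k m] less.IH[of m k] less.prems by (cases "m < k") (auto simp: mult.commute)
 have "(LINT x|M. ?e n x * ?e m x) = (LINT x|M. h n x * ?e m x - (\<Sum>k<n. c k * (?e k x * ?e m x)))"
  by (subst gram_schmidt.simps, rule Bochner_Integration.integral_cong)
    (auto simp: c_def left_diff_distrib sum_distrib_right mult.assoc)
 also have "\<dots> = (LINT x|M. h n x * ?e m x) - (\<Sum>k<n. c k * (LINT x|M. ?e k x * ?e m x))"
  using int by simp
 also have "(\<Sum>k<n. c k * (LINT x|M. ?e k x * ?e m x)) = (\<Sum>k\<in>{m}. c k * (LINT x|M. ?e k x * ?e m x))"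
  using less.prems orth by (intro sum.mono_neutral_right) auto
 also have "\<dots> = (LINT x|M. h n x * ?e m x)"
 \<comment> \<open>If \<open>?e m\<close> vanishes almost surely, then so does its product with
   \<open>h n\<close>, and both sides are 0.\<close>
 proof (cases "(LINT x|M. ?e m x * ?e m x) = 0")
  case True
  then have "AE x in M. ?e m x * ?e m x = 0"
   using integral_nonneg_eq_0_iff_AE[OF int(1)[of m m]] by simp
  then have "AE x in M. h n x * ?e m x = 0" by eventually_elim simp
  then have "(LINT x|M. h n x * ?e m x) = (LINT x|M. 0)"
   by (intro integral_cong_AE)
    (auto intro!: bounded_rv_measurable bounded_rv_mult e h simp del: mult_eq_0_iff)
  then show ?thesis using True by simp
 qed (simp add: c_def)
 finally show ?case by simp
qed

text \<open>A Cholesky factor for infinitely many variables at once. Triangularity makes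
  \<open>L\<close> independent of the cut-off \<open>N\<close>, so that one Gaussian sequence serves
  all finite subfamilies simultaneously.\<close>

lemma (in prob_space) covariance_factorization:
 assumes h: "\<And>n. bounded_rv M (h n)"
 obtains L :: "nat \<Rightarrow> nat \<Rightarrow> real" where "\<And>i k. k > i \<Longrightarrow> L i k = 0"
  "\<And>i j N. i \<le> N \<Longrightarrow> j \<le> N \<Longrightarrow> (LINT x|M. h i x * h j x) = (\<Sum>k\<le>N. L i k * L j k)"
proof -
 let ?e = "gram_schmidt M h"
 note e = bounded_rv_gram_schmidt[OF h]
 have int: "integrable M (\<lambda>x. ?e i x * ?e j x)" for i j
  by (intro bounded_rv_integrable bounded_rv_mult e h)+
 define a where "a n k = (if k < n then (LINT x|M. h n x * ?e k x) / (LINT x|M. ?e k x * ?e k x)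
   else if k = n then 1 else 0)" for n k
 define q where "q k = (LINT x|M. ?e k x * ?e k x)" for k
 have q: "q k \<ge> 0" for k unfolding q_def by (intro integral_nonneg_AE) auto
 have h_eq: "h n \<omega> = (\<Sum>k\<le>N. a n k * ?e k \<omega>)" if "n \<le> N" for n N \<omega>
 proof -
  have "(\<Sum>k\<le>N. a n k * ?e k \<omega>) = (\<Sum>k\<le>n. a n k * ?e k \<omega>)"
   using that by (intro sum.mono_neutral_right) (auto simp: a_def)
  also have "\<dots> = (\<Sum>k<n. a n k * ?e k \<omega>) + ?e n \<omega>"
   by (simp add: lessThan_Suc_atMost[symmetric] a_def del: lessThan_Suc_atMost)
  also have "\<dots> = h n \<omega>"
   by (subst (2) gram_schmidt.simps) (simp add: a_def)
  finally show ?thesis by simp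
 qed
 \<comment> \<open>The norms of the orthogonal vectors are moved into the coefficients, which
   remains meaningful when \<open>q k = 0\<close>.\<close>
 define L where "L i k = a i k * sqrt (q k)" for i k
 show ?thesis
 proof (rule that[of L])
  show "L i k = 0" if "k > i" for i k using that by (simp add: L_def a_def)
  fix i j N assume ij: "i \<le> N" "j \<le> (N::nat)"
  have "(LINT x|M. h i x * h j x) = (LINT x|M. (\<Sum>k\<le>N. \<Sum>l\<le>N. (a i k * a j l) * (?e k x * ?e l x)))"
   unfolding h_eq[OF ij(1)] h_eq[OF ij(2)] sum_product by (simp add: mult_ac)
  also have "\<dots> = (\<Sum>k\<le>N. \<Sum>l\<le>N. (a i k * a j l) * (LINT x|M. ?e k x * ?e l x))"
   using int by simp
  also have "\<dots> = (\<Sum>k\<le>N. \<Sum>l\<in>{k}. (a i k * a j l) * (LINT x|M. ?e k x * ?e l x))"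
  proof (rule sum.cong[OF refl], rule sum.mono_neutral_right)
   fix k assume "k \<in> {..N}"
   show "\<forall>l\<in>{..N} - {k}. (a i k * a j l) * (LINT x|M. ?e k x * ?e l x) = 0"
   proof
    fix l assume "l \<in> {..N} - {k}"
    then have "(LINT x|M. ?e k x * ?e l x) = 0"
     using gram_schmidt_orthogonal[OF h, of k l] gram_schmidt_orthogonal[OF h, of l k]
     by (cases "k < l") (auto simp: mult.commute)
    then show "(a i k * a j l) * (LINT x|M. ?e k x * ?e l x) = 0" by simp
   qed
  qed auto
  also have "\<dots> = (\<Sum>k\<le>N. L i k * L j k)"
  proof (intro sum.cong refl)
   fix k
   have "L i k * L j k = a i k * a j k * (sqrt (q k) * sqrt (q k))" by (simp add: L_def mult_ac)
   then show "(\<Sum>l\<in>{k}. (a i k * a j l) * (LINT x|M. ?e k x * ?e l x)) = L i k * L j k"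
    using q[of k] by (simp add: q_def)
  qed
  finally show "(LINT x|M. h i x * h j x) = (\<Sum>k\<le>N. L i k * L j k)" .
 qed
qed

section \<open>Product measures and the standard Gaussian sequence\<close>

lemma iid_coordinates:
 assumes "prob_space p"
 shows "iid (PiM UNIV (\<lambda>_::nat. p)) p (\<lambda>i x. x i)"
proof -
 let ?P = "PiM UNIV (\<lambda>_::nat. p)"
 interpret P: prob_space ?P by (rule prob_space_PiM) (rule assms)
 have c: "distr ?P p (\<lambda>x. x i) = p" for i
 proof -
  interpret product_prob_space "\<lambda>_::nat. p" UNIV
   by (intro product_prob_spaceI assms)
  show ?thesis using PiM_component[of i] by simp
 qed
 have r: "(\<lambda>x. restrict x UNIV) = (\<lambda>x :: nat \<Rightarrow> 'a. x)" by (simp add: restrict_def)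
 have "P.indep_vars (\<lambda>_. p) (\<lambda>i x. x i) UNIV"
  by (subst P.indep_vars_iff_distr_eq_PiM) (auto simp: c r distr_id)
 then show ?thesis unfolding iid_def by (simp add: c)
qed

lemma (in prob_space) iid_distr_sequence:
 assumes "iid M S X"
 shows "distr M (PiM UNIV (\<lambda>_. S)) (\<lambda>\<omega> i. X i \<omega>) = PiM UNIV (\<lambda>_. distr M S (X 0))"
proof -
 have "distr M (PiM UNIV (\<lambda>_. S)) (\<lambda>\<omega>. \<lambda>i\<in>UNIV. X i \<omega>) = PiM UNIV (\<lambda>i. distr M S (X i))"
  using indep_vars_iff_distr_eq_PiM[where I=UNIV and M'="\<lambda>_. S" and X=X] iid_indep[OF assms] iid_measurable[OF assms] by simp
 also have "PiM UNIV (\<lambda>i. distr M S (X i)) = PiM UNIV (\<lambda>_. distr M S (X 0))"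
  using assms by (intro PiM_cong) (auto simp: iid_def)
 moreover have "(\<lambda>\<omega>. \<lambda>i\<in>UNIV. X i \<omega>) = (\<lambda>\<omega> i. X i \<omega>)" by (simp add: restrict_def)
 ultimately show ?thesis by simp
qed

abbreviation gauss_seq :: "(nat \<Rightarrow> real) measure" where
 "gauss_seq \<equiv> PiM UNIV (\<lambda>_. std_normal_distribution)"

lemma prob_space_gauss_seq: "prob_space gauss_seq"
 using real_dist_normal_dist by (intro prob_space_PiM) (simp add: real_distribution_def)

lemma char_gauss_linear:
 "char (distr gauss_seq borel (\<lambda>x. \<Sum>k\<le>N. a k * x k)) t
   = complex_of_real (exp (- (t\<^sup>2 * (\<Sum>k\<le>N. (a k)\<^sup>2)) / 2))"
proof -
 interpret G: prob_space gauss_seq by (rule prob_space_gauss_seq)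
 have std: "prob_space std_normal_distribution"
  using real_dist_normal_dist by (simp add: real_distribution_def)
 note iid = iid_coordinates[OF std]
 have m: "(\<lambda>x. x k) \<in> borel_measurable gauss_seq" for k
  using G.iid_measurable[OF iid, of k] by (simp add: measurable_def)
 have "G.indep_vars (\<lambda>_. std_normal_distribution) (\<lambda>i x. x i) {..N}"
  using G.indep_vars_subset[OF G.iid_indep[OF iid]] by simp
 then have "G.indep_vars (\<lambda>_. borel) (\<lambda>i x. a i * x i) {..N}"
 proof (rule G.indep_vars_compose2)
  have "(\<lambda>y. a i * y) \<in> borel_measurable borel" for i by simp
  then show "(\<lambda>y. a i * y) \<in> borel_measurable std_normal_distribution" for i
   by (subst measurable_cong_sets[of _ borel _ borel]) auto
 qed
 note char = G.char_distr_sum[OF this, of t]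
 have "char (distr gauss_seq borel (\<lambda>x. a k * x k)) t = complex_of_real (exp (- ((a k * t)\<^sup>2) / 2))" for k
 proof -
  have d: "distr gauss_seq std_normal_distribution (\<lambda>x. x k) = std_normal_distribution"
  proof -
   interpret product_prob_space "\<lambda>_::nat. std_normal_distribution" UNIV
    by (intro product_prob_spaceI std)
   show ?thesis using PiM_component[of k] by simp
  qed
  have "char (distr gauss_seq borel (\<lambda>x. a k * x k)) t = (CLINT x|gauss_seq. iexp ((a k * t) * x k))"
   unfolding char_def using m by (subst integral_distr) (auto simp: mult_ac)
  also have "\<dots> = (CLINT y|distr gauss_seq std_normal_distribution (\<lambda>x. x k). iexp ((a k * t) * y))"
   by (subst integral_distr[OF G.iid_measurable[OF iid]]) simp_all
  also have "\<dots> = char std_normal_distribution (a k * t)"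
   unfolding d char_def ..
  finally show ?thesis by (simp add: char_std_normal_distribution)
 qed
 then have "char (distr gauss_seq borel (\<lambda>x. \<Sum>k\<le>N. a k * x k)) t = complex_of_real (\<Prod>k\<le>N. exp (- ((a k * t)\<^sup>2) / 2))"
  using char by simp
 also have "(\<Prod>k\<le>N. exp (- ((a k * t)\<^sup>2) / 2)) = exp (- (t\<^sup>2 * (\<Sum>k\<le>N. (a k)\<^sup>2)) / 2)"
  by (simp add: exp_sum[symmetric] sum_divide_distrib sum_distrib_left power_mult_distrib sum_negf mult_ac)
 finally show ?thesis .
qed

lemma gauss_second_moment:
 "integrable gauss_seq (\<lambda>x. (x k)\<^sup>2)" "(LINT x|gauss_seq. (x k)\<^sup>2) = 1"
 "integrable gauss_seq (\<lambda>x. x k)" "(LINT x|gauss_seq. x k) = 0"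
 "k \<noteq> l \<Longrightarrow> integrable gauss_seq (\<lambda>x. x k * x l)" "k \<noteq> l \<Longrightarrow> (LINT x|gauss_seq. x k * x l) = 0"
proof -
 interpret G: prob_space gauss_seq by (rule prob_space_gauss_seq)
 have std: "prob_space std_normal_distribution"
  using real_dist_normal_dist by (simp add: real_distribution_def)
 note iid = iid_coordinates[OF std]
 interpret product_prob_space "\<lambda>_::nat. std_normal_distribution" UNIV
  by (intro product_prob_spaceI std)
 have d: "distr gauss_seq std_normal_distribution (\<lambda>x. x k) = std_normal_distribution" for k
  using PiM_component[of k] by simp
 note m = G.iid_measurable[OF iid]
 have mom: "integrable std_normal_distribution (\<lambda>x. x ^ n)" for n
  by (rule integrable_std_normal_distribution_moment)
 have int: "integrable gauss_seq (\<lambda>x. (x k) ^ n)" for k n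
  using mom[of n] integrable_distr[OF m[of k], of "\<lambda>x. x ^ n"] unfolding d by simp
 have E: "(LINT x|gauss_seq. (x k) ^ n) = (LINT x|std_normal_distribution. x ^ n)" for k n
  using m[of k] by (subst (2) d[of k, symmetric]) (simp add: integral_distr)
 show "integrable gauss_seq (\<lambda>x. (x k)\<^sup>2)" by (rule int)
 show i1: "integrable gauss_seq (\<lambda>x. x k)" for k using int[of k 1] by simp
 show "(LINT x|gauss_seq. (x k)\<^sup>2) = 1"
  unfolding E using std_normal_distribution_even_moments[of 1] by simp
 show e1: "(LINT x|gauss_seq. x k) = 0" for k
  using E[of k 1] integral_std_normal_moment_odd[of 0] by (simp add: integral_density)
 assume kl: "k \<noteq> l"
 have m': "(\<lambda>x. x k) \<in> borel_measurable gauss_seq" for k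
  using m[of k] by (simp add: measurable_def)
 have iv: "G.indep_vars (\<lambda>_. borel) (\<lambda>i x. x i) UNIV"
  using G.indep_vars_compose2[OF G.iid_indep[OF iid], of "\<lambda>_ x. x" "\<lambda>_. borel"]
  by (auto simp: measurable_def)
 have "G.indep_var borel (\<lambda>x. x k) borel (\<lambda>x. \<Sum>i\<in>{l}. x i)"
  using kl by (intro G.indep_vars_sum G.indep_vars_subset[OF iv]) auto
 then have ind: "G.indep_var borel (\<lambda>x. x k) borel (\<lambda>x. x l)" by simp
 show "integrable gauss_seq (\<lambda>x. x k * x l)" "(LINT x|gauss_seq. x k * x l) = 0"
  using G.indep_var_integrable[OF ind i1 i1] G.indep_var_lebesgue_integral[OF ind i1 i1] e1 by simp_all
qed

lemma gauss_linear_second_moment: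
 "integrable gauss_seq (\<lambda>x. (\<Sum>k\<le>N. a k * x k)\<^sup>2)"
 "(LINT x|gauss_seq. (\<Sum>k\<le>N. a k * x k)\<^sup>2) = (\<Sum>k\<le>N. (a k)\<^sup>2)"
proof -
 have eq: "(\<Sum>k\<le>N. a k * x k)\<^sup>2 = (\<Sum>k\<le>N. \<Sum>l\<le>N. (a k * a l) * (x k * x l))" for x :: "nat \<Rightarrow> real"
  unfolding power2_eq_square sum_product by (simp add: mult_ac)
 have int: "integrable gauss_seq (\<lambda>x. x k * x l)" for k l
  using gauss_second_moment(1)[of k] gauss_second_moment(5)[of k l]
  by (cases "k = l") (auto simp: power2_eq_square)
 have E: "(LINT x|gauss_seq. x k * x l) = (if k = l then 1 else 0)" for k l
  using gauss_second_moment(2)[of k] gauss_second_moment(6)[of k l] by (auto simp: power2_eq_square)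
 show "integrable gauss_seq (\<lambda>x. (\<Sum>k\<le>N. a k * x k)\<^sup>2)" unfolding eq using int by simp
 show "(LINT x|gauss_seq. (\<Sum>k\<le>N. a k * x k)\<^sup>2) = (\<Sum>k\<le>N. (a k)\<^sup>2)"
  unfolding eq using int by (simp add: E power2_eq_square if_distrib cong: if_cong)
qed

text \<open>The scalar central limit theorem normalizes by the standard deviation, so variance 0 is
  treated apart; for positive variance the argument \<open>t * sqrt v\<close> undoes the
  normalization.\<close>

lemma (in prob_space) clt_char:
 fixes X :: "nat \<Rightarrow> 'a \<Rightarrow> real"
 assumes X: "iid M borel X" and sq: "integrable M (\<lambda>\<omega>. (X 0 \<omega>)\<^sup>2)" and mean: "expectation (X 0) = 0"
 shows "(\<lambda>n. CLINT \<omega>|M. iexp (t * ((1 / sqrt (real n)) * (\<Sum>k<n. X k \<omega>))))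
   \<longlonglongrightarrow> complex_of_real (exp (- (t\<^sup>2 * expectation (\<lambda>\<omega>. (X 0 \<omega>)\<^sup>2)) / 2))"
proof -
 note [measurable] = iid_measurable[OF X]
 define v where "v = expectation (\<lambda>\<omega>. (X 0 \<omega>)\<^sup>2)"
 have sqn: "integrable M (\<lambda>\<omega>. (X n \<omega>)\<^sup>2)" for n
  using sq iid_integrable[OF X, of "\<lambda>x. x\<^sup>2" n] by simp
 have mean_n: "expectation (X n) = 0" for n
  using iid_integral[OF X, of "\<lambda>x. x" n] mean by simp
 have var_n: "expectation (\<lambda>\<omega>. (X n \<omega>)\<^sup>2) = v" for n
  using iid_integral[OF X, of "\<lambda>x. x\<^sup>2" n] by (simp add: v_def)
 have v0: "v \<ge> 0" unfolding v_def by simp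
 show ?thesis
 proof (cases "v = 0")
  case True
  have "AE \<omega> in M. X n \<omega> = 0" for n
   using integral_nonneg_eq_0_iff_AE[OF sqn[of n]] var_n[of n] True by simp
  then have "AE \<omega> in M. \<forall>n. X n \<omega> = 0" unfolding AE_all_countable by simp
  then have "AE \<omega> in M. iexp (t * ((1 / sqrt (real n)) * (\<Sum>k<n. X k \<omega>))) = 1" for n
   by eventually_elim simp
  then have "(CLINT \<omega>|M. iexp (t * ((1 / sqrt (real n)) * (\<Sum>k<n. X k \<omega>)))) = (CLINT \<omega>|M. 1)" for n
   by (intro integral_cong_AE) auto
  then have "(CLINT \<omega>|M. iexp (t * ((1 / sqrt (real n)) * (\<Sum>k<n. X k \<omega>)))) = 1" for n
   by (simp add: prob_space)
  then show ?thesis using True unfolding v_def[symmetric] by simp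
 next
  case False
  then have s: "sqrt v > 0" using v0 by simp
  have "weak_conv_m (\<lambda>n. distr M borel (\<lambda>\<omega>. (\<Sum>k<n. X k \<omega>) / sqrt (real n * (sqrt v)\<^sup>2))) std_normal_distribution"
   by (rule central_limit_theorem_zero_mean[where \<mu>="distr M borel (X 0)"])
     (use s sqn mean_n var_n v0 iid_indep[OF X] X in \<open>auto simp: iid_def\<close>)
  then have "(\<lambda>n. char (distr M borel (\<lambda>\<omega>. (\<Sum>k<n. X k \<omega>) / sqrt (real n * (sqrt v)\<^sup>2))) (t * sqrt v))
    \<longlonglongrightarrow> char std_normal_distribution (t * sqrt v)"
   by (intro levy_continuity1 real_dist_normal_dist real_distribution_distr) auto
  moreover have "char (distr M borel (\<lambda>\<omega>. (\<Sum>k<n. X k \<omega>) / sqrt (real n * (sqrt v)\<^sup>2))) (t * sqrt v)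
   = (CLINT \<omega>|M. iexp (t * ((1 / sqrt (real n)) * (\<Sum>k<n. X k \<omega>))))" for n
  proof -
   have "char (distr M borel (\<lambda>\<omega>. (\<Sum>k<n. X k \<omega>) / sqrt (real n * (sqrt v)\<^sup>2))) (t * sqrt v)
    = (CLINT \<omega>|M. iexp ((t * sqrt v) * ((\<Sum>k<n. X k \<omega>) / sqrt (real n * (sqrt v)\<^sup>2))))"
    unfolding char_def by (subst integral_distr) auto
   moreover have eq: "(t * sqrt v) * (y / sqrt (real n * (sqrt v)\<^sup>2)) = t * ((1 / sqrt (real n)) * y)" for y
    using s v0 by (simp add: real_sqrt_mult)
   ultimately show ?thesis by (simp only:)
  qed
  ultimately show ?thesis
   using v0 unfolding v_def[symmetric] by (simp add: char_std_normal_distribution power_mult_distrib)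
 qed
qed

text \<open>The phases \<open>\<theta>\<close> put sines and constants into the class and make it
  closed under products by the addition formulas, as the Stone-Weierstrass theorem demands.\<close>

inductive trig_poly :: "nat set \<Rightarrow> ((nat \<Rightarrow> real) \<Rightarrow> real) \<Rightarrow> bool" for F where
 base: "trig_poly F (\<lambda>c. a * cos ((\<Sum>i\<in>F. \<xi> i * c i) + \<theta>))"
| add: "trig_poly F p \<Longrightarrow> trig_poly F q \<Longrightarrow> trig_poly F (\<lambda>c. p c + q c)"

lemma trig_poly_mult_base:
 assumes "trig_poly F q"
 shows "trig_poly F (\<lambda>c. a * cos ((\<Sum>i\<in>F. \<xi> i * c i) + \<theta>) * q c)"
 using assms
proof induction
 case (base a' \<xi>' \<theta>')
 have "a * cos ((\<Sum>i\<in>F. \<xi> i * c i) + \<theta>) * (a' * cos ((\<Sum>i\<in>F. \<xi>' i * c i) + \<theta>')) =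
   (a * a' / 2) * cos ((\<Sum>i\<in>F. (\<xi> i - \<xi>' i) * c i) + (\<theta> - \<theta>'))
   + (a * a' / 2) * cos ((\<Sum>i\<in>F. (\<xi> i + \<xi>' i) * c i) + (\<theta> + \<theta>'))" for c :: "nat \<Rightarrow> real"
 proof -
  have "(\<Sum>i\<in>F. (\<xi> i - \<xi>' i) * c i) + (\<theta> - \<theta>') = ((\<Sum>i\<in>F. \<xi> i * c i) + \<theta>) - ((\<Sum>i\<in>F. \<xi>' i * c i) + \<theta>')"
   "(\<Sum>i\<in>F. (\<xi> i + \<xi>' i) * c i) + (\<theta> + \<theta>') = ((\<Sum>i\<in>F. \<xi> i * c i) + \<theta>) + ((\<Sum>i\<in>F. \<xi>' i * c i) + \<theta>')"
   by (simp_all add: left_diff_distrib distrib_right sum_subtractf sum.distrib)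
  then show ?thesis by (simp only: cos_diff cos_add) (simp add: algebra_simps)
 qed
 then show ?case
  by (simp only:) (intro trig_poly.intros)
next
 case (add p q)
 then show ?case by (simp only: distrib_left) (intro trig_poly.add)
qed

lemma trig_poly_mult:
 assumes "trig_poly F p" "trig_poly F q"
 shows "trig_poly F (\<lambda>c. p c * q c)"
 using assms
 by induction (auto simp only: distrib_right intro: trig_poly_mult_base trig_poly.add)

lemma trig_poly_const: "trig_poly F (\<lambda>c. a)"
 using trig_poly.base[of F a "\<lambda>_. 0" 0] by simp

lemma trig_poly_bounded: "trig_poly F p \<Longrightarrow> \<exists>B. \<forall>c. \<bar>p c\<bar> \<le> B"
proof (induction rule: trig_poly.induct)
 case (base a \<xi> \<theta>)
 have "\<bar>a * cos y\<bar> \<le> \<bar>a\<bar>" for y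
  using mult_left_mono[OF abs_cos_le_one[of y], of "\<bar>a\<bar>"] by (simp add: abs_mult)
 then show ?case by blast
next
 case (add p q)
 then obtain B1 B2 where "\<And>c. \<bar>p c\<bar> \<le> B1" "\<And>c. \<bar>q c\<bar> \<le> B2" by blast
 then have "\<bar>p c + q c\<bar> \<le> B1 + B2" for c by (meson abs_triangle_ineq add_mono order_trans)
 then show ?case by blast
qed

lemma trig_poly_measurable:
 assumes "trig_poly F p" "\<And>i. (\<lambda>\<omega>. H \<omega> i) \<in> borel_measurable M"
 shows "(\<lambda>\<omega>. p (H \<omega>)) \<in> borel_measurable M"
 using assms
proof (induction rule: trig_poly.induct)
 case (base a \<xi> \<theta>)
 then have [measurable]: "(\<lambda>\<omega>. H \<omega> i) \<in> borel_measurable M" for i by simp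
 show ?case by measurable
qed auto

lemma trig_poly_integrable:
 assumes "prob_space M" "trig_poly F p" "\<And>i. (\<lambda>\<omega>. H \<omega> i) \<in> borel_measurable M"
 shows "integrable M (\<lambda>\<omega>. p (H \<omega>))"
proof -
 interpret prob_space M by fact
 obtain B where "\<And>c. \<bar>p c\<bar> \<le> B" using trig_poly_bounded[OF assms(2)] by blast
 then show ?thesis
  by (intro integrable_const_bound[where B=B]) (auto intro!: trig_poly_measurable[OF assms(2)] assms(3))
qed

lemma continuous_on_coordinate: "continuous_on S (\<lambda>u :: nat \<Rightarrow> real. u i)"
 by (rule continuous_on_subset[OF continuous_on_product_coordinates]) simp

text \<open>The substitution \<open>u = sin (a c)\<close> with \<open>a L = \<pi> / 2\<close> maps the box of half-width \<open>L\<close>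
 homeomorphically onto the unit box and keeps the approximating function bounded outside the box.\<close>

lemma trig_poly_approximation:
 fixes g :: "'w::real_normed_vector \<Rightarrow> real" and w :: "nat \<Rightarrow> 'w"
 assumes g: "continuous_on UNIV g" "\<And>y. \<bar>g y\<bar> \<le> B" and F: "finite F" and "L > 0" "e > 0"
 obtains p where "trig_poly F p"
  "\<And>c. \<bar>g (\<Sum>i\<in>F. c i *\<^sub>R w i) - p c\<bar> \<le> e + (2 * B + e) / L\<^sup>2 * (\<Sum>i\<in>F. (c i)\<^sup>2)"
proof -
 define a where "a = pi / (2 * L)"
 have a: "a > 0" using \<open>L > 0\<close> by (simp add: a_def)
 \<comment> \<open>Coordinates outside \<open>F\<close> are frozen at 0. Distinct points of the
   compact set \<open>S\<close> then already differ at an index in \<open>F\<close>, where a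
   trigonometric polynomial can separate them.\<close>
 define I where "I i = (if i \<in> F then {-1..1} else {0 :: real})" for i
 define S where "S = PiE UNIV I"
 define sn where "sn c = (\<lambda>i. if i \<in> F then sin (a * c i) else 0)" for c :: "nat \<Rightarrow> real"
 have sn_S: "sn c \<in> S" for c unfolding S_def sn_def I_def by auto
 define R where "R = {q. continuous_on S q \<and> trig_poly F (\<lambda>c. q (sn c))}"
 have "compactin (product_topology (\<lambda>_::nat. euclidean) UNIV) S"
  unfolding S_def compactin_PiE by (auto simp: I_def)
 then have "compact S" by (simp add: euclidean_product_topology)
 interpret function_ring_on R S
 proof
  show "compact S" by fact
  show "(\<lambda>x. f x + g x) \<in> R" if "f \<in> R" "g \<in> R" for f g
   using that unfolding R_def by (auto intro: continuous_on_add trig_poly.add)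
  show "(\<lambda>x. f x * g x) \<in> R" if "f \<in> R" "g \<in> R" for f g
   using that unfolding R_def by (auto intro: continuous_on_mult trig_poly_mult)
  show "(\<lambda>_. c) \<in> R" for c unfolding R_def by (auto intro: trig_poly_const)
  show "continuous_on S f" if "f \<in> R" for f using that by (simp add: R_def)
  fix u v assume uv: "u \<in> S" "v \<in> S" "u \<noteq> v"
  then obtain i where i: "u i \<noteq> v i" by blast
  have "u i \<in> I i" "v i \<in> I i" using uv(1,2) unfolding S_def by auto
  with i have iF: "i \<in> F" by (auto simp: I_def split: if_splits)
  \<comment> \<open>The sine is a cosine with phase \<open>- (pi / 2)\<close>, hence of the basic
    form.\<close>
  have "(\<lambda>c. sn c i) = (\<lambda>c. 1 * cos ((\<Sum>j\<in>F. (if j = i then a else 0) * c j) + (- (pi / 2))))"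
  proof
   fix c :: "nat \<Rightarrow> real"
   have "(\<Sum>j\<in>F. (if j = i then a else 0) * c j) = (\<Sum>j\<in>F. if j = i then a * c j else 0)"
    by (intro sum.cong) auto
   also have "\<dots> = a * c i" using F iF by simp
   finally show "sn c i = 1 * cos ((\<Sum>j\<in>F. (if j = i then a else 0) * c j) + (- (pi / 2)))"
    using iF by (simp add: sn_def cos_diff)
  qed
  then have "trig_poly F (\<lambda>c. sn c i)" by (simp only: trig_poly.base)
  then have "(\<lambda>u. u i) \<in> R" unfolding R_def by (simp add: continuous_on_coordinate)
  then show "\<exists>f\<in>R. f u \<noteq> f v" using i by (intro bexI[of _ "\<lambda>u. u i"])
 qed
 define ft where "ft u = g (\<Sum>i\<in>F. (arcsin (u i) / a) *\<^sub>R w i)" for u :: "nat \<Rightarrow> real"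
 have "continuous_on S ft"
  unfolding ft_def
 proof (rule continuous_on_compose2[OF g(1)])
  show "continuous_on S (\<lambda>u. \<Sum>i\<in>F. (arcsin (u i) / a) *\<^sub>R w i)"
  proof (intro continuous_on_sum continuous_on_scaleR continuous_on_divide continuous_on_const)
   fix i assume "i \<in> F"
   then show "continuous_on S (\<lambda>u. arcsin (u i))"
    by (intro continuous_on_compose2[OF continuous_on_arcsin' continuous_on_coordinate])
      (use \<open>i \<in> F\<close> PiE_mem[of _ UNIV I i] in \<open>auto simp: S_def I_def\<close>)
  qed (use a in auto)
 qed auto
 from Stone_Weierstrass_basic[OF this \<open>e > 0\<close>] obtain q where
  q: "q \<in> R" "\<And>u. u \<in> S \<Longrightarrow> \<bar>ft u - q u\<bar> < e" by blast
 have B0: "B \<ge> 0" using g(2)[of 0] by linarith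
 show ?thesis
 proof (rule that[of "\<lambda>c. q (sn c)"])
  show "trig_poly F (\<lambda>c. q (sn c))" using q(1) by (simp add: R_def)
  fix c :: "nat \<Rightarrow> real"
  have close: "\<bar>ft (sn c) - q (sn c)\<bar> < e" by (rule q(2)[OF sn_S])
  show "\<bar>g (\<Sum>i\<in>F. c i *\<^sub>R w i) - q (sn c)\<bar> \<le> e + (2 * B + e) / L\<^sup>2 * (\<Sum>i\<in>F. (c i)\<^sup>2)"
  proof (cases "\<forall>i\<in>F. \<bar>c i\<bar> \<le> L")
   case True
   have "arcsin (sin (a * c i)) / a = c i" if "i \<in> F" for i
   proof -
    have "a * \<bar>c i\<bar> \<le> pi / 2" using True that \<open>L > 0\<close> mult_left_mono[of "\<bar>c i\<bar>" L a] a
     by (simp add: a_def)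
    then have "\<bar>a * c i\<bar> \<le> pi / 2" using a by (simp add: abs_mult)
    then show ?thesis using a by (subst arcsin_sin) auto
   qed
   then have "ft (sn c) = g (\<Sum>i\<in>F. c i *\<^sub>R w i)"
    unfolding ft_def sn_def by (auto intro!: arg_cong[of _ _ g] sum.cong)
   moreover have "0 \<le> (2 * B + e) / L\<^sup>2 * (\<Sum>i\<in>F. (c i)\<^sup>2)"
    using B0 \<open>e > 0\<close> by (intro mult_nonneg_nonneg divide_nonneg_nonneg sum_nonneg) auto
   ultimately show ?thesis using close by linarith
  next
   \<comment> \<open>Outside the box the crude bound \<open>2 * B + e\<close> is paid for by the
     factor \<open>(\<Sum>i\<in>F. (c i)^2) / L^2\<close>, which is at least 1 there. After
     integration this becomes Chebyshev's inequality.\<close>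
   case False
   then obtain i where i: "i \<in> F" "\<bar>c i\<bar> > L" by auto
   have "L\<^sup>2 \<le> (c i)\<^sup>2" using i(2) \<open>L > 0\<close> by (metis abs_le_square_iff abs_of_pos less_imp_le)
   also have "\<dots> \<le> (\<Sum>i\<in>F. (c i)\<^sup>2)" using F i(1) by (intro member_le_sum) auto
   finally have "1 \<le> (\<Sum>i\<in>F. (c i)\<^sup>2) / L\<^sup>2" using \<open>L > 0\<close> by simp
   then have "(2 * B + e) * 1 \<le> (2 * B + e) * ((\<Sum>i\<in>F. (c i)\<^sup>2) / L\<^sup>2)"
    using B0 \<open>e > 0\<close> by (intro mult_left_mono) auto
   moreover have "\<bar>g (\<Sum>i\<in>F. c i *\<^sub>R w i) - q (sn c)\<bar> \<le> 2 * B + e"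
    using close g(2)[of "\<Sum>i\<in>F. c i *\<^sub>R w i"] g(2)[of "\<Sum>i\<in>F. (arcsin (sn c i) / a) *\<^sub>R w i"]
    unfolding ft_def by linarith
   ultimately show ?thesis using \<open>e > 0\<close> by simp
  qed
 qed
qed

text \<open>Integrated form of the pointwise error bound; it is applied on \<open>M\<close>,
  uniformly in \<open>n\<close>, and on the limit space with the same constants.\<close>

lemma trig_poly_expectation_close:
 fixes h :: "'a \<Rightarrow> nat \<Rightarrow> real" and g :: "'w::{real_normed_vector, second_countable_topology} \<Rightarrow> real"
 assumes P: "prob_space P" and h[measurable]: "\<And>i. (\<lambda>\<omega>. h \<omega> i) \<in> borel_measurable P"
  and sq: "\<And>i. i \<in> F \<Longrightarrow> integrable P (\<lambda>\<omega>. (h \<omega> i)\<^sup>2)" "\<And>i. i \<in> F \<Longrightarrow> (LINT \<omega>|P. (h \<omega> i)\<^sup>2) \<le> K"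
  and g: "continuous_on UNIV g" "\<And>y. \<bar>g y\<bar> \<le> B" and D: "D \<ge> 0" and p: "trig_poly F p"
  "\<And>c. \<bar>g (\<Sum>i\<in>F. c i *\<^sub>R w i) - p c\<bar> \<le> e + D * (\<Sum>i\<in>F. (c i)\<^sup>2)"
 shows "\<bar>(LINT \<omega>|P. g (\<Sum>i\<in>F. h \<omega> i *\<^sub>R w i)) - (LINT \<omega>|P. p (h \<omega>))\<bar> \<le> e + D * (real (card F) * \<bar>K\<bar>)"
proof -
 interpret P: prob_space P by fact
 have [measurable]: "g \<in> borel_measurable borel" using g(1) by (rule borel_measurable_continuous_onI)
 have i1: "integrable P (\<lambda>\<omega>. g (\<Sum>i\<in>F. h \<omega> i *\<^sub>R w i))"
  by (rule P.integrable_const_bound[where B=B]) (use g(2) in auto)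
 have i2: "integrable P (\<lambda>\<omega>. p (h \<omega>))" by (rule trig_poly_integrable[OF P p(1) h])
 have i3: "integrable P (\<lambda>\<omega>. \<Sum>i\<in>F. (h \<omega> i)\<^sup>2)" using sq(1) by simp
 have "\<bar>(LINT \<omega>|P. g (\<Sum>i\<in>F. h \<omega> i *\<^sub>R w i)) - (LINT \<omega>|P. p (h \<omega>))\<bar>
   = \<bar>LINT \<omega>|P. g (\<Sum>i\<in>F. h \<omega> i *\<^sub>R w i) - p (h \<omega>)\<bar>"
  using i1 i2 by simp
 also have "\<dots> \<le> (LINT \<omega>|P. \<bar>g (\<Sum>i\<in>F. h \<omega> i *\<^sub>R w i) - p (h \<omega>)\<bar>)"
  by (rule integral_abs_bound)
 also have "\<dots> \<le> (LINT \<omega>|P. e + D * (\<Sum>i\<in>F. (h \<omega> i)\<^sup>2))"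
  using i1 i2 i3 p(2) by (intro integral_mono) auto
 also have "\<dots> = e + D * (\<Sum>i\<in>F. (LINT \<omega>|P. (h \<omega> i)\<^sup>2))"
  using sq(1) by (simp add: P.prob_space)
 also have "\<dots> \<le> e + D * (\<Sum>i\<in>F. \<bar>K\<bar>)"
  using sq(2) D by (intro add_left_mono mult_left_mono sum_mono) (auto intro: order_trans[OF _ abs_ge_self])
 finally show ?thesis by simp
qed

text \<open>The multivariate method of characteristic functions, restricted to functions of finitely
 many coordinates; tightness comes from the uniform second moment bound.\<close>

lemma convergence_from_characters:
 fixes H :: "nat \<Rightarrow> 'a \<Rightarrow> nat \<Rightarrow> real" and \<gamma> :: "'b \<Rightarrow> nat \<Rightarrow> real"
  and g :: "'w::{real_normed_vector, second_countable_topology} \<Rightarrow> real"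
 assumes M: "prob_space M" and N: "prob_space N" and F: "finite F"
  and mH: "\<And>n i. (\<lambda>\<omega>. H n \<omega> i) \<in> borel_measurable M" and mg: "\<And>i. (\<lambda>x. \<gamma> x i) \<in> borel_measurable N"
  and cosl: "\<And>\<xi> \<theta>. (\<lambda>n. LINT \<omega>|M. cos ((\<Sum>i\<in>F. \<xi> i * H n \<omega> i) + \<theta>))
    \<longlonglongrightarrow> (LINT x|N. cos ((\<Sum>i\<in>F. \<xi> i * \<gamma> x i) + \<theta>))"
  and sqH: "\<And>n i. i \<in> F \<Longrightarrow> integrable M (\<lambda>\<omega>. (H n \<omega> i)\<^sup>2)"
   "\<And>n i. i \<in> F \<Longrightarrow> (LINT \<omega>|M. (H n \<omega> i)\<^sup>2) \<le> K"
  and sqg: "\<And>i. i \<in> F \<Longrightarrow> integrable N (\<lambda>x. (\<gamma> x i)\<^sup>2)"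
   "\<And>i. i \<in> F \<Longrightarrow> (LINT x|N. (\<gamma> x i)\<^sup>2) \<le> K"
  and g: "continuous_on UNIV g" "\<And>y. \<bar>g y\<bar> \<le> B"
 shows "(\<lambda>n. LINT \<omega>|M. g (\<Sum>i\<in>F. H n \<omega> i *\<^sub>R w i)) \<longlonglongrightarrow> (LINT x|N. g (\<Sum>i\<in>F. \<gamma> x i *\<^sub>R w i))"
proof (rule metric_LIMSEQ_I)
 interpret M: prob_space M by fact
 interpret N: prob_space N by fact
 note [measurable] = mH mg
 have gm[measurable]: "g \<in> borel_measurable borel" using g(1) by (rule borel_measurable_continuous_onI)
 have B0: "B \<ge> 0" using g(2)[of 0] by linarith
 fix r :: real assume r: "r > 0"
 define e where "e = r / 8"
 have e: "e > 0" using r by (simp add: e_def)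
 define K' where "K' = (2 * B + e) * (real (card F) * \<bar>K\<bar>)"
 have K': "K' \<ge> 0" using B0 e by (simp add: K'_def)
 \<comment> \<open>The box is taken so large that the Chebyshev term contributes at most
   \<open>e\<close>, uniformly in \<open>n\<close>.\<close>
 define L where "L = sqrt (K' / e + 1)"
 have L: "L > 0" "K' / L\<^sup>2 \<le> e"
 proof -
  have pos: "K' / e + 1 > 0" using K' e by (simp add: add_nonneg_pos)
  then show "L > 0" by (simp add: L_def)
  have "L\<^sup>2 = K' / e + 1" using pos by (simp add: L_def)
  then show "K' / L\<^sup>2 \<le> e" using e pos K' by (simp add: divide_le_eq field_simps)
 qed
 obtain p where p: "trig_poly F p"
  "\<And>c. \<bar>g (\<Sum>i\<in>F. c i *\<^sub>R w i) - p c\<bar> \<le> e + (2 * B + e) / L\<^sup>2 * (\<Sum>i\<in>F. (c i)\<^sup>2)"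
  using trig_poly_approximation[OF g F L(1) e] by blast
 have D: "(2 * B + e) / L\<^sup>2 \<ge> 0" using B0 e by simp
 have De: "(2 * B + e) / L\<^sup>2 * (real (card F) * \<bar>K\<bar>) \<le> e" using L(2) by (simp add: K'_def)
 have p_lim: "(\<lambda>n. LINT \<omega>|M. p (H n \<omega>)) \<longlonglongrightarrow> (LINT x|N. p (\<gamma> x))"
  using p(1)
 proof (induction rule: trig_poly.induct)
  case (base a \<xi> \<theta>)
  show ?case using tendsto_mult_left[OF cosl, of a \<xi> \<theta>] by simp
 next
  case (add p q)
  have "integrable M (\<lambda>\<omega>. p (H n \<omega>))" "integrable M (\<lambda>\<omega>. q (H n \<omega>))" for n
   by (rule trig_poly_integrable[OF M add.hyps(1) mH], rule trig_poly_integrable[OF M add.hyps(2) mH])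
  moreover have "integrable N (\<lambda>x. p (\<gamma> x))" "integrable N (\<lambda>x. q (\<gamma> x))"
   by (rule trig_poly_integrable[OF N add.hyps(1) mg], rule trig_poly_integrable[OF N add.hyps(2) mg])
  ultimately show ?case using tendsto_add[OF add.IH] by simp
 qed
 have "\<forall>\<^sub>F n in sequentially. dist (LINT \<omega>|M. p (H n \<omega>)) (LINT x|N. p (\<gamma> x)) < e"
  by (rule tendstoD[OF p_lim e])
 then have "\<forall>\<^sub>F n in sequentially.
   dist (LINT \<omega>|M. g (\<Sum>i\<in>F. H n \<omega> i *\<^sub>R w i)) (LINT x|N. g (\<Sum>i\<in>F. \<gamma> x i *\<^sub>R w i)) < r"
 proof eventually_elim
  case (elim n)
  have "\<bar>(LINT \<omega>|M. g (\<Sum>i\<in>F. H n \<omega> i *\<^sub>R w i)) - (LINT \<omega>|M. p (H n \<omega>))\<bar>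
    \<le> e + (2 * B + e) / L\<^sup>2 * (real (card F) * \<bar>K\<bar>)"
   by (rule trig_poly_expectation_close[OF M mH sqH(1) sqH(2) g D p]) simp_all
  moreover have "\<bar>(LINT x|N. g (\<Sum>i\<in>F. \<gamma> x i *\<^sub>R w i)) - (LINT x|N. p (\<gamma> x))\<bar>
    \<le> e + (2 * B + e) / L\<^sup>2 * (real (card F) * \<bar>K\<bar>)"
   by (rule trig_poly_expectation_close[OF N mg sqg(1) sqg(2) g D p]) simp_all
  ultimately show ?case using elim De r
   unfolding dist_real_def e_def by linarith
 qed
 then show "\<exists>no. \<forall>n\<ge>no. dist (LINT \<omega>|M. g (\<Sum>i\<in>F. H n \<omega> i *\<^sub>R w i)) (LINT x|N. g (\<Sum>i\<in>F. \<gamma> x i *\<^sub>R w i)) < r"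
  by (simp add: eventually_sequentially)
qed

section \<open>Reindexing, second moments and simple approximations\<close>

lemma (in prob_space) indep_sets_reindex:
 assumes "inj_on f I" "indep_sets F (f ` I)"
 shows "indep_sets (\<lambda>i. F (f i)) I"
 unfolding indep_sets_def
proof (intro conjI ballI allI impI)
 show "F (f i) \<subseteq> events" if "i \<in> I" for i using that assms(2) by (auto simp: indep_sets_def)
 fix J A assume J: "J \<subseteq> I" "J \<noteq> {}" "finite J" "A \<in> (\<Pi> i\<in>J. F (f i))"
 have inj: "inj_on f J" using assms(1) J(1) by (rule inj_on_subset)
 have g: "inv_into J f (f j) = j" if "j \<in> J" for j using inj that by simp
 have "prob (\<Inter>k\<in>f ` J. A (inv_into J f k)) = (\<Prod>k\<in>f ` J. prob (A (inv_into J f k)))"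
  using J g by (intro indep_setsD[OF assms(2)]) auto
 then show "prob (\<Inter>j\<in>J. A j) = (\<Prod>j\<in>J. prob (A j))"
  using g by (simp add: prod.reindex[OF inj])
qed

lemma (in prob_space) indep_vars_reindex:
 assumes "inj_on f I" "indep_vars M' X (f ` I)"
 shows "indep_vars (\<lambda>i. M' (f i)) (\<lambda>i. X (f i)) I"
 using assms indep_sets_reindex[OF assms(1)] unfolding indep_vars_def2 by auto

lemma (in prob_space) iid_reindex:
 assumes "iid M S X" "inj f"
 shows "iid M S (\<lambda>n. X (f n))"
 unfolding iid_def
proof
 show "indep_vars (\<lambda>_. S) (\<lambda>n. X (f n)) UNIV"
  using assms(2) indep_vars_subset[OF iid_indep[OF assms(1)], of "range f"]
  by (intro indep_vars_reindex[of f UNIV "\<lambda>_. S"]) auto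
 show "\<forall>n. distr M S (X (f n)) = distr M S (X (f 0))"
  using assms(1) unfolding iid_def by metis
qed

lemma (in prob_space) L1_le_L2:
 fixes X :: "'a \<Rightarrow> real"
 assumes [measurable]: "X \<in> borel_measurable M" and sq: "integrable M (\<lambda>\<omega>. (X \<omega>)\<^sup>2)"
 shows "expectation X \<le> sqrt (expectation (\<lambda>\<omega>. (X \<omega>)\<^sup>2))"
proof -
 have int: "integrable M X" by (rule square_integrable_imp_integrable[OF _ sq]) simp
 have "0 \<le> variance X" by simp
 then have "(expectation X)\<^sup>2 \<le> expectation (\<lambda>\<omega>. (X \<omega>)\<^sup>2)"
  using variance_eq[OF int sq] by simp
 then show ?thesis by (rule real_le_rsqrt)
qed

lemma fatou_bound:
 fixes f :: "nat \<Rightarrow> 'a \<Rightarrow> real"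
 assumes [measurable]: "\<And>n. f n \<in> borel_measurable M"
  and lim: "AE x in M. (\<lambda>n. f n x) \<longlonglongrightarrow> g x"
  and le: "\<forall>\<^sub>F n in sequentially. (\<integral>\<^sup>+x. ennreal (f n x) \<partial>M) \<le> c"
 shows "(\<integral>\<^sup>+x. ennreal (g x) \<partial>M) \<le> c"
proof -
 have "(\<integral>\<^sup>+x. ennreal (g x) \<partial>M) = (\<integral>\<^sup>+x. liminf (\<lambda>n. ennreal (f n x)) \<partial>M)"
 proof (rule nn_integral_cong_AE)
  show "AE x in M. ennreal (g x) = liminf (\<lambda>n. ennreal (f n x))"
   using lim
  proof eventually_elim
   case (elim x)
   then have "(\<lambda>n. ennreal (f n x)) \<longlonglongrightarrow> ennreal (g x)" by (rule tendsto_ennrealI)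
   then show ?case by (simp add: lim_imp_Liminf)
  qed
 qed
 also have "\<dots> \<le> liminf (\<lambda>n. \<integral>\<^sup>+x. ennreal (f n x) \<partial>M)"
  by (rule nn_integral_liminf) measurable
 also have "\<dots> \<le> limsup (\<lambda>n. \<integral>\<^sup>+x. ennreal (f n x) \<partial>M)"
  by (rule Liminf_le_Limsup) simp
 also have "\<dots> \<le> c" by (rule Limsup_bounded[OF le])
 finally show ?thesis .
qed

lemma integrable_square_iff_nn_integral:
 fixes f :: "'a \<Rightarrow> real"
 assumes [measurable]: "f \<in> borel_measurable M" and "\<And>x. f x \<ge> 0" and le: "(\<integral>\<^sup>+x. ennreal (f x) \<partial>M) \<le> ennreal c" and "c \<ge> 0"
 shows "integrable M f" "(LINT x|M. f x) \<le> c"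
proof -
 show i: "integrable M f"
  using assms by (intro integrableI_nonneg) (auto simp: le_less_trans[OF le])
 have "ennreal (LINT x|M. f x) \<le> ennreal c"
  using nn_integral_eq_integral[OF i] assms by simp
 then show "(LINT x|M. f x) \<le> c" using assms(4) by (simp add: ennreal_le_iff)
qed

lemma norm_sum_square_le:
 fixes v :: "'i \<Rightarrow> 'w::real_normed_vector"
 assumes "finite F"
 shows "(norm (\<Sum>i\<in>F. c i *\<^sub>R v i))\<^sup>2 \<le> real (card F) * (\<Sum>i\<in>F. (c i)\<^sup>2 * (norm (v i))\<^sup>2)"
proof -
 have "(norm (\<Sum>i\<in>F. c i *\<^sub>R v i))\<^sup>2 \<le> (\<Sum>i\<in>F. \<bar>c i\<bar> * norm (v i))\<^sup>2"
  by (intro power_mono order_trans[OF norm_sum]) (auto intro!: sum_mono)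
 also have "\<dots> \<le> real (card F) * (\<Sum>i\<in>F. (\<bar>c i\<bar> * norm (v i))\<^sup>2)"
  using sum_squared_le_sum_of_squares[of "\<lambda>i. \<bar>c i\<bar> * norm (v i)" F] by (simp add: mult.commute)
 finally show ?thesis by (simp add: power_mult_distrib)
qed

lemma norm_add_square_le: "(norm (a + b))\<^sup>2 \<le> 2 * (norm a)\<^sup>2 + 2 * (norm (b :: 'w::real_normed_vector))\<^sup>2"
proof -
 have "(norm (a + b))\<^sup>2 \<le> (norm a + norm b)\<^sup>2"
  by (intro power_mono norm_triangle_ineq) simp
 also have "\<dots> \<le> 2 * (norm a)\<^sup>2 + 2 * (norm b)\<^sup>2"
  using zero_le_power2[of "norm a - norm b"] by (simp add: power2_eq_square algebra_simps)
 finally show ?thesis .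
qed

lemma norm_diff_square_le: "(norm (a - b))\<^sup>2 \<le> 2 * (norm a)\<^sup>2 + 2 * (norm (b :: 'w::real_normed_vector))\<^sup>2"
 using norm_add_square_le[of a "- b"] by simp

lemma L2_add:
 fixes f g :: "'a \<Rightarrow> 'w::{banach, second_countable_topology}"
 assumes "f \<in> borel_measurable M" "g \<in> borel_measurable M"
  "integrable M (\<lambda>x. (norm (f x))\<^sup>2)" "integrable M (\<lambda>x. (norm (g x))\<^sup>2)"
 shows "integrable M (\<lambda>x. (norm (f x + g x))\<^sup>2)" "integrable M (\<lambda>x. (norm (f x - g x))\<^sup>2)"
 by (rule Bochner_Integration.integrable_bound[of M "\<lambda>x. 2 * (norm (f x))\<^sup>2 + 2 * (norm (g x))\<^sup>2"];
   use assms in \<open>auto simp: norm_add_square_le norm_diff_square_le\<close>)+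

text \<open>The level sets of all \<open>s j\<close> are enumerated by one index via
  \<open>prod_encode\<close>. A single family \<open>b\<close>, and hence a single covariance
  factor, then serves every level of the approximation.\<close>

lemma simple_approximation_indexed:
 obtains s :: "nat \<Rightarrow> 'w \<Rightarrow> 'w::{real_normed_vector, second_countable_topology}"
  and b :: "nat \<Rightarrow> 'w \<Rightarrow> real" and v :: "nat \<Rightarrow> 'w" and F :: "nat \<Rightarrow> nat set"
 where "\<And>j. finite (F j)" "\<And>i. b i \<in> borel_measurable borel" "\<And>i w. \<bar>b i w\<bar> \<le> 1"
  "\<And>j w. s j w = (\<Sum>i\<in>F j. b i w *\<^sub>R v i)"
  "\<And>w. (\<lambda>j. s j w) \<longlonglongrightarrow> w" "\<And>j w. norm (s j w) \<le> 2 * norm w"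
proof -
 obtain s :: "nat \<Rightarrow> 'w \<Rightarrow> 'w" where sm: "\<And>j. s j \<in> borel_measurable borel"
  and s: "\<And>j. finite (range (s j))" "\<And>w. (\<lambda>j. s j w) \<longlonglongrightarrow> w" "\<And>j w. norm (s j w) \<le> 2 * norm w"
  by (rule simple_approximation) blast
 define v where "v i = from_nat_into (range (s (fst (prod_decode i)))) (snd (prod_decode i))" for i
 define b where "b i = (indicator (s (fst (prod_decode i)) -` {v i}) :: 'w \<Rightarrow> real)" for i
 define F where "F j = (\<lambda>l. prod_encode (j, l)) ` {..<card (range (s j))}" for j
 have inj: "inj_on (\<lambda>l. prod_encode (j, l)) A" for j A by (auto simp: inj_on_def prod_encode_eq)
 have H1: "s j w = (\<Sum>i\<in>F j. b i w *\<^sub>R v i)" for j w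
 proof -
  have "s j w = (\<Sum>u\<in>range (s j). indicator (s j -` {u}) w *\<^sub>R u)"
   by (rule simple_function_sum[OF s(1)])
  also have "\<dots> = (\<Sum>l<card (range (s j)). indicator (s j -` {from_nat_into (range (s j)) l}) w *\<^sub>R from_nat_into (range (s j)) l)"
   by (rule sum.reindex_bij_betw[OF bij_betw_from_nat_into_finite[OF s(1)], symmetric])
  also have "\<dots> = (\<Sum>i\<in>F j. b i w *\<^sub>R v i)"
   unfolding F_def by (subst sum.reindex[OF inj]) (simp add: b_def v_def)
  finally show ?thesis .
 qed
 have H2: "b i \<in> borel_measurable borel" for i
 proof -
  have "s (fst (prod_decode i)) -` {v i} \<in> sets borel"
   using measurable_sets[OF sm, of "{v i}"] by simp
  then show ?thesis unfolding b_def by (rule borel_measurable_indicator)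
 qed
 have H3: "\<bar>b i w\<bar> \<le> 1" for i w by (simp add: b_def indicator_def)
 have H0: "finite (F j)" for j by (simp add: F_def)
 show ?thesis by (rule that[of F b s v, OF H0 H2 H3 H1 s(2) s(3)])
qed

context prob_space
begin

text \<open>Working form of the type 2 inequality: summation from index 0, identically distributed
  summands, and integrability of the squared norm of the sum included.\<close>

lemma type_2_iid_bound:
 assumes "type_2 M TYPE('w::{banach, second_countable_topology})"
 obtains C where "C > 0"
  "\<And>(X :: nat \<Rightarrow> 'a \<Rightarrow> 'w) n. iid M borel X \<Longrightarrow> integrable M (\<lambda>\<omega>. (norm (X 0 \<omega>))\<^sup>2) \<Longrightarrow> expectation (X 0) = 0 \<Longrightarrow>
    integrable M (\<lambda>\<omega>. (norm (\<Sum>k<n. X k \<omega>))\<^sup>2) \<and>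
    expectation (\<lambda>\<omega>. (norm (\<Sum>k<n. X k \<omega>))\<^sup>2) \<le> C * (real n * expectation (\<lambda>\<omega>. (norm (X 0 \<omega>))\<^sup>2))"
proof -
 obtain C where C: "C > 0" "\<And>n (X :: nat \<Rightarrow> 'a \<Rightarrow> 'w).
    indep_vars (\<lambda>_. borel) X {1..n} \<Longrightarrow>
    (\<forall>k\<in>{1..n}. L2_rv M (X k) \<and> (LINT \<omega>|M. X k \<omega>) = 0) \<Longrightarrow>
    (LINT \<omega>|M. (norm (\<Sum>k=1..n. X k \<omega>))\<^sup>2) \<le> C * (\<Sum>k=1..n. LINT \<omega>|M. (norm (X k \<omega>))\<^sup>2)"
  using assms unfolding type_2_def by metis
 show ?thesis
 proof (rule that[OF C(1)], intro conjI)
  fix X :: "nat \<Rightarrow> 'a \<Rightarrow> 'w" and n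
  assume X: "iid M borel X" and sq: "integrable M (\<lambda>\<omega>. (norm (X 0 \<omega>))\<^sup>2)" and mean: "expectation (X 0) = 0"
  note [measurable] = iid_measurable[OF X]
  have sqn: "integrable M (\<lambda>\<omega>. (norm (X k \<omega>))\<^sup>2)" for k
   using sq iid_integrable[OF X, of "\<lambda>x. (norm x)\<^sup>2" k] by simp
  show "integrable M (\<lambda>\<omega>. (norm (\<Sum>k<n. X k \<omega>))\<^sup>2)"
  proof (induction n)
   case (Suc n)
   have "integrable M (\<lambda>\<omega>. (norm ((\<Sum>k<n. X k \<omega>) + X n \<omega>))\<^sup>2)"
    by (rule L2_add(1)) (use Suc sqn in auto)
   then show ?case by simp
  qed simp
  have sum_eq: "(\<Sum>k=1..n. X (k - 1) \<omega>) = (\<Sum>k<n. X k \<omega>)" for \<omega>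
   using sum.atLeast1_atMost_eq[of "\<lambda>k. X (k - 1) \<omega>" n] by simp
  have inj: "inj_on (\<lambda>k. k - 1) {1..n}" by (auto simp: inj_on_def)
  have "(LINT \<omega>|M. (norm (\<Sum>k=1..n. X (k - 1) \<omega>))\<^sup>2) \<le> C * (\<Sum>k=1..n. LINT \<omega>|M. (norm (X (k - 1) \<omega>))\<^sup>2)"
  proof (rule C(2))
   show "indep_vars (\<lambda>_. borel) (\<lambda>k. X (k - 1)) {1..n}"
    using indep_vars_reindex[OF inj, of "\<lambda>_. borel" X] indep_vars_subset[OF iid_indep[OF X]] by simp
   show "\<forall>k\<in>{1..n}. L2_rv M (X (k - 1)) \<and> (LINT \<omega>|M. X (k - 1) \<omega>) = 0"
    using sqn iid_integral[OF X, of "\<lambda>x. x"] mean by (simp add: L2_rv_def)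
  qed
  also have "(\<Sum>k=1..n. LINT \<omega>|M. (norm (X (k - 1) \<omega>))\<^sup>2) = real n * expectation (\<lambda>\<omega>. (norm (X 0 \<omega>))\<^sup>2)"
  proof -
   have E: "(LINT \<omega>|M. (norm (X k \<omega>))\<^sup>2) = expectation (\<lambda>\<omega>. (norm (X 0 \<omega>))\<^sup>2)" for k
    by (rule iid_integral[OF X, of "\<lambda>x. (norm x)\<^sup>2"]) simp
   show ?thesis by (subst sum.cong[OF refl E]) simp
  qed
  finally show "expectation (\<lambda>\<omega>. (norm (\<Sum>k<n. X k \<omega>))\<^sup>2) \<le> C * (real n * expectation (\<lambda>\<omega>. (norm (X 0 \<omega>))\<^sup>2))"
   unfolding sum_eq .
 qed
qed

lemma cos_integral_eq_char:
 fixes X :: "'a \<Rightarrow> real"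
 assumes [measurable]: "X \<in> borel_measurable M"
 shows "(LINT \<omega>|M. cos (X \<omega> + \<theta>)) = Re (iexp \<theta> * (CLINT \<omega>|M. iexp (X \<omega>)))"
proof -
 have int: "integrable M (\<lambda>\<omega>. iexp \<theta> * iexp (X \<omega>))"
  by (rule integrable_const_bound[where B=1]) (auto simp: norm_mult)
 have "Re (iexp \<theta> * (CLINT \<omega>|M. iexp (X \<omega>))) = Re (CLINT \<omega>|M. iexp \<theta> * iexp (X \<omega>))" by simp
 also have "\<dots> = (LINT \<omega>|M. Re (iexp \<theta> * iexp (X \<omega>)))" using int by (rule integral_Re[symmetric])
 also have "\<dots> = (LINT \<omega>|M. cos (X \<omega> + \<theta>))"
  by (intro Bochner_Integration.integral_cong refl) (simp add: Re_exp Im_exp cos_add mult.commute)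
 finally show ?thesis by simp
qed

text \<open>The Gaussian sequence \<open>\<lambda>i. \<Sum>k\<le>i. L i k * x k\<close> has the covariance of the variables
 \<open>h i (Y 0)\<close>.\<close>

lemma finite_dim_clt:
 fixes Y :: "nat \<Rightarrow> 'a \<Rightarrow> 'w::{real_normed_vector, second_countable_topology}" and h :: "nat \<Rightarrow> 'w \<Rightarrow> real"
  and g :: "'u::{real_normed_vector, second_countable_topology} \<Rightarrow> real"
 assumes Y: "iid M borel Y" and h[measurable]: "\<And>i. h i \<in> borel_measurable borel"
  and hb: "\<And>i. bounded_rv M (\<lambda>\<omega>. h i (Y 0 \<omega>))" and mean: "\<And>i. (LINT \<omega>|M. h i (Y 0 \<omega>)) = 0"
  and L: "\<And>i k. k > i \<Longrightarrow> L i k = 0"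
   "\<And>i j N. i \<le> N \<Longrightarrow> j \<le> N \<Longrightarrow> (LINT \<omega>|M. h i (Y 0 \<omega>) * h j (Y 0 \<omega>)) = (\<Sum>k\<le>N. L i k * L j k)"
  and F: "finite F" and g: "continuous_on UNIV g" "\<And>y. \<bar>g y\<bar> \<le> B"
 shows "(\<lambda>n. LINT \<omega>|M. g (\<Sum>i\<in>F. ((1 / sqrt (real n)) * (\<Sum>k<n. h i (Y k \<omega>))) *\<^sub>R u i))
   \<longlonglongrightarrow> (LINT x|gauss_seq. g (\<Sum>i\<in>F. (\<Sum>k\<le>i. L i k * x k) *\<^sub>R u i))"
proof -
 note [measurable] = iid_measurable[OF Y]
 interpret G: prob_space gauss_seq by (rule prob_space_gauss_seq)
 have gm[measurable]: "(\<lambda>x. x k) \<in> borel_measurable gauss_seq" for k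
  using measurable_component_singleton[of k UNIV "\<lambda>_. std_normal_distribution"]
  by (simp add: measurable_def)
 define N where "N = Max (insert 0 F)"
 have N: "i \<le> N" if "i \<in> F" for i using that F by (simp add: N_def)
 have \<gamma>: "(\<Sum>k\<le>i. L i k * x k) = (\<Sum>k\<le>N. L i k * x k)" if "i \<in> F" for i and x :: "nat \<Rightarrow> real"
  using N[OF that] L(1) by (intro sum.mono_neutral_left) auto
 have iidh: "iid M borel (\<lambda>k \<omega>. h i (Y k \<omega>))" for i by (rule iid_compose[OF Y]) measurable
 have int2: "integrable M (\<lambda>\<omega>. h i (Y 0 \<omega>) * h j (Y 0 \<omega>))" for i j
  by (intro bounded_rv_integrable bounded_rv_mult hb)
 have sqh: "integrable M (\<lambda>\<omega>. (h i (Y 0 \<omega>))\<^sup>2)" for i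
  using int2[of i i] by (simp add: power2_eq_square)
 define V where "V i = expectation (\<lambda>\<omega>. (h i (Y 0 \<omega>))\<^sup>2)" for i
 have V_eq: "V i = (\<Sum>k\<le>N. (L i k)\<^sup>2)" if "i \<in> F" for i
  using L(2)[OF N[OF that] N[OF that]] by (simp add: V_def power2_eq_square)
 define K where "K = (\<Sum>i\<in>F. V i)"
 have K: "V i \<le> K" if "i \<in> F" for i
  unfolding K_def using that F by (intro member_le_sum) (auto simp: V_def)
 show ?thesis
 proof (rule convergence_from_characters[OF prob_space_axioms prob_space_gauss_seq F _ _ _ _ _ _ _ g, where K=K])
  fix n i assume i: "i \<in> F"
  have s: "integrable M (\<lambda>\<omega>. (\<Sum>k<n. h i (Y k \<omega>))\<^sup>2)"
   "expectation (\<lambda>\<omega>. (\<Sum>k<n. h i (Y k \<omega>))\<^sup>2) = real n * V i"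
   using iid_centered_sum_square[OF iidh sqh mean] by (auto simp: V_def)
  show "integrable M (\<lambda>\<omega>. ((1 / sqrt (real n)) * (\<Sum>k<n. h i (Y k \<omega>)))\<^sup>2)"
   unfolding power_mult_distrib using s(1) by simp
  have "(LINT \<omega>|M. ((1 / sqrt (real n)) * (\<Sum>k<n. h i (Y k \<omega>)))\<^sup>2) = (1 / sqrt (real n))\<^sup>2 * (real n * V i)"
   unfolding power_mult_distrib using s(2) by simp
  also have "\<dots> \<le> V i" by (simp add: power_divide V_def)
  finally show "(LINT \<omega>|M. ((1 / sqrt (real n)) * (\<Sum>k<n. h i (Y k \<omega>)))\<^sup>2) \<le> K" using K[OF i] by simp
 next
  fix i assume i: "i \<in> F"
  show "integrable gauss_seq (\<lambda>x. (\<Sum>k\<le>i. L i k * x k)\<^sup>2)"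
   by (rule gauss_linear_second_moment)
  show "(LINT x|gauss_seq. (\<Sum>k\<le>i. L i k * x k)\<^sup>2) \<le> K"
   using K[OF i] V_eq[OF i] unfolding \<gamma>[OF i] gauss_linear_second_moment(2) by simp
 next
  fix \<xi> :: "nat \<Rightarrow> real" and \<theta> :: real
  \<comment> \<open>Cramer-Wold device: a linear combination of the coordinates is again a
    normalized sum of i.i.d. scalars \<open>q (Y k)\<close>, and the factor \<open>L\<close> gives
    the Gaussian combination the same variance.\<close>
  define q where "q w = (\<Sum>i\<in>F. \<xi> i * h i w)" for w
  have [measurable]: "q \<in> borel_measurable borel" unfolding q_def by measurable
  have iidq: "iid M borel (\<lambda>k \<omega>. q (Y k \<omega>))" by (rule iid_compose[OF Y]) measurable
  have qq: "(q w)\<^sup>2 = (\<Sum>i\<in>F. \<Sum>j\<in>F. (\<xi> i * \<xi> j) * (h i w * h j w))" for w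
   unfolding q_def power2_eq_square sum_product by (simp add: mult_ac)
  have sqq: "integrable M (\<lambda>\<omega>. (q (Y 0 \<omega>))\<^sup>2)" unfolding qq using int2 by simp
  have meanq: "expectation (\<lambda>\<omega>. q (Y 0 \<omega>)) = 0"
   unfolding q_def using bounded_rv_integrable[OF hb] mean by simp
  define a where "a k = (\<Sum>i\<in>F. \<xi> i * L i k)" for k
  have "expectation (\<lambda>\<omega>. (q (Y 0 \<omega>))\<^sup>2) = (\<Sum>i\<in>F. \<Sum>j\<in>F. (\<xi> i * \<xi> j) * (LINT \<omega>|M. h i (Y 0 \<omega>) * h j (Y 0 \<omega>)))"
   unfolding qq using int2 by simp
  also have "\<dots> = (\<Sum>i\<in>F. \<Sum>j\<in>F. \<Sum>k\<le>N. (\<xi> i * L i k) * (\<xi> j * L j k))"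
   by (intro sum.cong refl) (simp add: L(2)[OF N N] sum_distrib_left mult_ac)
  also have "\<dots> = (\<Sum>i\<in>F. \<Sum>k\<le>N. \<Sum>j\<in>F. (\<xi> i * L i k) * (\<xi> j * L j k))"
   by (intro sum.cong refl sum.swap)
  also have "\<dots> = (\<Sum>k\<le>N. \<Sum>i\<in>F. \<Sum>j\<in>F. (\<xi> i * L i k) * (\<xi> j * L j k))"
   by (rule sum.swap)
  also have "\<dots> = (\<Sum>k\<le>N. (a k)\<^sup>2)"
   unfolding a_def power2_eq_square sum_product ..
  finally have var: "expectation (\<lambda>\<omega>. (q (Y 0 \<omega>))\<^sup>2) = (\<Sum>k\<le>N. (a k)\<^sup>2)" .
  have lin: "(\<Sum>i\<in>F. \<xi> i * ((1 / sqrt (real n)) * (\<Sum>k<n. h i (Y k \<omega>)))) = 1 * ((1 / sqrt (real n)) * (\<Sum>k<n. q (Y k \<omega>)))" for n \<omega>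
  proof -
   have "(\<Sum>k<n. q (Y k \<omega>)) = (\<Sum>i\<in>F. \<xi> i * (\<Sum>k<n. h i (Y k \<omega>)))"
    unfolding q_def sum_distrib_left by (rule sum.swap)
   then show ?thesis by (simp add: sum_distrib_left mult_ac)
  qed
  have lin2: "(\<Sum>i\<in>F. \<xi> i * (\<Sum>k\<le>i. L i k * x k)) = (\<Sum>k\<le>N. a k * x k)" for x :: "nat \<Rightarrow> real"
  proof -
   have "(\<Sum>i\<in>F. \<xi> i * (\<Sum>k\<le>i. L i k * x k)) = (\<Sum>i\<in>F. \<xi> i * (\<Sum>k\<le>N. L i k * x k))"
    by (intro sum.cong refl) (simp add: \<gamma>)
   also have "\<dots> = (\<Sum>k\<le>N. a k * x k)"
    unfolding a_def sum_distrib_left sum_distrib_right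
    by (subst sum.swap) (simp add: mult_ac)
   finally show ?thesis .
  qed
  have ch: "(CLINT x|gauss_seq. iexp (\<Sum>k\<le>N. a k * x k)) = complex_of_real (exp (- (1\<^sup>2 * (\<Sum>k\<le>N. (a k)\<^sup>2)) / 2))"
   unfolding char_gauss_linear[symmetric] char_def by (subst integral_distr) auto
  have "(\<lambda>n. Re (iexp \<theta> * (CLINT \<omega>|M. iexp (1 * ((1 / sqrt (real n)) * (\<Sum>k<n. q (Y k \<omega>)))))))
    \<longlonglongrightarrow> Re (iexp \<theta> * complex_of_real (exp (- (1\<^sup>2 * (\<Sum>k\<le>N. (a k)\<^sup>2)) / 2)))"
   using clt_char[OF iidq sqq meanq, of 1] unfolding var by (intro tendsto_Re tendsto_mult tendsto_const)
  then show "(\<lambda>n. LINT \<omega>|M. cos ((\<Sum>i\<in>F. \<xi> i * ((1 / sqrt (real n)) * (\<Sum>k<n. h i (Y k \<omega>)))) + \<theta>))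
    \<longlonglongrightarrow> (LINT x|gauss_seq. cos ((\<Sum>i\<in>F. \<xi> i * (\<Sum>k\<le>i. L i k * x k)) + \<theta>))"
   unfolding lin lin2 ch[symmetric]
   by (subst (asm) cos_integral_eq_char[symmetric], simp, subst (asm) G.cos_integral_eq_char[symmetric]) simp_all
 qed measurable
qed

end

text \<open>\<open>hsum\<close> and \<open>gsum\<close> below are the same finite linear
  combination, evaluated in the data and in the Gaussian variables. Estimates are derived for
  \<open>hsum\<close> on \<open>M\<close> from the constant \<open>C\<close> and are then carried
  over to \<open>gsum\<close>.\<close>

locale gaussian_approximation = prob_space M for M :: "'a measure" +
 fixes Y :: "nat \<Rightarrow> 'a \<Rightarrow> 'w::{banach, second_countable_topology}"
  and h :: "nat \<Rightarrow> 'w \<Rightarrow> real" and L :: "nat \<Rightarrow> nat \<Rightarrow> real" and C :: real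
 assumes Y: "iid M borel Y" and Y_sq: "integrable M (\<lambda>\<omega>. (norm (Y 0 \<omega>))\<^sup>2)" and Y_mean: "expectation (Y 0) = 0"
  and h[measurable]: "\<And>i. h i \<in> borel_measurable borel"
  and hb: "\<And>i. bounded_rv M (\<lambda>\<omega>. h i (Y 0 \<omega>))" and h_mean: "\<And>i. (LINT \<omega>|M. h i (Y 0 \<omega>)) = 0"
  and L: "\<And>i k. k > i \<Longrightarrow> L i k = 0"
   "\<And>i j N. i \<le> N \<Longrightarrow> j \<le> N \<Longrightarrow> (LINT \<omega>|M. h i (Y 0 \<omega>) * h j (Y 0 \<omega>)) = (\<Sum>k\<le>N. L i k * L j k)"
  and C: "C > 0" "\<And>(X :: nat \<Rightarrow> 'a \<Rightarrow> 'w) n. iid M borel X \<Longrightarrow> integrable M (\<lambda>\<omega>. (norm (X 0 \<omega>))\<^sup>2) \<Longrightarrow> expectation (X 0) = 0 \<Longrightarrow>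
    integrable M (\<lambda>\<omega>. (norm (\<Sum>k<n. X k \<omega>))\<^sup>2) \<and>
    expectation (\<lambda>\<omega>. (norm (\<Sum>k<n. X k \<omega>))\<^sup>2) \<le> C * (real n * expectation (\<lambda>\<omega>. (norm (X 0 \<omega>))\<^sup>2))"
begin

lemma Y_measurable[measurable]: "Y n \<in> borel_measurable M"
 by (rule iid_measurable[OF Y])

lemma gauss_measurable[measurable]: "(\<lambda>x. x k) \<in> borel_measurable gauss_seq"
 using measurable_component_singleton[of k UNIV "\<lambda>_. std_normal_distribution"]
 by (simp add: measurable_def)

definition hsum :: "nat set \<Rightarrow> (nat \<Rightarrow> 'w) \<Rightarrow> 'w \<Rightarrow> 'w" where
 "hsum F u w = (\<Sum>i\<in>F. h i w *\<^sub>R u i)"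

definition gsum :: "nat set \<Rightarrow> (nat \<Rightarrow> 'w) \<Rightarrow> (nat \<Rightarrow> real) \<Rightarrow> 'w" where
 "gsum F u x = (\<Sum>i\<in>F. (\<Sum>k\<le>i. L i k * x k) *\<^sub>R u i)"

lemma hsum_measurable[measurable]: "hsum F u \<in> borel_measurable borel"
 unfolding hsum_def by measurable

lemma gsum_measurable[measurable]: "gsum F u \<in> borel_measurable gauss_seq"
 unfolding gsum_def by measurable

lemma hsum_sq: "integrable M (\<lambda>\<omega>. (norm (hsum F u (Y 0 \<omega>)))\<^sup>2)"
proof (cases "finite F")
 case True
 have "integrable M (\<lambda>\<omega>. real (card F) * (\<Sum>i\<in>F. (h i (Y 0 \<omega>))\<^sup>2 * (norm (u i))\<^sup>2))"
  unfolding power2_eq_square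
  by (intro bounded_rv_integrable bounded_rv_mult bounded_rv_sum bounded_rv_const hb)
 then show ?thesis
  by (rule Bochner_Integration.integrable_bound)
    (auto simp: hsum_def intro!: order_trans[OF norm_sum_square_le[OF True] abs_ge_self])
qed (simp add: hsum_def)

lemma hsum_mean: "(LINT \<omega>|M. hsum F u (Y 0 \<omega>)) = 0"
 unfolding hsum_def using bounded_rv_integrable[OF hb] h_mean by simp

text \<open>The normalization cancels the factor \<open>n\<close> of the type 2 inequality and
  leaves a bound that is uniform in \<open>n\<close>. For \<open>n = 0\<close> the sum is
  empty.\<close>

lemma normalized_bound:
 assumes [measurable]: "q \<in> borel_measurable borel" and sq: "integrable M (\<lambda>\<omega>. (norm (q (Y 0 \<omega>) :: 'w))\<^sup>2)"
  and mean: "(LINT \<omega>|M. q (Y 0 \<omega>)) = 0"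
 shows "integrable M (\<lambda>\<omega>. (norm ((1 / sqrt (real n)) *\<^sub>R (\<Sum>k<n. q (Y k \<omega>))))\<^sup>2)"
  "expectation (\<lambda>\<omega>. (norm ((1 / sqrt (real n)) *\<^sub>R (\<Sum>k<n. q (Y k \<omega>))))\<^sup>2)
    \<le> C * expectation (\<lambda>\<omega>. (norm (q (Y 0 \<omega>)))\<^sup>2)"
proof -
 have iid: "iid M borel (\<lambda>k \<omega>. q (Y k \<omega>))" by (rule iid_compose[OF Y]) measurable
 note b = C(2)[OF iid sq mean, of n]
 have eq: "(norm ((1 / sqrt (real n)) *\<^sub>R y))\<^sup>2 = (1 / real n) * (norm y)\<^sup>2" for y :: 'w
  by (simp add: power_divide)
 show "integrable M (\<lambda>\<omega>. (norm ((1 / sqrt (real n)) *\<^sub>R (\<Sum>k<n. q (Y k \<omega>))))\<^sup>2)"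
  unfolding eq using b by simp
 have "expectation (\<lambda>\<omega>. (norm ((1 / sqrt (real n)) *\<^sub>R (\<Sum>k<n. q (Y k \<omega>))))\<^sup>2)
   = (1 / real n) * expectation (\<lambda>\<omega>. (norm (\<Sum>k<n. q (Y k \<omega>)))\<^sup>2)"
  unfolding eq by simp
 also have "\<dots> \<le> (1 / real n) * (C * (real n * expectation (\<lambda>\<omega>. (norm (q (Y 0 \<omega>)))\<^sup>2)))"
  using b by (intro mult_left_mono) auto
 also have "\<dots> \<le> C * expectation (\<lambda>\<omega>. (norm (q (Y 0 \<omega>)))\<^sup>2)"
  using C(1) by (cases "n = 0") auto
 finally show "expectation (\<lambda>\<omega>. (norm ((1 / sqrt (real n)) *\<^sub>R (\<Sum>k<n. q (Y k \<omega>))))\<^sup>2)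
    \<le> C * expectation (\<lambda>\<omega>. (norm (q (Y 0 \<omega>)))\<^sup>2)" .
qed

lemma gsum_limit:
 fixes g :: "'w \<Rightarrow> real"
 assumes F: "finite F" and g: "continuous_on UNIV g" "\<And>y. \<bar>g y\<bar> \<le> B"
 shows "(\<lambda>n. LINT \<omega>|M. g ((1 / sqrt (real n)) *\<^sub>R (\<Sum>k<n. hsum F u (Y k \<omega>))))
   \<longlonglongrightarrow> (LINT x|gauss_seq. g (gsum F u x))"
proof -
 have "(1 / sqrt (real n)) *\<^sub>R (\<Sum>k<n. hsum F u (Y k \<omega>))
   = (\<Sum>i\<in>F. ((1 / sqrt (real n)) * (\<Sum>k<n. h i (Y k \<omega>))) *\<^sub>R u i)" for n \<omega>
 proof -
  have "(\<Sum>k<n. hsum F u (Y k \<omega>)) = (\<Sum>i\<in>F. (\<Sum>k<n. h i (Y k \<omega>)) *\<^sub>R u i)"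
   unfolding hsum_def scaleR_sum_left by (rule sum.swap)
  then show ?thesis by (simp only: scaleR_sum_right scaleR_scaleR)
 qed
 then show ?thesis
  using finite_dim_clt[OF Y h hb h_mean L F g, where u=u] unfolding gsum_def by simp
qed

text \<open>The squared norm is unbounded, so the finite-dimensional limit theorem is applied to its
  truncations at \<open>K\<close>. Their expectations on \<open>M\<close> are bounded uniformly in
  \<open>n\<close> and \<open>K\<close>; Fatou's lemma then removes the truncation.\<close>

lemma gsum_bound:
 assumes F: "finite F"
 shows "(\<integral>\<^sup>+x. ennreal ((norm (gsum F u x))\<^sup>2) \<partial>gauss_seq)
   \<le> ennreal (C * expectation (\<lambda>\<omega>. (norm (hsum F u (Y 0 \<omega>)))\<^sup>2))"
proof (rule fatou_bound)
 interpret G: prob_space gauss_seq by (rule prob_space_gauss_seq)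
 show "(\<lambda>x. min ((norm (gsum F u x))\<^sup>2) (real K)) \<in> borel_measurable gauss_seq" for K by measurable
 show "AE x in gauss_seq. (\<lambda>K. min ((norm (gsum F u x))\<^sup>2) (real K)) \<longlonglongrightarrow> (norm (gsum F u x))\<^sup>2"
 proof (intro AE_I2 tendsto_eventually)
  fix x
  obtain K0 :: nat where "(norm (gsum F u x))\<^sup>2 \<le> real K0" using real_arch_simple by blast
  then show "\<forall>\<^sub>F K in sequentially. min ((norm (gsum F u x))\<^sup>2) (real K) = (norm (gsum F u x))\<^sup>2"
   unfolding eventually_sequentially by (intro exI[of _ K0]) (auto simp: min_def)
 qed
 show "\<forall>\<^sub>F K in sequentially. (\<integral>\<^sup>+x. ennreal (min ((norm (gsum F u x))\<^sup>2) (real K)) \<partial>gauss_seq)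
   \<le> ennreal (C * expectation (\<lambda>\<omega>. (norm (hsum F u (Y 0 \<omega>)))\<^sup>2))"
 proof (intro always_eventually allI)
  fix K
  let ?g = "\<lambda>y :: 'w. min ((norm y)\<^sup>2) (real K)"
  have gc: "continuous_on UNIV ?g" by (intro continuous_intros)
  have gb: "\<bar>?g y\<bar> \<le> real K" for y by auto
  have lim: "(\<lambda>n. LINT \<omega>|M. ?g ((1 / sqrt (real n)) *\<^sub>R (\<Sum>k<n. hsum F u (Y k \<omega>))))
    \<longlonglongrightarrow> (LINT x|gauss_seq. ?g (gsum F u x))"
   by (rule gsum_limit[OF F gc gb])
  have "(LINT x|gauss_seq. ?g (gsum F u x)) \<le> C * expectation (\<lambda>\<omega>. (norm (hsum F u (Y 0 \<omega>)))\<^sup>2)"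
  proof (rule LIMSEQ_le_const2[OF lim], intro exI allI impI)
   fix n
   note nb = normalized_bound[OF hsum_measurable[of F u] hsum_sq[of F u] hsum_mean[of F u], where n=n]
   have "(LINT \<omega>|M. ?g ((1 / sqrt (real n)) *\<^sub>R (\<Sum>k<n. hsum F u (Y k \<omega>))))
    \<le> expectation (\<lambda>\<omega>. (norm ((1 / sqrt (real n)) *\<^sub>R (\<Sum>k<n. hsum F u (Y k \<omega>))))\<^sup>2)"
    by (intro integral_mono nb(1) integrable_const_bound[where B="real K"]) auto
   with nb(2) show "(LINT \<omega>|M. ?g ((1 / sqrt (real n)) *\<^sub>R (\<Sum>k<n. hsum F u (Y k \<omega>))))
    \<le> C * expectation (\<lambda>\<omega>. (norm (hsum F u (Y 0 \<omega>)))\<^sup>2)" by linarith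
  qed
  moreover have "integrable gauss_seq (\<lambda>x. ?g (gsum F u x))"
   by (rule G.integrable_const_bound[where B="real K"]) auto
  ultimately show "(\<integral>\<^sup>+x. ennreal (?g (gsum F u x)) \<partial>gauss_seq)
   \<le> ennreal (C * expectation (\<lambda>\<omega>. (norm (hsum F u (Y 0 \<omega>)))\<^sup>2))"
   by (subst nn_integral_eq_integral) (auto intro!: ennreal_leI)
 qed
qed

lemma gsum_sq:
 assumes F: "finite F"
 shows "integrable gauss_seq (\<lambda>x. (norm (gsum F u x))\<^sup>2)"
  "(LINT x|gauss_seq. (norm (gsum F u x))\<^sup>2) \<le> C * expectation (\<lambda>\<omega>. (norm (hsum F u (Y 0 \<omega>)))\<^sup>2)"
proof -
 have "0 \<le> C * expectation (\<lambda>\<omega>. (norm (hsum F u (Y 0 \<omega>)))\<^sup>2)" using C(1) by simp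
 from integrable_square_iff_nn_integral[OF _ _ gsum_bound[OF F] this]
 show "integrable gauss_seq (\<lambda>x. (norm (gsum F u x))\<^sup>2)"
  "(LINT x|gauss_seq. (norm (gsum F u x))\<^sup>2) \<le> C * expectation (\<lambda>\<omega>. (norm (hsum F u (Y 0 \<omega>)))\<^sup>2)"
  by auto
qed

lemma gsum_mean: "(LINT x|gauss_seq. gsum F u x) = 0"
 unfolding gsum_def using gauss_second_moment(3,4) by (simp add: integrable_mult_right)

text \<open>A difference of two approximations is again a sum of the same kind with modified
  vectors, so that \<open>gsum_bound\<close> also controls increments.\<close>

lemma sum_combine:
 assumes "finite F1" "finite F2"
 shows "hsum F1 v w - hsum F2 v w = hsum (F1 \<union> F2) (\<lambda>i. (indicator F1 i - indicator F2 i :: real) *\<^sub>R v i) w"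
  "gsum F1 v x - gsum F2 v x = gsum (F1 \<union> F2) (\<lambda>i. (indicator F1 i - indicator F2 i :: real) *\<^sub>R v i) x"
proof -
 have *: "(\<Sum>i\<in>F1. c i *\<^sub>R v i) - (\<Sum>i\<in>F2. c i *\<^sub>R v i)
   = (\<Sum>i\<in>F1 \<union> F2. c i *\<^sub>R ((indicator F1 i - indicator F2 i :: real) *\<^sub>R v i))" for c :: "nat \<Rightarrow> real"
 proof -
  have 1: "(\<Sum>i\<in>F. c i *\<^sub>R v i) = (\<Sum>i\<in>F1 \<union> F2. c i *\<^sub>R (indicator F i :: real) *\<^sub>R v i)"
   if "F \<subseteq> F1 \<union> F2" for F
   using that assms by (intro sum.mono_neutral_cong_left) (auto simp: indicator_def)
  have A: "(\<Sum>i\<in>F1. c i *\<^sub>R v i) = (\<Sum>i\<in>F1 \<union> F2. c i *\<^sub>R (indicator F1 i :: real) *\<^sub>R v i)"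
   "(\<Sum>i\<in>F2. c i *\<^sub>R v i) = (\<Sum>i\<in>F1 \<union> F2. c i *\<^sub>R (indicator F2 i :: real) *\<^sub>R v i)"
   by (rule 1, simp)+
  show ?thesis
   by (simp only: A sum_subtractf[symmetric] scaleR_diff_left scaleR_diff_right)
 qed
 show "hsum F1 v w - hsum F2 v w = hsum (F1 \<union> F2) (\<lambda>i. (indicator F1 i - indicator F2 i :: real) *\<^sub>R v i) w"
  "gsum F1 v x - gsum F2 v x = gsum (F1 \<union> F2) (\<lambda>i. (indicator F1 i - indicator F2 i :: real) *\<^sub>R v i) x"
  unfolding hsum_def gsum_def by (rule *)+
qed

text \<open>Almost sure convergence of the Gaussian sums follows from the geometric rate.\<close>

lemma gaussian_limit:
 assumes F: "\<And>j. finite (F j)"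
  and rate: "\<And>j. expectation (\<lambda>\<omega>. (norm (Y 0 \<omega> - hsum (F j) v (Y 0 \<omega>)))\<^sup>2) \<le> 4 * (1 / 4) ^ j"
 obtains Z where "Z \<in> borel_measurable gauss_seq" "integrable gauss_seq (\<lambda>x. (norm (Z x))\<^sup>2)"
  "(LINT x|gauss_seq. Z x) = 0"
  "\<And>(f :: 'w \<Rightarrow> real) \<Lambda> B. (\<And>a b. \<bar>f a - f b\<bar> \<le> \<Lambda> * norm (a - b)) \<Longrightarrow> (\<And>a. \<bar>f a\<bar> \<le> B) \<Longrightarrow>
   (\<lambda>n. LINT \<omega>|M. f ((1 / sqrt (real n)) *\<^sub>R (\<Sum>k<n. Y k \<omega>))) \<longlonglongrightarrow> (LINT x|gauss_seq. f (Z x))"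
proof -
 interpret G: prob_space gauss_seq by (rule prob_space_gauss_seq)
 let ?y = "\<lambda>j. hsum (F j) v" and ?G = "\<lambda>j. gsum (F j) v"
 \<comment> \<open>The number 16 arises as \<open>2 * 4 + 2 * 4\<close>: both approximations are
   compared with \<open>Y 0\<close>, each at rate \<open>4 * (1 / 4) ^ j\<close> or better.\<close>
 define c where "c = 16 * C"
 have c: "c > 0" using C(1) by (simp add: c_def)
 have Yd_sq: "integrable M (\<lambda>\<omega>. (norm (Y 0 \<omega> - ?y j (Y 0 \<omega>)))\<^sup>2)" for j
  by (rule L2_add(2)) (use Y_sq hsum_sq in auto)
 have Y_int: "integrable M (Y 0)"
 proof -
  have "integrable M (\<lambda>\<omega>. norm (Y 0 \<omega>))" by (rule square_integrable_imp_integrable[OF _ Y_sq]) simp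
  then show ?thesis by (simp add: integrable_norm_iff)
 qed
 have h_int: "integrable M (\<lambda>\<omega>. ?y j (Y 0 \<omega>))" for j
 proof -
  have "integrable M (\<lambda>\<omega>. norm (?y j (Y 0 \<omega>)))" by (rule square_integrable_imp_integrable[OF _ hsum_sq]) simp
  then show ?thesis by (simp add: integrable_norm_iff)
 qed
 have diff_rate: "(\<integral>\<^sup>+x. ennreal ((norm (?G j x - ?G l x))\<^sup>2) \<partial>gauss_seq) \<le> ennreal (c * (1 / 4) ^ j)"
  if "j \<le> l" for j l
 proof -
  have "expectation (\<lambda>\<omega>. (norm (?y j (Y 0 \<omega>) - ?y l (Y 0 \<omega>)))\<^sup>2) \<le>
    expectation (\<lambda>\<omega>. 2 * (norm (Y 0 \<omega> - ?y l (Y 0 \<omega>)))\<^sup>2 + 2 * (norm (Y 0 \<omega> - ?y j (Y 0 \<omega>)))\<^sup>2)"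
  proof (rule integral_mono)
   show "integrable M (\<lambda>\<omega>. (norm (?y j (Y 0 \<omega>) - ?y l (Y 0 \<omega>)))\<^sup>2)"
    by (rule L2_add(2)) (use hsum_sq in auto)
   show "integrable M (\<lambda>\<omega>. 2 * (norm (Y 0 \<omega> - ?y l (Y 0 \<omega>)))\<^sup>2 + 2 * (norm (Y 0 \<omega> - ?y j (Y 0 \<omega>)))\<^sup>2)"
    using Yd_sq by simp
   show "(norm (?y j (Y 0 \<omega>) - ?y l (Y 0 \<omega>)))\<^sup>2 \<le>
     2 * (norm (Y 0 \<omega> - ?y l (Y 0 \<omega>)))\<^sup>2 + 2 * (norm (Y 0 \<omega> - ?y j (Y 0 \<omega>)))\<^sup>2" for \<omega>
    using norm_diff_square_le[of "Y 0 \<omega> - ?y l (Y 0 \<omega>)" "Y 0 \<omega> - ?y j (Y 0 \<omega>)"] by simp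
  qed
  also have "\<dots> \<le> 2 * (4 * (1 / 4) ^ l) + 2 * (4 * (1 / 4) ^ j)"
   using Yd_sq rate[of l] rate[of j] by simp
  also have "\<dots> \<le> 16 * (1 / 4) ^ j"
   using power_decreasing[OF that, of "1 / 4 :: real"] by simp
  finally have "C * expectation (\<lambda>\<omega>. (norm (?y j (Y 0 \<omega>) - ?y l (Y 0 \<omega>)))\<^sup>2) \<le> c * (1 / 4) ^ j"
   using C(1) mult_left_mono[of _ "16 * (1 / 4) ^ j" C] by (simp add: c_def mult_ac)
  then have "ennreal (C * expectation (\<lambda>\<omega>. (norm (?y j (Y 0 \<omega>) - ?y l (Y 0 \<omega>)))\<^sup>2)) \<le> ennreal (c * (1 / 4) ^ j)"
   by (rule ennreal_leI)
  then show ?thesis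
   using gsum_bound[of "F j \<union> F l" "\<lambda>i. (indicator (F j) i - indicator (F l) i :: real) *\<^sub>R v i"] F
   unfolding sum_combine[OF F F, symmetric] by (meson finite_UnI order_trans)
 qed
 have G_sq: "integrable gauss_seq (\<lambda>x. (norm (?G j x))\<^sup>2)" for j by (rule gsum_sq(1)[OF F])
 have "AE x in gauss_seq. (\<Sum>j. ennreal (norm (?G j x - ?G (Suc j) x))) \<noteq> \<infinity>"
 proof (rule nn_integral_noteq_infinite)
  have "(\<integral>\<^sup>+x. (\<Sum>j. ennreal (norm (?G j x - ?G (Suc j) x))) \<partial>gauss_seq)
    = (\<Sum>j. \<integral>\<^sup>+x. ennreal (norm (?G j x - ?G (Suc j) x)) \<partial>gauss_seq)"
   by (rule nn_integral_suminf) measurable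
  also have "\<dots> \<le> (\<Sum>j. ennreal ((1 / 2) ^ j * (c + 1)))"
  proof (intro suminf_le allI)
   fix j
   \<comment> \<open>The arithmetic-geometric mean inequality with weight \<open>2 ^ j\<close> turns
     second moments of order \<open>(1 / 4) ^ j\<close> into first moments of the summable order
     \<open>(1 / 2) ^ j\<close>.\<close>
   have am: "a \<le> 2 ^ j * a\<^sup>2 + (1 / 2) ^ j" for a :: real
   proof -
    have "0 \<le> (2 ^ j * a - 1)\<^sup>2" by simp
    then have "2 * (2 ^ j * a) \<le> (2 ^ j)\<^sup>2 * a\<^sup>2 + 1" by (simp add: power2_diff power_mult_distrib)
    then have "2 * (2 ^ j * a) * (1 / 2) ^ j \<le> ((2 ^ j)\<^sup>2 * a\<^sup>2 + 1) * (1 / 2) ^ j"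
     by (intro mult_right_mono) auto
    then have "2 * a \<le> 2 ^ j * a\<^sup>2 + (1 / 2) ^ j"
     by (simp add: power_one_over field_simps power2_eq_square)
    moreover have "0 \<le> 2 ^ j * a\<^sup>2 + (1 / 2 :: real) ^ j" by simp
    ultimately show ?thesis by linarith
   qed
   have "(\<integral>\<^sup>+x. ennreal (norm (?G j x - ?G (Suc j) x)) \<partial>gauss_seq)
    \<le> (\<integral>\<^sup>+x. ennreal (2 ^ j) * ennreal ((norm (?G j x - ?G (Suc j) x))\<^sup>2) + ennreal ((1 / 2) ^ j) \<partial>gauss_seq)"
    by (intro nn_integral_mono) (auto simp: ennreal_mult[symmetric] ennreal_plus[symmetric] am simp del: ennreal_plus intro!: ennreal_leI)
   also have "\<dots> = ennreal (2 ^ j) * (\<integral>\<^sup>+x. ennreal ((norm (?G j x - ?G (Suc j) x))\<^sup>2) \<partial>gauss_seq) + ennreal ((1 / 2) ^ j)"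
    by (subst nn_integral_add) (auto simp: nn_integral_cmult G.emeasure_space_1)
   also have "\<dots> \<le> ennreal (2 ^ j) * ennreal (c * (1 / 4) ^ j) + ennreal ((1 / 2) ^ j)"
    by (intro add_right_mono mult_left_mono diff_rate) auto
   also have "\<dots> = ennreal (2 ^ j * (c * (1 / 4) ^ j) + (1 / 2) ^ j)"
    using c by (simp add: ennreal_mult[symmetric] ennreal_plus[symmetric] del: ennreal_plus)
   also have "2 ^ j * (c * (1 / 4) ^ j) + (1 / 2) ^ j = (1 / 2) ^ j * (c + 1)"
   proof -
    have "(2 :: real) ^ j * (1 / 4) ^ j = (1 / 2) ^ j" by (simp add: power_mult_distrib[symmetric])
    then show ?thesis by (simp add: algebra_simps)
   qed
   finally show "(\<integral>\<^sup>+x. ennreal (norm (?G j x - ?G (Suc j) x)) \<partial>gauss_seq) \<le> ennreal ((1 / 2) ^ j * (c + 1))" .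
  qed auto
  also have "\<dots> < \<infinity>"
  proof -
   have "summable (\<lambda>j. (1 / 2 :: real) ^ j * (c + 1))" by (intro summable_mult2 summable_geometric) auto
   then have "(\<Sum>j. ennreal ((1 / 2) ^ j * (c + 1))) = ennreal (\<Sum>j. (1 / 2) ^ j * (c + 1))"
    using c by (intro suminf_ennreal2) auto
   then show ?thesis by (simp only: ennreal_less_top infinity_ennreal_def)
  qed
  finally show "(\<integral>\<^sup>+x. (\<Sum>j. ennreal (norm (?G j x - ?G (Suc j) x))) \<partial>gauss_seq) \<noteq> \<infinity>" by simp
 qed measurable
 then have conv: "AE x in gauss_seq. convergent (\<lambda>j. ?G j x)"
 proof eventually_elim
  case (elim x)
  then have "summable (\<lambda>j. norm (?G (Suc j) x - ?G j x))"
   by (intro summable_suminf_not_top) (auto simp: norm_minus_commute top_unique)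
  then have "summable (\<lambda>j. ?G (Suc j) x - ?G j x)" by (rule summable_norm_cancel)
  then have "convergent (\<lambda>n. \<Sum>j<n. ?G (Suc j) x - ?G j x)" by (simp add: summable_iff_convergent)
  then have "convergent (\<lambda>n. ?G n x - ?G 0 x)" unfolding sum_lessThan_telescope[of "\<lambda>j. ?G j x"] .
  then obtain l where "(\<lambda>n. ?G n x - ?G 0 x) \<longlonglongrightarrow> l" by (auto simp: convergent_def)
  then have "(\<lambda>n. ?G n x - ?G 0 x + ?G 0 x) \<longlonglongrightarrow> l + ?G 0 x" by (intro tendsto_intros)
  then show ?case by (auto simp: convergent_def)
 qed
 define Z where "Z x = lim (\<lambda>j. ?G j x)" for x
 have Zm[measurable]: "Z \<in> borel_measurable gauss_seq"
  unfolding Z_def by (intro borel_measurable_lim_metric gsum_measurable)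
 have limZ: "AE x in gauss_seq. (\<lambda>j. ?G j x) \<longlonglongrightarrow> Z x"
  using conv by eventually_elim (simp add: Z_def convergent_LIMSEQ_iff)
 have Z_rate_nn: "(\<integral>\<^sup>+x. ennreal ((norm (?G j x - Z x))\<^sup>2) \<partial>gauss_seq) \<le> ennreal (c * (1 / 4) ^ j)" for j
 proof (rule fatou_bound)
  show "AE x in gauss_seq. (\<lambda>l. (norm (?G j x - ?G l x))\<^sup>2) \<longlonglongrightarrow> (norm (?G j x - Z x))\<^sup>2"
   using limZ by eventually_elim (intro tendsto_intros)
  show "\<forall>\<^sub>F l in sequentially. (\<integral>\<^sup>+x. ennreal ((norm (?G j x - ?G l x))\<^sup>2) \<partial>gauss_seq) \<le> ennreal (c * (1 / 4) ^ j)"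
   using diff_rate by (auto simp: eventually_sequentially)
 qed measurable
 have c4: "0 \<le> c * (1 / 4) ^ j" for j using c by simp
 have Zd: "integrable gauss_seq (\<lambda>x. (norm (?G j x - Z x))\<^sup>2)"
  "(LINT x|gauss_seq. (norm (?G j x - Z x))\<^sup>2) \<le> c * (1 / 4) ^ j" for j
  by (rule integrable_square_iff_nn_integral[OF _ _ Z_rate_nn c4]; simp)+
 have Z_sq: "integrable gauss_seq (\<lambda>x. (norm (Z x))\<^sup>2)"
 proof -
  have "integrable gauss_seq (\<lambda>x. (norm (?G 0 x - (?G 0 x - Z x)))\<^sup>2)"
   by (rule L2_add(2)) (use G_sq Zd in auto)
  then show ?thesis by simp
 qed
 have sqrt_rate: "(\<lambda>j. sqrt (c * (1 / 4) ^ j)) \<longlonglongrightarrow> 0"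
 proof -
  have "(\<lambda>j. sqrt (c * (1 / 4) ^ j)) \<longlonglongrightarrow> sqrt (c * 0)"
   by (intro tendsto_intros LIMSEQ_power_zero) auto
  then show ?thesis by simp
 qed
 have L1: "integrable gauss_seq (\<lambda>x. norm (?G j x - Z x))"
   "(LINT x|gauss_seq. norm (?G j x - Z x)) \<le> sqrt (c * (1 / 4) ^ j)" for j
 proof -
  show "integrable gauss_seq (\<lambda>x. norm (?G j x - Z x))"
   by (rule G.square_integrable_imp_integrable[OF _ Zd(1)]) simp
  have "(LINT x|gauss_seq. norm (?G j x - Z x)) \<le> sqrt (LINT x|gauss_seq. (norm (?G j x - Z x))\<^sup>2)"
   by (rule G.L1_le_L2[OF _ Zd(1)]) simp
  also have "\<dots> \<le> sqrt (c * (1 / 4) ^ j)" using Zd(2) by simp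
  finally show "(LINT x|gauss_seq. norm (?G j x - Z x)) \<le> sqrt (c * (1 / 4) ^ j)" .
 qed
 have G_int: "integrable gauss_seq (?G j)" for j
 proof -
  have "integrable gauss_seq (\<lambda>x. norm (?G j x))" by (rule G.square_integrable_imp_integrable[OF _ G_sq]) simp
  then show ?thesis by (simp add: integrable_norm_iff)
 qed
 have Z_int: "integrable gauss_seq Z"
 proof -
  have "integrable gauss_seq (\<lambda>x. norm (Z x))" by (rule G.square_integrable_imp_integrable[OF _ Z_sq]) simp
  then show ?thesis by (simp add: integrable_norm_iff)
 qed
 have Z_mean: "(LINT x|gauss_seq. Z x) = 0"
 proof -
  have "norm (LINT x|gauss_seq. Z x) \<le> sqrt (c * (1 / 4) ^ j)" for j
  proof -
   have "(LINT x|gauss_seq. ?G j x - Z x) = - (LINT x|gauss_seq. Z x)"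
    using G_int Z_int gsum_mean by simp
   then have "norm (LINT x|gauss_seq. Z x) = norm (LINT x|gauss_seq. ?G j x - Z x)" by simp
   also have "\<dots> \<le> (LINT x|gauss_seq. norm (?G j x - Z x))" by (rule integral_norm_bound)
   finally show ?thesis using L1(2)[of j] by linarith
  qed
  then have "norm (LINT x|gauss_seq. Z x) \<le> 0"
   by (intro LIMSEQ_le_const[OF sqrt_rate]) auto
  then show ?thesis by simp
 qed
 show ?thesis
 proof (rule that[OF Zm Z_sq Z_mean])
  fix f :: "'w \<Rightarrow> real" and \<Lambda> B
  assume lip: "\<And>a b. \<bar>f a - f b\<bar> \<le> \<Lambda> * norm (a - b)" and bd: "\<And>a. \<bar>f a\<bar> \<le> B"
  have \<Lambda>: "\<bar>\<Lambda>\<bar> * y \<ge> \<Lambda> * y" if "y \<ge> 0" for y using that by (simp add: mult_right_mono)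
  have lip': "\<bar>f a - f b\<bar> \<le> \<bar>\<Lambda>\<bar> * norm (a - b)" for a b
   using lip[of a b] \<Lambda>[of "norm (a - b)"] by simp
  have fc: "continuous_on UNIV f"
  proof (rule lipschitz_on_continuous_on[of "\<bar>\<Lambda>\<bar>"], rule lipschitz_onI)
   show "dist (f a) (f b) \<le> \<bar>\<Lambda>\<bar> * dist a b" for a b using lip'[of a b] by (simp add: dist_norm)
  qed simp
  have fm[measurable]: "f \<in> borel_measurable borel" using fc by (rule borel_measurable_continuous_onI)
  let ?S = "\<lambda>n \<omega>. (1 / sqrt (real n)) *\<^sub>R (\<Sum>k<n. Y k \<omega>)"
  let ?T = "\<lambda>j n \<omega>. (1 / sqrt (real n)) *\<^sub>R (\<Sum>k<n. ?y j (Y k \<omega>))"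
  \<comment> \<open>Uniform in \<open>n\<close>: the type 2 inequality is applied to the centered
    differences \<open>Y k - ?y j (Y k)\<close>, so one level \<open>j\<close> can be fixed before
    \<open>n\<close> tends to infinity.\<close>
  have cl1: "\<bar>(LINT \<omega>|M. f (?S n \<omega>)) - (LINT \<omega>|M. f (?T j n \<omega>))\<bar> \<le> \<bar>\<Lambda>\<bar> * sqrt (c * (1 / 4) ^ j)" for n j
  proof -
   have q: "(\<lambda>w. w - ?y j w) \<in> borel_measurable borel" by measurable
   have qm: "(LINT \<omega>|M. Y 0 \<omega> - ?y j (Y 0 \<omega>)) = 0"
    using Y_int h_int Y_mean hsum_mean by simp
   note nb = normalized_bound[OF q Yd_sq qm, where n=n]
   have eq: "?S n \<omega> - ?T j n \<omega> = (1 / sqrt (real n)) *\<^sub>R (\<Sum>k<n. Y k \<omega> - ?y j (Y k \<omega>))" for \<omega>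
    by (simp add: sum_subtractf scaleR_diff_right)
   have i: "integrable M (\<lambda>\<omega>. f (?S n \<omega>))" "integrable M (\<lambda>\<omega>. f (?T j n \<omega>))"
    by (rule integrable_const_bound[where B=B]; use bd in auto)+
   have d: "integrable M (\<lambda>\<omega>. norm (?S n \<omega> - ?T j n \<omega>))"
    unfolding eq by (rule square_integrable_imp_integrable[OF _ nb(1)]) simp
   have "\<bar>(LINT \<omega>|M. f (?S n \<omega>)) - (LINT \<omega>|M. f (?T j n \<omega>))\<bar> = \<bar>LINT \<omega>|M. f (?S n \<omega>) - f (?T j n \<omega>)\<bar>"
    using i by simp
   also have "\<dots> \<le> (LINT \<omega>|M. \<bar>f (?S n \<omega>) - f (?T j n \<omega>)\<bar>)" by (rule integral_abs_bound)
   also have "\<dots> \<le> (LINT \<omega>|M. \<bar>\<Lambda>\<bar> * norm (?S n \<omega> - ?T j n \<omega>))"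
    using i d lip' by (intro integral_mono) auto
   also have "\<dots> = \<bar>\<Lambda>\<bar> * (LINT \<omega>|M. norm (?S n \<omega> - ?T j n \<omega>))" by simp
   also have "\<dots> \<le> \<bar>\<Lambda>\<bar> * sqrt (c * (1 / 4) ^ j)"
   proof (intro mult_left_mono)
    have "(LINT \<omega>|M. norm (?S n \<omega> - ?T j n \<omega>)) \<le> sqrt (LINT \<omega>|M. (norm (?S n \<omega> - ?T j n \<omega>))\<^sup>2)"
     unfolding eq by (rule L1_le_L2[OF _ nb(1)]) simp
    also have "\<dots> \<le> sqrt (C * (4 * (1 / 4) ^ j))"
     unfolding eq using less_imp_le[OF C(1)]
     by (intro real_sqrt_le_mono order_trans[OF nb(2)] mult_left_mono[OF rate])
    also have "\<dots> \<le> sqrt (c * (1 / 4) ^ j)" using C(1) by (simp add: c_def)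
    finally show "(LINT \<omega>|M. norm (?S n \<omega> - ?T j n \<omega>)) \<le> sqrt (c * (1 / 4) ^ j)" .
   qed simp
   finally show ?thesis .
  qed
  have cl2: "\<bar>(LINT x|gauss_seq. f (?G j x)) - (LINT x|gauss_seq. f (Z x))\<bar> \<le> \<bar>\<Lambda>\<bar> * sqrt (c * (1 / 4) ^ j)" for j
  proof -
   have i: "integrable gauss_seq (\<lambda>x. f (?G j x))" "integrable gauss_seq (\<lambda>x. f (Z x))"
    by (rule G.integrable_const_bound[where B=B]; use bd in auto)+
   have "\<bar>(LINT x|gauss_seq. f (?G j x)) - (LINT x|gauss_seq. f (Z x))\<bar> = \<bar>LINT x|gauss_seq. f (?G j x) - f (Z x)\<bar>"
    using i by simp
   also have "\<dots> \<le> (LINT x|gauss_seq. \<bar>f (?G j x) - f (Z x)\<bar>)" by (rule integral_abs_bound)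
   also have "\<dots> \<le> (LINT x|gauss_seq. \<bar>\<Lambda>\<bar> * norm (?G j x - Z x))"
    using i L1(1) lip' by (intro integral_mono) auto
   also have "\<dots> \<le> \<bar>\<Lambda>\<bar> * sqrt (c * (1 / 4) ^ j)" using L1(2)[of j] by (simp add: mult_left_mono)
   finally show ?thesis .
  qed
  show "(\<lambda>n. LINT \<omega>|M. f (?S n \<omega>)) \<longlonglongrightarrow> (LINT x|gauss_seq. f (Z x))"
  proof (rule metric_LIMSEQ_I)
   fix r :: real assume r: "r > 0"
   have "(\<lambda>j. \<bar>\<Lambda>\<bar> * sqrt (c * (1 / 4) ^ j)) \<longlonglongrightarrow> \<bar>\<Lambda>\<bar> * 0" by (intro tendsto_intros sqrt_rate)
   then have "\<forall>\<^sub>F j in sequentially. \<bar>\<Lambda>\<bar> * sqrt (c * (1 / 4) ^ j) < r / 3"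
    using r by (intro order_tendstoD(2)) auto
   then obtain j where j: "\<bar>\<Lambda>\<bar> * sqrt (c * (1 / 4) ^ j) < r / 3" by (auto simp: eventually_sequentially)
   have "(\<lambda>n. LINT \<omega>|M. f (?T j n \<omega>)) \<longlonglongrightarrow> (LINT x|gauss_seq. f (?G j x))"
    by (rule gsum_limit[OF F fc bd])
   then have "\<forall>\<^sub>F n in sequentially. dist (LINT \<omega>|M. f (?T j n \<omega>)) (LINT x|gauss_seq. f (?G j x)) < r / 3"
    using r by (intro tendstoD) auto
   then have "\<forall>\<^sub>F n in sequentially. dist (LINT \<omega>|M. f (?S n \<omega>)) (LINT x|gauss_seq. f (Z x)) < r"
   proof eventually_elim
    case (elim n)
    then show ?case using cl1[of n j] cl2[of j] j unfolding dist_real_def by linarith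
   qed
   then show "\<exists>no. \<forall>n\<ge>no. dist (LINT \<omega>|M. f (?S n \<omega>)) (LINT x|gauss_seq. f (Z x)) < r"
    by (simp add: eventually_sequentially)
  qed
 qed
qed

end

text \<open>\<open>real_gaussian\<close> asks for a density unless the variable is almost surely
  constant. Variance 0 is therefore identified with the point mass at 0 and positive variance with
  the standard normal law after scaling, both by Levy's uniqueness theorem.\<close>

lemma real_gaussian_of_char:
 assumes "prob_space N" and X[measurable]: "X \<in> borel_measurable N"
  and sq: "integrable N (\<lambda>x. (X x)\<^sup>2)" and v: "v \<ge> 0"
  and char: "\<And>s. (CLINT x|N. iexp (s * X x)) = complex_of_real (exp (- (s\<^sup>2 * v) / 2))"
 shows "real_gaussian N X" "(LINT x|N. (X x)\<^sup>2) = v"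
proof -
 interpret N: prob_space N by fact
 have char_X: "Characteristic_Functions.char (distr N borel (\<lambda>x. a * X x)) s = complex_of_real (exp (- ((s * a)\<^sup>2 * v) / 2))" for a s
 proof -
  have "Characteristic_Functions.char (distr N borel (\<lambda>x. a * X x)) s = (CLINT x|N. iexp ((s * a) * X x))"
   unfolding char_def by (subst integral_distr) (auto simp: mult_ac)
  then show ?thesis unfolding char .
 qed
 have rd: "real_distribution (distr N borel (\<lambda>x. a * X x))" for a
  by (rule N.real_distribution_distr) simp
 have "real_gaussian N X \<and> (LINT x|N. (X x)\<^sup>2) = v"
 proof (cases "v = 0")
  case True
  interpret R: prob_space "return borel (0::real)" by (rule prob_space_return) simp
  have rdR: "real_distribution (return borel (0::real))"
   by (auto simp: real_distribution_def real_distribution_axioms_def R.prob_space_axioms)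
  have ret: "distr N borel (\<lambda>x. 1 * X x) = return borel 0"
  proof (rule Levy_uniqueness[OF rd rdR])
   show "Characteristic_Functions.char (distr N borel (\<lambda>x. 1 * X x)) = Characteristic_Functions.char (return borel (0::real))"
    unfolding fun_eq_iff char_X using True by (auto simp: char_def integral_return)
  qed
  have "AE y in distr N borel (\<lambda>x. 1 * X x). y = 0"
   unfolding ret by (simp add: AE_return)
  then have z: "AE x in N. X x = 0" by (subst (asm) AE_distr_iff) auto
  then have "(LINT x|N. (X x)\<^sup>2) = (LINT x|N. 0)" by (intro integral_cong_AE) auto
  then show ?thesis using z True unfolding real_gaussian_def by auto
 next
  case False
  then have s: "sqrt v > 0" using v by simp
  define X' where "X' x = (1 / sqrt v) * X x" for x
  have X'm[measurable]: "X' \<in> borel_measurable N" unfolding X'_def by measurable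
  have X_eq: "X = (\<lambda>x. 0 + sqrt v * X' x)" using s by (auto simp: X'_def)
  have "distr N borel X' = std_normal_distribution"
  proof (rule Levy_uniqueness)
   show "Characteristic_Functions.char (distr N borel X') = Characteristic_Functions.char std_normal_distribution"
    unfolding fun_eq_iff X'_def char_X char_std_normal_distribution
    using s v by (simp add: power_mult_distrib power_divide)
  qed (use rd in \<open>auto simp: X'_def intro: real_dist_normal_dist\<close>)
  moreover have "distr N lborel X' = distr N borel X'" by (rule distr_cong) auto
  ultimately have "distributed N lborel X' std_normal_density"
   unfolding distributed_def by simp
  from N.normal_density_affine[OF this, of "sqrt v" 0] s
  have d: "distributed N lborel X (normal_density 0 (sqrt v))"
   unfolding X_eq by simp
  have "N.variance X = v" "N.expectation X = 0"
   using N.normal_distributed_variance[OF s d] N.normal_distributed_expectation[OF s d] v by simp_all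
  then have "(LINT x|N. (X x)\<^sup>2) = v" by simp
  then show ?thesis using s d unfolding real_gaussian_def by auto
 qed
 then show "real_gaussian N X" "(LINT x|N. (X x)\<^sup>2) = v" by auto
qed

lemma blinfun_measurable[measurable (raw)]:
 fixes \<psi> :: "'w::{real_normed_vector, second_countable_topology} \<Rightarrow>\<^sub>L real"
 assumes "f \<in> borel_measurable M"
 shows "(\<lambda>x. blinfun_apply \<psi> (f x)) \<in> borel_measurable M"
 using assms by (rule borel_measurable_continuous_on[rotated]) (intro continuous_intros)

lemma blinfun_square_integrable:
 fixes \<psi> :: "'w::{banach, second_countable_topology} \<Rightarrow>\<^sub>L real"
 assumes [measurable]: "f \<in> borel_measurable M" and "integrable M (\<lambda>x. (norm (f x))\<^sup>2)"
 shows "integrable M (\<lambda>x. (blinfun_apply \<psi> (f x))\<^sup>2)"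
proof (rule Bochner_Integration.integrable_bound[of M "\<lambda>x. (norm \<psi>)\<^sup>2 * (norm (f x))\<^sup>2"])
 show "integrable M (\<lambda>x. (norm \<psi>)\<^sup>2 * (norm (f x))\<^sup>2)" using assms by simp
 have "(blinfun_apply \<psi> y)\<^sup>2 \<le> (norm \<psi>)\<^sup>2 * (norm y)\<^sup>2" for y
 proof -
  have "\<bar>blinfun_apply \<psi> y\<bar>\<^sup>2 \<le> (norm \<psi> * norm y)\<^sup>2"
   using norm_blinfun[of \<psi> y] by (intro power_mono) auto
  then show ?thesis by (simp add: power_mult_distrib)
 qed
 then show "AE x in M. norm ((blinfun_apply \<psi> (f x))\<^sup>2) \<le> norm ((norm \<psi>)\<^sup>2 * (norm (f x))\<^sup>2)" by auto
qed measurable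

text \<open>Subtracting the mean costs at most a factor 4. The approximating simple functions have
  to be centered before the type 2 inequality applies to them.\<close>

lemma (in prob_space) integral_centered_square_le:
 fixes a :: "'a \<Rightarrow> 'w::{banach, second_countable_topology}"
 assumes [measurable]: "a \<in> borel_measurable M" and sq: "integrable M (\<lambda>\<omega>. (norm (a \<omega>))\<^sup>2)"
 shows "(LINT \<omega>|M. (norm (a \<omega> - expectation a))\<^sup>2) \<le> 4 * (LINT \<omega>|M. (norm (a \<omega>))\<^sup>2)"
proof -
 have int: "integrable M (\<lambda>\<omega>. norm (a \<omega>))" by (rule square_integrable_imp_integrable[OF _ sq]) simp
 have c: "integrable M (\<lambda>\<omega>. (norm (expectation a))\<^sup>2)" by simp
 have "norm (expectation a) \<le> (LINT \<omega>|M. norm (a \<omega>))" by (rule integral_norm_bound)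
 also have "\<dots> \<le> sqrt (LINT \<omega>|M. (norm (a \<omega>))\<^sup>2)" by (rule L1_le_L2[OF _ sq]) simp
 finally have "(norm (expectation a))\<^sup>2 \<le> (sqrt (LINT \<omega>|M. (norm (a \<omega>))\<^sup>2))\<^sup>2" by (intro power_mono) auto
 then have e: "(norm (expectation a))\<^sup>2 \<le> (LINT \<omega>|M. (norm (a \<omega>))\<^sup>2)" by simp
 have "(LINT \<omega>|M. (norm (a \<omega> - expectation a))\<^sup>2) \<le> (LINT \<omega>|M. 2 * (norm (a \<omega>))\<^sup>2 + 2 * (norm (expectation a))\<^sup>2)"
  using sq by (intro integral_mono L2_add(2)) (auto simp: norm_diff_square_le)
 also have "\<dots> = 2 * (LINT \<omega>|M. (norm (a \<omega>))\<^sup>2) + 2 * (norm (expectation a))\<^sup>2"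
  using sq by (simp add: prob_space)
 finally show ?thesis using e by linarith
qed

text \<open>Lipschitz test functions identify the limit, since
  \<open>cos (s * \<psi> w + \<theta>)\<close> is one of them in \<open>w\<close>. The phases 0 and
  \<open>pi / 2\<close> recover the real and the imaginary part of the characteristic function, and
  polarization turns variances into covariances.\<close>

lemma (in prob_space) clt_limit_gaussian:
 fixes Y :: "nat \<Rightarrow> 'a \<Rightarrow> 'w::{banach, second_countable_topology}" and \<psi>1 \<psi>2 :: "'w \<Rightarrow>\<^sub>L real"
 assumes Y: "iid M borel Y" and Y_sq: "integrable M (\<lambda>\<omega>. (norm (Y 0 \<omega>))\<^sup>2)" and Y_mean: "expectation (Y 0) = 0"
  and N: "prob_space N" and Z[measurable]: "Z \<in> borel_measurable N" and Z_sq: "integrable N (\<lambda>x. (norm (Z x))\<^sup>2)"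
  and lim: "\<And>(f :: 'w \<Rightarrow> real) \<Lambda> B. (\<And>a b. \<bar>f a - f b\<bar> \<le> \<Lambda> * norm (a - b)) \<Longrightarrow> (\<And>a. \<bar>f a\<bar> \<le> B) \<Longrightarrow>
   (\<lambda>n. LINT \<omega>|M. f ((1 / sqrt (real n)) *\<^sub>R (\<Sum>k<n. Y k \<omega>))) \<longlonglongrightarrow> (LINT x|N. f (Z x))"
 shows "gaussian N Z"
  "(LINT x|N. blinfun_apply \<psi>1 (Z x) * blinfun_apply \<psi>2 (Z x)) = (LINT \<omega>|M. blinfun_apply \<psi>1 (Y 0 \<omega>) * blinfun_apply \<psi>2 (Y 0 \<omega>))"
proof -
 interpret N: prob_space N by fact
 note [measurable] = iid_measurable[OF Y]
 have Y_int: "integrable M (Y 0)"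
 proof -
  have "integrable M (\<lambda>\<omega>. norm (Y 0 \<omega>))" by (rule square_integrable_imp_integrable[OF _ Y_sq]) simp
  then show ?thesis by (simp add: integrable_norm_iff)
 qed
 define V where "V \<psi> = (LINT \<omega>|M. (blinfun_apply \<psi> (Y 0 \<omega>))\<^sup>2)" for \<psi> :: "'w \<Rightarrow>\<^sub>L real"
 have V0: "V \<psi> \<ge> 0" for \<psi> by (simp add: V_def)
 have charZ: "(CLINT x|N. iexp (s * blinfun_apply \<psi> (Z x))) = complex_of_real (exp (- (s\<^sup>2 * V \<psi>) / 2))" for s \<psi>
 proof -
  have iid: "iid M borel (\<lambda>k \<omega>. blinfun_apply \<psi> (Y k \<omega>))" by (rule iid_compose[OF Y]) measurable
  have sq: "integrable M (\<lambda>\<omega>. (blinfun_apply \<psi> (Y 0 \<omega>))\<^sup>2)" by (rule blinfun_square_integrable) (use Y_sq in auto)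
  have "(LINT \<omega>|M. blinfun_apply \<psi> (Y 0 \<omega>)) = blinfun_apply \<psi> (LINT \<omega>|M. Y 0 \<omega>)"
   by (rule integral_bounded_linear[OF blinfun.bounded_linear_right Y_int])
  then have mean: "(LINT \<omega>|M. blinfun_apply \<psi> (Y 0 \<omega>)) = 0" using Y_mean by simp
  have clt: "(\<lambda>n. CLINT \<omega>|M. iexp (s * ((1 / sqrt (real n)) * (\<Sum>k<n. blinfun_apply \<psi> (Y k \<omega>)))))
    \<longlonglongrightarrow> complex_of_real (exp (- (s\<^sup>2 * V \<psi>) / 2))"
   unfolding V_def by (rule clt_char[OF iid sq mean])
  have lin: "s * ((1 / sqrt (real n)) * (\<Sum>k<n. blinfun_apply \<psi> (Y k \<omega>))) = s * blinfun_apply \<psi> ((1 / sqrt (real n)) *\<^sub>R (\<Sum>k<n. Y k \<omega>))" for n \<omega>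
   by (simp add: blinfun.scaleR_right blinfun.sum_right)
  have Re: "(LINT x|N. cos (s * blinfun_apply \<psi> (Z x) + \<theta>)) = Re (iexp \<theta> * complex_of_real (exp (- (s\<^sup>2 * V \<psi>) / 2)))" for \<theta>
  proof (rule LIMSEQ_unique)
   show "(\<lambda>n. LINT \<omega>|M. cos (s * blinfun_apply \<psi> ((1 / sqrt (real n)) *\<^sub>R (\<Sum>k<n. Y k \<omega>)) + \<theta>))
     \<longlonglongrightarrow> (LINT x|N. cos (s * blinfun_apply \<psi> (Z x) + \<theta>))"
   proof (rule lim[of "\<lambda>w. cos (s * blinfun_apply \<psi> w + \<theta>)" "\<bar>s\<bar> * norm \<psi>" 1])
    fix a b :: 'w
    have "\<bar>cos (s * blinfun_apply \<psi> a + \<theta>) - cos (s * blinfun_apply \<psi> b + \<theta>)\<bar> \<le> \<bar>(s * blinfun_apply \<psi> a + \<theta>) - (s * blinfun_apply \<psi> b + \<theta>)\<bar>"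
     for s :: real
    proof -
     have "\<bar>cos x - cos y\<bar> \<le> \<bar>x - y\<bar>" for x y :: real
     proof -
      have "\<bar>cos x - cos y\<bar> = 2 * (\<bar>sin ((x + y) / 2)\<bar> * \<bar>sin ((y - x) / 2)\<bar>)"
       unfolding cos_diff_cos by (simp add: abs_mult)
      also have "\<dots> \<le> 2 * (1 * \<bar>(y - x) / 2\<bar>)"
       by (intro mult_left_mono mult_mono abs_sin_x_le_abs_x) auto
      finally show ?thesis by (simp add: abs_minus_commute)
     qed
     from this[of "s * blinfun_apply \<psi> a + \<theta>" "s * blinfun_apply \<psi> b + \<theta>"]
     show ?thesis .
    qed
    also have "\<bar>(s * blinfun_apply \<psi> a + \<theta>) - (s * blinfun_apply \<psi> b + \<theta>)\<bar> = \<bar>s\<bar> * \<bar>blinfun_apply \<psi> (a - b)\<bar>"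
     by (simp add: blinfun.diff_right abs_mult[symmetric] right_diff_distrib)
    also have "\<dots> \<le> \<bar>s\<bar> * (norm \<psi> * norm (a - b))"
     using norm_blinfun[of \<psi> "a - b"] by (intro mult_left_mono) auto
    finally show "\<bar>cos (s * blinfun_apply \<psi> a + \<theta>) - cos (s * blinfun_apply \<psi> b + \<theta>)\<bar> \<le> \<bar>s\<bar> * norm \<psi> * norm (a - b)"
     by (simp add: mult.assoc)
   qed simp
   have "(\<lambda>n. Re (iexp \<theta> * (CLINT \<omega>|M. iexp (s * ((1 / sqrt (real n)) * (\<Sum>k<n. blinfun_apply \<psi> (Y k \<omega>)))))))
     \<longlonglongrightarrow> Re (iexp \<theta> * complex_of_real (exp (- (s\<^sup>2 * V \<psi>) / 2)))"
    using clt by (intro tendsto_Re tendsto_mult tendsto_const)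
   then show "(\<lambda>n. LINT \<omega>|M. cos (s * blinfun_apply \<psi> ((1 / sqrt (real n)) *\<^sub>R (\<Sum>k<n. Y k \<omega>)) + \<theta>))
     \<longlonglongrightarrow> Re (iexp \<theta> * complex_of_real (exp (- (s\<^sup>2 * V \<psi>) / 2)))"
    unfolding lin by (subst (asm) cos_integral_eq_char[symmetric]) simp_all
  qed
  let ?I = "CLINT x|N. iexp (s * blinfun_apply \<psi> (Z x))"
  have R: "Re (iexp \<theta> * ?I) = Re (iexp \<theta> * complex_of_real (exp (- (s\<^sup>2 * V \<psi>) / 2)))" for \<theta>
   unfolding Re[symmetric] by (subst N.cos_integral_eq_char) simp_all
  have "Re ?I = Re (complex_of_real (exp (- (s\<^sup>2 * V \<psi>) / 2)))" using R[of 0] by simp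
  moreover have "iexp (pi / 2) = \<i>" by (simp add: exp_eq_polar cis_conv_exp[symmetric])
  then have "Im ?I = Im (complex_of_real (exp (- (s\<^sup>2 * V \<psi>) / 2)))" using R[of "pi / 2"] by (simp only:) simp
  ultimately show ?thesis by (rule complex_eqI)
 qed
 note g = real_gaussian_of_char[OF N _ blinfun_square_integrable[OF Z Z_sq] V0 charZ]
 show "gaussian N Z" unfolding gaussian_def using g(1) by simp
 have var: "(LINT x|N. (blinfun_apply \<psi> (Z x))\<^sup>2) = V \<psi>" for \<psi> by (rule g(2)) simp
 have pol: "blinfun_apply \<psi>1 w * blinfun_apply \<psi>2 w = (1 / 4) * ((blinfun_apply (\<psi>1 + \<psi>2) w)\<^sup>2 - (blinfun_apply (\<psi>1 - \<psi>2) w)\<^sup>2)" for w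
  by (simp add: blinfun.add_left blinfun.diff_left power2_eq_square algebra_simps)
 have "(LINT x|N. blinfun_apply \<psi>1 (Z x) * blinfun_apply \<psi>2 (Z x)) = (1 / 4) * (V (\<psi>1 + \<psi>2) - V (\<psi>1 - \<psi>2))"
  unfolding pol using blinfun_square_integrable[OF Z Z_sq] by (simp add: var)
 also have "\<dots> = (LINT \<omega>|M. blinfun_apply \<psi>1 (Y 0 \<omega>) * blinfun_apply \<psi>2 (Y 0 \<omega>))"
  unfolding pol V_def using blinfun_square_integrable[OF _ Y_sq] by simp
 finally show "(LINT x|N. blinfun_apply \<psi>1 (Z x) * blinfun_apply \<psi>2 (Z x)) = (LINT \<omega>|M. blinfun_apply \<psi>1 (Y 0 \<omega>) * blinfun_apply \<psi>2 (Y 0 \<omega>))" .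
qed

text \<open>Dominated convergence gives mean square convergence of the simple approximations of
  \<open>Y 0\<close>; the subsequence \<open>r\<close> enforces the geometric rate that
  \<open>gaussian_limit\<close> asks for. The test functions are bounded Lipschitz functions because
  the replacement errors are controlled in mean.\<close>

lemma (in prob_space) clt_type_2:
 fixes Y :: "nat \<Rightarrow> 'a \<Rightarrow> 'w::{banach, second_countable_topology}"
 assumes type2: "type_2 M TYPE('w)" and Y: "iid M borel Y"
  and Y_sq: "integrable M (\<lambda>\<omega>. (norm (Y 0 \<omega>))\<^sup>2)" and Y_mean: "expectation (Y 0) = 0"
 obtains Z where "Z \<in> borel_measurable gauss_seq" "integrable gauss_seq (\<lambda>x. (norm (Z x))\<^sup>2)"
  "(LINT x|gauss_seq. Z x) = 0"
  "\<And>(f :: 'w \<Rightarrow> real) \<Lambda> B. (\<And>a b. \<bar>f a - f b\<bar> \<le> \<Lambda> * norm (a - b)) \<Longrightarrow> (\<And>a. \<bar>f a\<bar> \<le> B) \<Longrightarrow>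
   (\<lambda>n. LINT \<omega>|M. f ((1 / sqrt (real n)) *\<^sub>R (\<Sum>k<n. Y k \<omega>))) \<longlonglongrightarrow> (LINT x|gauss_seq. f (Z x))"
  "gaussian gauss_seq Z"
  "\<And>(\<psi>1 :: 'w \<Rightarrow>\<^sub>L real) (\<psi>2 :: 'w \<Rightarrow>\<^sub>L real). (LINT x|gauss_seq. blinfun_apply \<psi>1 (Z x) * blinfun_apply \<psi>2 (Z x))
    = (LINT \<omega>|M. blinfun_apply \<psi>1 (Y 0 \<omega>) * blinfun_apply \<psi>2 (Y 0 \<omega>))"
proof -
 note [measurable] = iid_measurable[OF Y]
 obtain F :: "nat \<Rightarrow> nat set" and b s and v :: "nat \<Rightarrow> 'w" where F: "\<And>j. finite (F j)"
  and b[measurable]: "\<And>i. b i \<in> borel_measurable borel" and b1: "\<And>i w. \<bar>b i w\<bar> \<le> 1"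
  and s_eq: "\<And>j w. s j w = (\<Sum>i\<in>F j. b i w *\<^sub>R v i)"
  and s: "\<And>w. (\<lambda>j. s j w) \<longlonglongrightarrow> w" "\<And>j w. norm (s j w) \<le> 2 * norm w"
  by (rule simple_approximation_indexed) blast
 have sm[measurable]: "s j \<in> borel_measurable borel" for j unfolding s_eq[abs_def] by measurable
 have bnd: "(norm (w - s j w))\<^sup>2 \<le> 9 * (norm w)\<^sup>2" for j w
 proof -
  have "norm (w - s j w) \<le> 3 * norm w" using norm_triangle_ineq4[of w "s j w"] s(2)[of j w] by simp
  then have "(norm (w - s j w))\<^sup>2 \<le> (3 * norm w)\<^sup>2" by (intro power_mono) auto
  then show ?thesis by (simp add: power_mult_distrib)
 qed
 have d_sq: "integrable M (\<lambda>\<omega>. (norm (Y 0 \<omega> - s j (Y 0 \<omega>)))\<^sup>2)" for j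
  by (rule Bochner_Integration.integrable_bound[of M "\<lambda>\<omega>. 9 * (norm (Y 0 \<omega>))\<^sup>2"]) (use Y_sq bnd in auto)
 have "(\<lambda>j. LINT \<omega>|M. (norm (Y 0 \<omega> - s j (Y 0 \<omega>)))\<^sup>2) \<longlonglongrightarrow> (LINT \<omega>|M. 0)"
 proof (rule integral_dominated_convergence[where w="\<lambda>\<omega>. 9 * (norm (Y 0 \<omega>))\<^sup>2"])
  show "AE \<omega> in M. (\<lambda>j. (norm (Y 0 \<omega> - s j (Y 0 \<omega>)))\<^sup>2) \<longlonglongrightarrow> 0"
  proof (intro AE_I2)
   fix \<omega>
   have "(\<lambda>j. (norm (Y 0 \<omega> - s j (Y 0 \<omega>)))\<^sup>2) \<longlonglongrightarrow> (norm (Y 0 \<omega> - Y 0 \<omega>))\<^sup>2"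
    by (intro tendsto_intros s)
   then show "(\<lambda>j. (norm (Y 0 \<omega> - s j (Y 0 \<omega>)))\<^sup>2) \<longlonglongrightarrow> 0" by simp
  qed
 qed (use Y_sq bnd in auto)
 then have d0: "(\<lambda>j. LINT \<omega>|M. (norm (Y 0 \<omega> - s j (Y 0 \<omega>)))\<^sup>2) \<longlonglongrightarrow> 0" by simp
 have "\<exists>j. (LINT \<omega>|M. (norm (Y 0 \<omega> - s j (Y 0 \<omega>)))\<^sup>2) \<le> (1 / 4) ^ m" for m :: nat
 proof -
  have "\<forall>\<^sub>F j in sequentially. (LINT \<omega>|M. (norm (Y 0 \<omega> - s j (Y 0 \<omega>)))\<^sup>2) < (1 / 4) ^ m"
   using order_tendstoD(2)[OF d0, of "(1 / 4) ^ m"] by simp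
  then show ?thesis by (auto simp: eventually_sequentially intro: less_imp_le)
 qed
 then obtain r where r: "\<And>m. (LINT \<omega>|M. (norm (Y 0 \<omega> - s (r m) (Y 0 \<omega>)))\<^sup>2) \<le> (1 / 4) ^ m" by metis
 define m where "m i = (LINT \<omega>|M. b i (Y 0 \<omega>))" for i
 define h where "h i w = b i w - m i" for i w
 have h[measurable]: "h i \<in> borel_measurable borel" for i unfolding h_def by measurable
 have bb: "bounded_rv M (\<lambda>\<omega>. b i (Y 0 \<omega>))" for i using b1 by (auto simp: bounded_rv_def)
 have hb: "bounded_rv M (\<lambda>\<omega>. h i (Y 0 \<omega>))" for i
  using bounded_rv_add[OF bb bounded_rv_const[of M "- m i"]] by (simp add: h_def)
 have h_mean: "(LINT \<omega>|M. h i (Y 0 \<omega>)) = 0" for i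
  using bounded_rv_integrable[OF bb] by (simp add: h_def m_def prob_space)
 obtain L :: "nat \<Rightarrow> nat \<Rightarrow> real" where L: "\<And>i k. k > i \<Longrightarrow> L i k = 0"
  "\<And>i j N. i \<le> N \<Longrightarrow> j \<le> N \<Longrightarrow> (LINT \<omega>|M. h i (Y 0 \<omega>) * h j (Y 0 \<omega>)) = (\<Sum>k\<le>N. L i k * L j k)"
  using covariance_factorization[of "\<lambda>i \<omega>. h i (Y 0 \<omega>)", OF hb] by metis
 obtain C where C: "C > 0"
  "\<And>(X :: nat \<Rightarrow> 'a \<Rightarrow> 'w) n. iid M borel X \<Longrightarrow> integrable M (\<lambda>\<omega>. (norm (X 0 \<omega>))\<^sup>2) \<Longrightarrow> expectation (X 0) = 0 \<Longrightarrow>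
    integrable M (\<lambda>\<omega>. (norm (\<Sum>k<n. X k \<omega>))\<^sup>2) \<and>
    expectation (\<lambda>\<omega>. (norm (\<Sum>k<n. X k \<omega>))\<^sup>2) \<le> C * (real n * expectation (\<lambda>\<omega>. (norm (X 0 \<omega>))\<^sup>2))"
  using type_2_iid_bound[OF type2] by metis
 interpret A: gaussian_approximation M Y h L C
  by unfold_locales (fact Y Y_sq Y_mean h hb h_mean L C)+
 have Y_int: "integrable M (Y 0)"
 proof -
  have "integrable M (\<lambda>\<omega>. norm (Y 0 \<omega>))" by (rule square_integrable_imp_integrable[OF _ Y_sq]) simp
  then show ?thesis by (simp add: integrable_norm_iff)
 qed
 have rate: "expectation (\<lambda>\<omega>. (norm (Y 0 \<omega> - A.hsum (F (r j)) v (Y 0 \<omega>)))\<^sup>2) \<le> 4 * (1 / 4) ^ j" for j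
 proof -
  let ?a = "\<lambda>\<omega>. Y 0 \<omega> - s (r j) (Y 0 \<omega>)"
  have s_int: "integrable M (\<lambda>\<omega>. s (r j) (Y 0 \<omega>))"
   unfolding s_eq using bounded_rv_integrable[OF bb] by simp
  have "expectation ?a = - expectation (\<lambda>\<omega>. s (r j) (Y 0 \<omega>))"
   using Y_int s_int Y_mean by simp
  also have "expectation (\<lambda>\<omega>. s (r j) (Y 0 \<omega>)) = (\<Sum>i\<in>F (r j). m i *\<^sub>R v i)"
   unfolding s_eq m_def using bounded_rv_integrable[OF bb] by simp
  finally have eq: "Y 0 \<omega> - A.hsum (F (r j)) v (Y 0 \<omega>) = ?a \<omega> - expectation ?a" for \<omega>
   unfolding A.hsum_def h_def by (simp add: s_eq scaleR_diff_left sum_subtractf)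
  have "expectation (\<lambda>\<omega>. (norm (Y 0 \<omega> - A.hsum (F (r j)) v (Y 0 \<omega>)))\<^sup>2) \<le> 4 * (LINT \<omega>|M. (norm (?a \<omega>))\<^sup>2)"
   unfolding eq by (rule integral_centered_square_le[OF _ d_sq[of "r j"]]) measurable
  also have "\<dots> \<le> 4 * (1 / 4) ^ j" using r[of j] by simp
  finally show ?thesis .
 qed
 show ?thesis
 proof (rule A.gaussian_limit[where F="\<lambda>j. F (r j)" and v=v, OF F rate])
  fix Z
  assume Z: "Z \<in> borel_measurable gauss_seq" "integrable gauss_seq (\<lambda>x. (norm (Z x))\<^sup>2)"
   "(LINT x|gauss_seq. Z x) = 0"
   "\<And>(f :: 'w \<Rightarrow> real) \<Lambda> B. (\<And>a b. \<bar>f a - f b\<bar> \<le> \<Lambda> * norm (a - b)) \<Longrightarrow> (\<And>a. \<bar>f a\<bar> \<le> B) \<Longrightarrow>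
    (\<lambda>n. LINT \<omega>|M. f ((1 / sqrt (real n)) *\<^sub>R (\<Sum>k<n. Y k \<omega>))) \<longlonglongrightarrow> (LINT x|gauss_seq. f (Z x))"
  have G: "gaussian gauss_seq Z"
   by (rule clt_limit_gaussian(1)[OF Y Y_sq Y_mean prob_space_gauss_seq Z(1,2)]) (rule Z(4))
  have G2: "(LINT x|gauss_seq. blinfun_apply \<psi>1 (Z x) * blinfun_apply \<psi>2 (Z x))
    = (LINT \<omega>|M. blinfun_apply \<psi>1 (Y 0 \<omega>) * blinfun_apply \<psi>2 (Y 0 \<omega>))" for \<psi>1 \<psi>2 :: "'w \<Rightarrow>\<^sub>L real"
   by (rule clt_limit_gaussian(2)[OF Y Y_sq Y_mean prob_space_gauss_seq Z(1,2)]) (rule Z(4))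
  show ?thesis
  proof (rule that[OF Z(1-3) _ G G2])
   show "(\<lambda>n. LINT \<omega>|M. f ((1 / sqrt (real n)) *\<^sub>R (\<Sum>k<n. Y k \<omega>))) \<longlonglongrightarrow> (LINT x|gauss_seq. f (Z x))"
    if "\<And>a b. \<bar>f a - f b\<bar> \<le> \<Lambda> * norm (a - b)" "\<And>a. \<bar>f a\<bar> \<le> B" for f :: "'w \<Rightarrow> real" and \<Lambda> B
    using that by (rule Z(4))
  qed
 qed
qed

section \<open>Renewal reward processes\<close>

context prob_space
begin

text \<open>First passage decomposition: at the first \<open>k\<close> whose partial sum exceeds
  \<open>2 * a\<close>, the remaining sum is independent of the past and stays within
  \<open>a\<close> with probability at least one half; in that case the full sum exceeds
  \<open>a\<close>.\<close>

lemma ottaviani: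
 fixes X :: "nat \<Rightarrow> 'a \<Rightarrow> 'w::{banach, second_countable_topology}"
 assumes X: "indep_vars (\<lambda>_. borel) X UNIV"
  and half: "\<And>k. k \<le> n \<Longrightarrow> prob {\<omega>\<in>space M. norm (\<Sum>i=k..<n. X i \<omega>) > a} \<le> 1 / 2"
 shows "prob {\<omega>\<in>space M. \<exists>k\<le>n. norm (\<Sum>i<k. X i \<omega>) > 2 * a} \<le> 2 * prob {\<omega>\<in>space M. norm (\<Sum>i<n. X i \<omega>) > a}"
proof -
 have m[measurable]: "X i \<in> borel_measurable M" for i using X unfolding indep_vars_def by blast
 define E where "E k = {\<omega>\<in>space M. norm (\<Sum>i<k. X i \<omega>) > 2 * a \<and> (\<forall>j<k. norm (\<Sum>i<j. X i \<omega>) \<le> 2 * a)}" for k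
 define D where "D k = {\<omega>\<in>space M. norm (\<Sum>i=k..<n. X i \<omega>) \<le> a}" for k
 have Em[measurable]: "E k \<in> events" for k unfolding E_def by measurable
 have Dm[measurable]: "D k \<in> events" for k unfolding D_def by measurable
 have split: "(\<Sum>i<n. X i \<omega>) = (\<Sum>i<k. X i \<omega>) + (\<Sum>i=k..<n. X i \<omega>)" if "k \<le> n" for k \<omega>
  using that by (metis sum.atLeastLessThan_concat lessThan_atLeast0 zero_le)
 have U: "{\<omega>\<in>space M. \<exists>k\<le>n. norm (\<Sum>i<k. X i \<omega>) > 2 * a} = (\<Union>k\<in>{..n}. E k)"
 proof (intro equalityI subsetI)
  fix \<omega> assume \<omega>: "\<omega> \<in> {\<omega>\<in>space M. \<exists>k\<le>n. norm (\<Sum>i<k. X i \<omega>) > 2 * a}"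
  define k where "k = (LEAST k. norm (\<Sum>i<k. X i \<omega>) > 2 * a)"
  obtain k' where k': "k' \<le> n" "norm (\<Sum>i<k'. X i \<omega>) > 2 * a" using \<omega> by blast
  have "norm (\<Sum>i<k. X i \<omega>) > 2 * a" unfolding k_def by (rule LeastI[of "\<lambda>k. norm (\<Sum>i<k. X i \<omega>) > 2 * a", OF k'(2)])
  moreover have "norm (\<Sum>i<j. X i \<omega>) \<le> 2 * a" if "j < k" for j
   using not_less_Least[OF that[unfolded k_def]] by simp
  moreover have "k \<le> n" unfolding k_def using Least_le[of "\<lambda>k. norm (\<Sum>i<k. X i \<omega>) > 2 * a", OF k'(2)] k'(1) by simp
  ultimately show "\<omega> \<in> (\<Union>k\<in>{..n}. E k)" using \<omega> unfolding E_def by blast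
 next
  fix \<omega> assume "\<omega> \<in> (\<Union>k\<in>{..n}. E k)"
  then show "\<omega> \<in> {\<omega>\<in>space M. \<exists>k\<le>n. norm (\<Sum>i<k. X i \<omega>) > 2 * a}" unfolding E_def by blast
 qed
 have disj: "disjoint_family_on E {..n}"
  unfolding disjoint_family_on_def
 proof (intro ballI impI)
  fix k l :: nat assume "k \<noteq> l"
  then show "E k \<inter> E l = {}" unfolding E_def by (cases "k < l") (auto simp: not_less, (metis linorder_not_le nat_neq_iff)+)
 qed
 have ind: "prob (E k \<inter> D k) = prob (E k) * prob (D k)" if "k \<le> n" for k
 proof -
  let ?A = "\<lambda>\<omega>. restrict (\<lambda>i. X i \<omega>) {..<k}" and ?B = "\<lambda>\<omega>. restrict (\<lambda>i. X i \<omega>) {k..<n}"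
  let ?SA = "{f \<in> space (PiM {..<k} (\<lambda>_. borel)). norm (\<Sum>i<k. f i) > 2 * a \<and> (\<forall>j<k. norm (\<Sum>i<j. f i) \<le> 2 * a)} :: (nat \<Rightarrow> 'w) set"
  let ?SB = "{f \<in> space (PiM {k..<n} (\<lambda>_. borel)). norm (\<Sum>i=k..<n. f i) \<le> a} :: (nat \<Rightarrow> 'w) set"
  have iv: "indep_var (PiM {..<k} (\<lambda>_. borel)) ?A (PiM {k..<n} (\<lambda>_. borel)) ?B"
   by (rule indep_var_restrict[OF X]) auto
  have SA: "?SA \<in> sets (PiM {..<k} (\<lambda>_. borel))"
  proof -
   have "(\<lambda>f. \<Sum>i<j. f i) \<in> borel_measurable (PiM {..<k} (\<lambda>_. borel :: 'w measure))" if "j \<le> k" for j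
    using that by (intro borel_measurable_sum measurable_component_singleton) auto
   note [measurable] = this
   have "Measurable.pred (PiM {..<k} (\<lambda>_. borel)) (\<lambda>f :: nat \<Rightarrow> 'w. \<forall>j\<in>{..<k}. norm (\<Sum>i<j. f i) \<le> 2 * a)"
    by (rule pred_intros_finite(3)) (auto intro!: pred_le_const)
   moreover have "Measurable.pred (PiM {..<k} (\<lambda>_. borel)) (\<lambda>f :: nat \<Rightarrow> 'w. norm (\<Sum>i<k. f i) > 2 * a)"
    by measurable
   ultimately have "Measurable.pred (PiM {..<k} (\<lambda>_. borel)) (\<lambda>f :: nat \<Rightarrow> 'w. norm (\<Sum>i<k. f i) > 2 * a \<and> (\<forall>j\<in>{..<k}. norm (\<Sum>i<j. f i) \<le> 2 * a))"
    by (rule pred_intros_logic(3)[rotated])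
   then show ?thesis by (simp add: pred_def Ball_def)
  qed
  have SB: "?SB \<in> sets (PiM {k..<n} (\<lambda>_. borel))"
  proof -
   have "(\<lambda>f. \<Sum>i=k..<n. f i) \<in> borel_measurable (PiM {k..<n} (\<lambda>_. borel :: 'w measure))"
    by (intro borel_measurable_sum measurable_component_singleton) auto
   note [measurable] = this
   show ?thesis by measurable
  qed
  have restr: "(\<Sum>i<j. restrict (\<lambda>i. X i \<omega>) {..<k} i) = (\<Sum>i<j. X i \<omega>)" if "j \<le> k" for j \<omega>
   using that by (intro sum.cong) auto
  have EA: "?A -` ?SA \<inter> space M = E k"
  proof -
   have "?A \<omega> \<in> space (PiM {..<k} (\<lambda>_. borel))" for \<omega> by (simp add: space_PiM)
   moreover have "(\<forall>j<k. norm (\<Sum>i<j. ?A \<omega> i) \<le> 2 * a) \<longleftrightarrow> (\<forall>j<k. norm (\<Sum>i<j. X i \<omega>) \<le> 2 * a)" for \<omega>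
    using restr[of _ \<omega>] by (metis less_imp_le)
   ultimately show ?thesis unfolding E_def using restr[of k] by auto
  qed
  have DB: "?B -` ?SB \<inter> space M = D k"
   unfolding D_def by (auto simp: space_PiM)
  have "(\<lambda>x. (?A x, ?B x)) -` (?SA \<times> ?SB) \<inter> space M = E k \<inter> D k"
   using EA DB by blast
  then show ?thesis using indep_varD[OF iv SA SB] unfolding EA DB by simp
 qed
 have D_half: "prob (D k) \<ge> 1 / 2" if "k \<le> n" for k
 proof -
  have "{\<omega>\<in>space M. norm (\<Sum>i=k..<n. X i \<omega>) > a} = space M - D k" unfolding D_def by auto
  then show ?thesis using half[OF that] prob_compl[OF Dm[of k]] by simp
 qed
 have "prob (\<Union>k\<in>{..n}. E k) = (\<Sum>k\<le>n. prob (E k))"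
  by (rule finite_measure_finite_Union) (use disj in auto)
 also have "\<dots> \<le> (\<Sum>k\<le>n. 2 * prob (E k \<inter> D k))"
 proof (rule sum_mono)
  fix k assume "k \<in> {..n}"
  then have "prob (E k) * (1 / 2) \<le> prob (E k) * prob (D k)" by (intro mult_left_mono D_half) auto
  then show "prob (E k) \<le> 2 * prob (E k \<inter> D k)" using ind[of k] \<open>k \<in> {..n}\<close> by simp
 qed
 also have "\<dots> = 2 * prob (\<Union>k\<in>{..n}. E k \<inter> D k)"
 proof -
  have d: "disjoint_family_on (\<lambda>k. E k \<inter> D k) {..n}"
   using disj unfolding disjoint_family_on_def by blast
  have sub: "(\<lambda>k. E k \<inter> D k) ` {..n} \<subseteq> events"
   by (rule image_subsetI, rule sets.Int[OF Em Dm])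
  have "prob (\<Union>k\<in>{..n}. E k \<inter> D k) = (\<Sum>k\<le>n. prob (E k \<inter> D k))"
   by (rule finite_measure_finite_Union[OF finite_atMost sub d])
  then show ?thesis by (simp only: sum_distrib_left)
 qed
 also have "prob (\<Union>k\<in>{..n}. E k \<inter> D k) \<le> prob {\<omega>\<in>space M. norm (\<Sum>i<n. X i \<omega>) > a}"
 proof (rule finite_measure_mono)
  show "(\<Union>k\<in>{..n}. E k \<inter> D k) \<subseteq> {\<omega>\<in>space M. norm (\<Sum>i<n. X i \<omega>) > a}"
  proof
   fix \<omega> assume "\<omega> \<in> (\<Union>k\<in>{..n}. E k \<inter> D k)"
   then obtain k where k: "k \<le> n" "\<omega> \<in> space M" "norm (\<Sum>i<k. X i \<omega>) > 2 * a" "norm (\<Sum>i=k..<n. X i \<omega>) \<le> a"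
    unfolding E_def D_def by blast
   have "norm (\<Sum>i<k. X i \<omega>) \<le> norm (\<Sum>i<n. X i \<omega>) + norm (\<Sum>i=k..<n. X i \<omega>)"
    using norm_triangle_ineq4[of "\<Sum>i<n. X i \<omega>" "\<Sum>i=k..<n. X i \<omega>"] split[OF k(1), of \<omega>] by simp
   with k show "\<omega> \<in> {\<omega>\<in>space M. norm (\<Sum>i<n. X i \<omega>) > a}" by simp
  qed
 qed measurable
 finally show ?thesis unfolding U by simp
qed

lemma markov_square:
 fixes U :: "'a \<Rightarrow> 'w::{banach, second_countable_topology}"
 assumes [measurable]: "U \<in> borel_measurable M" and sq: "integrable M (\<lambda>\<omega>. (norm (U \<omega>))\<^sup>2)" and "a > 0"
 shows "prob {\<omega>\<in>space M. norm (U \<omega>) > a} \<le> expectation (\<lambda>\<omega>. (norm (U \<omega>))\<^sup>2) / a\<^sup>2"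
proof -
 have "prob {\<omega>\<in>space M. norm (U \<omega>) > a} \<le> prob {\<omega>\<in>space M. (norm (U \<omega>))\<^sup>2 \<ge> a\<^sup>2}"
 proof (rule finite_measure_mono)
  show "{\<omega>\<in>space M. norm (U \<omega>) > a} \<subseteq> {\<omega>\<in>space M. (norm (U \<omega>))\<^sup>2 \<ge> a\<^sup>2}"
  proof (intro subsetI CollectI conjI)
   fix \<omega> assume "\<omega> \<in> {\<omega>\<in>space M. norm (U \<omega>) > a}"
   then have "\<omega> \<in> space M" "a \<le> norm (U \<omega>)" by auto
   then show "\<omega> \<in> space M" "a\<^sup>2 \<le> (norm (U \<omega>))\<^sup>2" using assms(3) by (simp_all add: power_mono)
  qed
 qed measurable
 also have "\<dots> \<le> expectation (\<lambda>\<omega>. (norm (U \<omega>))\<^sup>2) / a\<^sup>2"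
  by (rule integral_Markov_inequality_measure[OF sq, where A="{}"]) (use assms(3) in auto)
 finally show ?thesis .
qed

text \<open>Chebyshev's bound \<open>c\<close> holds for all tails of the sum. If it is at most one
  half, Ottaviani's inequality applies; otherwise the claimed bound exceeds 1 and is
  trivial.\<close>

lemma maximal_inequality:
 fixes X :: "nat \<Rightarrow> 'a \<Rightarrow> 'w::{banach, second_countable_topology}"
 assumes X: "iid M borel X" and sq: "integrable M (\<lambda>\<omega>. (norm (X 0 \<omega>))\<^sup>2)" and mean: "expectation (X 0) = 0"
  and C: "C > 0" "\<And>(X :: nat \<Rightarrow> 'a \<Rightarrow> 'w) n. iid M borel X \<Longrightarrow> integrable M (\<lambda>\<omega>. (norm (X 0 \<omega>))\<^sup>2) \<Longrightarrow> expectation (X 0) = 0 \<Longrightarrow>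
    integrable M (\<lambda>\<omega>. (norm (\<Sum>k<n. X k \<omega>))\<^sup>2) \<and>
    expectation (\<lambda>\<omega>. (norm (\<Sum>k<n. X k \<omega>))\<^sup>2) \<le> C * (real n * expectation (\<lambda>\<omega>. (norm (X 0 \<omega>))\<^sup>2))"
  and a: "a > 0"
 shows "prob {\<omega>\<in>space M. \<exists>k\<le>n. norm (\<Sum>i<k. X i \<omega>) > 2 * a}
   \<le> 2 * (C * (real n * expectation (\<lambda>\<omega>. (norm (X 0 \<omega>))\<^sup>2)) / a\<^sup>2)"
proof -
 note [measurable] = iid_measurable[OF X]
 define V where "V = expectation (\<lambda>\<omega>. (norm (X 0 \<omega>))\<^sup>2)"
 have V: "V \<ge> 0" by (simp add: V_def)
 define c where "c = C * (real n * V) / a\<^sup>2"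
 have tail: "prob {\<omega>\<in>space M. norm (\<Sum>i=k..<n. X i \<omega>) > a} \<le> c" if "k \<le> n" for k
 proof -
  have iid: "iid M borel (\<lambda>i. X (k + i))" by (rule iid_reindex[OF X]) (auto simp: inj_def)
  have V': "expectation (\<lambda>\<omega>. (norm (X (k + 0) \<omega>))\<^sup>2) = V"
   unfolding V_def by (rule iid_integral[OF X, of "\<lambda>x. (norm x)\<^sup>2"]) simp
  have sq': "integrable M (\<lambda>\<omega>. (norm (X (k + 0) \<omega>))\<^sup>2)"
   using iid_integrable[OF X, of "\<lambda>x. (norm x)\<^sup>2" "k + 0"] sq by simp
  have mean': "expectation (X (k + 0)) = 0"
   using iid_integral[OF X, of "\<lambda>x. x" "k + 0"] mean by simp
  have eq: "(\<Sum>i=k..<n. X i \<omega>) = (\<Sum>i<n - k. X (k + i) \<omega>)" for \<omega>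
   unfolding sum.atLeastLessThan_shift_0[of _ k n] lessThan_atLeast0 by (simp add: comp_def)
  note b = C(2)[OF iid sq' mean', of "n - k"]
  have "prob {\<omega>\<in>space M. norm (\<Sum>i=k..<n. X i \<omega>) > a} \<le> expectation (\<lambda>\<omega>. (norm (\<Sum>i<n - k. X (k + i) \<omega>))\<^sup>2) / a\<^sup>2"
   unfolding eq by (rule markov_square) (use b a in auto)
  also have "\<dots> \<le> C * (real (n - k) * V) / a\<^sup>2" using b unfolding V' by (intro divide_right_mono) auto
  also have "\<dots> \<le> c" unfolding c_def using C(1) V
   by (intro divide_right_mono mult_left_mono mult_right_mono) auto
  finally show ?thesis .
 qed
 show ?thesis
 proof (cases "c \<le> 1 / 2")
  case True
  have "prob {\<omega>\<in>space M. \<exists>k\<le>n. norm (\<Sum>i<k. X i \<omega>) > 2 * a} \<le> 2 * prob {\<omega>\<in>space M. norm (\<Sum>i<n. X i \<omega>) > a}"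
   by (rule ottaviani[OF iid_indep[OF X]]) (use tail True in force)
  also have "\<dots> \<le> 2 * c" using tail[of 0] by (simp add: lessThan_atLeast0)
  finally show ?thesis by (simp add: c_def V_def)
 next
  case False
  then have "1 \<le> 2 * c" by simp
  with prob_le_1 have "prob {\<omega>\<in>space M. \<exists>k\<le>n. norm (\<Sum>i<k. X i \<omega>) > 2 * a} \<le> 2 * c" by (rule order_trans)
  then show ?thesis by (simp only: c_def V_def)
 qed
qed

end

text \<open>A bounded continuous function is the increasing limit of its Lipschitz minorants
 \<open>x \<mapsto> inf\<^sub>y (f y + k d(x, y))\<close>.\<close>

definition lip_minorant :: "('u::metric_space \<Rightarrow> real) \<Rightarrow> nat \<Rightarrow> 'u \<Rightarrow> real" where
 "lip_minorant f k x = (INF y. f y + real k * dist x y)"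

lemma lip_minorant:
 fixes f :: "'u::metric_space \<Rightarrow> real"
 assumes f: "continuous_on UNIV f" and B: "\<And>x. \<bar>f x\<bar> \<le> B"
 shows "\<bar>lip_minorant f k a - lip_minorant f k b\<bar> \<le> real k * dist a b"
  "\<bar>lip_minorant f k x\<bar> \<le> B" "lip_minorant f k x \<le> f x" "(\<lambda>k. lip_minorant f k x) \<longlonglongrightarrow> f x"
proof -
 have low: "- B \<le> f y + real k * dist x y" for x y k
  proof -
  have "- B \<le> f y" using B[of y] by linarith
  moreover have "0 \<le> real k * dist x y" by simp
  ultimately show ?thesis by linarith
 qed
 have bdd: "bdd_below (range (\<lambda>y. f y + real k * dist x y))" for x k
  using low by (intro bdd_belowI[of _ "- B"]) auto
 have le: "lip_minorant f k x \<le> f y + real k * dist x y" for x y k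
  unfolding lip_minorant_def by (rule cINF_lower[OF bdd]) simp
 have ge: "c \<le> lip_minorant f k x" if "\<And>y. c \<le> f y + real k * dist x y" for c x k
  unfolding lip_minorant_def by (rule cINF_greatest) (use that in auto)
 show 3: "lip_minorant f k x \<le> f x" for x k using le[of k x x] by simp
 show "\<bar>lip_minorant f k x\<bar> \<le> B" using ge[of "- B" k x] low 3[of k x] B[of x] by (simp add: abs_le_iff)
 have one: "lip_minorant f k a - real k * dist a b \<le> lip_minorant f k b" for a b
 proof (rule ge)
  fix y
  have "real k * dist a y \<le> real k * (dist a b + dist b y)" by (intro mult_left_mono dist_triangle) simp
  then show "lip_minorant f k a - real k * dist a b \<le> f y + real k * dist b y"
   using le[of k a y] by (simp add: distrib_left)
 qed
 show "\<bar>lip_minorant f k a - lip_minorant f k b\<bar> \<le> real k * dist a b"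
  using one[of a b] one[of b a] by (simp add: abs_le_iff dist_commute)
 show "(\<lambda>k. lip_minorant f k x) \<longlonglongrightarrow> f x"
 proof (rule metric_LIMSEQ_I)
  fix e :: real assume e: "e > 0"
  have "isCont f x" using f by (simp add: continuous_on_eq_continuous_at)
  then obtain d where d: "d > 0" "\<And>y. dist y x < d \<Longrightarrow> dist (f y) (f x) < e / 2"
   using e unfolding continuous_at_eps_delta by (metis half_gt_zero)
  \<comment> \<open>Beyond distance \<open>d\<close> the penalty \<open>k * d\<close> is at least
    the largest possible oscillation \<open>2 * B\<close>.\<close>
  obtain K :: nat where K: "2 * B / d < real K" using reals_Archimedean2 by blast
  have "dist (lip_minorant f k x) (f x) < e" if k: "k \<ge> K" for k
  proof -
   have "f x - e / 2 \<le> lip_minorant f k x"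
   proof (rule ge)
    fix y
    show "f x - e / 2 \<le> f y + real k * dist x y"
    proof (cases "dist y x < d")
     case True
     then have "f x - e / 2 \<le> f y" using d(2)[OF True] unfolding dist_real_def by linarith
     moreover have "0 \<le> real k * dist x y" by simp
     ultimately show ?thesis by linarith
    next
     case False
     have "2 * B \<le> real K * d" using K d(1) by (simp add: divide_less_eq less_imp_le)
     also have "\<dots> \<le> real k * dist x y" using k False d(1) by (intro mult_mono) (auto simp: dist_commute)
     finally show ?thesis using B[of x] B[of y] e by (simp add: abs_le_iff)
    qed
   qed
   then show ?thesis using 3[of k x] e by (simp add: dist_real_def)
  qed
  then show "\<exists>no. \<forall>k\<ge>no. dist (lip_minorant f k x) (f x) < e" by blast
 qed
qed

text \<open>The Lipschitz minorants give an asymptotic lower bound for the expectation of any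
  bounded continuous \<open>f\<close>; the same bound for \<open>- f\<close> is the upper
  one.\<close>

lemma converges_in_distr_lipschitz:
 fixes X :: "real \<Rightarrow> 'a \<Rightarrow> 'u::{real_normed_vector, second_countable_topology}"
 assumes M: "prob_space M" and N: "prob_space N" and X[measurable]: "\<And>t. X t \<in> borel_measurable M"
  and Z[measurable]: "Z \<in> borel_measurable N"
  and lim: "\<And>f \<Lambda> B. (\<And>a b. \<bar>f a - f b\<bar> \<le> \<Lambda> * norm (a - b)) \<Longrightarrow> (\<And>a. \<bar>f a\<bar> \<le> B) \<Longrightarrow>
   ((\<lambda>t. LINT \<omega>|M. f (X t \<omega>)) \<longlongrightarrow> (LINT x|N. f (Z x))) at_top"
 shows "converges_in_distr M X N Z"
proof -
 interpret M: prob_space M by fact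
 interpret N: prob_space N by fact
 have lower: "\<forall>\<^sub>F t in at_top. (LINT x|N. f (Z x)) - e < (LINT \<omega>|M. f (X t \<omega>))"
  if f: "continuous_on UNIV f" "\<And>x. \<bar>f x\<bar> \<le> B" and e: "e > 0" for f :: "'u \<Rightarrow> real" and B e
 proof -
  have fm[measurable]: "f \<in> borel_measurable borel" using f(1) by (rule borel_measurable_continuous_onI)
  note l = lip_minorant[OF f]
  have lc: "continuous_on UNIV (lip_minorant f k)" for k
   by (rule lipschitz_on_continuous_on[of "real k"], rule lipschitz_onI) (use l(1) in \<open>auto simp: dist_real_def\<close>)
  have lm[measurable]: "lip_minorant f k \<in> borel_measurable borel" for k using lc by (rule borel_measurable_continuous_onI)
  have "(\<lambda>k. LINT x|N. lip_minorant f k (Z x)) \<longlonglongrightarrow> (LINT x|N. f (Z x))"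
   by (rule integral_dominated_convergence[where w="\<lambda>_. B"]) (use l in auto)
  then have "\<forall>\<^sub>F k in sequentially. (LINT x|N. f (Z x)) - e / 2 < (LINT x|N. lip_minorant f k (Z x))"
   using e by (intro order_tendstoD(1)) auto
  then obtain k where k: "(LINT x|N. f (Z x)) - e / 2 < (LINT x|N. lip_minorant f k (Z x))"
   by (auto simp: eventually_sequentially)
  have "((\<lambda>t. LINT \<omega>|M. lip_minorant f k (X t \<omega>)) \<longlongrightarrow> (LINT x|N. lip_minorant f k (Z x))) at_top"
   by (rule lim[of _ "real k" B]) (use l in \<open>auto simp: dist_norm\<close>)
  then have "\<forall>\<^sub>F t in at_top. (LINT x|N. lip_minorant f k (Z x)) - e / 2 < (LINT \<omega>|M. lip_minorant f k (X t \<omega>))"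
   using e by (intro order_tendstoD(1)) auto
  then show ?thesis
  proof eventually_elim
   case (elim t)
   have "(LINT \<omega>|M. lip_minorant f k (X t \<omega>)) \<le> (LINT \<omega>|M. f (X t \<omega>))"
    by (intro integral_mono M.integrable_const_bound[where B=B]) (use l f in auto)
   with elim k show ?case by linarith
  qed
 qed
 show ?thesis
  unfolding converges_in_distr_def
 proof (intro allI impI)
  fix f :: "'u \<Rightarrow> real" assume f: "continuous_on UNIV f" and "bounded (range f)"
  then obtain B where B: "\<And>x. \<bar>f x\<bar> \<le> B" by (auto simp: bounded_iff)
  have nf: "continuous_on UNIV (\<lambda>x. - f x)" using f by (intro continuous_intros)
  show "((\<lambda>t. LINT \<omega>|M. f (X t \<omega>)) \<longlongrightarrow> (LINT x|N. f (Z x))) at_top"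
  proof (rule tendstoI)
   fix e :: real assume e: "e > 0"
   show "\<forall>\<^sub>F t in at_top. dist (LINT \<omega>|M. f (X t \<omega>)) (LINT x|N. f (Z x)) < e"
   proof -
    have nB: "\<bar>- f x\<bar> \<le> B" for x using B[of x] by simp
    show ?thesis
     using lower[OF f B e] lower[OF nf nB e]
    proof eventually_elim
     case (elim t)
     then show ?case unfolding dist_real_def Bochner_Integration.integral_minus by linarith
    qed
   qed
  qed
 qed
qed

text \<open>The deterministic part of the renewal argument: \<open>T n\<close> are the renewal epochs after time
 \<open>a\<close>, and \<open>N t\<close> counts the completed cycles.\<close>

lemma renewal_count:
 fixes T :: "nat \<Rightarrow> real" and a :: real
 assumes T0: "T 0 = 0" and T: "(\<lambda>n. T n / real n) \<longlonglongrightarrow> \<mu>" and \<mu>: "\<mu> > 0"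
 defines "N \<equiv> \<lambda>t. (LEAST n. t < a + T (Suc n))"
 shows "a \<le> t \<Longrightarrow> a + T (N t) \<le> t" "t < a + T (Suc (N t))"
  "filterlim N at_top at_top" "((\<lambda>t. real (N t) / t) \<longlongrightarrow> 1 / \<mu>) at_top"
proof -
 have T_inf: "filterlim T at_top sequentially"
 proof -
  have "filterlim (\<lambda>n. T n / real n * real n) at_top sequentially"
   by (rule filterlim_tendsto_pos_mult_at_top[OF T \<mu> filterlim_real_sequentially])
  moreover have ev: "\<forall>\<^sub>F n in sequentially. T n / real n * real n = T n"
   using eventually_gt_at_top[of 0] by eventually_elim simp
  ultimately show ?thesis using filterlim_cong[OF refl refl ev] by blast
 qed
 have ex: "\<exists>n. t < a + T (Suc n)" for t
 proof -
  have "\<forall>\<^sub>F n in sequentially. t - a < T n" using T_inf unfolding filterlim_at_top_dense by blast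
  then obtain n0 where "\<And>n. n \<ge> n0 \<Longrightarrow> t - a < T n" by (auto simp: eventually_sequentially)
  from this[of "Suc n0"] show ?thesis by (intro exI[of _ n0]) simp
 qed
 show up: "t < a + T (Suc (N t))" for t unfolding N_def using ex by (rule LeastI_ex)
 have min: "a + T (Suc m) \<le> t" if "m < N t" for m t
  using not_less_Least[OF that[unfolded N_def]] by simp
 show low: "a + T (N t) \<le> t" if "a \<le> t" for t
 proof (cases "N t")
  case 0
  then show ?thesis using that T0 by simp
 next
  case (Suc m)
  then show ?thesis using min[of m t] by simp
 qed
 show N_inf: "filterlim N at_top at_top"
  unfolding filterlim_at_top
 proof
  fix k
  show "\<forall>\<^sub>F t in at_top. k \<le> N t"
   using eventually_ge_at_top[of "Max ((\<lambda>i. a + T (Suc i)) ` {..k})"]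
  proof eventually_elim
   case (elim t)
   show ?case
   proof (rule ccontr)
    assume "\<not> k \<le> N t"
    then have "a + T (Suc (N t)) \<le> Max ((\<lambda>i. a + T (Suc i)) ` {..k})" by (intro Max_ge) auto
    with elim up[of t] show False by linarith
   qed
  qed
 qed
 have N_real: "filterlim (\<lambda>t. real (N t)) at_top at_top"
  by (rule filterlim_compose[OF filterlim_real_sequentially N_inf])
 have a0: "((\<lambda>t. a / real (N t)) \<longlongrightarrow> 0) at_top"
  by (rule tendsto_divide_0[OF tendsto_const filterlim_at_top_imp_at_infinity[OF N_real]])
 have l1: "((\<lambda>t. a / real (N t) + T (N t) / real (N t)) \<longlongrightarrow> 0 + \<mu>) at_top"
  by (intro tendsto_add a0 filterlim_compose[OF T N_inf])
 have TS: "(\<lambda>n. T (Suc n) / real n) \<longlonglongrightarrow> \<mu> * 1"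
 proof -
  have "(\<lambda>n. T (Suc n) / real (Suc n) * (real (Suc n) / real n)) \<longlonglongrightarrow> \<mu> * 1"
   by (intro tendsto_mult LIMSEQ_Suc[OF T] LIMSEQ_Suc_n_over_n)
  then show ?thesis by (simp del: of_nat_Suc)
 qed
 have l2: "((\<lambda>t. a / real (N t) + T (Suc (N t)) / real (N t)) \<longlongrightarrow> 0 + \<mu> * 1) at_top"
  by (intro tendsto_add a0 filterlim_compose[OF TS N_inf])
 have ev: "\<forall>\<^sub>F t in at_top. a \<le> t \<and> 0 < N t"
 proof -
  have "\<forall>\<^sub>F t in at_top. 1 \<le> N t" using N_inf unfolding filterlim_at_top by blast
  with eventually_ge_at_top[of a] show ?thesis by eventually_elim simp
 qed
 have "((\<lambda>t. t / real (N t)) \<longlongrightarrow> \<mu>) at_top"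
 proof (rule tendsto_sandwich[OF _ _ l1[simplified add_0] l2[simplified add_0 mult_1_right]])
  show "\<forall>\<^sub>F t in at_top. a / real (N t) + T (N t) / real (N t) \<le> t / real (N t)"
   using ev by eventually_elim (simp add: add_divide_distrib[symmetric] divide_right_mono low)
  show "\<forall>\<^sub>F t in at_top. t / real (N t) \<le> a / real (N t) + T (Suc (N t)) / real (N t)"
   using ev by eventually_elim (simp add: add_divide_distrib[symmetric] divide_right_mono less_imp_le up)
 qed
 then have "((\<lambda>t. inverse (t / real (N t))) \<longlongrightarrow> inverse \<mu>) at_top" using \<mu> by (intro tendsto_inverse) auto
 then show "((\<lambda>t. real (N t) / t) \<longlongrightarrow> 1 / \<mu>) at_top" by (simp add: inverse_eq_divide)
qed

text \<open>The pathwise part: \<open>N t\<close> grows linearly in \<open>t\<close>, hence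
  \<open>B (N t)\<close> is negligible against \<open>sqrt t\<close>, and so is the fixed reward
  \<open>J\<close>. Replacing \<open>I t\<close> by \<open>S (N t)\<close> is thus harmless already
  at the scale of the central limit theorem, and a further division by \<open>sqrt t\<close> gives
  the law of large numbers.\<close>

lemma renewal_deterministic:
 fixes T B :: "nat \<Rightarrow> real" and S :: "nat \<Rightarrow> 'w::real_normed_vector" and I :: "real \<Rightarrow> 'w" and a :: real
 assumes T0: "T 0 = 0" and T: "(\<lambda>n. T n / real n) \<longlonglongrightarrow> \<mu>" and \<mu>: "\<mu> > 0"
  and B: "(\<lambda>n. (B n)\<^sup>2 / real n) \<longlonglongrightarrow> 0" and S: "(\<lambda>n. (1 / real n) *\<^sub>R S n) \<longlonglongrightarrow> 0"
  and close: "\<And>n t. a + T n \<le> t \<Longrightarrow> t \<le> a + T (Suc n) \<Longrightarrow> norm (I t - J - S n) \<le> B n"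
 defines "N \<equiv> \<lambda>t. (LEAST n. t < a + T (Suc n))"
 shows "((\<lambda>t. norm (I t - S (N t)) / sqrt t) \<longlongrightarrow> 0) at_top" "((\<lambda>t. (1 / t) *\<^sub>R I t) \<longlongrightarrow> 0) at_top"
proof -
 have rc: "a \<le> t \<Longrightarrow> a + T (N t) \<le> t" "t < a + T (Suc (N t))"
  "filterlim N at_top at_top" "((\<lambda>t. real (N t) / t) \<longlongrightarrow> 1 / \<mu>) at_top" for t
 proof -
  show "a \<le> t \<Longrightarrow> a + T (N t) \<le> t" unfolding N_def by (rule renewal_count(1)[OF T0 T \<mu>])
  show "t < a + T (Suc (N t))" unfolding N_def by (rule renewal_count(2)[OF T0 T \<mu>])
  show "filterlim N at_top at_top" unfolding N_def by (rule renewal_count(3)[OF T0 T \<mu>])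
  show "((\<lambda>t. real (N t) / t) \<longlongrightarrow> 1 / \<mu>) at_top" unfolding N_def by (rule renewal_count(4)[OF T0 T \<mu>])
 qed
 note N_inf = rc(3)
 have Bn: "(\<lambda>n. \<bar>B n\<bar> / sqrt (real n)) \<longlonglongrightarrow> 0"
  using tendsto_real_sqrt[OF B] by (simp add: real_sqrt_divide)
 have sq: "((\<lambda>t. sqrt (real (N t)) / sqrt t) \<longlongrightarrow> sqrt (1 / \<mu>)) at_top"
  using tendsto_real_sqrt[OF rc(4)] by (simp add: real_sqrt_divide)
 have sqrt_inf: "filterlim sqrt at_top at_top" by (rule sqrt_at_top)
 have "((\<lambda>t. \<bar>B (N t)\<bar> / sqrt (real (N t)) * (sqrt (real (N t)) / sqrt t) + norm J / sqrt t) \<longlongrightarrow> 0 * sqrt (1 / \<mu>) + 0) at_top"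
  by (intro tendsto_add tendsto_mult filterlim_compose[OF Bn N_inf] sq
     tendsto_divide_0[OF tendsto_const filterlim_at_top_imp_at_infinity[OF sqrt_inf]])
 then have lim: "((\<lambda>t. \<bar>B (N t)\<bar> / sqrt (real (N t)) * (sqrt (real (N t)) / sqrt t) + norm J / sqrt t) \<longlongrightarrow> 0) at_top"
  by simp
 have ev: "\<forall>\<^sub>F t in at_top. a \<le> t \<and> 0 < t \<and> 0 < N t"
 proof -
  have "\<forall>\<^sub>F t in at_top. 1 \<le> N t" using N_inf unfolding filterlim_at_top by blast
  with eventually_ge_at_top[of a] eventually_gt_at_top[of 0] show ?thesis by eventually_elim simp
 qed
 show A: "((\<lambda>t. norm (I t - S (N t)) / sqrt t) \<longlongrightarrow> 0) at_top"
 proof (rule tendsto_sandwich[OF _ _ tendsto_const lim])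
  show "\<forall>\<^sub>F t in at_top. 0 \<le> norm (I t - S (N t)) / sqrt t"
   using ev by eventually_elim simp
  show "\<forall>\<^sub>F t in at_top. norm (I t - S (N t)) / sqrt t
    \<le> \<bar>B (N t)\<bar> / sqrt (real (N t)) * (sqrt (real (N t)) / sqrt t) + norm J / sqrt t"
   using ev
  proof eventually_elim
   case (elim t)
   have "norm (I t - J - S (N t)) \<le> B (N t)"
    using elim rc(1)[of t] rc(2)[of t] by (intro close) auto
   then have "norm (I t - S (N t)) \<le> \<bar>B (N t)\<bar> + norm J"
    using norm_triangle_ineq[of "I t - J - S (N t)" J] by (simp add: algebra_simps)
   then have "norm (I t - S (N t)) / sqrt t \<le> (\<bar>B (N t)\<bar> + norm J) / sqrt t"
    using elim by (intro divide_right_mono) auto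
   then show ?case using elim by (simp add: add_divide_distrib)
  qed
 qed
 have "((\<lambda>t. norm (I t - S (N t)) / sqrt t * (1 / sqrt t) + norm ((1 / real (N t)) *\<^sub>R S (N t)) * (real (N t) / t)) \<longlongrightarrow> 0 * 0 + norm (0::'w) * (1 / \<mu>)) at_top"
  by (intro tendsto_add tendsto_mult A tendsto_norm filterlim_compose[OF S N_inf] rc(4)
     tendsto_divide_0[OF tendsto_const filterlim_at_top_imp_at_infinity[OF sqrt_inf]])
 then have lim2: "((\<lambda>t. norm (I t - S (N t)) / sqrt t * (1 / sqrt t) + norm ((1 / real (N t)) *\<^sub>R S (N t)) * (real (N t) / t)) \<longlongrightarrow> 0) at_top"
  by simp
 show "((\<lambda>t. (1 / t) *\<^sub>R I t) \<longlongrightarrow> 0) at_top"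
 proof (rule Lim_null_comparison[OF _ lim2])
  show "\<forall>\<^sub>F t in at_top. norm ((1 / t) *\<^sub>R I t) \<le> norm (I t - S (N t)) / sqrt t * (1 / sqrt t) + norm ((1 / real (N t)) *\<^sub>R S (N t)) * (real (N t) / t)"
   using ev
  proof eventually_elim
   case (elim t)
   have "norm ((1 / t) *\<^sub>R I t) = norm (I t) / t" using elim by simp
   also have "\<dots> \<le> (norm (I t - S (N t)) + norm (S (N t))) / t"
    using elim norm_triangle_ineq[of "I t - S (N t)" "S (N t)"] by (intro divide_right_mono) auto
   also have "\<dots> = norm (I t - S (N t)) / sqrt t * (1 / sqrt t) + norm ((1 / real (N t)) *\<^sub>R S (N t)) * (real (N t) / t)"
    using elim by (simp add: add_divide_distrib)
   finally show ?case .
  qed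
 qed
qed

text \<open>Convergence in probability is expressed below by the expectation of
  \<open>min W 1\<close>, the form in which it combines with bounded Lipschitz test
  functions.\<close>

lemma (in prob_space) expectation_min_le:
 assumes [measurable]: "W \<in> borel_measurable M" and nn: "\<And>\<omega>. W \<omega> \<ge> 0" and e: "e \<ge> 0"
 shows "expectation (\<lambda>\<omega>. min (W \<omega>) 1) \<le> e + prob {\<omega>\<in>space M. W \<omega> > e}"
proof -
 have "expectation (\<lambda>\<omega>. min (W \<omega>) 1) \<le> expectation (\<lambda>\<omega>. e + indicator {\<omega>\<in>space M. W \<omega> > e} \<omega>)"
 proof (rule integral_mono)
  show "integrable M (\<lambda>\<omega>. min (W \<omega>) 1)" by (rule integrable_const_bound[where B=1]) (use nn in auto)
  show "min (W \<omega>) 1 \<le> e + indicator {\<omega>\<in>space M. W \<omega> > e} \<omega>" if "\<omega> \<in> space M" for \<omega>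
   using that e nn[of \<omega>] by (auto simp: indicator_def min_def)
  show "integrable M (\<lambda>\<omega>. e + indicator {\<omega>\<in>space M. W \<omega> > e} \<omega> :: real)"
   by (rule integrable_const_bound[where B="e + 1"]) (use e in \<open>auto simp: indicator_def\<close>)
 qed
 also have "\<dots> = expectation (\<lambda>\<omega>. e) + expectation (indicator {\<omega>\<in>space M. W \<omega> > e})"
  by (rule Bochner_Integration.integral_add) (auto intro!: integrable_const_bound[where B=1] simp: indicator_def)
 also have "\<dots> = e + prob {\<omega>\<in>space M. W \<omega> > e}" by (simp add: prob_space)
 finally show ?thesis .
qed

text \<open>Anscombe's argument: the random number of cycles may be replaced by its deterministic
 equivalent because the maximal inequality controls the sums over a short window.\<close>

lemma (in prob_space) anscombe:
 fixes Y :: "nat \<Rightarrow> 'a \<Rightarrow> 'w::{banach, second_countable_topology}"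
 assumes Y: "iid M borel Y" and Y_sq: "integrable M (\<lambda>\<omega>. (norm (Y 0 \<omega>))\<^sup>2)" and Y_mean: "expectation (Y 0) = 0"
  and type2: "type_2 M TYPE('w)"
  and N[measurable]: "\<And>n. N n \<in> measurable M (count_space UNIV)"
  and t: "filterlim t at_top sequentially"
  and Nt: "AE \<omega> in M. (\<lambda>n. real (N n \<omega>) / t n) \<longlonglongrightarrow> l" and mt: "(\<lambda>n. real (m n) / t n) \<longlonglongrightarrow> l"
 shows "(\<lambda>n. expectation (\<lambda>\<omega>. min (norm ((\<Sum>k<N n \<omega>. Y k \<omega>) - (\<Sum>k<m n. Y k \<omega>)) / sqrt \<bar>t n\<bar>) 1)) \<longlonglongrightarrow> 0"
proof -
 note Ym[measurable] = iid_measurable[OF Y]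
 obtain C where C: "C > 0"
  "\<And>(X :: nat \<Rightarrow> 'a \<Rightarrow> 'w) n. iid M borel X \<Longrightarrow> integrable M (\<lambda>\<omega>. (norm (X 0 \<omega>))\<^sup>2) \<Longrightarrow> expectation (X 0) = 0 \<Longrightarrow>
    integrable M (\<lambda>\<omega>. (norm (\<Sum>k<n. X k \<omega>))\<^sup>2) \<and>
    expectation (\<lambda>\<omega>. (norm (\<Sum>k<n. X k \<omega>))\<^sup>2) \<le> C * (real n * expectation (\<lambda>\<omega>. (norm (X 0 \<omega>))\<^sup>2))"
  using type_2_iid_bound[OF type2] by metis
 define V where "V = expectation (\<lambda>\<omega>. (norm (Y 0 \<omega>))\<^sup>2)"
 have V: "V \<ge> 0" by (simp add: V_def)
 define S where "S k \<omega> = (\<Sum>i<k. Y i \<omega>)" for k \<omega>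
 have Sm[measurable]: "S k \<in> borel_measurable M" for k unfolding S_def by measurable
 have SN[measurable]: "(\<lambda>\<omega>. S (N n \<omega>) \<omega>) \<in> borel_measurable M" for n
  by (rule measurable_compose_countable[OF Sm N])
 define W where "W n \<omega> = norm (S (N n \<omega>) \<omega> - S (m n) \<omega>) / sqrt \<bar>t n\<bar>" for n \<omega>
 have Wm[measurable]: "W n \<in> borel_measurable M" for n unfolding W_def by measurable
 have W0: "W n \<omega> \<ge> 0" for n \<omega> by (simp add: W_def)
 have t_pos: "\<forall>\<^sub>F n in sequentially. t n > c" for c using t unfolding filterlim_at_top_dense by blast
 have "(\<lambda>n. expectation (\<lambda>\<omega>. min (W n \<omega>) 1)) \<longlonglongrightarrow> 0"
 proof (rule metric_LIMSEQ_I)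
  fix r :: real assume r: "r > 0"
  define e where "e = r / 4"
  have e: "e > 0" using r by (simp add: e_def)
  \<comment> \<open>The number 64 is \<open>2 * 2 * 16\<close>: a 2 from the maximal inequality, a 2
    from the window length \<open>2 * d n\<close>, and 16 from squaring the threshold
    \<open>e * sqrt (t n) / 4\<close>.\<close>
  define D where "D = 64 * (C * V) / e\<^sup>2"
  have D: "D \<ge> 0" using C(1) V by (simp add: D_def)
  define \<delta> where "\<delta> = e / (2 * (D + 1))"
  have \<delta>: "\<delta> > 0" "D * (2 * \<delta>) \<le> e"
  proof -
   show "\<delta> > 0" using e D by (simp add: \<delta>_def)
   have "D * (2 * \<delta>) = e * (D / (D + 1))" using D by (simp add: \<delta>_def field_simps)
   also have "\<dots> \<le> e * 1" using e D by (intro mult_left_mono) auto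
   finally show "D * (2 * \<delta>) \<le> e" by simp
  qed
  define d where "d n = nat \<lceil>\<delta> * t n\<rceil>" for n
  define bad where "bad n = {\<omega>\<in>space M. \<bar>real (N n \<omega>) - real (m n)\<bar> > \<delta> * t n}" for n
  have badm[measurable]: "bad n \<in> events" for n unfolding bad_def by measurable
  have "(\<lambda>n. expectation (indicator (bad n) :: _ \<Rightarrow> real)) \<longlonglongrightarrow> expectation (\<lambda>_. 0)"
  proof (rule integral_dominated_convergence[where w="\<lambda>_. 1"])
   show "AE \<omega> in M. (\<lambda>n. indicator (bad n) \<omega> :: real) \<longlonglongrightarrow> 0"
    using Nt
   proof eventually_elim
    case (elim \<omega>)
    have "(\<lambda>n. real (N n \<omega>) / t n - real (m n) / t n) \<longlonglongrightarrow> l - l" by (intro tendsto_diff elim mt)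
    then have "\<forall>\<^sub>F n in sequentially. dist (real (N n \<omega>) / t n - real (m n) / t n) (l - l) < \<delta>"
     using \<delta>(1) by (rule tendstoD)
    then have "\<forall>\<^sub>F n in sequentially. indicator (bad n) \<omega> = (0 :: real)"
     using t_pos[of 0]
    proof eventually_elim
     case (elim n)
     then have "\<bar>real (N n \<omega>) - real (m n)\<bar> / t n < \<delta>"
      by (simp add: dist_real_def diff_divide_distrib[symmetric])
     then have "\<bar>real (N n \<omega>) - real (m n)\<bar> < \<delta> * t n" using elim(2) by (simp add: divide_less_eq)
     then show ?case by (simp add: bad_def indicator_def)
    qed
    then show ?case by (rule tendsto_eventually)
   qed
  qed auto
  then have "(\<lambda>n. prob (bad n)) \<longlonglongrightarrow> 0" by simp
  then have ev_bad: "\<forall>\<^sub>F n in sequentially. prob (bad n) < e" using e by (rule order_tendstoD(2))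
  have "\<forall>\<^sub>F n in sequentially. dist (expectation (\<lambda>\<omega>. min (W n \<omega>) 1)) 0 < r"
   using ev_bad t_pos[of 0] t_pos[of "1 / \<delta>"]
  proof eventually_elim
   case (elim n)
   \<comment> \<open>Left end of a window of length \<open>2 * d n\<close> around
     \<open>m n\<close>; subtraction of natural numbers clips it at 0. Both sums are compared with
     the sum up to \<open>a\<close>.\<close>
   define a where "a = m n - d n"
   define w where "w = {\<omega>\<in>space M. \<exists>k\<le>2 * d n. norm (\<Sum>i<k. Y (a + i) \<omega>) > 2 * (e * sqrt (t n) / 4)}"
   have wm[measurable]: "w \<in> events" unfolding w_def by measurable
   have iid: "iid M borel (\<lambda>i. Y (a + i))" by (rule iid_reindex[OF Y]) (auto simp: inj_def)
   have V': "expectation (\<lambda>\<omega>. (norm (Y (a + 0) \<omega>))\<^sup>2) = V"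
    unfolding V_def by (rule iid_integral[OF Y, of "\<lambda>x. (norm x)\<^sup>2"]) simp
   have sq': "integrable M (\<lambda>\<omega>. (norm (Y (a + 0) \<omega>))\<^sup>2)"
    using iid_integrable[OF Y, of "\<lambda>x. (norm x)\<^sup>2" "a + 0"] Y_sq by simp
   have mean': "expectation (Y (a + 0)) = 0"
    using iid_integral[OF Y, of "\<lambda>x. x" "a + 0"] Y_mean by simp
   have ea: "e * sqrt (t n) / 4 > 0" using e elim by simp
   have sub: "{\<omega>\<in>space M. W n \<omega> > e} \<subseteq> bad n \<union> w"
   proof
    fix \<omega> assume "\<omega> \<in> {\<omega>\<in>space M. W n \<omega> > e}"
    then have \<omega>: "\<omega> \<in> space M" "W n \<omega> > e" by auto
    show "\<omega> \<in> bad n \<union> w"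
    proof (rule ccontr)
     assume no: "\<omega> \<notin> bad n \<union> w"
     then have "\<bar>real (N n \<omega>) - real (m n)\<bar> \<le> \<delta> * t n" using \<omega> by (simp add: bad_def)
     also have "\<dots> \<le> real (d n)" unfolding d_def using \<delta>(1) elim(2) by (simp add: of_nat_ceiling)
     finally have "\<bar>int (N n \<omega>) - int (m n)\<bar> \<le> int (d n)" by linarith
     then have rng: "a \<le> N n \<omega>" "N n \<omega> - a \<le> 2 * d n" "a \<le> m n" "m n - a \<le> 2 * d n" unfolding a_def by auto
     have small: "norm (S k \<omega> - S a \<omega>) \<le> e * sqrt (t n) / 2" if "a \<le> k" "k - a \<le> 2 * d n" for k
     proof -
      have "S k \<omega> - S a \<omega> = (\<Sum>i=a..<k. Y i \<omega>)"
       unfolding S_def lessThan_atLeast0 using that(1) by (simp add: sum_diff_nat_ivl)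
      also have "\<dots> = (\<Sum>i<k - a. Y (a + i) \<omega>)"
       unfolding sum.atLeastLessThan_shift_0[of _ a k] lessThan_atLeast0 by (simp add: comp_def)
      finally have "S k \<omega> - S a \<omega> = (\<Sum>i<k - a. Y (a + i) \<omega>)" .
      then show ?thesis using no \<omega>(1) that(2) unfolding w_def by (auto simp: not_less)
     qed
     have "norm (S (N n \<omega>) \<omega> - S (m n) \<omega>) \<le> norm (S (N n \<omega>) \<omega> - S a \<omega>) + norm (S (m n) \<omega> - S a \<omega>)"
      using norm_triangle_ineq4[of "S (N n \<omega>) \<omega> - S a \<omega>" "S (m n) \<omega> - S a \<omega>"] by simp
     also have "\<dots> \<le> e * sqrt (t n)" using small[OF rng(1,2)] small[OF rng(3,4)] by simp
     finally have "W n \<omega> \<le> e" unfolding W_def using elim(2) by (simp add: divide_le_eq)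
     with \<omega>(2) show False by simp
    qed
   qed
   have "prob w \<le> 2 * (C * (real (2 * d n) * V) / (e * sqrt (t n) / 4)\<^sup>2)"
    unfolding w_def using maximal_inequality[OF iid sq' mean' C ea, of "2 * d n"] unfolding V' .
   also have "\<dots> = D * (real (d n) / t n)"
    using elim(2) e by (simp add: D_def power_mult_distrib power_divide field_simps)
   also have "\<dots> \<le> D * (2 * \<delta>)"
   proof (rule mult_left_mono[OF _ D])
    have "real (d n) \<le> \<delta> * t n + 1" unfolding d_def using \<delta>(1) elim(2) by (simp add: of_nat_nat)
    also have "\<dots> \<le> 2 * \<delta> * t n" using elim(3) \<delta>(1) by (simp add: divide_less_eq mult.commute)
    finally show "real (d n) / t n \<le> 2 * \<delta>" using elim(2) by (simp add: divide_le_eq)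
   qed
   also have "\<dots> \<le> e" by (rule \<delta>(2))
   finally have pw: "prob w \<le> e" .
   have "expectation (\<lambda>\<omega>. min (W n \<omega>) 1) \<le> e + prob {\<omega>\<in>space M. W n \<omega> > e}"
    by (rule expectation_min_le) (use W0 e in auto)
   also have "prob {\<omega>\<in>space M. W n \<omega> > e} \<le> prob (bad n \<union> w)"
    by (rule finite_measure_mono[OF sub]) measurable
   also have "\<dots> \<le> prob (bad n) + prob w" by (rule measure_Un_le[OF badm wm])
   finally have "expectation (\<lambda>\<omega>. min (W n \<omega>) 1) < r" using pw elim(1) r unfolding e_def by linarith
   moreover have "0 \<le> expectation (\<lambda>\<omega>. min (W n \<omega>) 1)" by (intro integral_nonneg_AE) (use W0 in auto)
   ultimately show ?case by (simp add: dist_real_def)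
  qed
  then show "\<exists>no. \<forall>n\<ge>no. dist (expectation (\<lambda>\<omega>. min (W n \<omega>) 1)) 0 < r"
   by (simp add: eventually_sequentially)
 qed
 then show ?thesis by (simp add: W_def S_def)
qed

text \<open>The Lipschitz bound serves where \<open>D\<close> is at most 1, and boundedness of
  \<open>f\<close> serves where it exceeds 1.\<close>

lemma (in prob_space) lipschitz_expectation_close:
 fixes f :: "'w::{banach, second_countable_topology} \<Rightarrow> real"
 assumes [measurable]: "f \<in> borel_measurable borel" "X \<in> borel_measurable M" "X' \<in> borel_measurable M" "D \<in> borel_measurable M"
  and f: "\<And>a b. \<bar>f a - f b\<bar> \<le> \<Lambda> * norm (a - b)" "\<And>a. \<bar>f a\<bar> \<le> B" and \<Lambda>: "\<Lambda> \<ge> 0"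
  and D: "\<And>\<omega>. norm (X \<omega> - X' \<omega>) \<le> D \<omega>"
 shows "\<bar>expectation (\<lambda>\<omega>. f (X \<omega>)) - expectation (\<lambda>\<omega>. f (X' \<omega>))\<bar> \<le> (\<Lambda> + 2 * B) * expectation (\<lambda>\<omega>. min (D \<omega>) 1)"
proof -
 have D0: "D \<omega> \<ge> 0" for \<omega> using D[of \<omega>] norm_ge_zero order_trans by blast
 have B0: "B \<ge> 0" using f(2)[of 0] by linarith
 have i: "integrable M (\<lambda>\<omega>. f (X \<omega>))" "integrable M (\<lambda>\<omega>. f (X' \<omega>))" "integrable M (\<lambda>\<omega>. min (D \<omega>) 1)"
 proof -
  show "integrable M (\<lambda>\<omega>. f (X \<omega>))" by (rule integrable_const_bound[where B=B]) (use f in auto)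
  show "integrable M (\<lambda>\<omega>. f (X' \<omega>))" by (rule integrable_const_bound[where B=B]) (use f in auto)
  show "integrable M (\<lambda>\<omega>. min (D \<omega>) 1)" by (rule integrable_const_bound[where B=1]) (use D0 in auto)
 qed
 have pw: "\<bar>f (X \<omega>) - f (X' \<omega>)\<bar> \<le> (\<Lambda> + 2 * B) * min (D \<omega>) 1" for \<omega>
 proof (cases "D \<omega> \<le> 1")
  case True
  have "\<bar>f (X \<omega>) - f (X' \<omega>)\<bar> \<le> \<Lambda> * D \<omega>"
   using f(1)[of "X \<omega>" "X' \<omega>"] mult_left_mono[OF D[of \<omega>] \<Lambda>] by linarith
  also have "\<dots> \<le> (\<Lambda> + 2 * B) * D \<omega>" using B0 D0[of \<omega>] by (intro mult_right_mono) auto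
  finally show ?thesis using True by simp
 next
  case False
  have "\<bar>f (X \<omega>) - f (X' \<omega>)\<bar> \<le> 2 * B" using f(2)[of "X \<omega>"] f(2)[of "X' \<omega>"] by linarith
  with False \<Lambda> show ?thesis by simp
 qed
 have "\<bar>expectation (\<lambda>\<omega>. f (X \<omega>)) - expectation (\<lambda>\<omega>. f (X' \<omega>))\<bar> = \<bar>expectation (\<lambda>\<omega>. f (X \<omega>) - f (X' \<omega>))\<bar>"
  using i by simp
 also have "\<dots> \<le> expectation (\<lambda>\<omega>. \<bar>f (X \<omega>) - f (X' \<omega>)\<bar>)" by (rule integral_abs_bound)
 also have "\<dots> \<le> expectation (\<lambda>\<omega>. (\<Lambda> + 2 * B) * min (D \<omega>) 1)" using i pw by (intro integral_mono) auto
 finally show ?thesis by simp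
qed

lemma measurable_Least_nat:
 assumes "\<And>n::nat. Measurable.pred M (P n)"
 shows "(\<lambda>\<omega>. LEAST n. P n \<omega>) \<in> measurable M (count_space UNIV)"
 using assms by (rule measurable_Least)

context prob_space
begin

text \<open>The durations are nonnegative almost surely, whereas \<open>slln_nonneg\<close> asks for
  this everywhere; the law is therefore applied to their absolute values, which changes nothing
  almost surely.\<close>

lemma renewal_reward_slln:
 fixes Y :: "nat \<Rightarrow> 'a \<Rightarrow> 'w::{banach, second_countable_topology}" and \<tau> B :: "nat \<Rightarrow> 'a \<Rightarrow> real"
 assumes Y: "iid M borel Y" and Y_sq: "integrable M (\<lambda>\<omega>. (norm (Y 0 \<omega>))\<^sup>2)" and Y_mean: "expectation (Y 0) = 0"
  and \<tau>: "iid M borel \<tau>" and \<tau>_sq: "integrable M (\<lambda>\<omega>. (\<tau> 0 \<omega>)\<^sup>2)" and \<tau>_nn: "AE \<omega> in M. \<forall>k. \<tau> k \<omega> \<ge> 0"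
  and B: "iid M borel B" and B_sq: "integrable M (\<lambda>\<omega>. (B 0 \<omega>)\<^sup>2)"
 shows "AE \<omega> in M. (\<lambda>n. (\<Sum>k<n. \<tau> k \<omega>) / real n) \<longlonglongrightarrow> expectation (\<tau> 0)
   \<and> (\<lambda>n. (B n \<omega>)\<^sup>2 / real n) \<longlonglongrightarrow> 0 \<and> (\<lambda>n. (1 / real n) *\<^sub>R (\<Sum>k<n. Y k \<omega>)) \<longlonglongrightarrow> 0"
proof -
 note [measurable] = iid_measurable[OF \<tau>]
 have "AE \<omega> in M. (\<lambda>n. (\<Sum>k<n. \<bar>\<tau> k \<omega>\<bar>) / real n) \<longlonglongrightarrow> expectation (\<lambda>\<omega>. \<bar>\<tau> 0 \<omega>\<bar>)"
  by (rule slln_nonneg) (use \<tau>_sq iid_compose[OF \<tau>, of abs borel] in auto)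
 moreover have "expectation (\<lambda>\<omega>. \<bar>\<tau> 0 \<omega>\<bar>) = expectation (\<tau> 0)"
  using \<tau>_nn by (intro integral_cong_AE) auto
 ultimately have 1: "AE \<omega> in M. (\<lambda>n. (\<Sum>k<n. \<bar>\<tau> k \<omega>\<bar>) / real n) \<longlonglongrightarrow> expectation (\<tau> 0)" by simp
 from 1 \<tau>_nn iid_square_over_n[OF B B_sq] slln_banach[OF Y Y_sq]
 show ?thesis by eventually_elim (use Y_mean in simp)
qed

text \<open>\<open>a\<close> and \<open>J\<close> are the duration and the reward of a delay before the first regular cycle;
 \<open>B n\<close> bounds the fluctuation inside a cycle.\<close>

lemma renewal_reward:
 fixes Y :: "nat \<Rightarrow> 'a \<Rightarrow> 'w::{banach, second_countable_topology}" and \<tau> B :: "nat \<Rightarrow> 'a \<Rightarrow> real"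
 assumes Y: "iid M borel Y" and Y_sq: "integrable M (\<lambda>\<omega>. (norm (Y 0 \<omega>))\<^sup>2)" and Y_mean: "expectation (Y 0) = 0"
  and \<tau>: "iid M borel \<tau>" and \<tau>_sq: "integrable M (\<lambda>\<omega>. (\<tau> 0 \<omega>)\<^sup>2)" and \<tau>_nn: "AE \<omega> in M. \<forall>k. \<tau> k \<omega> \<ge> 0"
  and \<mu>: "expectation (\<tau> 0) > 0"
  and B: "iid M borel B" and B_sq: "integrable M (\<lambda>\<omega>. (B 0 \<omega>)\<^sup>2)"
  and a[measurable]: "a \<in> borel_measurable M" and I[measurable]: "\<And>t. I t \<in> borel_measurable M"
  and close: "AE \<omega> in M. \<forall>n t. a \<omega> + (\<Sum>k<n. \<tau> k \<omega>) \<le> t \<longrightarrow> t \<le> a \<omega> + (\<Sum>k<Suc n. \<tau> k \<omega>) \<longrightarrow>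
    norm (I t \<omega> - J \<omega> - (\<Sum>k<n. Y k \<omega>)) \<le> B n \<omega>"
 shows "AE \<omega> in M. ((\<lambda>t. (1 / t) *\<^sub>R I t \<omega>) \<longlongrightarrow> 0) at_top"
  and "type_2 M TYPE('w) \<Longrightarrow> \<exists>Z. Z \<in> borel_measurable gauss_seq \<and> integrable gauss_seq (\<lambda>x. (norm (Z x))\<^sup>2) \<and>
    (LINT x|gauss_seq. Z x) = 0 \<and> gaussian gauss_seq Z \<and>
    (\<forall>\<psi>1 \<psi>2 :: 'w \<Rightarrow>\<^sub>L real. (LINT x|gauss_seq. blinfun_apply \<psi>1 (Z x) * blinfun_apply \<psi>2 (Z x)) =
     (LINT \<omega>|M. blinfun_apply \<psi>1 (sqrt (1 / expectation (\<tau> 0)) *\<^sub>R Y 0 \<omega>) * blinfun_apply \<psi>2 (sqrt (1 / expectation (\<tau> 0)) *\<^sub>R Y 0 \<omega>))) \<and>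
    converges_in_distr M (\<lambda>t \<omega>. (1 / sqrt t) *\<^sub>R I t \<omega>) gauss_seq Z"
proof -
 note [measurable] = iid_measurable[OF Y] iid_measurable[OF \<tau>]
 let ?\<mu> = "expectation (\<tau> 0)"
 let ?T = "\<lambda>\<omega> n. \<Sum>k<n. \<tau> k \<omega>"
 let ?S = "\<lambda>\<omega> n. \<Sum>k<n. Y k \<omega>"
 define N where "N t \<omega> = (LEAST n. t < a \<omega> + ?T \<omega> (Suc n))" for t \<omega>
 have Nm[measurable]: "N t \<in> measurable M (count_space UNIV)" for t
  unfolding N_def by (rule measurable_Least_nat) measurable
 note slln = renewal_reward_slln[OF Y Y_sq Y_mean \<tau> \<tau>_sq \<tau>_nn B B_sq]
 have det: "AE \<omega> in M. ((\<lambda>t. norm (I t \<omega> - ?S \<omega> (N t \<omega>)) / sqrt t) \<longlongrightarrow> 0) at_top \<and>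
   ((\<lambda>t. (1 / t) *\<^sub>R I t \<omega>) \<longlongrightarrow> 0) at_top \<and> ((\<lambda>t. real (N t \<omega>) / t) \<longlongrightarrow> 1 / ?\<mu>) at_top"
  using slln close
 proof eventually_elim
  case (elim \<omega>)
  have T0: "?T \<omega> 0 = 0" by simp
  have T: "(\<lambda>n. ?T \<omega> n / real n) \<longlonglongrightarrow> ?\<mu>" and B': "(\<lambda>n. (B n \<omega>)\<^sup>2 / real n) \<longlonglongrightarrow> 0"
   and S: "(\<lambda>n. (1 / real n) *\<^sub>R ?S \<omega> n) \<longlonglongrightarrow> 0" using elim by auto
  have cl: "norm (I t \<omega> - J \<omega> - ?S \<omega> n) \<le> B n \<omega>" if "a \<omega> + ?T \<omega> n \<le> t" "t \<le> a \<omega> + ?T \<omega> (Suc n)" for n t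
   using elim that by blast
  show ?case unfolding N_def
   by (intro conjI renewal_deterministic[where T="?T \<omega>" and S="?S \<omega>" and J="J \<omega>" and B="\<lambda>n. B n \<omega>", OF T0 T \<mu> B' S cl]
      renewal_count(4)[where T="?T \<omega>", OF T0 T \<mu>])
 qed
 then show "AE \<omega> in M. ((\<lambda>t. (1 / t) *\<^sub>R I t \<omega>) \<longlongrightarrow> 0) at_top" by eventually_elim simp
 assume type2: "type_2 M TYPE('w)"
 define c where "c = sqrt (1 / ?\<mu>)"
 have Y': "iid M borel (\<lambda>k \<omega>. c *\<^sub>R Y k \<omega>)" by (rule iid_compose[OF Y]) measurable
 have Y'_sq: "integrable M (\<lambda>\<omega>. (norm (c *\<^sub>R Y 0 \<omega>))\<^sup>2)" using Y_sq by (simp add: power_mult_distrib)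
 have Y'_mean: "expectation (\<lambda>\<omega>. c *\<^sub>R Y 0 \<omega>) = 0" using Y_mean by simp
 obtain C where C: "C > 0"
  "\<And>(X :: nat \<Rightarrow> 'a \<Rightarrow> 'w) n. iid M borel X \<Longrightarrow> integrable M (\<lambda>\<omega>. (norm (X 0 \<omega>))\<^sup>2) \<Longrightarrow> expectation (X 0) = 0 \<Longrightarrow>
    integrable M (\<lambda>\<omega>. (norm (\<Sum>k<n. X k \<omega>))\<^sup>2) \<and>
    expectation (\<lambda>\<omega>. (norm (\<Sum>k<n. X k \<omega>))\<^sup>2) \<le> C * (real n * expectation (\<lambda>\<omega>. (norm (X 0 \<omega>))\<^sup>2))"
  using type_2_iid_bound[OF type2] by metis
 define V where "V = expectation (\<lambda>\<omega>. (norm (Y 0 \<omega>))\<^sup>2)"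
 show "\<exists>Z. Z \<in> borel_measurable gauss_seq \<and> integrable gauss_seq (\<lambda>x. (norm (Z x))\<^sup>2) \<and>
    (LINT x|gauss_seq. Z x) = 0 \<and> gaussian gauss_seq Z \<and>
    (\<forall>\<psi>1 \<psi>2 :: 'w \<Rightarrow>\<^sub>L real. (LINT x|gauss_seq. blinfun_apply \<psi>1 (Z x) * blinfun_apply \<psi>2 (Z x)) =
     (LINT \<omega>|M. blinfun_apply \<psi>1 (sqrt (1 / ?\<mu>) *\<^sub>R Y 0 \<omega>) * blinfun_apply \<psi>2 (sqrt (1 / ?\<mu>) *\<^sub>R Y 0 \<omega>))) \<and>
    converges_in_distr M (\<lambda>t \<omega>. (1 / sqrt t) *\<^sub>R I t \<omega>) gauss_seq Z"
 proof (rule clt_type_2[OF type2 Y' Y'_sq Y'_mean])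
  fix Z :: "(nat \<Rightarrow> real) \<Rightarrow> 'w"
  assume Z[measurable]: "Z \<in> borel_measurable gauss_seq" and Z2: "integrable gauss_seq (\<lambda>x. (norm (Z x))\<^sup>2)"
   "(LINT x|gauss_seq. Z x) = 0"
   and Zlim: "\<And>(f :: 'w \<Rightarrow> real) \<Lambda> B. (\<And>a b. \<bar>f a - f b\<bar> \<le> \<Lambda> * norm (a - b)) \<Longrightarrow> (\<And>a. \<bar>f a\<bar> \<le> B) \<Longrightarrow>
    (\<lambda>n. LINT \<omega>|M. f ((1 / sqrt (real n)) *\<^sub>R (\<Sum>k<n. c *\<^sub>R Y k \<omega>))) \<longlonglongrightarrow> (LINT x|gauss_seq. f (Z x))"
   and Zg: "gaussian gauss_seq Z"
   "\<And>\<psi>1 \<psi>2 :: 'w \<Rightarrow>\<^sub>L real. (LINT x|gauss_seq. blinfun_apply \<psi>1 (Z x) * blinfun_apply \<psi>2 (Z x))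
    = (LINT \<omega>|M. blinfun_apply \<psi>1 (c *\<^sub>R Y 0 \<omega>) * blinfun_apply \<psi>2 (c *\<^sub>R Y 0 \<omega>))"
  have "converges_in_distr M (\<lambda>t \<omega>. (1 / sqrt t) *\<^sub>R I t \<omega>) gauss_seq Z"
  proof (rule converges_in_distr_lipschitz[OF prob_space_axioms prob_space_gauss_seq])
   fix f :: "'w \<Rightarrow> real" and \<Lambda>0 b
   assume lip0: "\<And>x y. \<bar>f x - f y\<bar> \<le> \<Lambda>0 * norm (x - y)" and bd: "\<And>x. \<bar>f x\<bar> \<le> b"
   define \<Lambda> where "\<Lambda> = \<bar>\<Lambda>0\<bar>"
   have \<Lambda>: "\<Lambda> \<ge> 0" by (simp add: \<Lambda>_def)
   have lip: "\<bar>f x - f y\<bar> \<le> \<Lambda> * norm (x - y)" for x y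
    using lip0[of x y] mult_right_mono[OF abs_ge_self[of \<Lambda>0] norm_ge_zero[of "x - y"]] unfolding \<Lambda>_def by linarith
   have "continuous_on UNIV f"
    by (rule lipschitz_on_continuous_on[of \<Lambda>], rule lipschitz_onI) (use lip \<Lambda> in \<open>auto simp: dist_norm\<close>)
   then have fm[measurable]: "f \<in> borel_measurable borel" by (rule borel_measurable_continuous_onI)
   show "((\<lambda>t. LINT \<omega>|M. f ((1 / sqrt t) *\<^sub>R I t \<omega>)) \<longlongrightarrow> (LINT x|gauss_seq. f (Z x))) at_top"
   \<comment> \<open>Dominated convergence and Anscombe's argument work along sequences, so the
     limit in the real variable is tested on an arbitrary sequence tending to infinity.\<close>
   proof (rule tendsto_at_topI_sequentially)
    fix t :: "nat \<Rightarrow> real" assume t: "filterlim t at_top sequentially"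
    \<comment> \<open>Deterministic equivalent of \<open>N (t n)\<close>, chosen according to the
      limit \<open>1 / ?\<mu>\<close> of \<open>N t / t\<close>.\<close>
    define m where "m n = nat \<lfloor>t n / ?\<mu>\<rfloor>" for n
    have t_pos: "\<forall>\<^sub>F n in sequentially. t n > r" for r using t unfolding filterlim_at_top_dense by blast
    have inv_t: "(\<lambda>n. 1 / t n) \<longlonglongrightarrow> 0"
     by (rule tendsto_divide_0[OF tendsto_const filterlim_at_top_imp_at_infinity[OF t]])
    have "(\<lambda>n. real (m n) / t n - 1 / ?\<mu>) \<longlonglongrightarrow> 0"
    proof (rule Lim_null_comparison[OF _ inv_t])
     show "\<forall>\<^sub>F n in sequentially. norm (real (m n) / t n - 1 / ?\<mu>) \<le> 1 / t n"
      using t_pos[of 0]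
     proof eventually_elim
      case (elim n)
      then have "0 \<le> t n / ?\<mu>" using \<mu> by simp
      then have "\<bar>real (m n) - t n / ?\<mu>\<bar> \<le> 1" unfolding m_def by linarith
      then have "\<bar>real (m n) - t n / ?\<mu>\<bar> / t n \<le> 1 / t n" using elim by (intro divide_right_mono) auto
      moreover have "norm (real (m n) / t n - 1 / ?\<mu>) = \<bar>real (m n) - t n / ?\<mu>\<bar> / t n"
      proof -
       have "real (m n) / t n - 1 / ?\<mu> = (real (m n) - t n / ?\<mu>) / t n" using elim by (simp add: diff_divide_distrib)
       then show ?thesis using elim by simp
      qed
      ultimately show ?case by simp
     qed
    qed
    then have mt: "(\<lambda>n. real (m n) / t n) \<longlonglongrightarrow> 1 / ?\<mu>" by (simp add: LIM_zero_iff)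
    have m_inf: "filterlim m at_top sequentially"
    proof -
     have "filterlim (\<lambda>n. real (m n) / t n * t n) at_top sequentially"
      by (rule filterlim_tendsto_pos_mult_at_top[OF mt _ t]) (use \<mu> in simp)
     moreover have ev: "\<forall>\<^sub>F n in sequentially. real (m n) / t n * t n = real (m n)"
      using t_pos[of 0] by eventually_elim simp
     ultimately have r: "filterlim (\<lambda>n. real (m n)) at_top sequentially"
      using filterlim_cong[OF refl refl ev] by blast
     show ?thesis
      unfolding filterlim_at_top
     proof
      fix Z
      have "\<forall>\<^sub>F n in sequentially. real Z \<le> real (m n)" using r unfolding filterlim_at_top by blast
      then show "\<forall>\<^sub>F n in sequentially. Z \<le> m n" by simp
     qed
    qed
    have SN[measurable]: "(\<lambda>\<omega>. ?S \<omega> (N (t n) \<omega>)) \<in> borel_measurable M" for n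
     by (rule measurable_compose_countable[OF _ Nm]) measurable
    let ?E = "\<lambda>D n. expectation (\<lambda>\<omega>. min (D n \<omega>) 1)"
    \<comment> \<open>Three replacement errors: \<open>D1\<close> passes from the integral to the
      sum over completed cycles, \<open>D2\<close> from the random to the deterministic number of
      cycles, and \<open>D3\<close> below from the normalization by \<open>sqrt (t n)\<close> to
      that by \<open>sqrt (m n)\<close> with the factor \<open>c\<close>.\<close>
    define D1 where "D1 n \<omega> = norm (I (t n) \<omega> - ?S \<omega> (N (t n) \<omega>)) / sqrt \<bar>t n\<bar>" for n \<omega>
    define D2 where "D2 n \<omega> = norm (?S \<omega> (N (t n) \<omega>) - ?S \<omega> (m n)) / sqrt \<bar>t n\<bar>" for n \<omega>
    have [measurable]: "D1 n \<in> borel_measurable M" "D2 n \<in> borel_measurable M" for n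
     unfolding D1_def D2_def by measurable
    have D_nn: "D1 n \<omega> \<ge> 0" "D2 n \<omega> \<ge> 0" for n \<omega> by (simp_all add: D1_def D2_def)
    have "(\<lambda>n. ?E D1 n) \<longlonglongrightarrow> expectation (\<lambda>_. 0)"
    proof (rule integral_dominated_convergence[where w="\<lambda>_. 1"])
     show "AE \<omega> in M. (\<lambda>n. min (D1 n \<omega>) 1) \<longlonglongrightarrow> 0"
      using det
     proof eventually_elim
      case (elim \<omega>)
      then have "(\<lambda>n. norm (I (t n) \<omega> - ?S \<omega> (N (t n) \<omega>)) / sqrt (t n)) \<longlonglongrightarrow> 0"
       using filterlim_compose[OF conjunct1[OF elim] t] by simp
      moreover have "\<forall>\<^sub>F n in sequentially. norm (I (t n) \<omega> - ?S \<omega> (N (t n) \<omega>)) / sqrt (t n) = D1 n \<omega>"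
       using t_pos[of 0] by eventually_elim (simp add: D1_def)
      ultimately have "(\<lambda>n. D1 n \<omega>) \<longlonglongrightarrow> 0" by (rule Lim_transform_eventually)
      from tendsto_min[OF this tendsto_const[of 1]] show ?case by simp
     qed
    qed (use D_nn in auto)
    then have E1: "(\<lambda>n. ?E D1 n) \<longlonglongrightarrow> 0" by simp
    have Nt: "AE \<omega> in M. (\<lambda>n. real (N (t n) \<omega>) / t n) \<longlonglongrightarrow> 1 / ?\<mu>"
     using det
    proof eventually_elim
     case (elim \<omega>)
     then have "((\<lambda>t. real (N t \<omega>) / t) \<longlongrightarrow> 1 / ?\<mu>) at_top" by simp
     from filterlim_compose[OF this t] show ?case .
    qed
    have E2: "(\<lambda>n. ?E D2 n) \<longlonglongrightarrow> 0"
     unfolding D2_def by (rule anscombe[OF Y Y_sq Y_mean type2 Nm t Nt mt])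
    define D3 where "D3 n \<omega> = \<bar>sqrt (real (m n) / t n) - c\<bar> * norm ((1 / sqrt (real (m n))) *\<^sub>R ?S \<omega> (m n))" for n \<omega>
    have [measurable]: "D3 n \<in> borel_measurable M" for n unfolding D3_def by measurable
    have E3: "(\<lambda>n. ?E D3 n) \<longlonglongrightarrow> 0"
    proof (rule tendsto_sandwich[OF _ _ tendsto_const])
     have "(\<lambda>n. \<bar>sqrt (real (m n) / t n) - c\<bar> * sqrt (C * V)) \<longlonglongrightarrow> \<bar>sqrt (1 / ?\<mu>) - c\<bar> * sqrt (C * V)"
      by (intro tendsto_intros mt)
     then show "(\<lambda>n. \<bar>sqrt (real (m n) / t n) - c\<bar> * sqrt (C * V)) \<longlonglongrightarrow> 0" by (simp add: c_def)
     show "\<forall>\<^sub>F n in sequentially. 0 \<le> ?E D3 n"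
      by (intro always_eventually allI integral_nonneg_AE) (auto simp: D3_def)
     show "\<forall>\<^sub>F n in sequentially. ?E D3 n \<le> \<bar>sqrt (real (m n) / t n) - c\<bar> * sqrt (C * V)"
     proof (intro always_eventually allI)
      fix n
      note b = C(2)[OF Y Y_sq Y_mean, of "m n"]
      have eq: "(norm ((1 / sqrt (real k)) *\<^sub>R y))\<^sup>2 = (1 / real k) * (norm y)\<^sup>2" for y :: 'w and k
       by (simp add: power_divide)
      have sq: "integrable M (\<lambda>\<omega>. (norm ((1 / sqrt (real (m n))) *\<^sub>R ?S \<omega> (m n)))\<^sup>2)"
       unfolding eq using b by simp
      have i: "integrable M (\<lambda>\<omega>. norm ((1 / sqrt (real (m n))) *\<^sub>R ?S \<omega> (m n)))"
       by (rule square_integrable_imp_integrable[OF _ sq]) simp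
      have "expectation (\<lambda>\<omega>. norm ((1 / sqrt (real (m n))) *\<^sub>R ?S \<omega> (m n))) \<le> sqrt (expectation (\<lambda>\<omega>. (norm ((1 / sqrt (real (m n))) *\<^sub>R ?S \<omega> (m n)))\<^sup>2))"
       by (rule L1_le_L2[OF _ sq]) simp
      also have "\<dots> \<le> sqrt (C * V)"
      proof (rule real_sqrt_le_mono)
       have "expectation (\<lambda>\<omega>. (norm ((1 / sqrt (real (m n))) *\<^sub>R ?S \<omega> (m n)))\<^sup>2) = (1 / real (m n)) * expectation (\<lambda>\<omega>. (norm (?S \<omega> (m n)))\<^sup>2)"
        unfolding eq by simp
       also have "\<dots> \<le> (1 / real (m n)) * (C * (real (m n) * V))"
        using b unfolding V_def by (intro mult_left_mono) auto
       also have "\<dots> \<le> C * V" using C(1) by (cases "m n = 0") (auto simp: V_def)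
       finally show "expectation (\<lambda>\<omega>. (norm ((1 / sqrt (real (m n))) *\<^sub>R ?S \<omega> (m n)))\<^sup>2) \<le> C * V" .
      qed
      finally have L1: "expectation (\<lambda>\<omega>. norm ((1 / sqrt (real (m n))) *\<^sub>R ?S \<omega> (m n))) \<le> sqrt (C * V)" .
      have iD: "integrable M (D3 n)" unfolding D3_def by (rule integrable_mult_right) (rule i)
      have "?E D3 n \<le> expectation (D3 n)"
       by (rule integral_mono[OF _ iD]) (auto intro!: integrable_const_bound[where B=1] simp: D3_def abs_le_iff intro: order_trans[of _ 0])
      also have "\<dots> = \<bar>sqrt (real (m n) / t n) - c\<bar> * expectation (\<lambda>\<omega>. norm ((1 / sqrt (real (m n))) *\<^sub>R ?S \<omega> (m n)))"
       unfolding D3_def by (rule integral_mult_right_zero)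
      also have "\<dots> \<le> \<bar>sqrt (real (m n) / t n) - c\<bar> * sqrt (C * V)" by (intro mult_left_mono L1) simp
      finally show "?E D3 n \<le> \<bar>sqrt (real (m n) / t n) - c\<bar> * sqrt (C * V)" .
     qed
    qed
    let ?R = "\<lambda>n. LINT \<omega>|M. f ((1 / sqrt (real (m n))) *\<^sub>R (\<Sum>k<m n. c *\<^sub>R Y k \<omega>))"
    have R: "?R \<longlonglongrightarrow> (LINT x|gauss_seq. f (Z x))"
     by (rule filterlim_compose[OF Zlim[OF lip bd] m_inf])
    have K: "(\<lambda>n. (\<Lambda> + 2 * b) * (?E D1 n + ?E D2 n) + (\<Lambda> + 2 * b) * ?E D3 n) \<longlonglongrightarrow> (\<Lambda> + 2 * b) * (0 + 0) + (\<Lambda> + 2 * b) * 0"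
     by (intro tendsto_intros E1 E2 E3)
    have b0: "b \<ge> 0" using bd[of 0] by linarith
    have m_pos: "\<forall>\<^sub>F n in sequentially. 1 \<le> m n" using m_inf unfolding filterlim_at_top by blast
    have "(\<lambda>n. (LINT \<omega>|M. f ((1 / sqrt (t n)) *\<^sub>R I (t n) \<omega>)) - ?R n) \<longlonglongrightarrow> 0"
    proof (rule Lim_null_comparison[OF _ K[simplified mult_zero_right add_0_right]])
     show "\<forall>\<^sub>F n in sequentially. norm ((LINT \<omega>|M. f ((1 / sqrt (t n)) *\<^sub>R I (t n) \<omega>)) - ?R n) \<le>
       (\<Lambda> + 2 * b) * (?E D1 n + ?E D2 n) + (\<Lambda> + 2 * b) * ?E D3 n"
      using t_pos[of 0] m_pos
     proof eventually_elim
      case (elim n)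
      have i: "integrable M (\<lambda>\<omega>. min (D1 n \<omega>) 1)" "integrable M (\<lambda>\<omega>. min (D2 n \<omega>) 1)" "integrable M (\<lambda>\<omega>. min (D1 n \<omega> + D2 n \<omega>) 1)"
       using D_nn[of n] by (auto intro!: integrable_const_bound[where B=1] simp: abs_le_iff min_def intro: order_trans[of _ 0])
      have "norm ((1 / sqrt (t n)) *\<^sub>R I (t n) \<omega> - (1 / sqrt (t n)) *\<^sub>R ?S \<omega> (m n)) \<le> D1 n \<omega> + D2 n \<omega>" for \<omega>
      proof -
       have "norm ((1 / sqrt (t n)) *\<^sub>R I (t n) \<omega> - (1 / sqrt (t n)) *\<^sub>R ?S \<omega> (m n)) = norm (I (t n) \<omega> - ?S \<omega> (m n)) / sqrt (t n)"
        using elim by (simp add: scaleR_diff_right[symmetric])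
       also have "\<dots> \<le> (norm (I (t n) \<omega> - ?S \<omega> (N (t n) \<omega>)) + norm (?S \<omega> (N (t n) \<omega>) - ?S \<omega> (m n))) / sqrt (t n)"
        using elim norm_triangle_ineq[of "I (t n) \<omega> - ?S \<omega> (N (t n) \<omega>)" "?S \<omega> (N (t n) \<omega>) - ?S \<omega> (m n)"]
        by (intro divide_right_mono) auto
       finally show ?thesis using elim by (simp add: D1_def D2_def add_divide_distrib)
      qed
      then have A: "\<bar>(LINT \<omega>|M. f ((1 / sqrt (t n)) *\<^sub>R I (t n) \<omega>)) - (LINT \<omega>|M. f ((1 / sqrt (t n)) *\<^sub>R ?S \<omega> (m n)))\<bar>
        \<le> (\<Lambda> + 2 * b) * expectation (\<lambda>\<omega>. min (D1 n \<omega> + D2 n \<omega>) 1)"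
       by (intro lipschitz_expectation_close[OF _ _ _ _ lip bd \<Lambda>]) measurable
      have "expectation (\<lambda>\<omega>. min (D1 n \<omega> + D2 n \<omega>) 1) \<le> expectation (\<lambda>\<omega>. min (D1 n \<omega>) 1 + min (D2 n \<omega>) 1)"
      proof (intro integral_mono i(3) Bochner_Integration.integrable_add i(1) i(2))
       fix \<omega>
       have "min (x + y) 1 \<le> min x 1 + min y (1::real)" if "x \<ge> 0" "y \<ge> 0" for x y
        using that by (auto simp: min_def)
       then show "min (D1 n \<omega> + D2 n \<omega>) 1 \<le> min (D1 n \<omega>) 1 + min (D2 n \<omega>) 1"
        using D_nn by blast
      qed
      also have "\<dots> = ?E D1 n + ?E D2 n" using i by simp
      finally have A2: "(\<Lambda> + 2 * b) * expectation (\<lambda>\<omega>. min (D1 n \<omega> + D2 n \<omega>) 1) \<le> (\<Lambda> + 2 * b) * (?E D1 n + ?E D2 n)"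
       using \<Lambda> b0 by (intro mult_left_mono) auto
      have "norm ((1 / sqrt (t n)) *\<^sub>R ?S \<omega> (m n) - (1 / sqrt (real (m n))) *\<^sub>R (\<Sum>k<m n. c *\<^sub>R Y k \<omega>)) \<le> D3 n \<omega>" for \<omega>
      proof -
       have "(1 / sqrt (t n)) *\<^sub>R ?S \<omega> (m n) - (1 / sqrt (real (m n))) *\<^sub>R (\<Sum>k<m n. c *\<^sub>R Y k \<omega>)
        = (sqrt (real (m n) / t n) - c) *\<^sub>R ((1 / sqrt (real (m n))) *\<^sub>R ?S \<omega> (m n))"
        using elim by (simp add: scaleR_sum_right[symmetric] real_sqrt_divide scaleR_diff_left diff_divide_distrib)
       then show ?thesis unfolding D3_def by simp
      qed
      then have A3: "\<bar>(LINT \<omega>|M. f ((1 / sqrt (t n)) *\<^sub>R ?S \<omega> (m n))) - ?R n\<bar> \<le> (\<Lambda> + 2 * b) * ?E D3 n"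
       by (intro lipschitz_expectation_close[OF _ _ _ _ lip bd \<Lambda>]) measurable
      show ?case using A A2 A3 by simp
     qed
    qed
    from tendsto_add[OF this R] show "(\<lambda>n. LINT \<omega>|M. f ((1 / sqrt (t n)) *\<^sub>R I (t n) \<omega>)) \<longlonglongrightarrow> (LINT x|gauss_seq. f (Z x))"
     by simp
   qed
  qed measurable
  then show ?thesis using Z Z2 Zg unfolding c_def by blast
 qed
qed

end

section \<open>Regeneration\<close>

primrec walk :: "('v::zero \<Rightarrow> 'e \<Rightarrow> 'v) \<Rightarrow> (nat \<Rightarrow> 'e) \<Rightarrow> nat \<Rightarrow> 'v" where
 "walk \<phi> s 0 = 0"
| "walk \<phi> s (Suc m) = \<phi> (walk \<phi> s m) (s m)"

definition hits :: "('v::zero \<Rightarrow> 'e \<Rightarrow> 'v) \<Rightarrow> (nat \<Rightarrow> 'e) \<Rightarrow> nat \<Rightarrow> bool" where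
 "hits \<phi> s k \<longleftrightarrow> 1 \<le> k \<and> walk \<phi> s k = 0 \<and> (\<forall>m<k. 1 \<le> m \<longrightarrow> walk \<phi> s m \<noteq> 0)"

definition returns :: "('v::zero \<Rightarrow> 'e \<Rightarrow> 'v) \<Rightarrow> (nat \<Rightarrow> 'e) \<Rightarrow> bool" where
 "returns \<phi> s \<longleftrightarrow> (\<exists>k. hits \<phi> s k)"

definition ret :: "('v::zero \<Rightarrow> 'e \<Rightarrow> 'v) \<Rightarrow> (nat \<Rightarrow> 'e) \<Rightarrow> nat" where
 "ret \<phi> s = (LEAST k. hits \<phi> s k)"

definition drop_seq :: "nat \<Rightarrow> (nat \<Rightarrow> 'e) \<Rightarrow> nat \<Rightarrow> 'e" where
 "drop_seq k s = (\<lambda>i. s (k + i))"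

primrec epoch :: "('v::zero \<Rightarrow> 'e \<Rightarrow> 'v) \<Rightarrow> (nat \<Rightarrow> 'e) \<Rightarrow> nat \<Rightarrow> nat" where
 "epoch \<phi> s 0 = 0"
| "epoch \<phi> s (Suc n) = epoch \<phi> s n + ret \<phi> (drop_seq (epoch \<phi> s n) s)"

text \<open>The entire remaining sequence from the \<open>n\<close>-th epoch on, rather than the
  finite block of the cycle; all cycles then have the same type, and functionals that read only the
  block are singled out by \<open>adapted\<close>.\<close>

definition nth_cycle :: "('v::zero \<Rightarrow> 'e \<Rightarrow> 'v) \<Rightarrow> nat \<Rightarrow> (nat \<Rightarrow> 'e) \<Rightarrow> nat \<Rightarrow> 'e" where
 "nth_cycle \<phi> n s = drop_seq (epoch \<phi> s n) s"

text \<open>An elementary form of measurability with respect to the past of a stopping time: the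
  value is settled by the entries before the first return.\<close>

definition adapted :: "('v::zero \<Rightarrow> 'e \<Rightarrow> 'v) \<Rightarrow> ((nat \<Rightarrow> 'e) \<Rightarrow> 'b) \<Rightarrow> bool" where
 "adapted \<phi> g \<longleftrightarrow> (\<forall>s s' k. hits \<phi> s k \<longrightarrow> (\<forall>i<k. s i = s' i) \<longrightarrow> g s = g s')"

lemma walk_cong: "(\<And>i. i < m \<Longrightarrow> s i = s' i) \<Longrightarrow> walk \<phi> s m = walk \<phi> s' m"
 by (induction m) auto

lemma hits_cong: "(\<And>i. i < k \<Longrightarrow> s i = s' i) \<Longrightarrow> hits \<phi> s k \<longleftrightarrow> hits \<phi> s' k"
proof -
 assume "\<And>i. i < k \<Longrightarrow> s i = s' i"
 then have "walk \<phi> s m = walk \<phi> s' m" if "m \<le> k" for m using that by (intro walk_cong) auto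
 then show ?thesis unfolding hits_def by auto
qed

lemma hits_unique: "hits \<phi> s k \<Longrightarrow> hits \<phi> s l \<Longrightarrow> k = l"
 unfolding hits_def by (metis linorder_neqE_nat)

lemma ret_eqI: "hits \<phi> s k \<Longrightarrow> ret \<phi> s = k"
 unfolding ret_def by (metis hits_unique LeastI)

lemma hits_ret: "returns \<phi> s \<Longrightarrow> hits \<phi> s (ret \<phi> s)"
 unfolding returns_def ret_def by (rule LeastI_ex)

lemma shift_shift: "drop_seq k (drop_seq l s) = drop_seq (l + k) s"
 by (simp add: drop_seq_def add.assoc)

lemma walk_shift: "walk \<phi> s k = 0 \<Longrightarrow> walk \<phi> (drop_seq k s) i = walk \<phi> s (k + i)"
 by (induction i) (auto simp: drop_seq_def)

lemma cycle_0: "nth_cycle \<phi> 0 s = s"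
 by (simp add: nth_cycle_def drop_seq_def)

text \<open>The recursion of \<open>epoch\<close> appends the latest return at the end; the strong
  Markov property requires the first one to be split off at the front.\<close>

lemma epoch_Suc_shift: "epoch \<phi> s (Suc n) = ret \<phi> s + epoch \<phi> (drop_seq (ret \<phi> s) s) n"
proof (induction n)
 case 0
 show ?case by (simp add: drop_seq_def)
next
 case (Suc n)
 have "epoch \<phi> s (Suc (Suc n)) = epoch \<phi> s (Suc n) + ret \<phi> (drop_seq (epoch \<phi> s (Suc n)) s)" by simp
 then show ?case unfolding Suc by (simp add: shift_shift add.assoc)
qed

lemma cycle_Suc: "nth_cycle \<phi> (Suc n) s = nth_cycle \<phi> n (drop_seq (ret \<phi> s) s)"
 unfolding nth_cycle_def epoch_Suc_shift by (simp add: shift_shift)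

lemma walk_epoch:
 assumes "\<And>i. i < n \<Longrightarrow> returns \<phi> (nth_cycle \<phi> i s)"
 shows "walk \<phi> s (epoch \<phi> s n) = 0"
 using assms
proof (induction n)
 case (Suc n)
 then have 0: "walk \<phi> s (epoch \<phi> s n) = 0" and "hits \<phi> (nth_cycle \<phi> n s) (ret \<phi> (nth_cycle \<phi> n s))"
  using hits_ret by auto
 then show ?case using walk_shift[OF 0] by (simp add: hits_def nth_cycle_def)
qed simp

section \<open>Measurability of return times and cycles\<close>

abbreviation seqs :: "(nat \<Rightarrow> 'e::topological_space) measure" where
 "seqs \<equiv> PiM UNIV (\<lambda>_. borel)"

lemma seqs_component[measurable]: "(\<lambda>s. s i) \<in> seqs \<rightarrow>\<^sub>M borel"
 by (rule measurable_component_singleton) simp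

lemma measurable_seqsI: "(\<And>i. (\<lambda>x. f x i) \<in> M \<rightarrow>\<^sub>M borel) \<Longrightarrow> f \<in> M \<rightarrow>\<^sub>M seqs"
 by (rule measurable_PiM_single') (auto simp: space_PiM)

lemma shift_measurable[measurable]: "drop_seq k \<in> seqs \<rightarrow>\<^sub>M seqs"
 unfolding drop_seq_def by (rule measurable_seqsI) measurable

text \<open>The class \<open>t1_space\<close> makes \<open>{0}\<close> a Borel set, so that returns
  to 0 are measurable events.\<close>

locale regenerative =
 fixes \<phi> :: "'v::{zero, t1_space} \<Rightarrow> 'e::topological_space \<Rightarrow> 'v"
 assumes \<phi>_measurable: "(\<lambda>p. \<phi> (fst p) (snd p)) \<in> borel \<Otimes>\<^sub>M borel \<rightarrow>\<^sub>M borel"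
begin

lemma walk_measurable[measurable]: "(\<lambda>s. walk \<phi> s m) \<in> seqs \<rightarrow>\<^sub>M borel"
proof (induction m)
 case (Suc m)
 have "(\<lambda>s. (walk \<phi> s m, s m)) \<in> seqs \<rightarrow>\<^sub>M borel \<Otimes>\<^sub>M borel"
  by (intro measurable_Pair Suc seqs_component)
 from measurable_compose[OF this \<phi>_measurable] show ?case by simp
qed simp

lemma walk_zero_measurable[measurable]: "Measurable.pred seqs (\<lambda>s. walk \<phi> s m = 0)"
proof -
 have "{0::'v} \<in> sets borel" by simp
 from measurable_sets[OF walk_measurable this, of m]
 have "{s \<in> space seqs. walk \<phi> s m = 0} \<in> sets seqs"
  by (simp add: vimage_def Int_def conj_commute)
 then show ?thesis by (simp add: pred_def)
qed

lemma hits_measurable[measurable]: "Measurable.pred seqs (\<lambda>s. hits \<phi> s k)"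
 unfolding hits_def by measurable

lemma returns_measurable[measurable]: "Measurable.pred seqs (\<lambda>s. returns \<phi> s)"
 unfolding returns_def by measurable

lemma ret_measurable[measurable]: "ret \<phi> \<in> measurable seqs (count_space UNIV)"
 unfolding ret_def[abs_def] by (rule measurable_Least) measurable

lemma epoch_measurable[measurable]: "(\<lambda>s. epoch \<phi> s n) \<in> measurable seqs (count_space UNIV)"
proof (induction n)
 case (Suc n)
 have "(\<lambda>s. drop_seq (epoch \<phi> s n) s) \<in> seqs \<rightarrow>\<^sub>M seqs"
  by (rule measurable_compose_countable[OF _ Suc]) measurable
 from measurable_compose[OF this ret_measurable]
 have "(\<lambda>s. ret \<phi> (drop_seq (epoch \<phi> s n) s)) \<in> measurable seqs (count_space UNIV)" .
 note [measurable] = this Suc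
 show ?case by simp
qed simp

lemma cycle_measurable[measurable]: "nth_cycle \<phi> n \<in> seqs \<rightarrow>\<^sub>M seqs"
 unfolding nth_cycle_def[abs_def] by (rule measurable_compose_countable[OF _ epoch_measurable]) measurable

lemma cycle_compose_measurable: "h \<in> seqs \<rightarrow>\<^sub>M N \<Longrightarrow> (\<lambda>s. h (nth_cycle \<phi> i s)) \<in> seqs \<rightarrow>\<^sub>M N"
 by (rule measurable_compose[OF cycle_measurable])

end

lemma (in prob_space) indep_var_nn_integral:
 assumes "indep_var borel X borel Y"
 shows "(\<integral>\<^sup>+\<omega>. X \<omega> * Y \<omega> \<partial>M) = (\<integral>\<^sup>+\<omega>. X \<omega> \<partial>M) * (\<integral>\<^sup>+\<omega>. (Y \<omega> :: ennreal) \<partial>M)"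
proof -
 have c: "case_bool borel borel = (\<lambda>_. borel)" by (auto split: bool.split)
 have "indep_vars (\<lambda>_. borel) (case_bool X Y) UNIV" using assms unfolding indep_var_def c .
 from indep_vars_nn_integral[OF _ this] show ?thesis by (simp add: UNIV_bool mult.commute)
qed

text \<open>The entries from index 1 on share the law \<open>p\<close>, while entry 0 will carry the
  initial value and may have any law.\<close>

locale regenerative_noise = regenerative \<phi> + prob_space M
 for \<phi> :: "'v::{zero, t1_space} \<Rightarrow> 'e::topological_space \<Rightarrow> 'v" and M :: "'a measure" +
 fixes \<xi> :: "nat \<Rightarrow> 'a \<Rightarrow> 'e" and p :: "'e measure"
 assumes \<xi>: "indep_vars (\<lambda>_. borel) \<xi> UNIV" and \<xi>_distr: "\<And>m. m \<ge> 1 \<Longrightarrow> distr M borel (\<xi> m) = p"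
  and \<xi>_returns: "AE \<omega> in M. returns \<phi> (\<lambda>m. \<xi> m \<omega>)"
begin

lemma \<xi>_measurable: "\<xi> m \<in> M \<rightarrow>\<^sub>M borel"
 using \<xi> unfolding indep_vars_def by blast

lemma noise_measurable: "(\<lambda>\<omega> m. \<xi> m \<omega>) \<in> M \<rightarrow>\<^sub>M seqs"
 by (rule measurable_seqsI) (rule \<xi>_measurable)

lemma shift_noise_distr:
 assumes "k \<ge> 1"
 shows "distr M seqs (\<lambda>\<omega>. drop_seq k (\<lambda>m. \<xi> m \<omega>)) = PiM UNIV (\<lambda>_. p)"
proof -
 have "iid M borel (\<lambda>i. \<xi> (k + i))"
  unfolding iid_def
 proof
  show "indep_vars (\<lambda>_. borel) (\<lambda>i. \<xi> (k + i)) UNIV"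
   by (rule indep_vars_reindex[of "\<lambda>i. k + i" UNIV "\<lambda>_. borel" \<xi>])
     (auto simp: inj_def intro: indep_vars_subset[OF \<xi>])
  show "\<forall>n. distr M borel (\<xi> (k + n)) = distr M borel (\<xi> (k + 0))"
   using assms by (auto simp: \<xi>_distr)
 qed
 from iid_distr_sequence[OF this] assms show ?thesis by (simp add: drop_seq_def \<xi>_distr)
qed

text \<open>Decomposition over the value \<open>k\<close> of the return time: on
  \<open>hits \<phi> s k\<close> the factor \<open>g\<close> depends on the first \<open>k\<close>
  entries alone and the other factor on the later ones. Since \<open>k >= 1\<close>, the shifted
  sequence avoids entry 0 and has the product law.\<close>

lemma strong_markov:
 fixes g F :: "(nat \<Rightarrow> 'e) \<Rightarrow> ennreal"
 assumes g[measurable]: "g \<in> borel_measurable seqs" and F[measurable]: "F \<in> borel_measurable seqs"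
  and ad: "adapted \<phi> g"
 shows "(\<integral>\<^sup>+\<omega>. g (\<lambda>m. \<xi> m \<omega>) * F (drop_seq (ret \<phi> (\<lambda>m. \<xi> m \<omega>)) (\<lambda>m. \<xi> m \<omega>)) \<partial>M)
   = (\<integral>\<^sup>+\<omega>. g (\<lambda>m. \<xi> m \<omega>) \<partial>M) * (\<integral>\<^sup>+s. F s \<partial>PiM UNIV (\<lambda>_. p))"
proof -
 note [measurable] = noise_measurable \<xi>_measurable
 define H where "H k \<omega> = (indicator {s. hits \<phi> s k} (\<lambda>m. \<xi> m \<omega>) * g (\<lambda>m. \<xi> m \<omega>) :: ennreal)" for k \<omega>
 have ind_m[measurable]: "indicator {s. hits \<phi> s k} \<in> borel_measurable seqs" for k
  using hits_measurable[of k] by (intro borel_measurable_indicator) (simp add: pred_def space_PiM)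
 have Hm[measurable]: "H k \<in> borel_measurable M" for k unfolding H_def by measurable
 have decomp: "AE \<omega> in M. (\<Sum>k. H k \<omega> * F (drop_seq k (\<lambda>m. \<xi> m \<omega>))) = g (\<lambda>m. \<xi> m \<omega>) * F (drop_seq (ret \<phi> (\<lambda>m. \<xi> m \<omega>)) (\<lambda>m. \<xi> m \<omega>))
   \<and> (\<Sum>k. H k \<omega>) = g (\<lambda>m. \<xi> m \<omega>)"
  using \<xi>_returns
 proof eventually_elim
  case (elim \<omega>)
  let ?k = "ret \<phi> (\<lambda>m. \<xi> m \<omega>)"
  have h: "hits \<phi> (\<lambda>m. \<xi> m \<omega>) ?k" using elim by (rule hits_ret)
  have H0: "H k \<omega> = 0" if "k \<noteq> ?k" for k
   using hits_unique[OF _ h, of k] that by (auto simp: H_def indicator_def)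
  have "(\<Sum>k. H k \<omega> * F (drop_seq k (\<lambda>m. \<xi> m \<omega>))) = (\<Sum>k\<in>{?k}. H k \<omega> * F (drop_seq k (\<lambda>m. \<xi> m \<omega>)))"
   by (rule suminf_finite) (auto simp: H0)
  moreover have "(\<Sum>k. H k \<omega>) = (\<Sum>k\<in>{?k}. H k \<omega>)"
   by (rule suminf_finite) (auto simp: H0)
  ultimately show ?case using h by (simp add: H_def)
 qed
 have one: "(\<integral>\<^sup>+\<omega>. H k \<omega> * F (drop_seq k (\<lambda>m. \<xi> m \<omega>)) \<partial>M) = (\<integral>\<^sup>+\<omega>. H k \<omega> \<partial>M) * (\<integral>\<^sup>+s. F s \<partial>PiM UNIV (\<lambda>_. p))" for k
 proof (cases "k \<ge> 1")
  case False
  then have "H k \<omega> = 0" for \<omega> by (simp add: H_def hits_def indicator_def)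
  then show ?thesis by simp
 next
  case True
  define e0 :: 'e where "e0 = undefined"
  \<comment> \<open>Filling a finite block with a dummy value turns functionals of sequences into
    measurable functions on a finite product. Both \<open>hits\<close> at \<open>k\<close> and the
    adapted factor \<open>g\<close> ignore the filling.\<close>
  define ext where "ext r = (\<lambda>i. if i < k then r i else e0)" for r :: "nat \<Rightarrow> 'e"
  define G where "G r = (indicator {s. hits \<phi> s k} (ext r) * g (ext r) :: ennreal)" for r
  define Fk where "Fk r = F (\<lambda>i. r (k + i))" for r
  let ?A = "\<lambda>\<omega>. restrict (\<lambda>i. \<xi> i \<omega>) {..<k}" and ?B = "\<lambda>\<omega>. restrict (\<lambda>i. \<xi> i \<omega>) {k..}"
  have ext[measurable]: "ext \<in> PiM {..<k} (\<lambda>_. borel) \<rightarrow>\<^sub>M seqs"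
   unfolding ext_def
  proof (rule measurable_seqsI)
   fix i show "(\<lambda>r. if i < k then r i else e0) \<in> PiM {..<k} (\<lambda>_. borel) \<rightarrow>\<^sub>M borel"
    by (cases "i < k") (auto intro: measurable_component_singleton)
  qed
  have Gm: "G \<in> borel_measurable (PiM {..<k} (\<lambda>_. borel))"
   unfolding G_def by measurable
  have "(\<lambda>r i. r (k + i)) \<in> PiM {k..} (\<lambda>_. borel :: 'e measure) \<rightarrow>\<^sub>M seqs"
   by (rule measurable_seqsI) (auto intro: measurable_component_singleton)
  then have Fm: "Fk \<in> borel_measurable (PiM {k..} (\<lambda>_. borel))"
   unfolding Fk_def by (rule measurable_compose[OF _ F])
  have iv: "indep_var (PiM {..<k} (\<lambda>_. borel)) ?A (PiM {k..} (\<lambda>_. borel)) ?B"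
   by (rule indep_var_restrict[OF \<xi>]) auto
  have HG: "H k \<omega> = (G \<circ> ?A) \<omega>" for \<omega>
  proof -
   have agree: "\<xi> i \<omega> = ext (?A \<omega>) i" if "i < k" for i using that by (simp add: ext_def)
   have "hits \<phi> (\<lambda>m. \<xi> m \<omega>) k \<longleftrightarrow> hits \<phi> (ext (?A \<omega>)) k" by (rule hits_cong) (rule agree)
   moreover have "g (\<lambda>m. \<xi> m \<omega>) = g (ext (?A \<omega>))" if "hits \<phi> (\<lambda>m. \<xi> m \<omega>) k"
    using ad that agree unfolding adapted_def by blast
   ultimately show ?thesis by (auto simp: H_def G_def indicator_def)
  qed
  have FB: "F (drop_seq k (\<lambda>m. \<xi> m \<omega>)) = (Fk \<circ> ?B) \<omega>" for \<omega>
   by (simp add: Fk_def drop_seq_def)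
  have "(\<integral>\<^sup>+\<omega>. H k \<omega> * F (drop_seq k (\<lambda>m. \<xi> m \<omega>)) \<partial>M) = (\<integral>\<^sup>+\<omega>. H k \<omega> \<partial>M) * (\<integral>\<^sup>+\<omega>. F (drop_seq k (\<lambda>m. \<xi> m \<omega>)) \<partial>M)"
   unfolding HG FB by (rule indep_var_nn_integral[OF indep_var_compose[OF iv Gm Fm]])
  also have "(\<integral>\<^sup>+\<omega>. F (drop_seq k (\<lambda>m. \<xi> m \<omega>)) \<partial>M) = (\<integral>\<^sup>+s. F s \<partial>distr M seqs (\<lambda>\<omega>. drop_seq k (\<lambda>m. \<xi> m \<omega>)))"
   by (rule nn_integral_distr[symmetric]) measurable
  also have "distr M seqs (\<lambda>\<omega>. drop_seq k (\<lambda>m. \<xi> m \<omega>)) = PiM UNIV (\<lambda>_. p)" by (rule shift_noise_distr[OF True])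
  finally show ?thesis .
 qed
 have "(\<integral>\<^sup>+\<omega>. g (\<lambda>m. \<xi> m \<omega>) * F (drop_seq (ret \<phi> (\<lambda>m. \<xi> m \<omega>)) (\<lambda>m. \<xi> m \<omega>)) \<partial>M) = (\<integral>\<^sup>+\<omega>. (\<Sum>k. H k \<omega> * F (drop_seq k (\<lambda>m. \<xi> m \<omega>))) \<partial>M)"
  using decomp by (intro nn_integral_cong_AE) auto
 also have "\<dots> = (\<Sum>k. \<integral>\<^sup>+\<omega>. H k \<omega> * F (drop_seq k (\<lambda>m. \<xi> m \<omega>)) \<partial>M)"
  by (rule nn_integral_suminf) measurable
 also have "\<dots> = (\<Sum>k. \<integral>\<^sup>+\<omega>. H k \<omega> \<partial>M) * (\<integral>\<^sup>+s. F s \<partial>PiM UNIV (\<lambda>_. p))"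
  unfolding one by simp
 also have "(\<Sum>k. \<integral>\<^sup>+\<omega>. H k \<omega> \<partial>M) = (\<integral>\<^sup>+\<omega>. (\<Sum>k. H k \<omega>) \<partial>M)"
  by (rule nn_integral_suminf[symmetric]) measurable
 also have "\<dots> = (\<integral>\<^sup>+\<omega>. g (\<lambda>m. \<xi> m \<omega>) \<partial>M)"
  using decomp by (intro nn_integral_cong_AE) auto
 finally show ?thesis .
qed

end

lemma adapted_const: "adapted \<phi> (\<lambda>_. c)"
 by (simp add: adapted_def)

lemma adapted_compose: "adapted \<phi> g \<Longrightarrow> adapted \<phi> (\<lambda>s. h (g s))"
 unfolding adapted_def by metis

text \<open>The canonical model on the product space. The sequence after the first return has its
  law, so the induction over cycles takes place there.\<close>

lemma regenerative_noise_coordinates: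
 assumes "regenerative \<phi>" "prob_space p" "sets p = sets borel" "AE s in PiM UNIV (\<lambda>_::nat. p). returns \<phi> s"
 shows "regenerative_noise \<phi> (PiM UNIV (\<lambda>_. p)) (\<lambda>m s. s m) p"
proof -
 interpret regenerative \<phi> by fact
 interpret P: prob_space "PiM UNIV (\<lambda>_::nat. p)" by (rule prob_space_PiM) (rule assms)
 have i: "iid (PiM UNIV (\<lambda>_::nat. p)) p (\<lambda>m s. s m)" by (rule iid_coordinates[OF assms(2)])
 have "iid (PiM UNIV (\<lambda>_::nat. p)) borel (\<lambda>m s. (\<lambda>x. x) (s m))"
  by (rule P.iid_compose[OF i]) (simp add: measurable_ident_sets assms(3))
 then have iv: "P.indep_vars (\<lambda>_. borel) (\<lambda>m s. s m) UNIV" unfolding iid_def by simp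
 have d: "distr (PiM UNIV (\<lambda>_::nat. p)) borel (\<lambda>s. s m) = p" for m
 proof -
  interpret product_prob_space "\<lambda>_::nat. p" UNIV
   by (intro product_prob_spaceI assms)
  have "distr (PiM UNIV (\<lambda>_::nat. p)) borel (\<lambda>s. s m) = distr (PiM UNIV (\<lambda>_::nat. p)) p (\<lambda>s. s m)"
   by (rule distr_cong) (auto simp: assms(3))
  then show ?thesis using PiM_component[of m] by simp
 qed
 show ?thesis
  by unfold_locales (use iv d assms(4) in auto)
qed

context regenerative_noise
begin

lemma sets_p: "sets p = sets borel" "prob_space p"
proof -
 have p: "p = distr M borel (\<xi> 1)" by (simp add: \<xi>_distr)
 show "sets p = sets borel" unfolding p by simp
 show "prob_space p" unfolding p by (rule prob_space_distr) (rule \<xi>_measurable)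
qed

lemma sets_PiM_p: "sets (PiM UNIV (\<lambda>_::nat. p)) = sets seqs"
 by (rule sets_PiM_cong) (auto simp: sets_p)

lemma measurable_PiM_p: "measurable (PiM UNIV (\<lambda>_::nat. p)) N = measurable seqs N"
 by (rule measurable_cong_sets) (auto simp: sets_PiM_p)

lemma first_cycle_distr: "distr M seqs (\<lambda>\<omega>. nth_cycle \<phi> 1 (\<lambda>m. \<xi> m \<omega>)) = PiM UNIV (\<lambda>_. p)"
proof (rule measure_eqI)
 show "sets (distr M seqs (\<lambda>\<omega>. nth_cycle \<phi> 1 (\<lambda>m. \<xi> m \<omega>))) = sets (PiM UNIV (\<lambda>_. p))"
  by (simp add: sets_PiM_p)
 fix A assume "A \<in> sets (distr M seqs (\<lambda>\<omega>. nth_cycle \<phi> 1 (\<lambda>m. \<xi> m \<omega>)))"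
 then have A[measurable]: "A \<in> sets seqs" by simp
 note [measurable] = noise_measurable
 have c: "nth_cycle \<phi> 1 s = drop_seq (ret \<phi> s) s" for s :: "nat \<Rightarrow> 'e"
  using cycle_Suc[of \<phi> 0 s] by (simp add: cycle_0)
 have "emeasure (distr M seqs (\<lambda>\<omega>. nth_cycle \<phi> 1 (\<lambda>m. \<xi> m \<omega>))) A = (\<integral>\<^sup>+\<omega>. indicator A (nth_cycle \<phi> 1 (\<lambda>m. \<xi> m \<omega>)) \<partial>M)"
  by (subst nn_integral_distr[symmetric, where M'=seqs and f="indicator A"]) auto
 also have "\<dots> = (\<integral>\<^sup>+\<omega>. 1 * indicator A (drop_seq (ret \<phi> (\<lambda>m. \<xi> m \<omega>)) (\<lambda>m. \<xi> m \<omega>)) \<partial>M)"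
  by (simp only: c mult_1)
 also have "\<dots> = (\<integral>\<^sup>+\<omega>. 1 \<partial>M) * (\<integral>\<^sup>+s. indicator A s \<partial>PiM UNIV (\<lambda>_. p))"
  by (rule strong_markov[where g="\<lambda>_. 1", OF _ _ adapted_const]) auto
 also have "\<dots> = emeasure (PiM UNIV (\<lambda>_. p)) A"
  by (simp add: sets_PiM_p emeasure_space_1)
 finally show "emeasure (distr M seqs (\<lambda>\<omega>. nth_cycle \<phi> 1 (\<lambda>m. \<xi> m \<omega>))) A = emeasure (PiM UNIV (\<lambda>_. p)) A" .
qed

end

text \<open>One application of the strong Markov property, after \<open>cycle_Suc\<close> has
  expressed the later cycles as cycles of the sequence shifted by its first return.\<close>

lemma cycles_product_Suc:
 fixes f :: "nat \<Rightarrow> (nat \<Rightarrow> 'e::topological_space) \<Rightarrow> ennreal"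
 assumes rn: "regenerative_noise \<phi> (PiM UNIV (\<lambda>_. p)) (\<lambda>m s. s m) p"
  and f: "\<And>i. f i \<in> borel_measurable seqs" and ad: "adapted \<phi> (f 0)" and F: "F \<in> borel_measurable seqs"
 shows "(\<integral>\<^sup>+s. (\<Prod>i<Suc n. f i (nth_cycle \<phi> i s)) * F (nth_cycle \<phi> (Suc n) s) \<partial>PiM UNIV (\<lambda>_. p))
   = (\<integral>\<^sup>+s. f 0 s \<partial>PiM UNIV (\<lambda>_. p)) *
    (\<integral>\<^sup>+s. (\<Prod>i<n. f (Suc i) (nth_cycle \<phi> i s)) * F (nth_cycle \<phi> n s) \<partial>PiM UNIV (\<lambda>_. p))"
proof -
 interpret regenerative_noise \<phi> "PiM UNIV (\<lambda>_. p)" "\<lambda>m s. s m" p by (rule rn)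
 have c: "(\<lambda>s. f (Suc i) (nth_cycle \<phi> i s)) \<in> borel_measurable seqs" for i
  by (rule cycle_compose_measurable) (rule f)
 have d: "(\<lambda>s. F (nth_cycle \<phi> n s)) \<in> borel_measurable seqs"
  by (rule cycle_compose_measurable) (rule F)
 have Fm: "(\<lambda>s. (\<Prod>i<n. f (Suc i) (nth_cycle \<phi> i s)) * F (nth_cycle \<phi> n s)) \<in> borel_measurable seqs"
  by (intro borel_measurable_times_ennreal borel_measurable_prod_ennreal c d)
 have "(\<integral>\<^sup>+s. (\<Prod>i<Suc n. f i (nth_cycle \<phi> i s)) * F (nth_cycle \<phi> (Suc n) s) \<partial>PiM UNIV (\<lambda>_. p))
  = (\<integral>\<^sup>+s. f 0 s * ((\<Prod>i<n. f (Suc i) (nth_cycle \<phi> i (drop_seq (ret \<phi> s) s))) * F (nth_cycle \<phi> n (drop_seq (ret \<phi> s) s))) \<partial>PiM UNIV (\<lambda>_. p))"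
  by (simp only: prod.lessThan_Suc_shift cycle_Suc cycle_0 mult.assoc)
 also have "\<dots> = (\<integral>\<^sup>+s. f 0 s \<partial>PiM UNIV (\<lambda>_. p)) * (\<integral>\<^sup>+s. (\<Prod>i<n. f (Suc i) (nth_cycle \<phi> i s)) * F (nth_cycle \<phi> n s) \<partial>PiM UNIV (\<lambda>_. p))"
  by (rule strong_markov[OF f Fm ad])
 finally show ?thesis .
qed

text \<open>The last factor \<open>F\<close> reads the whole remaining sequence. With constant
  \<open>f\<close> the identity gives the law of the sequence after \<open>n\<close> returns, with
  constant \<open>F\<close> the independence of the cycles.\<close>

lemma cycles_product:
 fixes f :: "nat \<Rightarrow> (nat \<Rightarrow> 'e::topological_space) \<Rightarrow> ennreal"
 assumes rn: "regenerative_noise \<phi> (PiM UNIV (\<lambda>_. p)) (\<lambda>m s. s m) p"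
  and f: "\<And>i. f i \<in> borel_measurable seqs" "\<And>i. adapted \<phi> (f i)" and F: "F \<in> borel_measurable seqs"
 shows "(\<integral>\<^sup>+s. (\<Prod>i<n. f i (nth_cycle \<phi> i s)) * F (nth_cycle \<phi> n s) \<partial>PiM UNIV (\<lambda>_. p))
   = (\<Prod>i<n. \<integral>\<^sup>+s. f i s \<partial>PiM UNIV (\<lambda>_. p)) * (\<integral>\<^sup>+s. F s \<partial>PiM UNIV (\<lambda>_. p))"
 using f
proof (induction n arbitrary: f)
 case 0
 show ?case by (simp add: cycle_0)
next
 case (Suc n)
 show ?case
  unfolding cycles_product_Suc[OF rn Suc.prems(1,2) F] Suc.IH[OF Suc.prems]
  by (simp only: prod.lessThan_Suc_shift mult.assoc)
qed

text \<open>It suffices to factorize over initial segments \<open>{..<n}\<close>: any finite index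
  set is filled up with the certain event.\<close>

lemma (in prob_space) indep_vars_of_products:
 assumes X: "\<And>i::nat. X i \<in> M \<rightarrow>\<^sub>M N"
  and prod: "\<And>n A. (\<And>i. A i \<in> sets N) \<Longrightarrow>
    (\<integral>\<^sup>+\<omega>. (\<Prod>i<n. indicator (A i) (X i \<omega>)) \<partial>M) = (\<Prod>i<n. \<integral>\<^sup>+\<omega>. indicator (A i) (X i \<omega>) \<partial>M)"
 shows "indep_vars (\<lambda>_. N) X UNIV"
 unfolding indep_vars_def2
proof (intro conjI ballI indep_setsI)
 show "random_variable N (X i)" for i by (rule X)
 show "{X i -` A \<inter> space M |A. A \<in> sets N} \<subseteq> events" for i
  using measurable_sets[OF X[of i]] by auto
 fix E and J :: "nat set"
 assume J: "J \<noteq> {}" "finite J" and E: "\<forall>j\<in>J. E j \<in> {X j -` A \<inter> space M |A. A \<in> sets N}"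
 then have "\<forall>j\<in>J. \<exists>A. A \<in> sets N \<and> E j = X j -` A \<inter> space M" by auto
 then obtain A where A: "\<And>j. j \<in> J \<Longrightarrow> A j \<in> sets N" "\<And>j. j \<in> J \<Longrightarrow> E j = X j -` A j \<inter> space M"
  by metis
 define A' where "A' j = (if j \<in> J then A j else space N)" for j
 have A': "A' j \<in> sets N" for j using A(1) by (simp add: A'_def)
 define n where "n = Suc (Max J)"
 have Jn: "J \<subseteq> {..<n}" unfolding n_def using J(2) Max_ge by (auto simp: less_Suc_eq_le)
 have ev: "X j -` A' j \<inter> space M \<in> events" for j using measurable_sets[OF X A'] .
 have i1: "(\<integral>\<^sup>+\<omega>. indicator (A' i) (X i \<omega>) \<partial>M) = ennreal (prob (X i -` A' i \<inter> space M))" for i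
 proof -
  have "(\<integral>\<^sup>+\<omega>. indicator (A' i) (X i \<omega>) \<partial>M) = (\<integral>\<^sup>+\<omega>. indicator (X i -` A' i \<inter> space M) \<omega> \<partial>M)"
   by (intro nn_integral_cong) (auto simp: indicator_def)
  then show ?thesis using ev by (simp add: emeasure_eq_measure)
 qed
 have "ennreal (prob (\<Inter>j\<in>J. E j)) = (\<integral>\<^sup>+\<omega>. indicator (\<Inter>j\<in>J. E j) \<omega> \<partial>M)"
  using J E measurable_sets[OF X] by (subst nn_integral_indicator) (auto intro!: sets.finite_INT simp: emeasure_eq_measure)
 also have "\<dots> = (\<integral>\<^sup>+\<omega>. (\<Prod>i<n. indicator (A' i) (X i \<omega>)) \<partial>M)"
 proof (rule nn_integral_cong)
  fix \<omega> assume \<omega>: "\<omega> \<in> space M"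
  have "(\<Prod>i<n. indicator (A' i) (X i \<omega>) :: ennreal) = (\<Prod>i\<in>J. indicator (A' i) (X i \<omega>))"
   using Jn measurable_space[OF X \<omega>] by (intro prod.mono_neutral_right) (auto simp: A'_def)
  also have "\<dots> = indicator (\<Inter>j\<in>J. E j) \<omega>"
  proof (cases "\<forall>j\<in>J. X j \<omega> \<in> A j")
   case True
   then show ?thesis using \<omega> A(2) by (auto simp: A'_def indicator_def intro!: prod.neutral)
  next
   case False
   then obtain j where j: "j \<in> J" "X j \<omega> \<notin> A j" by blast
   then have "(\<Prod>i\<in>J. indicator (A' i) (X i \<omega>) :: ennreal) = 0"
    using J(2) by (intro prod_zero) (auto simp: A'_def indicator_def intro!: bexI[of _ j])
   moreover have "\<omega> \<notin> (\<Inter>j\<in>J. E j)" using j A(2)[OF j(1)] by auto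
   ultimately show ?thesis by simp
  qed
  finally show "indicator (\<Inter>j\<in>J. E j) \<omega> = (\<Prod>i<n. indicator (A' i) (X i \<omega>) :: ennreal)" by simp
 qed
 also have "\<dots> = (\<Prod>i<n. ennreal (prob (X i -` A' i \<inter> space M)))"
  by (simp only: prod[OF A'] i1)
 also have "\<dots> = (\<Prod>i\<in>J. ennreal (prob (X i -` A' i \<inter> space M)))"
 proof (rule prod.mono_neutral_right)
  show "\<forall>i\<in>{..<n} - J. ennreal (prob (X i -` A' i \<inter> space M)) = 1"
  proof
   fix i assume "i \<in> {..<n} - J"
   then have "X i -` A' i \<inter> space M = space M" using measurable_space[OF X] by (auto simp: A'_def)
   then show "ennreal (prob (X i -` A' i \<inter> space M)) = 1" by (simp add: prob_space)
  qed
 qed (use Jn in auto)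
 also have "\<dots> = (\<Prod>i\<in>J. ennreal (prob (E i)))"
  by (rule prod.cong) (auto simp: A'_def A(2))
 also have "\<dots> = ennreal (\<Prod>i\<in>J. prob (E i))" by (rule prod_ennreal) simp
 finally show "prob (\<Inter>j\<in>J. E j) = (\<Prod>j\<in>J. prob (E j))"
  by (subst (asm) ennreal_inj) (auto intro: prod_nonneg)
qed

context regenerative_noise
begin

lemma coordinates_noise:
 assumes "AE s in PiM UNIV (\<lambda>_::nat. p). returns \<phi> s"
 shows "regenerative_noise \<phi> (PiM UNIV (\<lambda>_. p)) (\<lambda>m s. s m) p"
 by (rule regenerative_noise_coordinates[OF regenerative_axioms sets_p(2,1) assms])

lemma nn_integral_cycle_Suc:
 assumes "F \<in> borel_measurable seqs"
 shows "(\<integral>\<^sup>+\<omega>. F (nth_cycle \<phi> 1 (\<lambda>m. \<xi> m \<omega>)) \<partial>M) = (\<integral>\<^sup>+s. F s \<partial>PiM UNIV (\<lambda>_. p))"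
proof -
 have "(\<lambda>\<omega>. nth_cycle \<phi> 1 (\<lambda>m. \<xi> m \<omega>)) \<in> M \<rightarrow>\<^sub>M seqs"
  by (rule measurable_compose[OF noise_measurable cycle_measurable])
 from nn_integral_distr[OF this, of F] assms show ?thesis unfolding first_cycle_distr by (simp add: measurable_PiM_p)
qed

text \<open>Cycles are counted from \<open>Suc n\<close> because the first cycle contains entry 0,
  whose law may differ. One strong Markov step leads to the canonical model, where the product
  formula applies.\<close>

lemma cycles_iid:
 fixes G :: "(nat \<Rightarrow> 'e) \<Rightarrow> 'b"
 assumes ret: "AE s in PiM UNIV (\<lambda>_::nat. p). returns \<phi> s"
  and G[measurable]: "G \<in> seqs \<rightarrow>\<^sub>M N" and ad: "adapted \<phi> G"
 shows "iid M N (\<lambda>n \<omega>. G (nth_cycle \<phi> (Suc n) (\<lambda>m. \<xi> m \<omega>)))"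
  "distr M N (\<lambda>\<omega>. G (nth_cycle \<phi> (Suc n) (\<lambda>m. \<xi> m \<omega>))) = distr (PiM UNIV (\<lambda>_. p)) N G"
proof -
 note rn = coordinates_noise[OF ret]
 interpret P: prob_space "PiM UNIV (\<lambda>_::nat. p)" by (rule prob_space_PiM) (rule sets_p)
 note [measurable] = noise_measurable
 have cs: "nth_cycle \<phi> (Suc n) s = nth_cycle \<phi> n (nth_cycle \<phi> 1 s)" for n and s :: "nat \<Rightarrow> 'e"
  by (simp add: cycle_Suc cycle_0)
 have prodM: "(\<integral>\<^sup>+\<omega>. (\<Prod>i<n. indicator (A i) (G (nth_cycle \<phi> (Suc i) (\<lambda>m. \<xi> m \<omega>)))) \<partial>M)
   = (\<Prod>i<n. \<integral>\<^sup>+s. indicator (A i) (G s) \<partial>PiM UNIV (\<lambda>_. p))"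
  if A: "\<And>i. A i \<in> sets N" for n and A :: "nat \<Rightarrow> 'b set"
 proof -
  have fm: "(\<lambda>s. indicator (A i) (G s) :: ennreal) \<in> borel_measurable seqs" for i
   using A[of i] by measurable
  have "(\<integral>\<^sup>+\<omega>. (\<Prod>i<n. indicator (A i) (G (nth_cycle \<phi> (Suc i) (\<lambda>m. \<xi> m \<omega>)))) \<partial>M)
   = (\<integral>\<^sup>+s. (\<Prod>i<n. indicator (A i) (G (nth_cycle \<phi> i s))) \<partial>PiM UNIV (\<lambda>_. p))"
   unfolding cs by (rule nn_integral_cycle_Suc) (use A in measurable)
  also have "\<dots> = (\<Prod>i<n. \<integral>\<^sup>+s. indicator (A i) (G s) \<partial>PiM UNIV (\<lambda>_. p))"
  proof -
   have ad': "adapted \<phi> (\<lambda>s. indicator (A i) (G s) :: ennreal)" for i by (rule adapted_compose[OF ad])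
   show ?thesis using cycles_product[OF rn fm ad', where F="\<lambda>_. 1" and n=n] by (simp add: P.emeasure_space_1)
  qed
  finally show ?thesis .
 qed
 have single: "(\<integral>\<^sup>+\<omega>. indicator A (G (nth_cycle \<phi> (Suc n) (\<lambda>m. \<xi> m \<omega>))) \<partial>M) = (\<integral>\<^sup>+s. indicator A (G s) \<partial>PiM UNIV (\<lambda>_. p))"
  if A[measurable]: "A \<in> sets N" for A n
 proof -
  have "(\<integral>\<^sup>+\<omega>. indicator A (G (nth_cycle \<phi> (Suc n) (\<lambda>m. \<xi> m \<omega>))) \<partial>M) = (\<integral>\<^sup>+s. indicator A (G (nth_cycle \<phi> n s)) \<partial>PiM UNIV (\<lambda>_. p))"
   unfolding cs by (rule nn_integral_cycle_Suc) measurable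
  also have "\<dots> = (\<integral>\<^sup>+s. indicator A (G s) \<partial>PiM UNIV (\<lambda>_. p))"
   using cycles_product[OF rn, where f="\<lambda>i s. 1" and F="\<lambda>s. indicator A (G s)" and n=n] by (simp add: adapted_const P.emeasure_space_1)
  finally show ?thesis .
 qed
 have Xm[measurable]: "(\<lambda>\<omega>. G (nth_cycle \<phi> (Suc n) (\<lambda>m. \<xi> m \<omega>))) \<in> M \<rightarrow>\<^sub>M N" for n by measurable
 have GP: "G \<in> measurable (PiM UNIV (\<lambda>_. p)) N" unfolding measurable_PiM_p by (rule G)
 show D: "distr M N (\<lambda>\<omega>. G (nth_cycle \<phi> (Suc n) (\<lambda>m. \<xi> m \<omega>))) = distr (PiM UNIV (\<lambda>_. p)) N G" for n
 proof (rule measure_eqI)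
  fix A assume "A \<in> sets (distr M N (\<lambda>\<omega>. G (nth_cycle \<phi> (Suc n) (\<lambda>m. \<xi> m \<omega>))))"
  then have A: "A \<in> sets N" by simp
  have "emeasure (distr M N (\<lambda>\<omega>. G (nth_cycle \<phi> (Suc n) (\<lambda>m. \<xi> m \<omega>)))) A = (\<integral>\<^sup>+\<omega>. indicator A (G (nth_cycle \<phi> (Suc n) (\<lambda>m. \<xi> m \<omega>))) \<partial>M)"
   using nn_integral_distr[OF Xm, of "indicator A" n] A by simp
  also have "\<dots> = (\<integral>\<^sup>+s. indicator A (G s) \<partial>PiM UNIV (\<lambda>_. p))" by (rule single[OF A])
  also have "\<dots> = emeasure (distr (PiM UNIV (\<lambda>_. p)) N G) A"
   using nn_integral_distr[OF GP, of "indicator A"] A by simp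
  finally show "emeasure (distr M N (\<lambda>\<omega>. G (nth_cycle \<phi> (Suc n) (\<lambda>m. \<xi> m \<omega>)))) A = emeasure (distr (PiM UNIV (\<lambda>_. p)) N G) A" .
 qed simp
 show "iid M N (\<lambda>n \<omega>. G (nth_cycle \<phi> (Suc n) (\<lambda>m. \<xi> m \<omega>)))"
  unfolding iid_def
 proof
  show "indep_vars (\<lambda>_. N) (\<lambda>n \<omega>. G (nth_cycle \<phi> (Suc n) (\<lambda>m. \<xi> m \<omega>))) UNIV"
  proof (rule indep_vars_of_products[OF Xm])
   fix n :: nat and A :: "nat \<Rightarrow> 'b set" assume A: "\<And>i. A i \<in> sets N"
   show "(\<integral>\<^sup>+\<omega>. (\<Prod>i<n. indicator (A i) (G (nth_cycle \<phi> (Suc i) (\<lambda>m. \<xi> m \<omega>)))) \<partial>M) = (\<Prod>i<n. \<integral>\<^sup>+\<omega>. indicator (A i) (G (nth_cycle \<phi> (Suc i) (\<lambda>m. \<xi> m \<omega>))) \<partial>M)"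
    unfolding prodM[OF A] single[OF A] ..
  qed
  show "\<forall>n. distr M N (\<lambda>\<omega>. G (nth_cycle \<phi> (Suc n) (\<lambda>m. \<xi> m \<omega>))) = distr M N (\<lambda>\<omega>. G (nth_cycle \<phi> (Suc 0) (\<lambda>m. \<xi> m \<omega>)))"
   by (simp only: D) simp
 qed
qed

lemma cycles_distr:
 assumes ret: "AE s in PiM UNIV (\<lambda>_::nat. p). returns \<phi> s"
 shows "distr M seqs (\<lambda>\<omega>. nth_cycle \<phi> (Suc n) (\<lambda>m. \<xi> m \<omega>)) = PiM UNIV (\<lambda>_. p)"
proof (rule measure_eqI)
 show "sets (distr M seqs (\<lambda>\<omega>. nth_cycle \<phi> (Suc n) (\<lambda>m. \<xi> m \<omega>))) = sets (PiM UNIV (\<lambda>_. p))" by (simp add: sets_PiM_p)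
 interpret P: prob_space "PiM UNIV (\<lambda>_::nat. p)" by (rule prob_space_PiM) (rule sets_p)
 note [measurable] = noise_measurable
 fix A assume "A \<in> sets (distr M seqs (\<lambda>\<omega>. nth_cycle \<phi> (Suc n) (\<lambda>m. \<xi> m \<omega>)))"
 then have A[measurable]: "A \<in> sets seqs" by simp
 have cs: "nth_cycle \<phi> (Suc n) s = nth_cycle \<phi> n (nth_cycle \<phi> 1 s)" for s :: "nat \<Rightarrow> 'e"
  by (simp add: cycle_Suc cycle_0)
 have "emeasure (distr M seqs (\<lambda>\<omega>. nth_cycle \<phi> (Suc n) (\<lambda>m. \<xi> m \<omega>))) A = (\<integral>\<^sup>+\<omega>. indicator A (nth_cycle \<phi> (Suc n) (\<lambda>m. \<xi> m \<omega>)) \<partial>M)"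
  by (subst nn_integral_distr[symmetric, where M'=seqs and f="indicator A"]) auto
 also have "\<dots> = (\<integral>\<^sup>+s. indicator A (nth_cycle \<phi> n s) \<partial>PiM UNIV (\<lambda>_. p))"
  unfolding cs by (rule nn_integral_cycle_Suc) measurable
 also have "\<dots> = emeasure (PiM UNIV (\<lambda>_. p)) A"
  using cycles_product[OF coordinates_noise[OF ret], where f="\<lambda>i s. 1" and F="indicator A" and n=n]
  by (simp add: adapted_const P.emeasure_space_1 sets_PiM_p)
 finally show "emeasure (distr M seqs (\<lambda>\<omega>. nth_cycle \<phi> (Suc n) (\<lambda>m. \<xi> m \<omega>))) A = emeasure (PiM UNIV (\<lambda>_. p)) A" .
qed

lemma cycles_AE:
 assumes ret: "AE s in PiM UNIV (\<lambda>_::nat. p). returns \<phi> s"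
  and Q: "AE s in PiM UNIV (\<lambda>_::nat. p). Q s"
 shows "AE \<omega> in M. \<forall>n. Q (nth_cycle \<phi> (Suc n) (\<lambda>m. \<xi> m \<omega>))"
 unfolding AE_all_countable
proof
 fix n
 note [measurable] = noise_measurable
 have "AE s in distr M seqs (\<lambda>\<omega>. nth_cycle \<phi> (Suc n) (\<lambda>m. \<xi> m \<omega>)). Q s" unfolding cycles_distr[OF ret] by (rule Q)
 from AE_distrD[OF _ this] show "AE \<omega> in M. Q (nth_cycle \<phi> (Suc n) (\<lambda>m. \<xi> m \<omega>))" by measurable
qed

end

section \<open>Random walks with negative drift\<close>

text \<open>Moments of centered random walks: the increments of \<open>n \<mapsto> E (S n)\<^sup>q\<close> only involve moments of
 order at most \<open>q - 2\<close>, so the growth exponent increases by one every second step.\<close>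

lemma moment_recursion_bound:
 fixes a :: "nat \<Rightarrow> nat \<Rightarrow> real" and m :: "nat \<Rightarrow> real"
 assumes rec: "\<And>q n. q \<le> N \<Longrightarrow> a q (Suc n) = (\<Sum>j\<le>q. real (q choose j) * m j * a (q - j) n)"
  and a0: "\<And>q. a q 0 = 0 ^ q" and m: "m 0 = 1" "m 1 = 0" and "q \<le> N"
 shows "\<exists>C\<ge>0. \<forall>n. \<bar>a q n\<bar> \<le> C * real n ^ (q div 2)"
 using \<open>q \<le> N\<close>
proof (induction q rule: less_induct)
 case (less q)
 consider "q = 0" | "q = 1" | "q \<ge> 2" by linarith
 then show ?case
 proof cases
  case 1
  have "a 0 n = 1" for n by (induction n) (auto simp: a0 rec m)
  then show ?thesis using 1 by (intro exI[of _ 1]) auto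
 next
  case 2
  have "a 1 n = 0" for n
  proof (induction n)
   case (Suc n)
   have "a 1 (Suc n) = (\<Sum>j\<le>1. real (1 choose j) * m j * a (1 - j) n)" by (rule rec) (use 2 less.prems in simp)
   also have "{..1} = {0, 1::nat}" by auto
   finally show ?case using Suc m by simp
  qed (simp add: a0)
  then show ?thesis using 2 by (intro exI[of _ 0]) auto
 next
  case 3
  have "\<forall>r. \<exists>C. r < q \<longrightarrow> C \<ge> 0 \<and> (\<forall>n. \<bar>a r n\<bar> \<le> C * real n ^ (r div 2))"
   using less.IH less.prems by (meson less_imp_le_nat order_trans)
  then obtain C where C: "\<And>r. r < q \<Longrightarrow> C r \<ge> 0" "\<And>r n. r < q \<Longrightarrow> \<bar>a r n\<bar> \<le> C r * real n ^ (r div 2)"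
   by metis
  \<comment> \<open>For \<open>j >= 2\<close> the exponent \<open>(q - j) div 2\<close> is at most
    \<open>q div 2 - 1\<close>; summation of the increments restores the missing power of
    \<open>n\<close>.\<close>
  define e where "e = q div 2 - 1"
  have e: "Suc e = q div 2" using 3 by (simp add: e_def)
  define K where "K = (\<Sum>j\<in>{2..q}. real (q choose j) * \<bar>m j\<bar> * C (q - j))"
  have K: "K \<ge> 0" unfolding K_def using 3 C(1) by (intro sum_nonneg mult_nonneg_nonneg) auto
  have step: "\<bar>a q (Suc n) - a q n\<bar> \<le> K * real (Suc n) ^ e" for n
  proof -
   have "a q (Suc n) = (\<Sum>j\<le>q. real (q choose j) * m j * a (q - j) n)" by (rule rec[OF less.prems])
   also have "{..q} = insert 0 (insert 1 {2..q})" using 3 by auto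
   also have "(\<Sum>j\<in>insert 0 (insert 1 {2..q}). real (q choose j) * m j * a (q - j) n)
     = a q n + (\<Sum>j\<in>{2..q}. real (q choose j) * m j * a (q - j) n)"
    by (simp add: m[unfolded One_nat_def] m)
   finally have "\<bar>a q (Suc n) - a q n\<bar> = \<bar>\<Sum>j\<in>{2..q}. real (q choose j) * m j * a (q - j) n\<bar>" by simp
   also have "\<dots> \<le> (\<Sum>j\<in>{2..q}. \<bar>real (q choose j) * m j * a (q - j) n\<bar>)" by (rule sum_abs)
   also have "\<dots> \<le> (\<Sum>j\<in>{2..q}. real (q choose j) * \<bar>m j\<bar> * C (q - j) * real (Suc n) ^ e)"
   proof (rule sum_mono)
    fix j assume j: "j \<in> {2..q}"
    then have lt: "q - j < q" by auto
    have "real n ^ ((q - j) div 2) \<le> real (Suc n) ^ ((q - j) div 2)" by (intro power_mono) auto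
    also have "\<dots> \<le> real (Suc n) ^ e"
     by (intro power_increasing) (use j e in \<open>auto simp: e_def\<close>)
    finally have "\<bar>a (q - j) n\<bar> \<le> C (q - j) * real (Suc n) ^ e"
     using C(2)[OF lt, of n] C(1)[OF lt] by (meson mult_left_mono order_trans)
    then have "real (q choose j) * \<bar>m j\<bar> * \<bar>a (q - j) n\<bar> \<le> real (q choose j) * \<bar>m j\<bar> * (C (q - j) * real (Suc n) ^ e)"
     by (intro mult_left_mono) auto
    then show "\<bar>real (q choose j) * m j * a (q - j) n\<bar> \<le> real (q choose j) * \<bar>m j\<bar> * C (q - j) * real (Suc n) ^ e"
     by (simp add: abs_mult mult.assoc)
   qed
   also have "\<dots> = K * real (Suc n) ^ e" unfolding K_def by (simp add: sum_distrib_right)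
   finally show ?thesis .
  qed
  have "\<bar>a q n\<bar> \<le> K * (real n * real n ^ e)" for n
  proof -
   have "\<bar>a q n\<bar> \<le> (\<Sum>i<n. K * real (Suc i) ^ e)"
   proof (induction n)
    case 0
    then show ?case using 3 by (simp add: a0 zero_power)
   next
    case (Suc n)
    then show ?case using step[of n] by simp
   qed
   also have "\<dots> \<le> (\<Sum>i<n. K * real n ^ e)"
    using K by (intro sum_mono mult_left_mono power_mono) auto
   finally show ?thesis by (simp add: mult.left_commute)
  qed
  then show ?thesis using K by (intro exI[of _ K]) (auto simp: e[symmetric])
 qed
qed

context prob_space
begin

text \<open>The binomial theorem and the independence of the newest summand from the earlier sum
  produce exactly the recursion of \<open>moment_recursion_bound\<close>.\<close>

lemma centered_sum_moment:
 fixes X :: "nat \<Rightarrow> 'a \<Rightarrow> real"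
 assumes X: "iid M borel X" and int: "\<And>q. q \<le> N \<Longrightarrow> integrable M (\<lambda>\<omega>. X 0 \<omega> ^ q)" and mean: "expectation (X 0) = 0"
  and "q \<le> N"
 shows "integrable M (\<lambda>\<omega>. (\<Sum>k<n. X k \<omega>) ^ q)"
  "\<exists>C\<ge>0. \<forall>n. \<bar>expectation (\<lambda>\<omega>. (\<Sum>k<n. X k \<omega>) ^ q)\<bar> \<le> C * real n ^ (q div 2)"
proof -
 note [measurable] = iid_measurable[OF X]
 define S where "S n \<omega> = (\<Sum>k<n. X k \<omega>)" for n \<omega>
 define m where "m j = expectation (\<lambda>\<omega>. X 0 \<omega> ^ j)" for j
 have Xint: "integrable M (\<lambda>\<omega>. X n \<omega> ^ j)" if "j \<le> N" for n j
  using iid_integrable[OF X, of "\<lambda>x. x ^ j" n] int[OF that] by simp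
 have Xm: "expectation (\<lambda>\<omega>. X n \<omega> ^ j) = m j" for n j
  using iid_integral[OF X, of "\<lambda>x. x ^ j" n] by (simp add: m_def)
 have ind: "indep_var borel (\<lambda>\<omega>. X n \<omega> ^ j) borel (\<lambda>\<omega>. S n \<omega> ^ i)" for n i j
 proof -
  have "indep_var borel (X n) borel (\<lambda>\<omega>. \<Sum>k<n. X k \<omega>)"
   by (rule indep_vars_sum) (auto intro: indep_vars_subset[OF iid_indep[OF X]])
  from indep_var_compose[OF this, of "\<lambda>x. x ^ j" borel "\<lambda>x. x ^ i" borel]
  show ?thesis by (simp add: comp_def S_def)
 qed
 have expand: "S (Suc n) \<omega> ^ q = (\<Sum>j\<le>q. real (q choose j) * (X n \<omega> ^ j * S n \<omega> ^ (q - j)))" for n \<omega> q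
  unfolding S_def sum.lessThan_Suc add.commute[of _ "X n \<omega>"] binomial_ring by (simp add: mult.assoc)
 have Sint: "integrable M (\<lambda>\<omega>. S n \<omega> ^ q)" if "q \<le> N" for n q
  using that
 proof (induction n arbitrary: q)
  case 0
  show ?case by (simp add: S_def)
 next
  case (Suc n)
  have "integrable M (\<lambda>\<omega>. X n \<omega> ^ j * S n \<omega> ^ (q - j))" if "j \<le> q" for j
   by (rule indep_var_integrable[OF ind]) (use Xint Suc that in auto)
  then show ?case unfolding expand by (intro Bochner_Integration.integrable_sum integrable_mult_right) auto
 qed
 show "integrable M (\<lambda>\<omega>. (\<Sum>k<n. X k \<omega>) ^ q)"
  using Sint[OF \<open>q \<le> N\<close>, of n] by (simp add: S_def)
 have rec: "expectation (\<lambda>\<omega>. S (Suc n) \<omega> ^ q) = (\<Sum>j\<le>q. real (q choose j) * m j * expectation (\<lambda>\<omega>. S n \<omega> ^ (q - j)))"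
  if "q \<le> N" for q n
 proof -
  have i: "integrable M (\<lambda>\<omega>. X n \<omega> ^ j * S n \<omega> ^ (q - j))"
   "expectation (\<lambda>\<omega>. X n \<omega> ^ j * S n \<omega> ^ (q - j)) = m j * expectation (\<lambda>\<omega>. S n \<omega> ^ (q - j))" if "j \<le> q" for j
   using indep_var_integrable[OF ind, of n j "q - j"] indep_var_lebesgue_integral[OF ind, of n j "q - j"]
    Xint[of j n] Sint[of "q - j" n] that \<open>q \<le> N\<close> Xm[of n j] by auto
  have "expectation (\<lambda>\<omega>. S (Suc n) \<omega> ^ q) = (\<Sum>j\<le>q. expectation (\<lambda>\<omega>. real (q choose j) * (X n \<omega> ^ j * S n \<omega> ^ (q - j))))"
   unfolding expand by (rule Bochner_Integration.integral_sum) (auto intro!: integrable_mult_right i)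
  also have "\<dots> = (\<Sum>j\<le>q. real (q choose j) * m j * expectation (\<lambda>\<omega>. S n \<omega> ^ (q - j)))"
   by (intro sum.cong refl) (simp add: i)
  finally show ?thesis .
 qed
 have "\<exists>C\<ge>0. \<forall>n. \<bar>expectation (\<lambda>\<omega>. S n \<omega> ^ q)\<bar> \<le> C * real n ^ (q div 2)"
  by (rule moment_recursion_bound[where a="\<lambda>q n. expectation (\<lambda>\<omega>. S n \<omega> ^ q)" and m=m and N=N, OF rec])
    (use \<open>q \<le> N\<close> mean in \<open>auto simp: S_def m_def prob_space power_0_left\<close>)
 then show "\<exists>C\<ge>0. \<forall>n. \<bar>expectation (\<lambda>\<omega>. (\<Sum>k<n. X k \<omega>) ^ q)\<bar> \<le> C * real n ^ (q div 2)"
  by (simp add: S_def)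
qed

text \<open>Positivity of the sum means that the centered sum exceeds \<open>n * \<delta>\<close>.
  Markov's inequality with the tenth power sets a moment of order \<open>n ^ 5\<close> against
  \<open>(n * \<delta>) ^ 10\<close>.\<close>

lemma negative_drift_tail:
 fixes X :: "nat \<Rightarrow> 'a \<Rightarrow> real"
 assumes X: "iid M borel X" and int: "integrable M (\<lambda>\<omega>. X 0 \<omega> ^ 10)" and mean: "expectation (X 0) < 0"
 shows "\<exists>C>0. \<forall>n. prob {\<omega>\<in>space M. 0 < (\<Sum>k<n. X k \<omega>)} \<le> C / real (Suc n) ^ 5"
proof -
 note [measurable] = iid_measurable[OF X]
 define \<delta> where "\<delta> = - expectation (X 0)"
 have \<delta>: "\<delta> > 0" using mean by (simp add: \<delta>_def)
 have pow_le: "\<bar>x\<bar> ^ q \<le> 1 + x ^ 10" if "q \<le> 10" for x :: real and q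
 proof (cases "\<bar>x\<bar> \<le> 1")
  case True
  then have "\<bar>x\<bar> ^ q \<le> 1" by (intro power_le_one) auto
  moreover have "0 \<le> x ^ 10" by simp
  ultimately show ?thesis by linarith
 next
  case False
  then have "\<bar>x\<bar> ^ q \<le> \<bar>x\<bar> ^ 10" using that by (intro power_increasing) auto
  then show ?thesis by (simp add: power_even_abs)
 qed
 have X_int: "integrable M (\<lambda>\<omega>. X 0 \<omega> ^ q)" if "q \<le> 10" for q
  by (rule Bochner_Integration.integrable_bound[of M "\<lambda>\<omega>. 1 + X 0 \<omega> ^ 10"])
    (use int pow_le[OF that] in \<open>auto simp: power_abs intro: order_trans[OF _ abs_ge_self]\<close>)
 define Y where "Y k \<omega> = X k \<omega> + \<delta>" for k \<omega>
 have Y: "iid M borel Y" unfolding Y_def by (rule iid_compose[OF X, of "\<lambda>x. x + \<delta>"]) simp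
 have Y_int: "integrable M (\<lambda>\<omega>. Y 0 \<omega> ^ q)" if "q \<le> 10" for q
  unfolding Y_def binomial_ring
  by (intro Bochner_Integration.integrable_sum integrable_mult_left integrable_mult_right X_int) (use that in auto)
 have Y_mean: "expectation (Y 0) = 0"
 proof -
  have "integrable M (X 0)" using X_int[of 1] by simp
  then have "expectation (\<lambda>\<omega>. X 0 \<omega> + \<delta>) = expectation (X 0) + \<delta>" by (simp add: prob_space)
  then show ?thesis by (simp add: Y_def[abs_def] \<delta>_def)
 qed
 obtain C0 where C0: "C0 \<ge> 0" "\<And>n. \<bar>expectation (\<lambda>\<omega>. (\<Sum>k<n. Y k \<omega>) ^ 10)\<bar> \<le> C0 * real n ^ 5"
  using centered_sum_moment(2)[OF Y Y_int Y_mean, of 10 10] by auto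
 \<comment> \<open>The factor \<open>32 = 2 ^ 5\<close> pays for passing from \<open>n\<close> to
   \<open>Suc n\<close> in the denominator; the maximum with 1 keeps \<open>C\<close>
   positive.\<close>
 define C where "C = max 1 (32 * (C0 / \<delta> ^ 10))"
 have "prob {\<omega>\<in>space M. 0 < (\<Sum>k<n. X k \<omega>)} \<le> C / real (Suc n) ^ 5" for n
 proof (cases "n = 0")
  case True
  then show ?thesis by (simp add: C_def)
 next
  case False
  then have n: "real n > 0" by simp
  have i10: "integrable M (\<lambda>\<omega>. (\<Sum>k<n. Y k \<omega>) ^ 10)"
   by (rule centered_sum_moment(1)[OF Y Y_int Y_mean]) auto
  have [measurable]: "Y k \<in> borel_measurable M" for k by (rule iid_measurable[OF Y])
  have "prob {\<omega>\<in>space M. 0 < (\<Sum>k<n. X k \<omega>)} \<le> prob {\<omega>\<in>space M. (real n * \<delta>) ^ 10 \<le> (\<Sum>k<n. Y k \<omega>) ^ 10}"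
  proof (rule finite_measure_mono)
   show "{\<omega>\<in>space M. 0 < (\<Sum>k<n. X k \<omega>)} \<subseteq> {\<omega>\<in>space M. (real n * \<delta>) ^ 10 \<le> (\<Sum>k<n. Y k \<omega>) ^ 10}"
   proof (intro subsetI CollectI conjI)
    fix \<omega> assume \<omega>: "\<omega> \<in> {\<omega>\<in>space M. 0 < (\<Sum>k<n. X k \<omega>)}"
    then show "\<omega> \<in> space M" by simp
    have "(\<Sum>k<n. Y k \<omega>) = (\<Sum>k<n. X k \<omega>) + real n * \<delta>" by (simp add: Y_def sum.distrib)
    then have "real n * \<delta> \<le> (\<Sum>k<n. Y k \<omega>)" using \<omega> by simp
    then show "(real n * \<delta>) ^ 10 \<le> (\<Sum>k<n. Y k \<omega>) ^ 10" using \<delta> by (intro power_mono) auto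
   qed
  qed measurable
  also have "\<dots> \<le> expectation (\<lambda>\<omega>. (\<Sum>k<n. Y k \<omega>) ^ 10) / (real n * \<delta>) ^ 10"
   by (rule integral_Markov_inequality_measure[OF i10, where A="{}"]) (use n \<delta> in auto)
  also have "\<dots> \<le> C0 * real n ^ 5 / (real n * \<delta>) ^ 10"
   using C0(2)[of n] by (intro divide_right_mono) (auto simp: abs_le_iff)
  also have "\<dots> = (C0 / \<delta> ^ 10) / real n ^ 5"
   using n \<delta> by (simp add: power_mult_distrib field_simps)
  also have "\<dots> \<le> (C0 / \<delta> ^ 10) * (32 / real (Suc n) ^ 5)"
  proof -
   have "real (Suc n) \<le> 2 * real n" using n by simp
   then have "real (Suc n) ^ 5 \<le> (2 * real n) ^ 5" by (intro power_mono) auto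
   then have "real (Suc n) ^ 5 \<le> 32 * real n ^ 5" by (simp only: power_mult_distrib) simp
   then have "1 / real n ^ 5 \<le> 32 / real (Suc n) ^ 5" using n by (simp add: field_simps)
   from mult_left_mono[OF this, of "C0 / \<delta> ^ 10"] C0(1) \<delta> show ?thesis by simp
  qed
  also have "\<dots> \<le> C / real (Suc n) ^ 5"
  proof -
   have "(C0 / \<delta> ^ 10) * (32 / real (Suc n) ^ 5) = (32 * (C0 / \<delta> ^ 10)) / real (Suc n) ^ 5" by (simp del: of_nat_Suc)
   also have "\<dots> \<le> C / real (Suc n) ^ 5" unfolding C_def by (intro divide_right_mono max.cobounded2) simp
   finally show ?thesis .
  qed
  finally show ?thesis .
 qed
 moreover have "C > 0" by (simp add: C_def)
 ultimately show ?thesis by blast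
qed

end

text \<open>Hoelder's inequality with exponents 4 and 4/3, obtained by using the Cauchy-Schwarz
  inequality twice with the same weights.\<close>

lemma fourth_power_sum_le:
 fixes y w :: "'i \<Rightarrow> real"
 assumes "\<And>k. k \<in> I \<Longrightarrow> w k > 0"
 shows "(\<Sum>k\<in>I. y k) ^ 4 \<le> (\<Sum>k\<in>I. w k) ^ 3 * (\<Sum>k\<in>I. (y k) ^ 4 / (w k) ^ 3)"
proof -
 have cs: "(\<Sum>k\<in>I. z k)\<^sup>2 \<le> (\<Sum>k\<in>I. w k) * (\<Sum>k\<in>I. (z k)\<^sup>2 / w k)" for z
 proof -
  have "(\<Sum>k\<in>I. z k)\<^sup>2 = (\<Sum>k\<in>I. sqrt (w k) * (z k / sqrt (w k)))\<^sup>2"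
   using assms by (intro arg_cong[of _ _ "\<lambda>x. x\<^sup>2"] sum.cong) (auto simp: less_imp_neq[symmetric])
  also have "\<dots> \<le> (\<Sum>k\<in>I. (sqrt (w k))\<^sup>2) * (\<Sum>k\<in>I. (z k / sqrt (w k))\<^sup>2)"
   by (rule Cauchy_Schwarz_ineq_sum)
  also have "(\<Sum>k\<in>I. (sqrt (w k))\<^sup>2) = (\<Sum>k\<in>I. w k)"
   using assms by (intro sum.cong) (auto simp: less_imp_le)
  also have "(\<Sum>k\<in>I. (z k / sqrt (w k))\<^sup>2) = (\<Sum>k\<in>I. (z k)\<^sup>2 / w k)"
   using assms by (intro sum.cong) (auto simp: less_imp_le power_divide)
  finally show ?thesis .
 qed
 have w0: "0 \<le> (\<Sum>k\<in>I. w k)" using assms by (intro sum_nonneg) (auto intro: less_imp_le)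
 have "(\<Sum>k\<in>I. y k) ^ 4 = ((\<Sum>k\<in>I. y k)\<^sup>2)\<^sup>2" by simp
 also have "\<dots> \<le> ((\<Sum>k\<in>I. w k) * (\<Sum>k\<in>I. (y k)\<^sup>2 / w k))\<^sup>2"
  by (intro power_mono cs) simp
 also have "\<dots> = (\<Sum>k\<in>I. w k)\<^sup>2 * (\<Sum>k\<in>I. (y k)\<^sup>2 / w k)\<^sup>2" by (rule power_mult_distrib)
 also have "\<dots> \<le> (\<Sum>k\<in>I. w k)\<^sup>2 * ((\<Sum>k\<in>I. w k) * (\<Sum>k\<in>I. ((y k)\<^sup>2 / w k)\<^sup>2 / w k))"
  by (intro mult_left_mono cs) simp
 also have "\<dots> = (\<Sum>k\<in>I. w k) ^ 3 * (\<Sum>k\<in>I. (y k) ^ 4 / (w k) ^ 3)"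
 proof -
  have "((y k)\<^sup>2 / w k)\<^sup>2 / w k = (y k) ^ 4 / (w k) ^ 3" for k
   by (simp add: power_divide power2_eq_square power3_eq_cube power4_eq_xxxx)
  moreover have "W\<^sup>2 * (W * R) = W ^ 3 * R" for W R :: real by (simp add: power2_eq_square power3_eq_cube)
  ultimately show ?thesis by simp
 qed
 finally show ?thesis .
qed

text \<open>The exponent \<open>7/6\<close> balances Hoelder's inequality: \<open>(k + 1) powr (- 7/6)\<close> and
 \<open>(k + 1) powr (3 * 7/6 - 5)\<close> are both summable.\<close>

lemma fourth_moment_sum_bound:
 fixes y :: "nat \<Rightarrow> 'a \<Rightarrow> real"
 assumes y[measurable]: "\<And>k. y k \<in> borel_measurable M" and C: "C \<ge> 0"
  and b: "\<And>k. (\<integral>\<^sup>+\<omega>. ennreal ((y k \<omega>) ^ 4) \<partial>M) \<le> ennreal (C / real (Suc k) ^ 5)"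
 shows "\<exists>K\<ge>0. \<forall>n. (\<integral>\<^sup>+\<omega>. ennreal ((\<Sum>k<n. y k \<omega>) ^ 4) \<partial>M) \<le> ennreal K"
proof -
 define w where "w k = real (Suc k) powr (- (7/6))" for k
 have w: "w k > 0" for k by (simp add: w_def)
 have sw: "summable w"
  unfolding w_def using summable_real_powr_iff[of "- (7/6)"] by (subst summable_Suc_iff) auto
 define W where "W = suminf w"
 have W: "(\<Sum>k<n. w k) \<le> W" for n
  unfolding W_def by (rule sum_le_suminf[OF sw]) (use w in \<open>auto intro: less_imp_le\<close>)
 have W0: "W \<ge> 0" using W[of 0] by simp
 define u where "u k = C / real (Suc k) ^ 5 / (w k) ^ 3" for k
 \<comment> \<open>The exponent is \<open>- 5 + 3 * (7/6) = - 3/2\<close>.\<close>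
 have u: "u k = C * real (Suc k) powr (- (3/2))" for k
 proof -
  have "(w k) ^ 3 = real (Suc k) powr (- (7/2))"
   by (simp add: w_def powr_power del: of_nat_Suc)
  moreover have "real (Suc k) ^ 5 = real (Suc k) powr 5" by (simp add: powr_numeral del: of_nat_Suc)
  ultimately have "u k = C * (1 / (real (Suc k) powr 5 * real (Suc k) powr (- (7/2))))" by (simp add: u_def)
  also have "real (Suc k) powr 5 * real (Suc k) powr (- (7/2)) = real (Suc k) powr (3/2)"
   by (subst powr_add[symmetric]) simp
  also have "1 / real (Suc k) powr (3/2) = real (Suc k) powr (- (3/2))" by (simp add: powr_minus_divide del: of_nat_Suc)
  finally show ?thesis .
 qed
 have su: "summable u"
 proof -
  have "summable (\<lambda>k. real (Suc k) powr (- (3/2)))"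
   using summable_real_powr_iff[of "- (3/2)"] by (subst summable_Suc_iff) auto
  then show ?thesis unfolding u[abs_def] by (rule summable_mult)
 qed
 have u0: "u k \<ge> 0" for k unfolding u using C by simp
 define U where "U = suminf u"
 have U: "(\<Sum>k<n. u k) \<le> U" for n unfolding U_def by (rule sum_le_suminf[OF su]) (use u0 in auto)
 have U0: "U \<ge> 0" using U[of 0] by simp
 have "(\<integral>\<^sup>+\<omega>. ennreal ((\<Sum>k<n. y k \<omega>) ^ 4) \<partial>M) \<le> ennreal (W ^ 3 * U)" for n
 proof -
  have "(\<integral>\<^sup>+\<omega>. ennreal ((\<Sum>k<n. y k \<omega>) ^ 4) \<partial>M) \<le> (\<integral>\<^sup>+\<omega>. ennreal (W ^ 3) * (\<Sum>k<n. ennreal (1 / (w k) ^ 3) * ennreal ((y k \<omega>) ^ 4)) \<partial>M)"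
  proof (rule nn_integral_mono)
   fix \<omega>
   have "(\<Sum>k<n. y k \<omega>) ^ 4 \<le> (\<Sum>k<n. w k) ^ 3 * (\<Sum>k<n. (y k \<omega>) ^ 4 / (w k) ^ 3)"
    by (rule fourth_power_sum_le) (rule w)
   also have "\<dots> \<le> W ^ 3 * (\<Sum>k<n. (y k \<omega>) ^ 4 / (w k) ^ 3)"
    using W[of n] w[THEN less_imp_le] by (intro mult_right_mono power_mono sum_nonneg) (auto intro: divide_nonneg_nonneg)
   finally have "ennreal ((\<Sum>k<n. y k \<omega>) ^ 4) \<le> ennreal (W ^ 3 * (\<Sum>k<n. (y k \<omega>) ^ 4 / (w k) ^ 3))"
    by (rule ennreal_leI)
   also have "\<dots> = ennreal (W ^ 3) * (\<Sum>k<n. ennreal (1 / (w k) ^ 3) * ennreal ((y k \<omega>) ^ 4))"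
   proof -
    have nn: "0 \<le> (y k \<omega>) ^ 4 / (w k) ^ 3" for k using w[of k] by (simp add: less_imp_le)
    have "ennreal (1 / (w k) ^ 3) * ennreal ((y k \<omega>) ^ 4) = ennreal ((y k \<omega>) ^ 4 / (w k) ^ 3)" for k
     using w[of k] by (subst ennreal_mult[symmetric]) (simp_all add: less_imp_le)
    then have "(\<Sum>k<n. ennreal (1 / (w k) ^ 3) * ennreal ((y k \<omega>) ^ 4)) = ennreal (\<Sum>k<n. (y k \<omega>) ^ 4 / (w k) ^ 3)"
     by (simp only: sum_ennreal[OF nn])
    then show ?thesis using W0 nn by (simp only: ennreal_mult zero_le_power sum_nonneg)
   qed
   finally show "ennreal ((\<Sum>k<n. y k \<omega>) ^ 4) \<le> ennreal (W ^ 3) * (\<Sum>k<n. ennreal (1 / (w k) ^ 3) * ennreal ((y k \<omega>) ^ 4))" .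
  qed
  also have "\<dots> = ennreal (W ^ 3) * (\<Sum>k<n. ennreal (1 / (w k) ^ 3) * (\<integral>\<^sup>+\<omega>. ennreal ((y k \<omega>) ^ 4) \<partial>M))"
   by (simp add: nn_integral_cmult nn_integral_sum)
  also have "\<dots> \<le> ennreal (W ^ 3) * (\<Sum>k<n. ennreal (1 / (w k) ^ 3) * ennreal (C / real (Suc k) ^ 5))"
   by (intro mult_left_mono sum_mono b) auto
  also have "\<dots> = ennreal (W ^ 3) * (\<Sum>k<n. ennreal (u k))"
   using w C by (simp add: ennreal_mult[symmetric] u_def less_imp_le mult.commute del: of_nat_Suc)
  also have "\<dots> = ennreal (W ^ 3 * (\<Sum>k<n. u k))"
   using W0 u0 by (simp add: ennreal_mult sum_nonneg)
  also have "\<dots> \<le> ennreal (W ^ 3 * U)" using W0 U by (intro ennreal_leI mult_left_mono) auto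
  finally show ?thesis .
 qed
 moreover have "W ^ 3 * U \<ge> 0" using W0 U0 by simp
 ultimately show ?thesis by blast
qed

section \<open>The driving noise\<close>

context prob_space
begin

text \<open>A finite selection from the union splits into two halves; each half factorizes within
  its own family, and its intersection stays in the corresponding intersection-stable system
  \<open>F\<close> or \<open>G\<close>, where the two systems are independent.\<close>

lemma indep_sets_Un:
 assumes E: "indep_sets E I" "indep_sets E J" and FG: "indep_set F G" "Int_stable F" "Int_stable G"
  and sub: "\<And>i. i \<in> I \<Longrightarrow> E i \<subseteq> F" "\<And>j. j \<in> J \<Longrightarrow> E j \<subseteq> G" and disj: "I \<inter> J = {}"
 shows "indep_sets E (I \<union> J)"
proof (rule indep_setsI)
 show "E i \<subseteq> events" if "i \<in> I \<union> J" for i using that E unfolding indep_sets_def by auto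
 fix A K assume K: "K \<noteq> {}" "K \<subseteq> I \<union> J" "finite K" and A: "\<forall>j\<in>K. A j \<in> E j"
 have Inter: "(\<Inter>k\<in>L. A k) \<in> H" if "finite L" "L \<noteq> {}" "L \<subseteq> K" "\<And>k. k \<in> L \<Longrightarrow> E k \<subseteq> H" "Int_stable H" for L and H :: "'a set set"
  using that
 proof (induction L rule: finite_ne_induct)
  case (singleton x)
  then show ?case using A by auto
 next
  case (insert x L)
  then have "A x \<in> H" "(\<Inter>k\<in>L. A k) \<in> H" using A by blast+
  then show ?case using \<open>Int_stable H\<close> by (auto dest: Int_stableD)
 qed
 let ?K1 = "K \<inter> I" and ?K2 = "K \<inter> J"
 have KU: "K = ?K1 \<union> ?K2" "?K1 \<inter> ?K2 = {}" using K disj by auto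
 have p1: "prob (\<Inter>j\<in>?K1. A j) = (\<Prod>j\<in>?K1. prob (A j))" if "?K1 \<noteq> {}"
  using that A K(3) by (intro indep_setsD[OF E(1)]) auto
 have p2: "prob (\<Inter>j\<in>?K2. A j) = (\<Prod>j\<in>?K2. prob (A j))" if "?K2 \<noteq> {}"
  using that A K(3) by (intro indep_setsD[OF E(2)]) auto
 consider "?K1 = {}" | "?K2 = {}" | "?K1 \<noteq> {}" "?K2 \<noteq> {}" by blast
 then show "prob (\<Inter>j\<in>K. A j) = (\<Prod>j\<in>K. prob (A j))"
 proof cases
  case 1
  then have "?K2 = K" using KU by auto
  then show ?thesis using p2 K by simp
 next
  case 2
  then have "?K1 = K" using KU by auto
  then show ?thesis using p1 K by simp
 next
  case 3
  have "(\<Inter>j\<in>?K1. A j) \<in> F" "(\<Inter>j\<in>?K2. A j) \<in> G"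
   using 3 K(3) sub FG by (auto intro!: Inter)
  then have "prob ((\<Inter>j\<in>?K1. A j) \<inter> (\<Inter>j\<in>?K2. A j)) = prob (\<Inter>j\<in>?K1. A j) * prob (\<Inter>j\<in>?K2. A j)"
   by (rule indep_setD[OF FG(1)])
  also have "\<dots> = (\<Prod>j\<in>?K1 \<union> ?K2. prob (A j))"
   unfolding p1[OF 3(1)] p2[OF 3(2)] using K(3) KU(2) by (intro prod.union_disjoint[symmetric]) auto
  also have "(\<Inter>j\<in>?K1. A j) \<inter> (\<Inter>j\<in>?K2. A j) = (\<Inter>j\<in>?K1 \<union> ?K2. A j)" by (rule INT_Un[symmetric])
  finally show ?thesis unfolding KU(1)[symmetric] .
 qed
qed

lemma indep_sets_image:
 assumes E: "indep_sets (\<lambda>i. E (f i)) I" and inj: "inj_on f I"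
 shows "indep_sets E (f ` I)"
proof (rule indep_setsI)
 show "E i \<subseteq> events" if "i \<in> f ` I" for i using that E unfolding indep_sets_def by auto
 fix A K assume K: "K \<noteq> {}" "K \<subseteq> f ` I" "finite K" and A: "\<forall>j\<in>K. A j \<in> E j"
 obtain L where L: "L \<subseteq> I" "finite L" "K = f ` L" using finite_subset_image[OF K(3,2)] by auto
 have "prob (\<Inter>i\<in>L. A (f i)) = (\<Prod>i\<in>L. prob (A (f i)))"
  using L K A by (intro indep_setsD[OF E]) auto
 moreover have "inj_on f L" using inj L(1) by (rule inj_on_subset)
 ultimately show "prob (\<Inter>j\<in>K. A j) = (\<Prod>j\<in>K. prob (A j))"
  unfolding L(3) by (simp add: prod.reindex)
qed

end

lemma Int_stable_preimages: "Int_stable {X -` S \<inter> \<Omega> | S. S \<in> sets N}"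
proof (rule Int_stableI)
 fix a b assume "a \<in> {X -` S \<inter> \<Omega> | S. S \<in> sets N}" "b \<in> {X -` S \<inter> \<Omega> | S. S \<in> sets N}"
 then obtain S S' where S: "S \<in> sets N" "S' \<in> sets N" "a = X -` S \<inter> \<Omega>" "b = X -` S' \<inter> \<Omega>" by blast
 then have "a \<inter> b = X -` (S \<inter> S') \<inter> \<Omega>" by auto
 then show "a \<inter> b \<in> {X -` S \<inter> \<Omega> | S. S \<in> sets N}" using S sets.Int[OF S(1,2)] by blast
qed

lemma preimages_compose:
 assumes f: "f \<in> N \<rightarrow>\<^sub>M K" and X: "X \<in> \<Omega> \<rightarrow> space N" and eq: "\<And>\<omega>. \<omega> \<in> \<Omega> \<Longrightarrow> Z \<omega> = f (X \<omega>)"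
 shows "{Z -` A \<inter> \<Omega> | A. A \<in> sets K} \<subseteq> {X -` S \<inter> \<Omega> | S. S \<in> sets N}"
proof clarify
 fix A assume A: "A \<in> sets K"
 have "Z -` A \<inter> \<Omega> = X -` (f -` A \<inter> space N) \<inter> \<Omega>" using X eq by auto
 then show "\<exists>S. Z -` A \<inter> \<Omega> = X -` S \<inter> \<Omega> \<and> S \<in> sets N" using measurable_sets[OF f A] by blast
qed

definition noise :: "(nat \<Rightarrow> 'a \<Rightarrow> real) \<Rightarrow> (nat \<Rightarrow> 'a \<Rightarrow> 'v) \<Rightarrow> ('a \<Rightarrow> 'v) \<Rightarrow> nat \<Rightarrow> 'a \<Rightarrow> 'v \<times> real" where
 "noise \<beta> \<eta> x m \<omega> = (if m = 0 then x \<omega> else \<eta> m \<omega>, \<beta> (Suc m) \<omega>)"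

context prob_space
begin

context
 fixes \<beta> :: "nat \<Rightarrow> 'a \<Rightarrow> real" and \<eta> :: "nat \<Rightarrow> 'a \<Rightarrow> 'v::second_countable_topology" and x :: "'a \<Rightarrow> 'v"
 assumes \<eta>: "iid_seq M \<eta>" and \<beta>: "iid_seq M \<beta>"
  and \<eta>\<beta>: "indep_rvs M seq_space (seq_rv \<eta>) seq_space (seq_rv \<beta>)" and x: "indep_of_noise M \<beta> \<eta> x"
begin

text \<open>Jumps and waiting times take values in different types. The index type
  \<open>nat + nat\<close> brings their generated events into one family, so that the joint
  independence of all of them can be stated.\<close>

definition "noise_events = case_sum
  (\<lambda>m. {(if m = 0 then x else \<eta> m) -` A \<inter> space M | A. A \<in> sets borel})
  (\<lambda>m. {\<beta> (Suc m) -` A \<inter> space M | A. A \<in> sets borel})"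

lemma noise_components_measurable:
 "(if m = 0 then x else \<eta> m) \<in> borel_measurable M" "\<beta> (Suc m) \<in> borel_measurable M"
 using \<eta> \<beta> x unfolding iid_seq_def indep_vars_def indep_of_noise_def indep_rvs_def by auto

lemma seq_rv_component:
 fixes Y :: "nat \<Rightarrow> 'a \<Rightarrow> 'b::topological_space"
 assumes "m \<ge> 1" "seq_rv Y \<in> M \<rightarrow>\<^sub>M seq_space"
 shows "{Y m -` A \<inter> space M | A. A \<in> sets borel} \<subseteq> {seq_rv Y -` S \<inter> space M | S. S \<in> sets seq_space}"
 using assms measurable_space[OF assms(2)]
 by (intro preimages_compose[where f="\<lambda>s. s m"]) (auto simp: seq_rv_def intro!: measurable_component_singleton)

text \<open>Two merges: jumps with waiting times by independence of the two sequences, and the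
  initial value with all of these by its independence of the pair of sequences.\<close>

lemma noise_events_indep: "indep_sets noise_events UNIV"
proof -
 have m: "seq_rv \<eta> \<in> M \<rightarrow>\<^sub>M seq_space" "seq_rv \<beta> \<in> M \<rightarrow>\<^sub>M seq_space" using \<eta>\<beta> unfolding indep_rvs_def by auto
 have \<eta>i: "indep_sets noise_events (Inl ` {1..})"
 proof (rule indep_sets_image)
  have "indep_sets (\<lambda>m. {\<eta> m -` A \<inter> space M | A. A \<in> sets borel}) {1..}"
   using \<eta> unfolding iid_seq_def indep_vars_def2 by auto
  then show "indep_sets (\<lambda>i. noise_events (Inl i)) {1..}"
   by (rule indep_sets_mono_sets) (auto simp: noise_events_def)
 qed simp
 have \<beta>i: "indep_sets noise_events (Inr ` UNIV)"
 proof (rule indep_sets_image)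
  have "indep_vars (\<lambda>_. borel) (\<lambda>m. \<beta> (Suc m)) UNIV"
   by (rule indep_vars_reindex[where f=Suc]) (use \<beta> in \<open>auto simp: iid_seq_def inj_on_def intro: indep_vars_subset\<close>)
  then have "indep_sets (\<lambda>m. {\<beta> (Suc m) -` A \<inter> space M | A. A \<in> sets borel}) UNIV"
   unfolding indep_vars_def2 by auto
  then show "indep_sets (\<lambda>i. noise_events (Inr i)) UNIV"
   by (rule indep_sets_mono_sets) (auto simp: noise_events_def)
 qed simp
 have x0: "indep_sets noise_events {Inl 0}"
 proof (rule indep_setsI)
  show "noise_events i \<subseteq> events" if "i \<in> {Inl 0}" for i
   using that measurable_sets[OF noise_components_measurable(1)[of 0]] by (auto simp: noise_events_def)
  fix A J assume "J \<noteq> {}" "J \<subseteq> {Inl 0 :: nat + nat}"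
  then have "J = {Inl 0}" by auto
  then show "prob (\<Inter>j\<in>J. A j) = (\<Prod>j\<in>J. prob (A j))" by simp
 qed
 have 1: "indep_sets noise_events (Inl ` {1..} \<union> Inr ` UNIV)"
 proof (rule indep_sets_Un[OF \<eta>i \<beta>i])
  show "indep_set {seq_rv \<eta> -` S \<inter> space M | S. S \<in> sets seq_space} {seq_rv \<beta> -` S \<inter> space M | S. S \<in> sets seq_space}"
   using \<eta>\<beta> unfolding indep_rvs_def by simp
  show "noise_events i \<subseteq> {seq_rv \<eta> -` S \<inter> space M | S. S \<in> sets seq_space}" if "i \<in> Inl ` {1..}" for i
  proof -
   from that obtain k where k: "k \<ge> 1" "i = Inl k" by auto
   show ?thesis using k(1) seq_rv_component[OF k(1) m(1)] by (simp add: k(2) noise_events_def)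
  qed
  show "noise_events i \<subseteq> {seq_rv \<beta> -` S \<inter> space M | S. S \<in> sets seq_space}" if "i \<in> Inr ` UNIV" for i
  proof -
   from that obtain k where k: "i = Inr k" by auto
   show ?thesis using seq_rv_component[OF _ m(2), of "Suc k"] by (simp add: k noise_events_def)
  qed
 qed (auto intro: Int_stable_preimages)
 let ?P = "seq_space \<Otimes>\<^sub>M seq_space :: ((nat \<Rightarrow> real) \<times> (nat \<Rightarrow> 'v)) measure" and ?Z = "\<lambda>\<omega>. (seq_rv \<beta> \<omega>, seq_rv \<eta> \<omega>)"
 have Z: "?Z \<in> space M \<rightarrow> space ?P" using measurable_space[OF m(1)] measurable_space[OF m(2)] by (auto simp: space_pair_measure)
 have "indep_sets noise_events ({Inl 0} \<union> (Inl ` {1..} \<union> Inr ` UNIV))"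
 proof (rule indep_sets_Un[OF x0 1])
  show "indep_set {x -` S \<inter> space M | S. S \<in> sets borel} {?Z -` S \<inter> space M | S. S \<in> sets ?P}"
   using x unfolding indep_of_noise_def indep_rvs_def by simp
  show "noise_events i \<subseteq> {x -` S \<inter> space M | S. S \<in> sets borel}" if "i \<in> {Inl 0}" for i
   using that by (auto simp: noise_events_def)
  have l: "noise_events (Inl k) \<subseteq> {?Z -` S \<inter> space M | S. S \<in> sets ?P}" if "k \<ge> 1" for k
  proof -
   have "{\<eta> k -` A \<inter> space M | A. A \<in> sets borel} \<subseteq> {?Z -` S \<inter> space M | S. S \<in> sets ?P}"
   proof (rule preimages_compose[where f="\<lambda>z. snd z k", OF _ Z])
    show "(\<lambda>z. snd z k) \<in> ?P \<rightarrow>\<^sub>M borel"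
     by (rule measurable_compose[OF measurable_snd measurable_component_singleton]) (use that in simp)
   qed (use that in \<open>simp add: seq_rv_def\<close>)
   then show ?thesis using that by (simp add: noise_events_def)
  qed
  have r: "noise_events (Inr k) \<subseteq> {?Z -` S \<inter> space M | S. S \<in> sets ?P}" for k
  proof -
   have "{\<beta> (Suc k) -` A \<inter> space M | A. A \<in> sets borel} \<subseteq> {?Z -` S \<inter> space M | S. S \<in> sets ?P}"
   proof (rule preimages_compose[where f="\<lambda>z. fst z (Suc k)", OF _ Z])
    show "(\<lambda>z. fst z (Suc k)) \<in> ?P \<rightarrow>\<^sub>M borel"
     by (rule measurable_compose[OF measurable_fst measurable_component_singleton]) simp
   qed (simp add: seq_rv_def)
   then show ?thesis by (simp add: noise_events_def)
  qed
  show "noise_events i \<subseteq> {?Z -` S \<inter> space M | S. S \<in> sets ?P}" if "i \<in> Inl ` {1..} \<union> Inr ` UNIV" for i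
  proof (cases i)
   case (Inl k)
   then have "k \<ge> 1" using that by auto
   from l[OF this] show ?thesis unfolding Inl .
  next
   case (Inr k)
   show ?thesis unfolding Inr by (rule r)
  qed
 qed (auto intro: Int_stable_preimages)
 moreover have "{Inl 0} \<union> (Inl ` {1..} \<union> Inr ` UNIV) = (UNIV :: (nat + nat) set)"
 proof -
  have "z \<in> {Inl 0} \<union> (Inl ` {1..} \<union> Inr ` UNIV)" for z :: "nat + nat"
  proof (cases z)
   case (Inl m)
   then show ?thesis by (cases m) auto
  qed simp
  then show ?thesis by blast
 qed
 ultimately show ?thesis by simp
qed

text \<open>Grouping the family into the blocks \<open>{Inl m, Inr m}\<close> yields independent
  sigma-algebras, and the \<open>m\<close>-th pair is measurable with respect to the
  \<open>m\<close>-th of them.\<close>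

lemma noise_indep: "indep_vars (\<lambda>_. borel) (noise \<beta> \<eta> x) UNIV"
 unfolding indep_vars_def2
proof (intro conjI ballI)
 show nm: "noise \<beta> \<eta> x m \<in> borel_measurable M" for m
 proof -
  have "(\<lambda>\<omega>. ((if m = 0 then x else \<eta> m) \<omega>, \<beta> (Suc m) \<omega>)) \<in> M \<rightarrow>\<^sub>M borel \<Otimes>\<^sub>M borel"
   by (intro measurable_Pair noise_components_measurable)
  then show ?thesis by (simp add: noise_def[abs_def] borel_prod if_distrib[of "\<lambda>f. f _"] cong: if_cong)
 qed
 have Int: "Int_stable (noise_events i)" for i
  by (cases i) (auto simp: noise_events_def intro: Int_stable_preimages)
 have "indep_sets (\<lambda>m. sigma_sets (space M) (\<Union>i\<in>{Inl m, Inr m}. noise_events i)) UNIV"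
 proof (rule indep_sets_collect_sigma)
  show "indep_sets noise_events (\<Union>m. {Inl m, Inr m})" by (rule indep_sets_mono_index[OF _ noise_events_indep]) simp
 qed (auto simp: disjoint_family_on_def Int)
 then show "indep_sets (\<lambda>m. {noise \<beta> \<eta> x m -` A \<inter> space M | A. A \<in> sets borel}) UNIV"
 proof (rule indep_sets_mono_sets)
  fix m :: nat
  let ?G = "\<Union>i\<in>{Inl m, Inr m}. noise_events i"
  let ?S = "sigma (space M) ?G"
  have G: "?G \<subseteq> Pow (space M)" by (auto simp: noise_events_def)
  have "(if m = 0 then x else \<eta> m) \<in> ?S \<rightarrow>\<^sub>M borel" "\<beta> (Suc m) \<in> ?S \<rightarrow>\<^sub>M borel"
  proof -
   show "(if m = 0 then x else \<eta> m) \<in> ?S \<rightarrow>\<^sub>M borel"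
   proof (rule measurableI)
    fix A :: "'v set" assume "A \<in> sets borel"
    then have "(if m = 0 then x else \<eta> m) -` A \<inter> space M \<in> noise_events (Inl m)" unfolding noise_events_def by auto
    then show "(if m = 0 then x else \<eta> m) -` A \<inter> space ?S \<in> sets ?S" using G by auto
   qed simp
   show "\<beta> (Suc m) \<in> ?S \<rightarrow>\<^sub>M borel"
   proof (rule measurableI)
    fix A :: "real set" assume "A \<in> sets borel"
    then have "\<beta> (Suc m) -` A \<inter> space M \<in> noise_events (Inr m)" unfolding noise_events_def by auto
    then show "\<beta> (Suc m) -` A \<inter> space ?S \<in> sets ?S" using G by auto
   qed simp
  qed
  then have "(\<lambda>\<omega>. ((if m = 0 then x else \<eta> m) \<omega>, \<beta> (Suc m) \<omega>)) \<in> ?S \<rightarrow>\<^sub>M borel \<Otimes>\<^sub>M borel"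
   by (intro measurable_Pair)
  then have "noise \<beta> \<eta> x m \<in> ?S \<rightarrow>\<^sub>M borel" by (simp add: noise_def[abs_def] borel_prod if_distrib[of "\<lambda>f. f _"] cong: if_cong)
  from measurable_sets[OF this] show "{noise \<beta> \<eta> x m -` A \<inter> space M | A. A \<in> sets borel} \<subseteq> sigma_sets (space M) ?G"
   using G by auto
 qed
qed

lemma noise_distr:
 "distr M borel (noise \<beta> \<eta> x m) = distr M borel (if m = 0 then x else \<eta> m) \<Otimes>\<^sub>M distr M borel (\<beta> 1)"
proof -
 let ?H = "if m = 0 then x else \<eta> m"
 note meas = noise_components_measurable[of m]
 have \<beta>1: "distr M borel (\<beta> 1) = distr M borel (\<beta> (Suc m))" using \<beta> unfolding iid_seq_def by (metis le_add1 plus_1_eq_Suc)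
 interpret H: prob_space "distr M borel ?H" by (rule prob_space_distr) (rule meas)
 interpret B: prob_space "distr M borel (\<beta> (Suc m))" by (rule prob_space_distr) (rule meas)
 have nm: "noise \<beta> \<eta> x m \<in> borel_measurable M" using noise_indep unfolding indep_vars_def by auto
 show ?thesis unfolding \<beta>1
 proof (rule pair_measure_eqI[symmetric])
  show "sets (distr M borel ?H \<Otimes>\<^sub>M distr M borel (\<beta> (Suc m))) = sets (distr M borel (noise \<beta> \<eta> x m))"
   by (simp add: borel_prod[symmetric] cong: sets_pair_measure_cong)
  fix A B assume "A \<in> sets (distr M borel ?H)" "B \<in> sets (distr M borel (\<beta> (Suc m)))"
  then have A: "A \<in> sets borel" and B: "B \<in> sets borel" by auto
  have AB: "A \<times> B \<in> sets borel" using A B by (metis borel_prod pair_measureI)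
  let ?E = "case_sum (\<lambda>_. ?H -` A \<inter> space M) (\<lambda>_. \<beta> (Suc m) -` B \<inter> space M) :: nat + nat \<Rightarrow> 'a set"
  have "prob (\<Inter>i\<in>{Inl m, Inr m}. ?E i) = (\<Prod>i\<in>{Inl m, Inr m}. prob (?E i))"
   using A B by (intro indep_setsD[OF noise_events_indep]) (auto simp: noise_events_def)
  moreover have "noise \<beta> \<eta> x m -` (A \<times> B) \<inter> space M = (\<Inter>i\<in>{Inl m, Inr m}. ?E i)"
   by (auto simp: noise_def)
  ultimately have "prob (noise \<beta> \<eta> x m -` (A \<times> B) \<inter> space M) = prob (?H -` A \<inter> space M) * prob (\<beta> (Suc m) -` B \<inter> space M)"
   by simp
  then show "emeasure (distr M borel ?H) A * emeasure (distr M borel (\<beta> (Suc m))) B = emeasure (distr M borel (noise \<beta> \<eta> x m)) (A \<times> B)"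
   using A B AB meas nm by (simp add: emeasure_distr emeasure_eq_measure ennreal_mult[symmetric])
 qed (unfold_locales)
qed

end

end

section \<open>Extinction of the chain\<close>

lemma sub_norm_apply: "embedding j \<Longrightarrow> sub_norm j (j u) = norm u"
 by (simp add: sub_norm_def embedding_def)

lemma sub_norm_nonneg [simp]: "0 \<le> sub_norm j v"
 by (simp add: sub_norm_def)

lemma range_embedding_add:
 assumes "embedding j" "u \<in> range j" "v \<in> range j"
 shows "u + v \<in> range j" "sub_norm j (u + v) \<le> sub_norm j u + sub_norm j v"
proof -
 obtain a b where ab: "u = j a" "v = j b" using assms by blast
 have "u + v = j (a + b)" using assms(1) ab by (simp add: embedding_def linear_simps)
 then show "u + v \<in> range j" "sub_norm j (u + v) \<le> sub_norm j u + sub_norm j v"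
  using ab by (simp_all only: sub_norm_apply[OF assms(1)] norm_triangle_ineq rangeI)
qed

lemma zero_in_range_embedding: "embedding j \<Longrightarrow> 0 \<in> range j"
 unfolding embedding_def using linear_simps(3)[of j] by (metis rangeI)

lemma sub_norm_eq_0D: "embedding j \<Longrightarrow> v \<in> range j \<Longrightarrow> sub_norm j v = 0 \<Longrightarrow> v = 0"
 by (auto simp: sub_norm_apply embedding_def linear_simps)

lemma sub_norm_zero: "embedding j \<Longrightarrow> sub_norm j 0 = 0"
 using sub_norm_apply[of j 0] by (simp add: embedding_def linear_simps)

text \<open>After division by \<open>c = a + b\<close> both parts lie in the unit interval, where
  \<open>t \<le> t powr \<rho>\<close>; the two normalized parts add up to 1.\<close>

lemma powr_add_le:
 fixes a b \<rho> :: real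
 assumes "0 \<le> a" "0 \<le> b" "0 < \<rho>" "\<rho> < 1"
 shows "(a + b) powr \<rho> \<le> a powr \<rho> + b powr \<rho>"
proof (cases "a + b = 0")
 case True
 then show ?thesis using assms by auto
next
 case False
 define c where "c = a + b"
 have c: "c > 0" using False assms by (auto simp: c_def)
 have le: "x / c \<le> (x / c) powr \<rho>" if "0 \<le> x" "x \<le> c" for x
 proof (cases "x = 0")
  case False
  then have "(x / c) powr 1 \<le> (x / c) powr \<rho>" using that assms c by (intro powr_mono') auto
  then show ?thesis using that c False by simp
 qed simp
 have "1 = a / c + b / c" using c by (simp add: c_def add_divide_distrib[symmetric])
 also have "\<dots> \<le> (a / c) powr \<rho> + (b / c) powr \<rho>" using assms by (intro add_mono le) (auto simp: c_def)
 also have "\<dots> = (a powr \<rho> + b powr \<rho>) / c powr \<rho>" using assms c by (simp add: powr_divide add_divide_distrib)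
 finally show ?thesis using c by (simp add: c_def pos_le_divide_eq)
qed

text \<open>In contrast to \<open>hits\<close> this is decreasing in \<open>k\<close>; when a return
  occurs, it amounts to \<open>k < ret \<phi> s\<close>, the event whose probability is
  estimated.\<close>

definition survives :: "('v::zero \<Rightarrow> 'e \<Rightarrow> 'v) \<Rightarrow> (nat \<Rightarrow> 'e) \<Rightarrow> nat \<Rightarrow> bool" where
 "survives \<phi> s k \<longleftrightarrow> (\<forall>m\<le>k. 1 \<le> m \<longrightarrow> walk \<phi> s m \<noteq> 0)"

lemma returns_iff_not_survives: "returns \<phi> s \<longleftrightarrow> (\<exists>k. \<not> survives \<phi> s k)"
proof
 assume "\<exists>k. \<not> survives \<phi> s k"
 then have "\<exists>m. 1 \<le> m \<and> walk \<phi> s m = 0" unfolding survives_def by auto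
 define m where "m = (LEAST m. 1 \<le> m \<and> walk \<phi> s m = 0)"
 have "1 \<le> m \<and> walk \<phi> s m = 0" unfolding m_def by (rule LeastI_ex) fact
 moreover have "\<forall>i<m. 1 \<le> i \<longrightarrow> walk \<phi> s i \<noteq> 0" unfolding m_def using not_less_Least by blast
 ultimately show "returns \<phi> s" unfolding returns_def hits_def by blast
qed (auto simp: returns_def hits_def survives_def)

lemma survives_iff_less_ret: "returns \<phi> s \<Longrightarrow> survives \<phi> s k \<longleftrightarrow> k < ret \<phi> s"
 using hits_ret[of \<phi> s] unfolding survives_def hits_def by (metis le_less_trans not_le)

text \<open>The probabilistic part sees the semigroup through joint measurability, invariance of the
  two embedded spaces, decay and contraction; the operator behind \<open>T\<close> is left out of
  sight.\<close>

locale extinction_semigroup =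
 fixes T :: "real \<Rightarrow> 'v \<Rightarrow> 'v::{banach, second_countable_topology}"
  and j1 :: "'v1::{banach, second_countable_topology} \<Rightarrow> 'v" and j2 :: "'v2::{banach, second_countable_topology} \<Rightarrow> 'v"
  and \<kappa> \<rho> :: real
 assumes T_measurable: "(\<lambda>p. T (fst p) (snd p)) \<in> borel_measurable borel"
  and j1: "embedding j1" and j2: "embedding j2"
  and T_range1: "\<And>t v. t \<ge> 0 \<Longrightarrow> v \<in> range j1 \<Longrightarrow> T t v \<in> range j1"
  and T_range2: "\<And>t v. t \<ge> 0 \<Longrightarrow> v \<in> range j2 \<Longrightarrow> T t v \<in> range j2"
  and \<kappa>: "\<kappa> > 0" and \<rho>: "0 < \<rho>" "\<rho> < 1"
  and T_decay: "\<And>t v. t \<ge> 0 \<Longrightarrow> v \<in> range j1 \<Longrightarrow>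
      sub_norm j1 (T t v) powr \<rho> \<le> max (- \<kappa> * t + sub_norm j1 v powr \<rho>) 0"
  and T_contract: "\<And>t v. t \<ge> 0 \<Longrightarrow> v \<in> range j2 \<Longrightarrow> sub_norm j2 (T t v) \<le> sub_norm j2 v"
begin

text \<open>First the jump, then the flow over the waiting time that follows it. Accordingly
  \<open>W\<close> holds the values before a jump and \<open>state\<close> those after it.\<close>

definition step :: "'v \<Rightarrow> 'v \<times> real \<Rightarrow> 'v" where
 "step r e = T (snd e) (r + fst e)"

definition good :: "'v \<times> real \<Rightarrow> bool" where
 "good e \<longleftrightarrow> fst e \<in> range j1 \<inter> range j2 \<and> 0 < snd e"

text \<open>Increment of the dominating random walk; the drift condition on the noise says that its
  mean is negative.\<close>

definition drift :: "'v \<times> real \<Rightarrow> real" where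
 "drift e = sub_norm j1 (fst e) powr \<rho> - \<kappa> * snd e"

abbreviation "W \<equiv> walk step"
abbreviation "R \<equiv> ret step"

definition state :: "(nat \<Rightarrow> 'v \<times> real) \<Rightarrow> nat \<Rightarrow> 'v" where
 "state s m = W s m + fst (s m)"

definition durations :: "(nat \<Rightarrow> 'v \<times> real) \<Rightarrow> nat \<Rightarrow> real" where
 "durations s n = (\<Sum>k<n. snd (s k))"

lemma drift_measurable[measurable]: "drift \<in> borel_measurable borel"
proof -
 note [measurable] = sub_norm_measurable[OF j1]
 have "drift \<in> borel_measurable (borel \<Otimes>\<^sub>M borel)" unfolding drift_def[abs_def] by measurable
 then show ?thesis unfolding borel_prod .
qed

lemma T_measurable2[measurable (raw)]:
 assumes "f \<in> borel_measurable N" "g \<in> borel_measurable N"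
 shows "(\<lambda>x. T (f x) (g x)) \<in> borel_measurable N"
proof -
 have "(\<lambda>x. (f x, g x)) \<in> borel_measurable N" using assms by measurable
 from measurable_compose[OF this T_measurable] show ?thesis by simp
qed

lemma fst_snd_borel[measurable]: "fst \<in> borel_measurable (borel :: ('v \<times> real) measure)" "snd \<in> borel_measurable (borel :: ('v \<times> real) measure)"
 by (auto intro!: borel_measurable_continuous_onI continuous_intros)

lemma step_regenerative: "regenerative step"
proof
 show "(\<lambda>p. step (fst p) (snd p)) \<in> borel \<Otimes>\<^sub>M borel \<rightarrow>\<^sub>M borel"
  unfolding step_def by measurable
qed

sublocale regenerative step by (rule step_regenerative)

lemma state_measurable[measurable]: "(\<lambda>s. state s m) \<in> borel_measurable seqs"
 unfolding state_def by measurable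

lemma durations_measurable[measurable]: "(\<lambda>s. durations s n) \<in> borel_measurable seqs"
 unfolding durations_def by measurable

context
 fixes s :: "nat \<Rightarrow> 'v \<times> real" assumes s: "\<And>i. good (s i)"
begin

lemma W_range: "W s m \<in> range j1" "W s m \<in> range j2" "state s m \<in> range j1" "state s m \<in> range j2"
proof -
 have g: "fst (s m) \<in> range j1" "fst (s m) \<in> range j2" "snd (s m) \<ge> 0" for m using s[of m] by (auto simp: good_def)
 have "W s m \<in> range j1 \<and> W s m \<in> range j2"
  by (induction m) (use g zero_in_range_embedding[OF j1] zero_in_range_embedding[OF j2] in
    \<open>auto simp: step_def intro!: T_range1 T_range2 range_embedding_add(1) j1 j2\<close>)
 then show "W s m \<in> range j1" "W s m \<in> range j2" "state s m \<in> range j1" "state s m \<in> range j2"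
  using g by (auto simp: state_def intro!: range_embedding_add(1) j1 j2)
qed

lemma W_Suc: "W s (Suc m) = T (snd (s m)) (state s m)"
 by (simp add: step_def state_def)

text \<open>As long as the walk does not vanish, \<open>sub_norm j1 (W s m) powr \<rho>\<close> stays below a random walk whose
 increments have negative mean.\<close>

lemma survives_drift:
 assumes "survives step s k" "k \<ge> 1"
 shows "0 < (\<Sum>i<k. drift (s i))"
proof -
 let ?q = "\<lambda>v. sub_norm j1 v powr \<rho>"
 have pos: "0 < ?q (W s m)" if "1 \<le> m" "m \<le> k" for m
 proof -
  have "W s m \<noteq> 0" using assms(1) that unfolding survives_def by blast
  then have "sub_norm j1 (W s m) \<noteq> 0" using sub_norm_eq_0D[OF j1 W_range(1)] by blast
  then show ?thesis by simp
 qed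
 have "?q (W s m) \<le> (\<Sum>i<m. drift (s i))" if "m \<le> k" for m
  using that
 proof (induction m)
  case 0
  show ?case using sub_norm_zero[OF j1] by simp
 next
  case (Suc m)
  have g: "fst (s m) \<in> range j1" "snd (s m) \<ge> 0" using s[of m] by (auto simp: good_def)
  have "?q (state s m) \<le> (sub_norm j1 (W s m) + sub_norm j1 (fst (s m))) powr \<rho>"
   unfolding state_def using \<rho> by (intro powr_mono2 range_embedding_add(2)[OF j1 W_range(1) g(1)]) auto
  also have "\<dots> \<le> ?q (W s m) + ?q (fst (s m))" by (rule powr_add_le) (use \<rho> in auto)
  finally have 1: "?q (state s m) \<le> ?q (W s m) + ?q (fst (s m))" .
  have "?q (W s (Suc m)) \<le> max (- \<kappa> * snd (s m) + ?q (state s m)) 0"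
   unfolding W_Suc by (rule T_decay[OF g(2) W_range(3)])
  \<comment> \<open>Positivity rules out the cut-off at 0 in the decay estimate, so the linear
    branch applies and \<open>drift (s m)\<close> bounds the increase.\<close>
  moreover have "0 < ?q (W s (Suc m))" by (rule pos) (use Suc.prems in auto)
  ultimately have "?q (W s (Suc m)) \<le> - \<kappa> * snd (s m) + ?q (state s m)" by linarith
  with 1 Suc show ?case by (simp add: drift_def)
 qed
 from this[OF order_refl] pos[OF assms(2) order_refl] show ?thesis by linarith
qed

text \<open>The flow never increases the second norm, so only the jumps contribute.\<close>

lemma sub_norm_state_le: "sub_norm j2 (state s m) \<le> (\<Sum>i\<le>m. sub_norm j2 (fst (s i)))"
proof (induction m)
 case 0
 show ?case using sub_norm_zero[OF j2] by (simp add: state_def)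
next
 case (Suc m)
 have g: "fst (s (Suc m)) \<in> range j2" "snd (s m) \<ge> 0" using s[of m] s[of "Suc m"] by (auto simp: good_def)
 have "sub_norm j2 (state s (Suc m)) \<le> sub_norm j2 (W s (Suc m)) + sub_norm j2 (fst (s (Suc m)))"
  unfolding state_def by (rule range_embedding_add(2)[OF j2 W_range(2) g(1)])
 moreover have "sub_norm j2 (W s (Suc m)) \<le> sub_norm j2 (state s m)"
  unfolding W_Suc by (rule T_contract[OF g(2) W_range(4)])
 ultimately show ?case using Suc by simp
qed

end

end

locale extinction_functional = extinction_semigroup T j1 j2 \<kappa> \<rho>
 for T :: "real \<Rightarrow> 'v \<Rightarrow> 'v::{banach, second_countable_topology}"
  and j1 :: "'v1::{banach, second_countable_topology} \<Rightarrow> 'v" and j2 :: "'v2::{banach, second_countable_topology} \<Rightarrow> 'v"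
  and \<kappa> \<rho> :: real +
 fixes f :: "'v \<Rightarrow> 'w::{banach, second_countable_topology}" and c1 c2 :: real
 assumes f_measurable[measurable]: "f \<in> borel_measurable borel" and c: "c1 \<ge> 0" "c2 \<ge> 0"
  and f_bound: "\<And>v. v \<in> range j2 \<Longrightarrow> norm (f v) \<le> c1 * sub_norm j2 v + c2"
begin

definition flow_integral :: "'v \<Rightarrow> real \<Rightarrow> 'w" where
 "flow_integral v u = (LINT t:{0..u}|lborel. f (T t v))"

definition reward :: "(nat \<Rightarrow> 'v \<times> real) \<Rightarrow> nat \<Rightarrow> 'w" where
 "reward s n = (\<Sum>k<n. flow_integral (state s k) (snd (s k)))"

definition load :: "(nat \<Rightarrow> 'v \<times> real) \<Rightarrow> nat \<Rightarrow> real" where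
 "load s n = (\<Sum>k<n. sub_norm j2 (fst (s k)))"

lemma flow_integrable:
 assumes "v \<in> range j2" "u \<ge> 0"
 shows "set_integrable lborel {0..u} (\<lambda>t. f (T t v))"
  "norm (flow_integral v u) \<le> u * (c1 * sub_norm j2 v + c2)"
proof -
 let ?b = "c1 * sub_norm j2 v + c2"
 have le: "norm (f (T t v)) \<le> ?b" if "t \<in> {0..u}" for t
 proof -
  have "norm (f (T t v)) \<le> c1 * sub_norm j2 (T t v) + c2" using that assms by (intro f_bound T_range2) auto
  also have "\<dots> \<le> ?b" using that assms c by (intro add_right_mono mult_left_mono T_contract) auto
  finally show ?thesis .
 qed
 have ib: "set_integrable lborel {0..u} (\<lambda>t. ?b)" by (intro borel_integrable_atLeastAtMost' continuous_on_const)
 show i: "set_integrable lborel {0..u} (\<lambda>t. f (T t v))"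
  by (rule set_integrable_bound[OF ib]) (use le in \<open>auto simp: set_borel_measurable_def abs_le_iff intro!: AE_I2 order_trans[OF _ abs_ge_self]\<close>)
 have "norm (flow_integral v u) \<le> (LINT t:{0..u}|lborel. norm (f (T t v)))"
  unfolding flow_integral_def by (rule set_integral_norm_bound[OF i])
 also have "\<dots> \<le> (LINT t:{0..u}|lborel. ?b)"
  by (rule set_integral_mono) (use le i ib in \<open>auto intro: set_integrable_norm\<close>)
 also have "\<dots> = u * ?b" using assms(2) by (simp add: set_lebesgue_integral_def)
 finally show "norm (flow_integral v u) \<le> u * ?b" .
qed

lemma flow_integral_measurable[measurable (raw)]:
 assumes [measurable]: "g \<in> borel_measurable N" "h \<in> borel_measurable N"
 shows "(\<lambda>x. flow_integral (g x) (h x)) \<in> borel_measurable N"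
proof -
 have "(\<lambda>x. LINT t|lborel. indicator {0..h x} t *\<^sub>R f (T t (g x))) \<in> borel_measurable N"
 proof (rule lborel.borel_measurable_lebesgue_integral)
  have "(\<lambda>(x, t). (if 0 \<le> t \<and> t \<le> h x then 1 else (0::real)) *\<^sub>R f (T t (g x))) \<in> borel_measurable (N \<Otimes>\<^sub>M lborel)"
   unfolding split_beta' by measurable
  then show "(\<lambda>(x, t). indicator {0..h x} t *\<^sub>R f (T t (g x))) \<in> borel_measurable (N \<Otimes>\<^sub>M lborel)"
   by (simp add: indicator_def)
 qed
 then show ?thesis unfolding flow_integral_def set_lebesgue_integral_def .
qed

lemma reward_measurable[measurable]: "(\<lambda>s. reward s n) \<in> borel_measurable seqs"
 unfolding reward_def by measurable

lemma load_measurable[measurable]: "(\<lambda>s. load s n) \<in> borel_measurable seqs"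
proof -
 note [measurable] = sub_norm_measurable[OF j2]
 show ?thesis unfolding load_def by measurable
qed

lemma durations_nonneg: "(\<And>i. good (s i)) \<Longrightarrow> 0 \<le> durations s n"
 unfolding durations_def good_def by (intro sum_nonneg) (simp add: less_imp_le)

lemma load_nonneg: "0 \<le> load s n"
 unfolding load_def by (intro sum_nonneg) simp

lemma durations_mono: "(\<And>i. good (s i)) \<Longrightarrow> m \<le> n \<Longrightarrow> durations s m \<le> durations s n"
 unfolding durations_def good_def by (intro sum_mono2) (auto simp: less_imp_le)

text \<open>The integral up to any moment of the first \<open>n\<close> steps is at most elapsed
  time times the largest possible integrand. By contraction the integrand never exceeds
  \<open>c1 * load s n + c2\<close>, so one bound serves for all intermediate times.\<close>

lemma reward_bound:
 assumes s: "\<And>i. good (s i)" and m: "m < n" and u: "0 \<le> u" "u \<le> snd (s m)"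
 shows "norm (reward s m + flow_integral (state s m) u) \<le> durations s n * (c1 * load s n + c2)"
proof -
 let ?b = "c1 * load s n + c2"
 have b: "?b \<ge> 0" using c load_nonneg[of s n] by simp
 have st: "norm (flow_integral (state s k) u) \<le> u * ?b" if "k < n" "u \<ge> 0" for k u
 proof -
  have "norm (flow_integral (state s k) u) \<le> u * (c1 * sub_norm j2 (state s k) + c2)"
   by (rule flow_integrable(2)[OF W_range(4)[OF s] that(2)])
  also have "sub_norm j2 (state s k) \<le> load s n"
  proof -
   have "(\<Sum>i\<le>k. sub_norm j2 (fst (s i))) \<le> load s n"
    unfolding load_def using that by (intro sum_mono2) auto
   then show ?thesis using sub_norm_state_le[where s=s and m=k, OF s] by linarith
  qed
  finally show ?thesis using that(2) c by (simp add: mult_left_mono)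
 qed
 have sn: "snd (s k) \<ge> 0" for k using s[of k] by (simp add: good_def)
 have "norm (reward s m + flow_integral (state s m) u) \<le> (\<Sum>k<m. snd (s k) * ?b) + u * ?b"
  unfolding reward_def
  by (intro order_trans[OF norm_triangle_ineq] add_mono order_trans[OF norm_sum] sum_mono st) (use m u sn in auto)
 also have "\<dots> \<le> (\<Sum>k<m. snd (s k) * ?b) + snd (s m) * ?b" using u b by (intro add_left_mono mult_right_mono)
 also have "\<dots> = durations s (Suc m) * ?b" by (simp add: durations_def sum_distrib_right distrib_right)
 also have "\<dots> \<le> durations s n * ?b" using m b by (intro mult_right_mono durations_mono s) auto
 finally show ?thesis .
qed

text \<open>At a zero of the walk the past no longer influences the states, so it enters the
  accumulated quantities only additively.\<close>

lemma reward_shift: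
 assumes "W s k = 0"
 shows "reward s (k + n) = reward s k + reward (drop_seq k s) n" "state s (k + n) = state (drop_seq k s) n"
  "durations s (k + n) = durations s k + durations (drop_seq k s) n"
proof -
 show st: "state s (k + n) = state (drop_seq k s) n" for n
  using walk_shift[OF assms] by (simp add: state_def drop_seq_def)
 have split: "(\<Sum>i<k + n. g i) = (\<Sum>i<k. g i) + (\<Sum>i<n. g (k + i))" for g :: "nat \<Rightarrow> 'c::comm_monoid_add"
  by (induction n) (auto simp: add.assoc)
 show "reward s (k + n) = reward s k + reward (drop_seq k s) n"
  unfolding reward_def split by (simp add: st drop_seq_def)
 show "durations s (k + n) = durations s k + durations (drop_seq k s) n"
  unfolding durations_def split by (simp add: drop_seq_def)
qed

lemma adapted_sums:
 assumes "\<And>s s' k. (\<And>i. i < k \<Longrightarrow> s i = s' i) \<Longrightarrow> g s k = g s' k"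
 shows "adapted step (\<lambda>s. g s (R s))"
 unfolding adapted_def
proof (intro allI impI)
 fix s s' k assume h: "hits step s k" and eq: "\<forall>i<k. s i = s' i"
 have "hits step s' k" using hits_cong[of k s s' step] h eq by blast
 then show "g s (R s) = g s' (R s')" using assms[of k s s'] eq by (simp add: ret_eqI[OF h] ret_eqI[OF \<open>hits step s' k\<close>])
qed

lemma reward_cong:
 assumes "\<And>i. i < k \<Longrightarrow> s i = s' i"
 shows "reward s k = reward s' k" "durations s k = durations s' k" "load s k = load s' k"
proof -
 have "W s i = W s' i" if "i < k" for i by (rule walk_cong) (use assms that in auto)
 then show "reward s k = reward s' k" "durations s k = durations s' k" "load s k = load s' k"
  using assms by (auto simp: reward_def durations_def load_def state_def intro!: sum.cong)
qed

end

lemma (in regenerative) survives_measurable[measurable]: "Measurable.pred seqs (\<lambda>s. survives \<phi> s k)"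
 unfolding survives_def by measurable

lemma survives_cong: "(\<And>i. i < k \<Longrightarrow> s i = s' i) \<Longrightarrow> survives \<phi> s k \<longleftrightarrow> survives \<phi> s' k"
proof -
 assume "\<And>i. i < k \<Longrightarrow> s i = s' i"
 then have "walk \<phi> s m = walk \<phi> s' m" if "m \<le> k" for m using that by (intro walk_cong) auto
 then show ?thesis unfolding survives_def by auto
qed

text \<open>Survival up to time \<open>k\<close> is decided before the \<open>k\<close>-th entry, so that the expectation factorizes.\<close>

lemma (in prob_space) cycle_sum_moment:
 fixes \<phi> :: "'v::{zero, t1_space} \<Rightarrow> 'e::topological_space \<Rightarrow> 'v" and \<xi> :: "nat \<Rightarrow> 'a \<Rightarrow> 'e" and h :: "'e \<Rightarrow> real"
 assumes \<phi>: "regenerative \<phi>" and \<xi>: "iid M borel \<xi>" and h[measurable]: "h \<in> borel_measurable borel" and h0: "\<And>e. h e \<ge> 0"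
  and int: "integrable M (\<lambda>\<omega>. h (\<xi> 0 \<omega>) ^ 4)" and ret: "AE \<omega> in M. returns \<phi> (\<lambda>m. \<xi> m \<omega>)"
  and C: "C \<ge> 0" and tail: "\<And>k. prob {\<omega>\<in>space M. survives \<phi> (\<lambda>m. \<xi> m \<omega>) k} \<le> C / real (Suc k) ^ 5"
 shows "integrable M (\<lambda>\<omega>. (\<Sum>k<ret \<phi> (\<lambda>m. \<xi> m \<omega>). h (\<xi> k \<omega>)) ^ 4)"
proof -
 interpret regenerative \<phi> by fact
 note [measurable] = iid_measurable[OF \<xi>]
 have seq[measurable]: "(\<lambda>\<omega> m. \<xi> m \<omega>) \<in> M \<rightarrow>\<^sub>M seqs" by (rule measurable_seqsI) measurable
 define H where "H = expectation (\<lambda>\<omega>. h (\<xi> 0 \<omega>) ^ 4)"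
 have H: "H \<ge> 0" unfolding H_def by (intro integral_nonneg_AE AE_I2) simp
 \<comment> \<open>Cutting off by survival replaces the random number of summands by an infinite
   series, since \<open>y k\<close> vanishes from the return time on.\<close>
 define y where "y k \<omega> = (if survives \<phi> (\<lambda>m. \<xi> m \<omega>) k then h (\<xi> k \<omega>) else 0)" for k \<omega>
 have [measurable]: "y k \<in> borel_measurable M" for k unfolding y_def by measurable
 have y4: "(\<integral>\<^sup>+\<omega>. ennreal (y k \<omega> ^ 4) \<partial>M) \<le> ennreal ((C * H) / real (Suc k) ^ 5)" for k
 proof -
  define e0 :: 'e where "e0 = undefined"
  define ext where "ext r = (\<lambda>i. if i < k then r i else e0)" for r :: "nat \<Rightarrow> 'e"
  define G where "G r = (indicator {s. survives \<phi> s k} (ext r) :: ennreal)" for r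
  define F where "F r = ennreal (h (r k) ^ 4)" for r :: "nat \<Rightarrow> 'e"
  let ?A = "\<lambda>\<omega>. restrict (\<lambda>i. \<xi> i \<omega>) {..<k}" and ?B = "\<lambda>\<omega>. restrict (\<lambda>i. \<xi> i \<omega>) {k}"
  have ext[measurable]: "ext \<in> PiM {..<k} (\<lambda>_. borel) \<rightarrow>\<^sub>M seqs"
   unfolding ext_def
  proof (rule measurable_seqsI)
   fix i show "(\<lambda>r. if i < k then r i else e0) \<in> PiM {..<k} (\<lambda>_. borel) \<rightarrow>\<^sub>M borel"
    by (cases "i < k") (auto intro: measurable_component_singleton)
  qed
  have [measurable]: "indicator {s. survives \<phi> s k} \<in> borel_measurable seqs"
   using survives_measurable[of k] by (intro borel_measurable_indicator) (simp add: pred_def space_PiM)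
  have G: "G \<in> borel_measurable (PiM {..<k} (\<lambda>_. borel))" unfolding G_def by measurable
  have F: "F \<in> borel_measurable (PiM {k} (\<lambda>_. borel))"
   unfolding F_def by (measurable; auto intro: measurable_component_singleton)
  have "indep_var (PiM {..<k} (\<lambda>_. borel)) ?A (PiM {k} (\<lambda>_. borel)) ?B"
   by (rule indep_var_restrict[OF iid_indep[OF \<xi>]]) auto
  note ind = indep_var_nn_integral[OF indep_var_compose[OF this G F]]
  have GA: "(G \<circ> ?A) \<omega> = indicator {\<omega>. survives \<phi> (\<lambda>m. \<xi> m \<omega>) k} \<omega>" for \<omega>
  proof -
   have "survives \<phi> (\<lambda>m. \<xi> m \<omega>) k \<longleftrightarrow> survives \<phi> (ext (?A \<omega>)) k" by (rule survives_cong) (simp add: ext_def)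
   then show ?thesis by (simp add: G_def indicator_def)
  qed
  have "(\<integral>\<^sup>+\<omega>. ennreal (y k \<omega> ^ 4) \<partial>M) = (\<integral>\<^sup>+\<omega>. (G \<circ> ?A) \<omega> * (F \<circ> ?B) \<omega> \<partial>M)"
   unfolding GA by (intro nn_integral_cong) (simp add: y_def F_def indicator_def)
  also have "\<dots> = (\<integral>\<^sup>+\<omega>. (G \<circ> ?A) \<omega> \<partial>M) * (\<integral>\<^sup>+\<omega>. (F \<circ> ?B) \<omega> \<partial>M)" by (rule ind)
  also have "(\<integral>\<^sup>+\<omega>. (F \<circ> ?B) \<omega> \<partial>M) = (\<integral>\<^sup>+\<omega>. ennreal (h (\<xi> k \<omega>) ^ 4) \<partial>M)" by (simp add: F_def)
  also have "\<dots> = (\<integral>\<^sup>+\<omega>. ennreal (h (\<xi> 0 \<omega>) ^ 4) \<partial>M)"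
   using iid_nn_integral[OF \<xi>, of "\<lambda>e. ennreal (h e ^ 4)" k] by simp
  also have "\<dots> = ennreal H" unfolding H_def by (rule nn_integral_eq_integral[OF int]) simp
  also have "(\<integral>\<^sup>+\<omega>. (G \<circ> ?A) \<omega> \<partial>M) = (\<integral>\<^sup>+\<omega>. indicator {\<omega>\<in>space M. survives \<phi> (\<lambda>m. \<xi> m \<omega>) k} \<omega> \<partial>M)"
   unfolding GA by (intro nn_integral_cong) (simp add: indicator_def)
  also have "\<dots> = ennreal (prob {\<omega>\<in>space M. survives \<phi> (\<lambda>m. \<xi> m \<omega>) k})"
   by (subst nn_integral_indicator) (auto simp: emeasure_eq_measure)
  also have "\<dots> * ennreal H \<le> ennreal (C / real (Suc k) ^ 5) * ennreal H"
   by (intro mult_right_mono ennreal_leI tail) simp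
  also have "\<dots> = ennreal ((C * H) / real (Suc k) ^ 5)" using C H by (simp add: ennreal_mult[symmetric])
  finally show ?thesis .
 qed
 obtain K where K: "K \<ge> 0" "\<And>n. (\<integral>\<^sup>+\<omega>. ennreal ((\<Sum>k<n. y k \<omega>) ^ 4) \<partial>M) \<le> ennreal K"
  using fourth_moment_sum_bound[of y M "C * H", OF _ _ y4] C H by auto
 let ?g = "\<lambda>\<omega>. (\<Sum>k<ret \<phi> (\<lambda>m. \<xi> m \<omega>). h (\<xi> k \<omega>)) ^ 4"
 have lim: "AE \<omega> in M. (\<lambda>n. (\<Sum>k<n. y k \<omega>) ^ 4) \<longlonglongrightarrow> ?g \<omega>"
  using ret
 proof eventually_elim
  case (elim \<omega>)
  let ?r = "ret \<phi> (\<lambda>m. \<xi> m \<omega>)"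
  have "(\<Sum>k<n. y k \<omega>) = (\<Sum>k<?r. h (\<xi> k \<omega>))" if "n \<ge> ?r" for n
  proof -
   have "(\<Sum>k<n. y k \<omega>) = (\<Sum>k<?r. y k \<omega>)"
    using that by (intro sum.mono_neutral_right) (auto simp: y_def survives_iff_less_ret[OF elim])
   then show ?thesis by (simp add: y_def survives_iff_less_ret[OF elim])
  qed
  then show ?case by (intro tendsto_eventually eventually_sequentiallyI[of ?r]) simp
 qed
 have gm: "?g \<in> borel_measurable M"
 proof -
  have "(\<lambda>s. (\<Sum>k<ret \<phi> s. h (s k)) ^ 4) \<in> borel_measurable seqs"
   by (rule measurable_compose_countable[OF _ ret_measurable, where f="\<lambda>r s. (\<Sum>k<r. h (s k)) ^ 4"]) measurable
  from measurable_compose[OF seq this] show ?thesis .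
 qed
 have "(\<integral>\<^sup>+\<omega>. ennreal (?g \<omega>) \<partial>M) \<le> ennreal K"
  by (rule fatou_bound[OF _ lim]) (use K in auto)
 from integrable_square_iff_nn_integral(1)[OF gm _ this K(1)] show ?thesis by simp
qed

context extinction_semigroup
begin

text \<open>The strong law is applied to the drift from index 1 on; the term with index 0 has
  arbitrary law but disappears after division by \<open>n\<close>. Hence some drift sum is negative,
  which contradicts survival by \<open>survives_drift\<close>.\<close>

lemma noise_returns:
 assumes "prob_space M" and \<xi>: "prob_space.indep_vars M (\<lambda>_. borel) \<xi> UNIV" "\<And>m. m \<ge> 1 \<Longrightarrow> distr M borel (\<xi> m) = p"
  and good: "AE \<omega> in M. \<forall>i. good (\<xi> i \<omega>)"
  and sq: "integrable M (\<lambda>\<omega>. (drift (\<xi> 1 \<omega>))\<^sup>2)" and mean: "(LINT \<omega>|M. drift (\<xi> 1 \<omega>)) < 0"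
 shows "AE \<omega> in M. returns step (\<lambda>m. \<xi> m \<omega>)"
proof -
 interpret prob_space M by fact
 have "iid M borel (\<lambda>i. \<xi> (Suc i))"
  unfolding iid_def
 proof
  show "indep_vars (\<lambda>_. borel) (\<lambda>i. \<xi> (Suc i)) UNIV"
   by (rule indep_vars_reindex[of Suc UNIV "\<lambda>_. borel" \<xi>]) (auto intro: indep_vars_subset[OF \<xi>(1)])
 qed (simp add: \<xi>(2))
 from iid_compose[OF this, of drift borel] have D: "iid M borel (\<lambda>i \<omega>. drift (\<xi> (Suc i) \<omega>))" by simp
 have "AE \<omega> in M. (\<lambda>n. (1 / real n) *\<^sub>R (\<Sum>k<n. drift (\<xi> (Suc k) \<omega>))) \<longlonglongrightarrow> (LINT \<omega>|M. drift (\<xi> (Suc 0) \<omega>))"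
  by (rule slln_banach[OF D]) (use sq in simp)
 then show ?thesis using good
 proof eventually_elim
  case (elim \<omega>)
  let ?D = "\<lambda>n. (\<Sum>i<n. drift (\<xi> i \<omega>))"
  have "(\<lambda>n. drift (\<xi> 0 \<omega>) * (1 / real n) + (1 / real n) *\<^sub>R (\<Sum>k<n. drift (\<xi> (Suc k) \<omega>))) \<longlonglongrightarrow> drift (\<xi> 0 \<omega>) * 0 + (LINT \<omega>|M. drift (\<xi> (Suc 0) \<omega>))"
   using elim(1) by (intro tendsto_intros lim_1_over_n)
  from order_tendstoD(2)[OF this, of 0] mean
  have "\<forall>\<^sub>F n in sequentially. drift (\<xi> 0 \<omega>) * (1 / real n) + (1 / real n) *\<^sub>R (\<Sum>k<n. drift (\<xi> (Suc k) \<omega>)) < 0" by simp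
  from eventually_conj[OF this eventually_gt_at_top[of 0]] obtain n
   where n: "drift (\<xi> 0 \<omega>) * (1 / real n) + (1 / real n) *\<^sub>R (\<Sum>k<n. drift (\<xi> (Suc k) \<omega>)) < 0" "n > 0"
   by (auto simp: eventually_sequentially)
  have "drift (\<xi> 0 \<omega>) * (1 / real n) + (1 / real n) *\<^sub>R (\<Sum>k<n. drift (\<xi> (Suc k) \<omega>)) = ?D (Suc n) / real n"
   by (simp only: sum.lessThan_Suc_shift) (simp add: add_divide_distrib)
  with n have "?D (Suc n) < 0" by (simp add: divide_less_0_iff)
  then have "\<not> survives step (\<lambda>m. \<xi> m \<omega>) (Suc n)"
   using survives_drift[of "\<lambda>m. \<xi> m \<omega>" "Suc n"] elim(2) by auto
  then show ?case unfolding returns_iff_not_survives by blast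
 qed
qed

lemma survival_tail:
 assumes "prob_space M" and \<xi>: "iid M borel \<xi>" and good: "AE \<omega> in M. \<forall>i. good (\<xi> i \<omega>)"
  and int: "integrable M (\<lambda>\<omega>. drift (\<xi> 0 \<omega>) ^ 10)" and mean: "(LINT \<omega>|M. drift (\<xi> 0 \<omega>)) < 0"
 shows "\<exists>C\<ge>0. \<forall>k. measure M {\<omega>\<in>space M. survives step (\<lambda>m. \<xi> m \<omega>) k} \<le> C / real (Suc k) ^ 5"
proof -
 interpret prob_space M by fact
 note [measurable] = iid_measurable[OF \<xi>]
 have seq[measurable]: "(\<lambda>\<omega> m. \<xi> m \<omega>) \<in> M \<rightarrow>\<^sub>M seqs" by (rule measurable_seqsI) measurable
 have D: "iid M borel (\<lambda>k \<omega>. drift (\<xi> k \<omega>))" using iid_compose[OF \<xi>, of drift borel] by simp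
 obtain C where C: "C > 0" "\<And>n. prob {\<omega>\<in>space M. 0 < (\<Sum>k<n. drift (\<xi> k \<omega>))} \<le> C / real (Suc n) ^ 5"
  using negative_drift_tail[OF D int mean] by blast
 \<comment> \<open>The maximum with 1 covers \<open>k = 0\<close>, where survival is certain and
   \<open>survives_drift\<close> says nothing.\<close>
 have "prob {\<omega>\<in>space M. survives step (\<lambda>m. \<xi> m \<omega>) k} \<le> max C 1 / real (Suc k) ^ 5" for k
 proof (cases "k = 0")
  case False
  have "prob {\<omega>\<in>space M. survives step (\<lambda>m. \<xi> m \<omega>) k} \<le> prob {\<omega>\<in>space M. 0 < (\<Sum>i<k. drift (\<xi> i \<omega>))}"
  proof (rule finite_measure_mono_AE)
   show "AE \<omega> in M. \<omega> \<in> {\<omega>\<in>space M. survives step (\<lambda>m. \<xi> m \<omega>) k} \<longrightarrow> \<omega> \<in> {\<omega>\<in>space M. 0 < (\<Sum>i<k. drift (\<xi> i \<omega>))}"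
    using good
   proof eventually_elim
    case (elim \<omega>)
    then show ?case using survives_drift[of "\<lambda>m. \<xi> m \<omega>" k] False by auto
   qed
  qed measurable
  also have "\<dots> \<le> C / real (Suc k) ^ 5" by (rule C)
  also have "\<dots> \<le> max C 1 / real (Suc k) ^ 5" by (intro divide_right_mono) auto
  finally show ?thesis .
 next
  case True
  have "prob {\<omega>\<in>space M. survives step (\<lambda>m. \<xi> m \<omega>) k} \<le> max C 1"
   by (rule order_trans[OF prob_le_1 max.cobounded2])
  then show ?thesis using True by simp
 qed
 then show ?thesis by (intro exI[of _ "max C 1"]) auto
qed

text \<open>Fourth moments of duration and load suffice, because the square of a product is at most
  the sum of the fourth powers of its factors.\<close>

lemma cycle_bound_integrable:
 assumes "prob_space M" and \<xi>: "iid M borel \<xi>" and good: "AE \<omega> in M. \<forall>i. good (\<xi> i \<omega>)"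
  and int: "integrable M (\<lambda>\<omega>. drift (\<xi> 0 \<omega>) ^ 10)" and mean: "(LINT \<omega>|M. drift (\<xi> 0 \<omega>)) < 0"
  and ret: "AE \<omega> in M. returns step (\<lambda>m. \<xi> m \<omega>)"
  and dur4: "integrable M (\<lambda>\<omega>. (snd (\<xi> 0 \<omega>)) ^ 4)" and load4: "integrable M (\<lambda>\<omega>. sub_norm j2 (fst (\<xi> 0 \<omega>)) ^ 4)"
 defines "D \<equiv> \<lambda>\<omega>. \<Sum>k<R (\<lambda>m. \<xi> m \<omega>). snd (\<xi> k \<omega>)" and "L \<equiv> \<lambda>\<omega>. \<Sum>k<R (\<lambda>m. \<xi> m \<omega>). sub_norm j2 (fst (\<xi> k \<omega>))"
 shows "integrable M (\<lambda>\<omega>. (D \<omega>)\<^sup>2)" "integrable M (\<lambda>\<omega>. (D \<omega> * (a * L \<omega> + b))\<^sup>2)"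
proof -
 interpret prob_space M by fact
 note [measurable] = iid_measurable[OF \<xi>] sub_norm_measurable[OF j2]
 have seq[measurable]: "(\<lambda>\<omega> m. \<xi> m \<omega>) \<in> M \<rightarrow>\<^sub>M seqs" by (rule measurable_seqsI) measurable
 obtain C where C: "C \<ge> 0" "\<And>k. prob {\<omega>\<in>space M. survives step (\<lambda>m. \<xi> m \<omega>) k} \<le> C / real (Suc k) ^ 5"
  using survival_tail[OF assms(1) \<xi> good int mean] by blast
 have hm: "(\<lambda>e. sub_norm j2 (fst e)) \<in> borel_measurable (borel :: ('v \<times> real) measure)" by measurable
 have L4: "integrable M (\<lambda>\<omega>. L \<omega> ^ 4)"
  unfolding L_def by (rule cycle_sum_moment[OF step_regenerative \<xi> hm _ load4 ret C]) simp
 have "integrable M (\<lambda>\<omega>. (\<Sum>k<R (\<lambda>m. \<xi> m \<omega>). \<bar>snd (\<xi> k \<omega>)\<bar>) ^ 4)"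
  by (rule cycle_sum_moment[OF step_regenerative \<xi> _ _ _ ret C]) (use dur4 in auto)
 moreover have Dm[measurable]: "D \<in> borel_measurable M"
 proof -
  have "(\<lambda>s. (\<Sum>k<R s. snd (s k))) \<in> borel_measurable seqs"
   by (rule measurable_compose_countable[OF _ ret_measurable, where f="\<lambda>r s. (\<Sum>k<r. snd (s k))"]) measurable
  from measurable_compose[OF seq this] show ?thesis unfolding D_def .
 qed
 moreover have "AE \<omega> in M. (\<Sum>k<R (\<lambda>m. \<xi> m \<omega>). \<bar>snd (\<xi> k \<omega>)\<bar>) ^ 4 = D \<omega> ^ 4"
  using good by eventually_elim (simp add: D_def good_def less_imp_le)
 ultimately have D4: "integrable M (\<lambda>\<omega>. D \<omega> ^ 4)"
  by (subst integrable_cong_AE_imp[where g="\<lambda>\<omega>. (\<Sum>k<R (\<lambda>m. \<xi> m \<omega>). \<bar>snd (\<xi> k \<omega>)\<bar>) ^ 4"]) auto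
 have Lm[measurable]: "L \<in> borel_measurable M"
 proof -
  have "(\<lambda>s. (\<Sum>k<R s. sub_norm j2 (fst (s k)))) \<in> borel_measurable seqs"
   by (rule measurable_compose_countable[OF _ ret_measurable, where f="\<lambda>r s. (\<Sum>k<r. sub_norm j2 (fst (s k)))"]) measurable
  from measurable_compose[OF seq this] show ?thesis unfolding L_def .
 qed
 have amgm: "(x * y)\<^sup>2 \<le> x ^ 4 + y ^ 4" for x y :: real
 proof -
  have "0 \<le> (x\<^sup>2 - y\<^sup>2)\<^sup>2 + (x\<^sup>2)\<^sup>2 + (y\<^sup>2)\<^sup>2" by simp
  then show ?thesis by (simp add: power2_diff power_mult_distrib)
 qed
 have four: "(x + y) ^ 4 \<le> 8 * (x ^ 4 + y ^ 4)" for x y :: real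
 proof -
  have sq: "(u + v)\<^sup>2 \<le> 2 * (u\<^sup>2 + v\<^sup>2)" for u v :: real
   using sum_squares_bound[of u v] by (simp add: power2_sum)
  have "(x + y) ^ 4 = ((x + y)\<^sup>2)\<^sup>2" by simp
  also have "\<dots> \<le> (2 * (x\<^sup>2 + y\<^sup>2))\<^sup>2" by (intro power_mono sq) simp
  also have "\<dots> = 4 * (x\<^sup>2 + y\<^sup>2)\<^sup>2" by (simp only: power_mult_distrib) simp
  also have "\<dots> \<le> 4 * (2 * ((x\<^sup>2)\<^sup>2 + (y\<^sup>2)\<^sup>2))" by (intro mult_left_mono sq) simp
  finally show ?thesis by simp
 qed
 show "integrable M (\<lambda>\<omega>. (D \<omega>)\<^sup>2)"
 proof (rule Bochner_Integration.integrable_bound)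
  show "integrable M (\<lambda>\<omega>. D \<omega> ^ 4 + 1)" using D4 by simp
  show "AE \<omega> in M. norm ((D \<omega>)\<^sup>2) \<le> norm (D \<omega> ^ 4 + 1)" using amgm[of "D _" 1] by (auto intro: order_trans[OF _ abs_ge_self])
 qed measurable
 show "integrable M (\<lambda>\<omega>. (D \<omega> * (a * L \<omega> + b))\<^sup>2)"
 proof (rule Bochner_Integration.integrable_bound)
  show "integrable M (\<lambda>\<omega>. D \<omega> ^ 4 + 8 * (a ^ 4 * L \<omega> ^ 4 + b ^ 4))" using D4 L4 by simp
  have "(D \<omega> * (a * L \<omega> + b))\<^sup>2 \<le> D \<omega> ^ 4 + 8 * (a ^ 4 * L \<omega> ^ 4 + b ^ 4)" for \<omega>
   using amgm[of "D \<omega>" "a * L \<omega> + b"] four[of "a * L \<omega>" b] by (simp add: power_mult_distrib)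
  then show "AE \<omega> in M. norm ((D \<omega> * (a * L \<omega> + b))\<^sup>2) \<le> norm (D \<omega> ^ 4 + 8 * (a ^ 4 * L \<omega> ^ 4 + b ^ 4))"
   by (auto intro: order_trans[OF _ abs_ge_self])
 qed measurable
qed

end

text \<open>The process is defined on half-open intervals, while the integrals run over closed ones;
  \<open>drop\<close> neglects the end points. Each piece is translated so that it starts at time 0,
  and the pieces are joined by induction.\<close>

lemma path_integral:
 fixes f :: "real \<Rightarrow> 'w::{banach, second_countable_topology}" and g :: "nat \<Rightarrow> real \<Rightarrow> 'w" and b :: "nat \<Rightarrow> real"
 assumes b: "\<And>k. b k \<ge> 0" and a: "\<And>n. a n = (\<Sum>k<n. b k)"
  and f: "\<And>k t. a k \<le> t \<Longrightarrow> t < a (Suc k) \<Longrightarrow> f t = g k (t - a k)"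
  and g: "\<And>k. set_integrable lborel {0..b k} (g k)"
  and t: "a n \<le> t" "t \<le> a (Suc n)"
 shows "set_integrable lborel {0..t} f"
  "(LINT \<tau>:{0..t}|lborel. f \<tau>) = (\<Sum>k<n. LINT r:{0..b k}|lborel. g k r) + (LINT r:{0..t - a n}|lborel. g n r)"
proof -
 have drop: "has_bochner_integral lborel h2 I" if "has_bochner_integral lborel h1 I" "\<And>r. r \<noteq> z \<Longrightarrow> h1 r = h2 r"
  for h1 h2 :: "real \<Rightarrow> 'w" and z I
  using that(1) by (subst (asm) has_bochner_integral_discrete_difference[where X="{z}" and g=h2]) (use that(2) in auto)
 have seg: "has_bochner_integral lborel (\<lambda>\<tau>. indicator {a m..<u} \<tau> *\<^sub>R f \<tau>) (LINT r:{0..u - a m}|lborel. g m r)"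
  if u: "a m \<le> u" "u \<le> a (Suc m)" for m u
 proof -
  have "set_integrable lborel {0..u - a m} (g m)"
   by (rule set_integrable_subset[OF g]) (use u in \<open>auto simp: a\<close>)
  then have "has_bochner_integral lborel (\<lambda>r. indicator {0..u - a m} r *\<^sub>R g m r) (LINT r:{0..u - a m}|lborel. g m r)"
   unfolding set_integrable_def set_lebesgue_integral_def by (rule has_bochner_integral_integrable)
  then have "has_bochner_integral lborel (\<lambda>r. indicator {0..<u - a m} r *\<^sub>R g m r) (LINT r:{0..u - a m}|lborel. g m r)"
   by (rule drop[where z="u - a m"]) (auto simp: indicator_def)
  then have "has_bochner_integral lborel (\<lambda>\<tau>. indicator {0..<u - a m} (- a m + 1 * \<tau>) *\<^sub>R g m (- a m + 1 * \<tau>)) ((LINT r:{0..u - a m}|lborel. g m r) /\<^sub>R \<bar>1\<bar>)"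
   by (subst lborel_has_bochner_integral_real_affine_iff[symmetric]) auto
  moreover have "indicator {0..<u - a m} (- a m + 1 * \<tau>) *\<^sub>R g m (- a m + 1 * \<tau>) = indicator {a m..<u} \<tau> *\<^sub>R f \<tau>" for \<tau>
   using f[of m \<tau>] u by (auto simp: indicator_def)
  ultimately show ?thesis by simp
 qed
 have mono: "a m \<le> a (Suc m)" for m by (simp add: a b)
 have a0: "0 \<le> a m" for m unfolding a by (intro sum_nonneg b)
 have join: "has_bochner_integral lborel (\<lambda>\<tau>. indicator {0..<u} \<tau> *\<^sub>R f \<tau>) (I + (LINT r:{0..u - a m}|lborel. g m r))"
  if "has_bochner_integral lborel (\<lambda>\<tau>. indicator {0..<a m} \<tau> *\<^sub>R f \<tau>) I" "a m \<le> u" "u \<le> a (Suc m)" for m u I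
 proof -
  have "indicator {0..<a m} \<tau> *\<^sub>R f \<tau> + indicator {a m..<u} \<tau> *\<^sub>R f \<tau> = indicator {0..<u} \<tau> *\<^sub>R f \<tau>" for \<tau>
   using that(2) a0[of m] by (auto simp: indicator_def)
  with has_bochner_integral_add[OF that(1) seg[OF that(2,3)]] show ?thesis by simp
 qed
 have "has_bochner_integral lborel (\<lambda>\<tau>. indicator {0..<a m} \<tau> *\<^sub>R f \<tau>) (\<Sum>k<m. LINT r:{0..b k}|lborel. g k r)" for m
 proof (induction m)
  case 0
  have "a 0 = 0" by (simp add: a)
  then show ?case by (simp add: has_bochner_integral_zero)
 next
  case (Suc m)
  have "a (Suc m) - a m = b m" by (simp add: a)
  with join[OF Suc mono order_refl] show ?case by simp
 qed
 from join[OF this t] have "has_bochner_integral lborel (\<lambda>\<tau>. indicator {0..<t} \<tau> *\<^sub>R f \<tau>)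
   ((\<Sum>k<n. LINT r:{0..b k}|lborel. g k r) + (LINT r:{0..t - a n}|lborel. g n r))" .
 then have "has_bochner_integral lborel (\<lambda>\<tau>. indicator {0..t} \<tau> *\<^sub>R f \<tau>)
   ((\<Sum>k<n. LINT r:{0..b k}|lborel. g k r) + (LINT r:{0..t - a n}|lborel. g n r))"
  by (rule drop[where z=t]) (auto simp: indicator_def)
 then show "set_integrable lborel {0..t} f"
  "(LINT \<tau>:{0..t}|lborel. f \<tau>) = (\<Sum>k<n. LINT r:{0..b k}|lborel. g k r) + (LINT r:{0..t - a n}|lborel. g n r)"
  unfolding set_integrable_def set_lebesgue_integral_def
  by (auto intro: integrable.intros simp: has_bochner_integral_integral_eq)
qed

context extinction_functional
begin

lemma exists_step:
 assumes "0 \<le> v" "v \<le> durations c r" "1 \<le> r"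
 shows "\<exists>m<r. durations c m \<le> v \<and> v \<le> durations c (Suc m)"
 using assms(2,3)
proof (induction r)
 case (Suc r)
 show ?case
 proof (cases "durations c r \<le> v")
  case True
  then show ?thesis using Suc.prems by blast
 next
  case False
  then have "r \<ge> 1" using assms(1) by (cases r) (auto simp: durations_def)
  with Suc.IH False show ?thesis by (metis less_Suc_eq linear)
 qed
qed simp

definition dur :: "(nat \<Rightarrow> 'v \<times> real) \<Rightarrow> real" where "dur s = durations s (R s)"
definition rew :: "(nat \<Rightarrow> 'v \<times> real) \<Rightarrow> 'w" where "rew s = reward s (R s)"
definition lod :: "(nat \<Rightarrow> 'v \<times> real) \<Rightarrow> real" where "lod s = load s (R s)"

lemma cycle_quantities_measurable[measurable]:
 "dur \<in> borel_measurable seqs" "rew \<in> borel_measurable seqs" "lod \<in> borel_measurable seqs"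
 unfolding dur_def[abs_def] rew_def[abs_def] lod_def[abs_def]
 by (rule measurable_compose_countable[OF _ ret_measurable], rule durations_measurable reward_measurable load_measurable)+

lemma cycle_quantities_adapted: "adapted step dur" "adapted step rew" "adapted step lod"
 unfolding dur_def[abs_def] rew_def[abs_def] lod_def[abs_def]
 using adapted_sums[of durations, OF reward_cong(2)] adapted_sums[of reward, OF reward_cong(1)] adapted_sums[of load, OF reward_cong(3)]
 by auto

context
 fixes s :: "nat \<Rightarrow> 'v \<times> real"
 assumes good: "\<And>i. good (s i)" and returns: "\<And>n. returns step (nth_cycle step n s)"
begin

lemma epoch_sums:
 "durations s (epoch step s n) = (\<Sum>k<n. dur (nth_cycle step k s))"
 "reward s (epoch step s n) = (\<Sum>k<n. rew (nth_cycle step k s))"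
proof -
 have "durations s (epoch step s n) = (\<Sum>k<n. dur (nth_cycle step k s)) \<and> reward s (epoch step s n) = (\<Sum>k<n. rew (nth_cycle step k s))"
 proof (induction n)
  case (Suc n)
  have "W s (epoch step s n) = 0" by (rule walk_epoch) (rule returns)
  with Suc show ?case using reward_shift[of s "epoch step s n"] by (simp add: dur_def rew_def nth_cycle_def)
 qed (simp add: durations_def reward_def)
 then show "durations s (epoch step s n) = (\<Sum>k<n. dur (nth_cycle step k s))"
  "reward s (epoch step s n) = (\<Sum>k<n. rew (nth_cycle step k s))" by auto
qed

text \<open>Up to epoch \<open>Suc n\<close> everything is a sum over complete cycles. What remains
  is an initial part of the running cycle, controlled by \<open>reward_bound\<close> for the
  sequence \<open>c\<close> of that cycle; \<open>norm \<nu>\<close> pays for the centering over the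
  elapsed time \<open>v\<close>.\<close>

lemma cycle_close:
 assumes I: "\<And>m t. durations s m \<le> t \<Longrightarrow> t \<le> durations s (Suc m) \<Longrightarrow> I t = reward s m + flow_integral (state s m) (t - durations s m)"
  and t: "dur s + (\<Sum>k<n. dur (nth_cycle step (Suc k) s)) \<le> t" "t \<le> dur s + (\<Sum>k<Suc n. dur (nth_cycle step (Suc k) s))"
 shows "norm (I t - t *\<^sub>R \<nu> - (rew s - dur s *\<^sub>R \<nu>) - (\<Sum>k<n. rew (nth_cycle step (Suc k) s) - dur (nth_cycle step (Suc k) s) *\<^sub>R \<nu>))
  \<le> dur (nth_cycle step (Suc n) s) * (c1 * lod (nth_cycle step (Suc n) s) + (c2 + norm \<nu>))"
proof -
 define E where "E = epoch step s (Suc n)"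
 define c where "c = drop_seq E s"
 have c: "c = nth_cycle step (Suc n) s" by (simp add: c_def E_def nth_cycle_def)
 have W0: "W s E = 0" unfolding E_def by (rule walk_epoch) (rule returns)
 have gc: "good (c i)" for i using good by (simp add: c_def drop_seq_def)
 have head: "(\<Sum>k<Suc n. g (nth_cycle step k s)) = g s + (\<Sum>k<n. g (nth_cycle step (Suc k) s))" for g :: "_ \<Rightarrow> 'c::comm_monoid_add" and n
  by (simp only: sum.lessThan_Suc_shift cycle_0)
 have dE: "durations s E = dur s + (\<Sum>k<n. dur (nth_cycle step (Suc k) s))"
  and rE: "reward s E = rew s + (\<Sum>k<n. rew (nth_cycle step (Suc k) s))"
  unfolding E_def epoch_sums head by simp_all
 define v where "v = t - durations s E"
 have v: "0 \<le> v" "v \<le> durations c (R c)" using t dE by (auto simp: v_def c dur_def)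
 have "1 \<le> R c" using hits_ret[OF returns[of "Suc n"]] by (simp add: c hits_def)
 then obtain m where m: "m < R c" "durations c m \<le> v" "v \<le> durations c (Suc m)" using exists_step[OF v] by blast
 note sh = reward_shift[OF W0, folded c_def]
 have tm: "durations s (E + m) \<le> t" "t \<le> durations s (Suc (E + m))"
  using m sh(3)[of m] sh(3)[of "Suc m"] by (auto simp: v_def)
 have It: "I t = reward s E + (reward c m + flow_integral (state c m) (v - durations c m))"
  using I[OF tm] sh(1)[of m] sh(2)[of m] sh(3)[of m] by (simp add: v_def add.assoc diff_diff_eq)
 have "norm (reward c m + flow_integral (state c m) (v - durations c m)) \<le> durations c (R c) * (c1 * load c (R c) + c2)"
  by (rule reward_bound[OF gc m(1)]) (use m in \<open>auto simp: durations_def\<close>)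
 moreover have "norm (v *\<^sub>R \<nu>) \<le> durations c (R c) * norm \<nu>" using v by (simp add: mult_right_mono)
 ultimately have "norm ((reward c m + flow_integral (state c m) (v - durations c m)) - v *\<^sub>R \<nu>) \<le> durations c (R c) * (c1 * load c (R c) + (c2 + norm \<nu>))"
  using norm_triangle_ineq4[of "reward c m + flow_integral (state c m) (v - durations c m)" "v *\<^sub>R \<nu>"] by (simp add: algebra_simps)
 moreover have "I t - t *\<^sub>R \<nu> - (rew s - dur s *\<^sub>R \<nu>) - (\<Sum>k<n. rew (nth_cycle step (Suc k) s) - dur (nth_cycle step (Suc k) s) *\<^sub>R \<nu>)
   = (reward c m + flow_integral (state c m) (v - durations c m)) - v *\<^sub>R \<nu>"
  unfolding It rE v_def dE by (simp add: sum_subtractf scaleR_sum_left algebra_simps)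
 ultimately show ?thesis by (simp only: c[symmetric] dur_def lod_def)
qed

end

section \<open>Expressing the process by cycle quantities\<close>

context
 fixes A :: "'v \<Rightarrow> 'v set" and \<beta> :: "nat \<Rightarrow> 'a \<Rightarrow> real" and \<eta> :: "nat \<Rightarrow> 'a \<Rightarrow> 'v" and x :: "'a \<Rightarrow> 'v"
 assumes T: "T = semigroup_of A"
begin

abbreviation "\<Xi>s \<omega> \<equiv> (\<lambda>m. noise \<beta> \<eta> x m \<omega>)"

lemma chain_eq_state: "chain A \<beta> \<eta> x m \<omega> = state (\<Xi>s \<omega>) m"
proof (induction m)
 case (Suc m)
 then show ?case by (simp add: state_def step_def noise_def T[symmetric])
qed (simp add: state_def noise_def)

lemma arrival_eq_durations: "arrival \<beta> m \<omega> = durations (\<Xi>s \<omega>) m"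
proof (induction m)
 case (Suc m)
 then show ?case by (simp add: arrival_def durations_def noise_def)
qed (simp add: arrival_def durations_def)

text \<open>Arrival times are nondecreasing for good noise, so every other summand of the defining
  series vanishes.\<close>

lemma process_eq:
 assumes good: "\<And>i. good (\<Xi>s \<omega> i)" and t: "durations (\<Xi>s \<omega>) n \<le> t" "t < durations (\<Xi>s \<omega>) (Suc n)"
 shows "process A \<beta> \<eta> x t \<omega> = T (t - durations (\<Xi>s \<omega>) n) (state (\<Xi>s \<omega>) n)"
proof -
 let ?s = "\<Xi>s \<omega>"
 let ?F = "\<lambda>m. indicator {durations ?s m..<durations ?s (Suc m)} t *\<^sub>R T (max (t - durations ?s m) 0) (state ?s m)"
 have "process A \<beta> \<eta> x t \<omega> = (\<Sum>m. ?F m)"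
  unfolding process_def arrival_eq_durations chain_eq_state T[symmetric] ..
 also have "\<dots> = (\<Sum>m\<in>{n}. ?F m)"
 proof (rule suminf_finite)
  fix m assume "m \<notin> {n}"
  then consider "Suc m \<le> n" | "Suc n \<le> m" by force
  then have "t \<notin> {durations ?s m..<durations ?s (Suc m)}"
  proof cases
   case 1
   from durations_mono[of ?s, OF good 1] t show ?thesis by simp
  next
   case 2
   from durations_mono[of ?s, OF good 2] t show ?thesis by simp
  qed
  then show "?F m = 0" by simp
 qed simp
 finally show ?thesis using t by simp
qed

lemma process_integral:
 assumes good: "\<And>i. good (\<Xi>s \<omega> i)" and t: "durations (\<Xi>s \<omega>) n \<le> t" "t \<le> durations (\<Xi>s \<omega>) (Suc n)"
 shows "set_integrable lborel {0..t} (\<lambda>\<tau>. f (process A \<beta> \<eta> x \<tau> \<omega>))"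
  "(LINT \<tau>:{0..t}|lborel. f (process A \<beta> \<eta> x \<tau> \<omega>)) = reward (\<Xi>s \<omega>) n + flow_integral (state (\<Xi>s \<omega>) n) (t - durations (\<Xi>s \<omega>) n)"
proof -
 let ?s = "\<Xi>s \<omega>"
 have sn: "snd (?s k) \<ge> 0" for k using good[of k] by (simp add: good_def)
 note P = path_integral[of "\<lambda>k. snd (?s k)" "durations ?s" "\<lambda>\<tau>. f (process A \<beta> \<eta> x \<tau> \<omega>)" "\<lambda>k r. f (T r (state ?s k))",
   OF sn durations_def _ flow_integrable(1) t]
 show "set_integrable lborel {0..t} (\<lambda>\<tau>. f (process A \<beta> \<eta> x \<tau> \<omega>))"
  by (rule P(1)) (use process_eq[OF good] sn W_range(4)[of ?s, OF good] in auto)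
 have "(LINT \<tau>:{0..t}|lborel. f (process A \<beta> \<eta> x \<tau> \<omega>)) = (\<Sum>k<n. LINT r:{0..snd (?s k)}|lborel. f (T r (state ?s k))) +
   (LINT r:{0..t - durations ?s n}|lborel. f (T r (state ?s n)))"
  by (rule P(2)) (use process_eq[OF good] sn W_range(4)[of ?s, OF good] in auto)
 then show "(LINT \<tau>:{0..t}|lborel. f (process A \<beta> \<eta> x \<tau> \<omega>)) = reward ?s n + flow_integral (state ?s n) (t - durations ?s n)"
  unfolding reward_def flow_integral_def .
qed

lemma first_extinction_eq:
 assumes "returns step (\<Xi>s \<omega>)"
 shows "first_extinction A \<beta> \<eta> x \<omega> = enat (R (\<Xi>s \<omega>))" "extinction_time A \<beta> \<eta> x \<omega> = dur (\<Xi>s \<omega>)"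
proof -
 let ?s = "\<Xi>s \<omega>"
 have W: "semigroup_of A (\<beta> m \<omega>) (chain A \<beta> \<eta> x (m - 1) \<omega>) = W ?s m" if "m \<ge> 1" for m
 proof -
  obtain k where k: "m = Suc k" using \<open>m \<ge> 1\<close> by (cases m) auto
  show ?thesis unfolding k chain_eq_state by (simp add: T[symmetric] step_def state_def noise_def)
 qed
 have S: "{enat m | m. m \<ge> 1 \<and> semigroup_of A (\<beta> m \<omega>) (chain A \<beta> \<eta> x (m - 1) \<omega>) = 0} = {enat m | m. m \<ge> 1 \<and> W ?s m = 0}"
  using W by auto
 have h: "hits step ?s (R ?s)" by (rule hits_ret[OF assms])
 show 1: "first_extinction A \<beta> \<eta> x \<omega> = enat (R ?s)"
  unfolding first_extinction_def S
 proof (rule antisym)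
  show "Inf {enat m |m. 1 \<le> m \<and> W ?s m = 0} \<le> enat (R ?s)" using h by (intro Inf_lower) (auto simp: hits_def)
  show "enat (R ?s) \<le> Inf {enat m |m. 1 \<le> m \<and> W ?s m = 0}"
  proof (rule Inf_greatest)
   fix z assume "z \<in> {enat m |m. 1 \<le> m \<and> W ?s m = 0}"
   then obtain m where m: "z = enat m" "1 \<le> m" "W ?s m = 0" by blast
   with h have "\<not> m < R ?s" unfolding hits_def by blast
   then show "enat (R ?s) \<le> z" using m by simp
  qed
 qed
 show "extinction_time A \<beta> \<eta> x \<omega> = dur ?s"
  unfolding extinction_time_def 1 by (simp add: arrival_eq_durations dur_def)
qed

lemma extinction_integral:
 assumes good: "\<And>i. good (\<Xi>s \<omega> i)" and ret: "returns step (\<Xi>s \<omega>)"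
 shows "(LINT \<tau>:{0..extinction_time A \<beta> \<eta> x \<omega>}|lborel. f (process A \<beta> \<eta> x \<tau> \<omega>)) = rew (\<Xi>s \<omega>)"
  "(LINT \<tau>:{0..extinction_time A \<beta> \<eta> x \<omega>}|lborel. f (process A \<beta> \<eta> x \<tau> \<omega>) - \<nu>) = rew (\<Xi>s \<omega>) - dur (\<Xi>s \<omega>) *\<^sub>R \<nu>"
proof -
 let ?s = "\<Xi>s \<omega>"
 have e: "extinction_time A \<beta> \<eta> x \<omega> = durations ?s (R ?s)" using first_extinction_eq(2)[OF ret] by (simp add: dur_def)
 have le: "durations ?s (R ?s) \<le> durations ?s (Suc (R ?s))" by (rule durations_mono[OF good]) simp
 \<comment> \<open>Extinction happens at the arrival with index \<open>R ?s\<close>, that is at the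
   very beginning of the next step; the flow part there has length 0.\<close>
 note P = process_integral[OF good order_refl le]
 have z: "flow_integral v 0 = 0" for v unfolding flow_integral_def set_lebesgue_integral_def
 proof (rule integral_eq_zero_AE)
  show "AE t in lborel. indicator {0..0} t *\<^sub>R f (T t v) = 0"
   using AE_lborel_singleton[of 0] by eventually_elim (simp add: indicator_def)
 qed
 show 1: "(LINT \<tau>:{0..extinction_time A \<beta> \<eta> x \<omega>}|lborel. f (process A \<beta> \<eta> x \<tau> \<omega>)) = rew ?s"
  unfolding e P(2) by (simp add: z rew_def)
 have "(LINT \<tau>:{0..durations ?s (R ?s)}|lborel. f (process A \<beta> \<eta> x \<tau> \<omega>) - \<nu>)
   = (LINT \<tau>:{0..durations ?s (R ?s)}|lborel. f (process A \<beta> \<eta> x \<tau> \<omega>)) - (LINT \<tau>:{0..durations ?s (R ?s)}|lborel. \<nu>)"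
  by (rule set_integral_diff(2)[OF P(1)]) (intro borel_integrable_atLeastAtMost' continuous_on_const)
 also have "(LINT \<tau>:{0..durations ?s (R ?s)}|lborel. \<nu>) = dur ?s *\<^sub>R \<nu>"
  using durations_nonneg[of ?s, OF good] by (simp add: set_lebesgue_integral_def dur_def)
 finally show "(LINT \<tau>:{0..extinction_time A \<beta> \<eta> x \<omega>}|lborel. f (process A \<beta> \<eta> x \<tau> \<omega>) - \<nu>) = rew ?s - dur ?s *\<^sub>R \<nu>"
  using 1 unfolding e by simp
qed

lemma process_integral_measurable:
 fixes g :: "'v \<Rightarrow> 'w"
 assumes [measurable]: "\<And>m. noise \<beta> \<eta> x m \<in> borel_measurable M" "g \<in> borel_measurable borel" "u \<in> borel_measurable M"
 shows "(\<lambda>\<omega>. LINT \<tau>:{0..u \<omega>}|lborel. g (process A \<beta> \<eta> x \<tau> \<omega>)) \<in> borel_measurable M"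
proof -
 have seq[measurable]: "(\<lambda>\<omega>. \<Xi>s \<omega>) \<in> M \<rightarrow>\<^sub>M seqs" by (rule measurable_seqsI) measurable
 have [measurable]: "(\<lambda>\<omega>. state (\<Xi>s \<omega>) m) \<in> borel_measurable M" "(\<lambda>\<omega>. durations (\<Xi>s \<omega>) m) \<in> borel_measurable M" for m
  using measurable_compose[OF seq state_measurable] measurable_compose[OF seq durations_measurable] by auto
 have "(\<lambda>(\<omega>, \<tau>). process A \<beta> \<eta> x \<tau> \<omega>) \<in> borel_measurable (M \<Otimes>\<^sub>M lborel)"
 proof -
  have "(\<lambda>(\<omega>, \<tau>). \<Sum>m. (if durations (\<Xi>s \<omega>) m \<le> \<tau> \<and> \<tau> < durations (\<Xi>s \<omega>) (Suc m) then 1 else (0::real)) *\<^sub>R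
    T (max (\<tau> - durations (\<Xi>s \<omega>) m) 0) (state (\<Xi>s \<omega>) m)) \<in> borel_measurable (M \<Otimes>\<^sub>M lborel)"
   unfolding split_beta' by measurable
  then show ?thesis
   unfolding process_def arrival_eq_durations chain_eq_state T[symmetric] by (simp add: indicator_def)
 qed
 from measurable_compose[OF this assms(2)]
 have [measurable]: "(\<lambda>p. g (process A \<beta> \<eta> x (snd p) (fst p))) \<in> borel_measurable (M \<Otimes>\<^sub>M lborel)" by (simp add: split_beta')
 show ?thesis
  unfolding set_lebesgue_integral_def
 proof (rule lborel.borel_measurable_lebesgue_integral)
  have "(\<lambda>(\<omega>, \<tau>). (if 0 \<le> \<tau> \<and> \<tau> \<le> u \<omega> then 1 else (0::real)) *\<^sub>R g (process A \<beta> \<eta> x \<tau> \<omega>)) \<in> borel_measurable (M \<Otimes>\<^sub>M lborel)"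
   unfolding split_beta' by measurable
  then show "(\<lambda>(\<omega>, \<tau>). indicator {0..u \<omega>} \<tau> *\<^sub>R g (process A \<beta> \<eta> x \<tau> \<omega>)) \<in> borel_measurable (M \<Otimes>\<^sub>M lborel)"
   by (simp add: indicator_def)
 qed
qed

lemma extinction_time_measurable:
 assumes [measurable]: "\<And>m. noise \<beta> \<eta> x m \<in> borel_measurable M"
 shows "extinction_time A \<beta> \<eta> x \<in> borel_measurable M"
proof -
 have seq: "(\<lambda>\<omega>. \<Xi>s \<omega>) \<in> M \<rightarrow>\<^sub>M seqs" by (rule measurable_seqsI) measurable
 \<comment> \<open>Without extinction, \<open>extinction_time\<close> evaluates
   \<open>the_enat\<close> at infinity, a fixed but unspecified number; \<open>r\<close> reproduces
   it so that the identity below holds at every point.\<close>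
 define r where "r s = (if returns step s then R s else the_enat \<infinity>)" for s
 have [measurable]: "r \<in> measurable seqs (count_space UNIV)" unfolding r_def[abs_def] by measurable
 have "(\<lambda>s. durations s (r s)) \<in> borel_measurable seqs"
  by (rule measurable_compose_countable[where f="\<lambda>n s. durations s n"]) measurable
 from measurable_compose[OF seq this] have m: "(\<lambda>\<omega>. durations (\<Xi>s \<omega>) (r (\<Xi>s \<omega>))) \<in> borel_measurable M" .
 have "extinction_time A \<beta> \<eta> x \<omega> = durations (\<Xi>s \<omega>) (r (\<Xi>s \<omega>))" for \<omega>
 proof (cases "returns step (\<Xi>s \<omega>)")
  case True
  then show ?thesis by (simp add: first_extinction_eq dur_def r_def)
 next
  case False
  have "{enat m | m. m \<ge> 1 \<and> semigroup_of A (\<beta> m \<omega>) (chain A \<beta> \<eta> x (m - 1) \<omega>) = 0} = {}"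
  proof (rule ccontr)
   assume "{enat m | m. m \<ge> 1 \<and> semigroup_of A (\<beta> m \<omega>) (chain A \<beta> \<eta> x (m - 1) \<omega>) = 0} \<noteq> {}"
   then obtain m where m: "m \<ge> 1" "semigroup_of A (\<beta> m \<omega>) (chain A \<beta> \<eta> x (m - 1) \<omega>) = 0" by blast
   then obtain k where k: "m = Suc k" by (cases m) auto
   have "W (\<Xi>s \<omega>) m = 0" using m(2) unfolding k chain_eq_state by (simp add: T[symmetric] step_def state_def noise_def)
   then have "\<not> survives step (\<Xi>s \<omega>) m" unfolding survives_def using m(1) by blast
   with False show False unfolding returns_iff_not_survives by blast
  qed
  then have "first_extinction A \<beta> \<eta> x \<omega> = \<infinity>" unfolding first_extinction_def by (simp only: Inf_empty top_enat_def)
  then show ?thesis using False by (simp add: extinction_time_def arrival_eq_durations r_def)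
 qed
 with m show ?thesis by (simp cong: measurable_cong)
qed

end

lemma rew_bound:
 assumes s: "\<And>i. good (s i)" and ret: "returns step s"
 shows "norm (rew s) \<le> dur s * (c1 * lod s + c2)" "0 < dur s"
proof -
 obtain m where m: "R s = Suc m" using hits_ret[OF ret] by (cases "R s") (auto simp: hits_def)
 have sn: "0 < snd (s i)" for i using s[of i] by (simp add: good_def)
 show "norm (rew s) \<le> dur s * (c1 * lod s + c2)"
  using reward_bound[of s m "R s" "snd (s m)", OF s] sn[of m] by (simp add: m rew_def dur_def lod_def reward_def)
 show "0 < dur s" unfolding dur_def m durations_def by (intro sum_pos sn) auto
qed

end

section \<open>The ergodic theorems\<close>

text \<open>Passing to the image measure makes the limit the identity on its own law, so that the
  limiting probability space lives on \<open>'w\<close>.\<close>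

lemma normal_rv_distr:
 fixes Z :: "'b \<Rightarrow> 'w::{banach, second_countable_topology}"
 assumes "prob_space G" and Z[measurable]: "Z \<in> borel_measurable G" and sq: "integrable G (\<lambda>x. (norm (Z x))\<^sup>2)"
  and mean: "(LINT x|G. Z x) = 0" and gauss: "gaussian G Z"
  and cov: "\<And>\<psi>1 \<psi>2. (LINT x|G. blinfun_apply \<psi>1 (Z x) * blinfun_apply \<psi>2 (Z x)) = Q \<psi>1 \<psi>2"
 shows "normal_rv (distr G borel Z) (\<lambda>w. w) 0 Q"
proof -
 interpret G: prob_space G by fact
 have id_m: "(\<lambda>w. w) \<in> borel_measurable (distr G borel Z)" by simp
 have mean': "(LINT w|distr G borel Z. w) = 0" using mean by (simp add: integral_distr)
 have "real_gaussian (distr G borel Z) (\<lambda>w. blinfun_apply \<psi> w)" for \<psi>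
 proof -
  have rg: "real_gaussian G (\<lambda>x. blinfun_apply \<psi> (Z x))" using gauss unfolding gaussian_def by blast
  have m: "(\<lambda>w. blinfun_apply \<psi> w) \<in> borel_measurable (distr G borel Z)" using blinfun_measurable[of \<psi>] by simp
  from rg consider c where "AE x in G. blinfun_apply \<psi> (Z x) = c"
   | \<mu> \<sigma> where "\<sigma> > 0" "distributed G lborel (\<lambda>x. blinfun_apply \<psi> (Z x)) (normal_density \<mu> \<sigma>)"
   unfolding real_gaussian_def by blast
  then show ?thesis
  proof cases
   case 1
   have "AE w in distr G borel Z. blinfun_apply \<psi> w = c"
    using 1 by (subst AE_distr_iff) auto
   then show ?thesis using m unfolding real_gaussian_def by blast
  next
   case 2
   have "distr (distr G borel Z) lborel (\<lambda>w. blinfun_apply \<psi> w) = distr G lborel (\<lambda>x. blinfun_apply \<psi> (Z x))"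
    by (subst distr_distr) (auto simp: comp_def)
   then have "distributed (distr G borel Z) lborel (\<lambda>w. blinfun_apply \<psi> w) (normal_density \<mu> \<sigma>)"
    using 2(2) m unfolding distributed_def by simp
   then show ?thesis using m 2(1) unfolding real_gaussian_def by blast
  qed
 qed
 then have "gaussian (distr G borel Z) (\<lambda>w. w)" using id_m unfolding gaussian_def by blast
 moreover have "L2_rv (distr G borel Z) (\<lambda>w. w)"
  using sq id_m unfolding L2_rv_def by (simp add: integrable_distr_eq)
 moreover have "Cov (distr G borel Z) (\<lambda>w. w) = Q"
 proof (intro ext)
  fix \<psi>1 \<psi>2
  have "Cov (distr G borel Z) (\<lambda>w. w) \<psi>1 \<psi>2 = (LINT w|distr G borel Z. blinfun_apply \<psi>1 w * blinfun_apply \<psi>2 w)"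
   unfolding Cov_def mean' by simp
  also have "\<dots> = (LINT x|G. blinfun_apply \<psi>1 (Z x) * blinfun_apply \<psi>2 (Z x))" by (rule integral_distr) measurable
  finally show "Cov (distr G borel Z) (\<lambda>w. w) \<psi>1 \<psi>2 = Q \<psi>1 \<psi>2" unfolding cov .
 qed
 ultimately show ?thesis unfolding normal_rv_def using mean' by blast
qed

lemma converges_in_distr_distr:
 fixes Z :: "'b \<Rightarrow> 'w::second_countable_topology"
 assumes "converges_in_distr M Y G Z" and [measurable]: "Z \<in> borel_measurable G"
 shows "converges_in_distr M Y (distr G borel Z) (\<lambda>w. w)"
 unfolding converges_in_distr_def
proof (intro allI impI)
 fix f :: "'w \<Rightarrow> real" assume f: "continuous_on UNIV f" "bounded (range f)"
 have "f \<in> borel_measurable borel" by (rule borel_measurable_continuous_onI[OF f(1)])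
 then have "(LINT w|distr G borel Z. f w) = (LINT x|G. f (Z x))" by (intro integral_distr) auto
 then show "((\<lambda>t. LINT \<omega>|M. f (Y t \<omega>)) \<longlongrightarrow> (LINT w|distr G borel Z. f w)) at_top"
  using assms(1) f unfolding converges_in_distr_def by simp
qed

context extinction_functional
begin

text \<open>\<open>\<xi>\<close> is the noise started from an arbitrary initial value, \<open>\<zeta>\<close> the fully i.i.d. noise; the cycles
 of \<open>\<xi>\<close> after the first one are independent copies of the first cycle of \<open>\<zeta>\<close>.\<close>

lemma ergodic_cycles:
 fixes I :: "real \<Rightarrow> 'a \<Rightarrow> 'w" and \<xi> \<zeta> :: "nat \<Rightarrow> 'a \<Rightarrow> 'v \<times> real" and \<nu> :: 'w
 assumes "prob_space M" and \<zeta>: "iid M borel \<zeta>"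
  and \<xi>: "prob_space.indep_vars M (\<lambda>_. borel) \<xi> UNIV" "\<And>m. m \<ge> 1 \<Longrightarrow> distr M borel (\<xi> m) = distr M borel (\<zeta> 0)"
  and good: "AE \<omega> in M. \<forall>i. good (\<xi> i \<omega>)" "AE \<omega> in M. \<forall>i. good (\<zeta> i \<omega>)"
  and int: "integrable M (\<lambda>\<omega>. drift (\<zeta> 0 \<omega>) ^ 10)" and mean: "(LINT \<omega>|M. drift (\<zeta> 0 \<omega>)) < 0"
  and dur4: "integrable M (\<lambda>\<omega>. (snd (\<zeta> 0 \<omega>)) ^ 4)" and load4: "integrable M (\<lambda>\<omega>. sub_norm j2 (fst (\<zeta> 0 \<omega>)) ^ 4)"
 defines "\<mu> \<equiv> LINT \<omega>|M. dur (\<lambda>m. \<zeta> m \<omega>)"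
 assumes \<nu>: "\<nu> = (1 / \<mu>) *\<^sub>R (LINT \<omega>|M. rew (\<lambda>m. \<zeta> m \<omega>))"
  and I_m: "\<And>t. I t \<in> borel_measurable M"
  and I: "AE \<omega> in M. \<forall>m t. durations (\<lambda>k. \<xi> k \<omega>) m \<le> t \<longrightarrow> t \<le> durations (\<lambda>k. \<xi> k \<omega>) (Suc m) \<longrightarrow>
     I t \<omega> = reward (\<lambda>k. \<xi> k \<omega>) m + flow_integral (state (\<lambda>k. \<xi> k \<omega>) m) (t - durations (\<lambda>k. \<xi> k \<omega>) m)"
 shows "AE \<omega> in M. returns step (\<lambda>m. \<zeta> m \<omega>)"
  and "(LINT \<omega>|M. rew (\<lambda>m. \<zeta> m \<omega>) - dur (\<lambda>m. \<zeta> m \<omega>) *\<^sub>R \<nu>) = 0"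
  and "AE \<omega> in M. ((\<lambda>t. (1 / t) *\<^sub>R (I t \<omega> - t *\<^sub>R \<nu>)) \<longlongrightarrow> 0) at_top"
  and "type_2 M TYPE('w) \<Longrightarrow> \<exists>Z. Z \<in> borel_measurable gauss_seq \<and> integrable gauss_seq (\<lambda>x. (norm (Z x))\<^sup>2) \<and>
    (LINT x|gauss_seq. Z x) = 0 \<and> gaussian gauss_seq Z \<and>
    (\<forall>\<psi>1 \<psi>2 :: 'w \<Rightarrow>\<^sub>L real. (LINT x|gauss_seq. blinfun_apply \<psi>1 (Z x) * blinfun_apply \<psi>2 (Z x)) =
     (LINT \<omega>|M. blinfun_apply \<psi>1 (sqrt (1 / \<mu>) *\<^sub>R (rew (\<lambda>m. \<zeta> m \<omega>) - dur (\<lambda>m. \<zeta> m \<omega>) *\<^sub>R \<nu>)) *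
       blinfun_apply \<psi>2 (sqrt (1 / \<mu>) *\<^sub>R (rew (\<lambda>m. \<zeta> m \<omega>) - dur (\<lambda>m. \<zeta> m \<omega>) *\<^sub>R \<nu>)))) \<and>
    converges_in_distr M (\<lambda>t \<omega>. (1 / sqrt t) *\<^sub>R (I t \<omega> - t *\<^sub>R \<nu>)) gauss_seq Z"
proof -
 interpret prob_space M by fact
 let ?z = "\<lambda>\<omega> m. \<zeta> m \<omega>" and ?x = "\<lambda>\<omega> m. \<xi> m \<omega>"
 define p where "p = distr M borel (\<zeta> 0)"
 let ?P = "PiM UNIV (\<lambda>_::nat. p)"
 note [measurable] = iid_measurable[OF \<zeta>] sub_norm_measurable[OF j2]
 have z[measurable]: "?z \<in> M \<rightarrow>\<^sub>M seqs" by (rule measurable_seqsI) measurable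
 have zP: "distr M seqs ?z = ?P" unfolding p_def by (rule iid_distr_sequence[OF \<zeta>])
 have \<xi>m[measurable]: "\<xi> m \<in> borel_measurable M" for m using \<xi>(1) unfolding indep_vars_def by blast
 have drift_sq: "integrable M (\<lambda>\<omega>. (drift (\<zeta> 0 \<omega>))\<^sup>2)"
 proof (rule Bochner_Integration.integrable_bound)
  show "integrable M (\<lambda>\<omega>. 1 + drift (\<zeta> 0 \<omega>) ^ 10)" using int by simp
  have "y\<^sup>2 \<le> 1 + y ^ 10" for y :: real
  proof (cases "\<bar>y\<bar> \<le> 1")
   case True
   then have "y\<^sup>2 \<le> 1" by (simp add: abs_square_le_1)
   moreover have "0 \<le> y ^ 10" by simp
   ultimately show ?thesis by linarith
  next
   case False
   then have "\<bar>y\<bar> ^ 2 \<le> \<bar>y\<bar> ^ 10" by (intro power_increasing) auto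
   then show ?thesis by simp
  qed
  then show "AE \<omega> in M. norm ((drift (\<zeta> 0 \<omega>))\<^sup>2) \<le> norm (1 + drift (\<zeta> 0 \<omega>) ^ 10)" by (auto intro: order_trans[OF _ abs_ge_self])
 qed measurable
 have transfer: "integrable M (\<lambda>\<omega>. (drift (\<xi> 1 \<omega>))\<^sup>2)" "(LINT \<omega>|M. drift (\<xi> 1 \<omega>)) < 0"
 proof -
  have e: "distr M borel (\<xi> 1) = distr M borel (\<zeta> 0)" by (rule \<xi>(2)) simp
  have "integrable (distr M borel (\<xi> 1)) (\<lambda>e. (drift e)\<^sup>2)" unfolding e using drift_sq by (simp add: integrable_distr_eq)
  then show "integrable M (\<lambda>\<omega>. (drift (\<xi> 1 \<omega>))\<^sup>2)" by (simp add: integrable_distr_eq)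
  have "(LINT e|distr M borel (\<xi> 1). drift e) < 0" unfolding e using mean by (simp add: integral_distr)
  then show "(LINT \<omega>|M. drift (\<xi> 1 \<omega>)) < 0" by (simp add: integral_distr)
 qed
 have ret_x: "AE \<omega> in M. returns step (?x \<omega>)"
  by (rule noise_returns[OF assms(1) \<xi> good(1) transfer])
 show ret_z: "AE \<omega> in M. returns step (?z \<omega>)"
 proof (rule noise_returns[OF assms(1) iid_indep[OF \<zeta>] _ good(2)])
  show "distr M borel (\<zeta> m) = p" for m using \<zeta> unfolding iid_def p_def by blast
  show "integrable M (\<lambda>\<omega>. (drift (\<zeta> 1 \<omega>))\<^sup>2)" using iid_integrable[OF \<zeta>, of "\<lambda>e. (drift e)\<^sup>2" 1] drift_sq by simp
  show "(LINT \<omega>|M. drift (\<zeta> 1 \<omega>)) < 0" using iid_integral[OF \<zeta>, of drift 1] mean by simp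
 qed
 \<comment> \<open>The sequence \<open>?z\<close> has the product law \<open>?P\<close>, so almost
   sure return passes to the canonical model on which the cycle lemmas rest.\<close>
 have ret_P: "AE s in ?P. returns step s"
  unfolding zP[symmetric] using ret_z by (subst AE_distr_iff) auto
 interpret RN: regenerative_noise step M \<xi> p
  by unfold_locales (use \<xi> ret_x in \<open>auto simp: p_def\<close>)
 define Y where "Y s = rew s - dur s *\<^sub>R \<nu>" for s
 \<comment> \<open>Bound for the fluctuation in a centered cycle: \<open>norm \<nu>\<close> is added
   to \<open>c2\<close> to account for the subtraction of \<open>t *\<^sub>R \<nu>\<close>.\<close>
 define B where "B s = dur s * (c1 * lod s + (c2 + norm \<nu>))" for s
 have Ym[measurable]: "Y \<in> borel_measurable seqs" and Bm[measurable]: "B \<in> borel_measurable seqs"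
  unfolding Y_def[abs_def] B_def[abs_def] by measurable
 have ad: "adapted step Y" "adapted step B"
  using cycle_quantities_adapted unfolding adapted_def Y_def B_def by metis+
 note Y_iid = RN.cycles_iid[OF ret_P Ym ad(1)]
 note D_iid = RN.cycles_iid[OF ret_P cycle_quantities_measurable(1) cycle_quantities_adapted(1)]
 note B_iid = RN.cycles_iid[OF ret_P Bm ad(2)]
 have cyc: "(\<lambda>\<omega>. nth_cycle step (Suc 0) (?x \<omega>)) \<in> M \<rightarrow>\<^sub>M seqs"
  by (rule measurable_compose[OF RN.noise_measurable cycle_measurable])
 have cyc_distr: "distr M seqs (\<lambda>\<omega>. nth_cycle step (Suc 0) (?x \<omega>)) = distr M seqs ?z"
  unfolding zP by (rule RN.cycles_distr[OF ret_P])
 \<comment> \<open>The first regular cycle of \<open>?x\<close>, with index \<open>Suc 0\<close>,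
   has the law of \<open>?z\<close>. Moments are computed for \<open>?z\<close> and moved by these
   two facts.\<close>
 have tr_int: "integrable M (\<lambda>\<omega>. h (nth_cycle step (Suc 0) (?x \<omega>))) \<longleftrightarrow> integrable M (\<lambda>\<omega>. h (?z \<omega>))"
  if h: "h \<in> borel_measurable seqs" for h :: "_ \<Rightarrow> 'c::{banach, second_countable_topology}"
  using integrable_distr_eq[OF cyc h] integrable_distr_eq[OF z h] unfolding cyc_distr by simp
 have tr_lint: "(LINT \<omega>|M. h (nth_cycle step (Suc 0) (?x \<omega>))) = (LINT \<omega>|M. h (?z \<omega>))"
  if h: "h \<in> borel_measurable seqs" for h :: "_ \<Rightarrow> 'c::{banach, second_countable_topology}"
  using integral_distr[OF cyc h] integral_distr[OF z h] unfolding cyc_distr by simp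
 have dur_sq: "integrable M (\<lambda>\<omega>. (dur (?z \<omega>))\<^sup>2)" and B_sq: "integrable M (\<lambda>\<omega>. (B (?z \<omega>))\<^sup>2)"
  using cycle_bound_integrable(1)[OF assms(1) \<zeta> good(2) int mean ret_z dur4 load4]
   cycle_bound_integrable(2)[OF assms(1) \<zeta> good(2) int mean ret_z dur4 load4, of c1 "c2 + norm \<nu>"]
  unfolding B_def dur_def durations_def lod_def load_def by simp_all
 have B0: "AE \<omega> in M. norm (Y (?z \<omega>)) \<le> B (?z \<omega>) \<and> norm (rew (?z \<omega>)) \<le> B (?z \<omega>) \<and> 0 < dur (?z \<omega>)"
  using good(2) ret_z
 proof eventually_elim
  case (elim \<omega>)
  note b = rew_bound[of "?z \<omega>", OF elim(1)[rule_format] elim(2)]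
  have "norm (Y (?z \<omega>)) \<le> norm (rew (?z \<omega>)) + dur (?z \<omega>) * norm \<nu>"
   unfolding Y_def using norm_triangle_ineq4[of "rew (?z \<omega>)" "dur (?z \<omega>) *\<^sub>R \<nu>"] b(2) by simp
  moreover have "0 \<le> dur (?z \<omega>) * norm \<nu>" using b(2) by simp
  moreover have "B (?z \<omega>) = dur (?z \<omega>) * (c1 * lod (?z \<omega>) + c2) + dur (?z \<omega>) * norm \<nu>" by (simp add: B_def algebra_simps)
  ultimately show ?case using b by linarith
 qed
 have int_of_sq: "integrable M (\<lambda>\<omega>. h (?z \<omega>))" if "integrable M (\<lambda>\<omega>. (h (?z \<omega>))\<^sup>2)" and [measurable]: "h \<in> borel_measurable seqs" for h :: "_ \<Rightarrow> real"
  by (rule square_integrable_imp_integrable) (use that in auto)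
 have dur_int: "integrable M (\<lambda>\<omega>. dur (?z \<omega>))" and B_int: "integrable M (\<lambda>\<omega>. B (?z \<omega>))"
  using int_of_sq[OF dur_sq] int_of_sq[OF B_sq] by auto
 have rew_int: "integrable M (\<lambda>\<omega>. rew (?z \<omega>))"
 proof (rule Bochner_Integration.integrable_bound[OF B_int])
  show "AE \<omega> in M. norm (rew (?z \<omega>)) \<le> norm (B (?z \<omega>))" using B0 by eventually_elim auto
 qed measurable
 have \<mu>: "\<mu> > 0"
 proof -
  have nn: "AE \<omega> in M. 0 \<le> dur (?z \<omega>)" using B0 by eventually_elim simp
  have "\<mu> \<noteq> 0"
  proof
   assume "\<mu> = 0"
   then have "AE \<omega> in M. dur (?z \<omega>) = 0" using integral_nonneg_eq_0_iff_AE[OF dur_int nn] by (simp add: \<mu>_def)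
   with B0 have "AE \<omega> in M. False" by eventually_elim simp
   then show False by simp
  qed
  moreover have "\<mu> \<ge> 0" unfolding \<mu>_def by (rule integral_nonneg_AE[OF nn])
  ultimately show ?thesis by simp
 qed
 \<comment> \<open>The constant \<open>\<nu>\<close> is the quotient of mean reward and mean
   duration precisely in order to center the cycle rewards.\<close>
 show Y_mean: "(LINT \<omega>|M. rew (?z \<omega>) - dur (?z \<omega>) *\<^sub>R \<nu>) = 0"
 proof -
  have "(LINT \<omega>|M. rew (?z \<omega>) - dur (?z \<omega>) *\<^sub>R \<nu>) = (LINT \<omega>|M. rew (?z \<omega>)) - \<mu> *\<^sub>R \<nu>"
   using rew_int dur_int by (simp add: \<mu>_def)
  then show ?thesis using \<mu> by (simp add: \<nu>)
 qed
 have Y_sq: "integrable M (\<lambda>\<omega>. (norm (Y (?z \<omega>)))\<^sup>2)"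
 proof (rule Bochner_Integration.integrable_bound[OF B_sq])
  show "AE \<omega> in M. norm ((norm (Y (?z \<omega>)))\<^sup>2) \<le> norm ((B (?z \<omega>))\<^sup>2)"
   using B0 by eventually_elim (simp add: power_mono)
 qed measurable
 let ?c = "\<lambda>k \<omega>. nth_cycle step (Suc k) (?x \<omega>)"
 have ret_all: "AE \<omega> in M. \<forall>n. returns step (?c n \<omega>)" by (rule RN.cycles_AE[OF ret_P ret_P])
 have good_c: "good (nth_cycle step n s i)" if "\<And>i. good (s i)" for n s i
  using that by (simp add: nth_cycle_def drop_seq_def)
 have dur_nn: "AE \<omega> in M. \<forall>k. dur (?c k \<omega>) \<ge> 0"
  using good(1) by eventually_elim (auto simp: dur_def intro!: durations_nonneg good_c)
 have close: "AE \<omega> in M. \<forall>n t. dur (?x \<omega>) + (\<Sum>k<n. dur (?c k \<omega>)) \<le> t \<longrightarrow> t \<le> dur (?x \<omega>) + (\<Sum>k<Suc n. dur (?c k \<omega>)) \<longrightarrow>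
   norm (I t \<omega> - t *\<^sub>R \<nu> - Y (?x \<omega>) - (\<Sum>k<n. Y (?c k \<omega>))) \<le> B (?c n \<omega>)"
  using good(1) ret_x ret_all I
 proof eventually_elim
  case (elim \<omega>)
  have "returns step (nth_cycle step n (?x \<omega>))" for n using elim(2,3) by (cases n) (auto simp: cycle_0)
  from cycle_close[of "?x \<omega>" "\<lambda>t. I t \<omega>", OF elim(1)[rule_format] this elim(4)[rule_format]]
  show ?case unfolding Y_def B_def by blast
 qed
 have a_m: "(\<lambda>\<omega>. dur (?x \<omega>)) \<in> borel_measurable M"
  by (rule measurable_compose[OF RN.noise_measurable cycle_quantities_measurable(1)])
 have I_m': "(\<lambda>\<omega>. I t \<omega> - t *\<^sub>R \<nu>) \<in> borel_measurable M" for t using I_m by measurable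
 have s1: "integrable M (\<lambda>\<omega>. (norm (Y (?c 0 \<omega>)))\<^sup>2)" using tr_int[of "\<lambda>s. (norm (Y s))\<^sup>2"] Y_sq by simp
 have s2: "expectation (\<lambda>\<omega>. Y (?c 0 \<omega>)) = 0" using tr_lint[of Y] Y_mean by (simp add: Y_def)
 have s3: "integrable M (\<lambda>\<omega>. (dur (?c 0 \<omega>))\<^sup>2)" using tr_int[of "\<lambda>s. (dur s)\<^sup>2"] dur_sq by simp
 have s4: "expectation (\<lambda>\<omega>. dur (?c 0 \<omega>)) = \<mu>" using tr_lint[of dur] by (simp add: \<mu>_def)
 have s5: "integrable M (\<lambda>\<omega>. (B (?c 0 \<omega>))\<^sup>2)" using tr_int[of "\<lambda>s. (B s)\<^sup>2"] B_sq by simp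
 have s4': "expectation (\<lambda>\<omega>. dur (?c 0 \<omega>)) > 0" using s4 \<mu> by simp
 note RR = renewal_reward[where Y="\<lambda>k \<omega>. Y (?c k \<omega>)" and \<tau>="\<lambda>k \<omega>. dur (?c k \<omega>)" and B="\<lambda>k \<omega>. B (?c k \<omega>)"
   and a="\<lambda>\<omega>. dur (?x \<omega>)" and J="\<lambda>\<omega>. Y (?x \<omega>)" and I="\<lambda>t \<omega>. I t \<omega> - t *\<^sub>R \<nu>",
   OF Y_iid(1) s1 s2 D_iid(1) s3 dur_nn s4' B_iid(1) s5 a_m I_m' close]
 show "AE \<omega> in M. ((\<lambda>t. (1 / t) *\<^sub>R (I t \<omega> - t *\<^sub>R \<nu>)) \<longlongrightarrow> 0) at_top" by (rule RR(1))
 assume t2: "type_2 M TYPE('w)"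
 have cov: "(LINT \<omega>|M. blinfun_apply \<psi>1 (sqrt (1 / \<mu>) *\<^sub>R Y (?c 0 \<omega>)) * blinfun_apply \<psi>2 (sqrt (1 / \<mu>) *\<^sub>R Y (?c 0 \<omega>)))
   = (LINT \<omega>|M. blinfun_apply \<psi>1 (sqrt (1 / \<mu>) *\<^sub>R Y (?z \<omega>)) * blinfun_apply \<psi>2 (sqrt (1 / \<mu>) *\<^sub>R Y (?z \<omega>)))" for \<psi>1 \<psi>2 :: "'w \<Rightarrow>\<^sub>L real"
  by (rule tr_lint[of "\<lambda>s. blinfun_apply \<psi>1 (sqrt (1 / \<mu>) *\<^sub>R Y s) * blinfun_apply \<psi>2 (sqrt (1 / \<mu>) *\<^sub>R Y s)"]) measurable
 from RR(2)[OF t2] show "\<exists>Z. Z \<in> borel_measurable gauss_seq \<and> integrable gauss_seq (\<lambda>x. (norm (Z x))\<^sup>2) \<and>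
    (LINT x|gauss_seq. Z x) = 0 \<and> gaussian gauss_seq Z \<and>
    (\<forall>\<psi>1 \<psi>2 :: 'w \<Rightarrow>\<^sub>L real. (LINT x|gauss_seq. blinfun_apply \<psi>1 (Z x) * blinfun_apply \<psi>2 (Z x)) =
     (LINT \<omega>|M. blinfun_apply \<psi>1 (sqrt (1 / \<mu>) *\<^sub>R (rew (?z \<omega>) - dur (?z \<omega>) *\<^sub>R \<nu>)) *
       blinfun_apply \<psi>2 (sqrt (1 / \<mu>) *\<^sub>R (rew (?z \<omega>) - dur (?z \<omega>) *\<^sub>R \<nu>)))) \<and>
    converges_in_distr M (\<lambda>t \<omega>. (1 / sqrt t) *\<^sub>R (I t \<omega> - t *\<^sub>R \<nu>)) gauss_seq Z"
  unfolding s4 cov unfolding Y_def .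
qed

end

section \<open>Integer moments from the moment assumptions\<close>

lemma power_le_powr:
 fixes y \<epsilon> :: real
 assumes "0 \<le> y" "n \<le> 11" "0 < \<epsilon>"
 shows "y ^ n \<le> 1 + y powr (11 + \<epsilon>)"
proof (cases "y \<le> 1")
 case True
 then have "y ^ n \<le> 1" using assms(1) by (intro power_le_one) auto
 moreover have "0 \<le> y powr (11 + \<epsilon>)" by simp
 ultimately show ?thesis by linarith
next
 case False
 then have "y ^ n = y powr real n" by (simp add: powr_realpow)
 also have "\<dots> \<le> y powr (11 + \<epsilon>)" using False assms by (intro powr_mono) auto
 finally show ?thesis by simp
qed

lemma integrable_power_of_powr:
 fixes h :: "'a \<Rightarrow> real"
 assumes "prob_space M" and [measurable]: "h \<in> borel_measurable M" and nn: "\<And>\<omega>. \<omega> \<in> space M \<Longrightarrow> 0 \<le> h \<omega>"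
  and int: "integrable M (\<lambda>\<omega>. h \<omega> powr (11 + \<epsilon>))" and "0 < \<epsilon>" "n \<le> 11"
 shows "integrable M (\<lambda>\<omega>. h \<omega> ^ n)"
proof (rule Bochner_Integration.integrable_bound)
 interpret prob_space M by fact
 show "integrable M (\<lambda>\<omega>. 1 + h \<omega> powr (11 + \<epsilon>))" using int by simp
 show "AE \<omega> in M. norm (h \<omega> ^ n) \<le> norm (1 + h \<omega> powr (11 + \<epsilon>))"
  using power_le_powr[OF nn assms(6,5)] nn by (intro AE_I2) simp
qed measurable

lemma power10_diff_le:
 fixes u v :: real
 assumes "0 \<le> u" "0 \<le> v"
 shows "(u - v) ^ 10 \<le> u ^ 10 + v ^ 10"
proof -
 have "(u - v) ^ 10 = \<bar>u - v\<bar> ^ 10" by (simp add: power_even_abs)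
 also have "\<dots> \<le> max u v ^ 10" using assms by (intro power_mono) auto
 also have "\<dots> \<le> u ^ 10 + v ^ 10" using assms by (auto simp: max_def)
 finally show ?thesis .
qed

theorem theorem0p3p21:
  fixes M :: "'a measure"
    and A :: "'v::{banach, second_countable_topology} \<Rightarrow> 'v set"
    and j1 :: "'v1::{banach, second_countable_topology} \<Rightarrow> 'v"
    and j2 :: "'v2::{banach, second_countable_topology} \<Rightarrow> 'v"
    and \<kappa> \<rho> \<epsilon> :: real
    and \<beta> :: "nat \<Rightarrow> 'a \<Rightarrow> real"
    and \<eta> :: "nat \<Rightarrow> 'a \<Rightarrow> 'v"
    and \<Xi> :: "'v \<Rightarrow> 'w::{banach, second_countable_topology}"
    and x xbar :: "'a \<Rightarrow> 'v"
    and \<nu> :: 'w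
    and Q :: "('w \<Rightarrow>\<^sub>L real) \<Rightarrow> ('w \<Rightarrow>\<^sub>L real) \<Rightarrow> real"
  assumes "prob_space M" and "complete_measure M"
    and "m_accretive A" and "closure (op_domain A) = UNIV"
    and "embedding j1" and "embedding j2"
    and "\<And>t v. t \<ge> 0 \<Longrightarrow> v \<in> range j1 \<Longrightarrow> semigroup_of A t v \<in> range j1"
    and "\<And>t v. t \<ge> 0 \<Longrightarrow> v \<in> range j2 \<Longrightarrow> semigroup_of A t v \<in> range j2"
    and "\<kappa> > 0" and "0 < \<rho>" and "\<rho> < 1"
    and "\<And>t v. t \<ge> 0 \<Longrightarrow> v \<in> range j1 \<Longrightarrow>
           sub_norm j1 (semigroup_of A t v) powr \<rho> \<le> max (- \<kappa> * t + sub_norm j1 v powr \<rho>) 0"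
    and "\<And>t v. t \<ge> 0 \<Longrightarrow> v \<in> range j2 \<Longrightarrow> sub_norm j2 (semigroup_of A t v) \<le> sub_norm j2 v"
    and "iid_seq M \<eta>" and "iid_seq M \<beta>"
    and "indep_rvs M seq_space (seq_rv \<eta>) seq_space (seq_rv \<beta>)"
    and "\<And>m \<omega>. m \<ge> 1 \<Longrightarrow> \<omega> \<in> space M \<Longrightarrow> \<beta> m \<omega> > 0"
    and "\<And>m. m \<ge> 1 \<Longrightarrow> AE \<omega> in M. \<eta> m \<omega> \<in> range j1 \<inter> range j2"
    and "\<And>m. m \<ge> 1 \<Longrightarrow> integrable M (\<lambda>\<omega>. sub_norm j2 (\<eta> m \<omega>) ^ 4)"
    and "\<epsilon> > 0"
    and "\<And>m. m \<ge> 1 \<Longrightarrow> integrable M (\<lambda>\<omega>. sub_norm j1 (\<eta> m \<omega>) powr (\<rho> * (11 + \<epsilon>)))"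
    and "\<And>m. m \<ge> 1 \<Longrightarrow> integrable M (\<lambda>\<omega>. \<beta> m \<omega> powr (11 + \<epsilon>))"
    and "\<And>m. m \<ge> 1 \<Longrightarrow>
           - \<kappa> * (LINT \<omega>|M. \<beta> m \<omega>) + (LINT \<omega>|M. sub_norm j1 (\<eta> m \<omega>) powr \<rho>) < 0"
    and "extinction_initial_value M j1 j2 \<rho> \<beta> \<eta> x"
    and "xbar \<in> borel_measurable M"
    and "distr M borel xbar = distr M borel (\<eta> 1)"
    and "indep_of_noise M \<beta> \<eta> xbar"
    and "sublinear_functional j2 \<Xi>"
    and nu: "\<nu> = (1 / (LINT \<omega>|M. extinction_time A \<beta> \<eta> xbar \<omega>)) *\<^sub>R
          (LINT \<omega>|M. (LINT \<tau>:{0..extinction_time A \<beta> \<eta> xbar \<omega>}|lborel.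
             \<Xi> (process A \<beta> \<eta> xbar \<tau> \<omega>)))"
    and Q: "Q = Cov M (\<lambda>\<omega>. sqrt (1 / (LINT \<omega>'|M. extinction_time A \<beta> \<eta> xbar \<omega>')) *\<^sub>R
          (LINT \<tau>:{0..extinction_time A \<beta> \<eta> xbar \<omega>}|lborel.
             (\<Xi> (process A \<beta> \<eta> xbar \<tau> \<omega>) - \<nu>)))"
  shows "(AE \<omega> in M.
            ((\<lambda>t. (1 / t) *\<^sub>R (LINT \<tau>:{0..t}|lborel. \<Xi> (process A \<beta> \<eta> x \<tau> \<omega>))) \<longlongrightarrow> \<nu>) at_top) \<and>
         (type_2 M TYPE('w) \<longrightarrow>
            (\<exists>(N :: 'w measure) Z. prob_space N \<and> normal_rv N Z 0 Q \<and>
               converges_in_distr M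
                 (\<lambda>t \<omega>. (1 / sqrt t) *\<^sub>R
                    ((LINT \<tau>:{0..t}|lborel. \<Xi> (process A \<beta> \<eta> x \<tau> \<omega>)) - t *\<^sub>R \<nu>))
                 N Z))"
proof -
 interpret prob_space M by fact
 obtain c1 c2 where \<Xi>: "\<Xi> \<in> borel_measurable borel" "c1 \<ge> 0" "c2 \<ge> 0"
  "\<And>v. v \<in> range j2 \<Longrightarrow> norm (\<Xi> v) \<le> c1 * sub_norm j2 v + c2"
  using assms(28) unfolding sublinear_functional_def by auto
 interpret extinction_functional "semigroup_of A" j1 j2 \<kappa> \<rho> \<Xi> c1 c2
 proof unfold_locales
  show "(\<lambda>p. semigroup_of A (fst p) (snd p)) \<in> borel_measurable borel" by (rule semigroup_of_measurable[OF assms(3)])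
  show "\<Xi> \<in> borel_measurable borel" "0 \<le> c1" "0 \<le> c2" by (rule \<Xi>)+
  show "norm (\<Xi> v) \<le> c1 * sub_norm j2 v + c2" if "v \<in> range j2" for v by (rule \<Xi>(4)[OF that])
 qed (fact assms(5-13))+
 have x: "indep_of_noise M \<beta> \<eta> x" "AE \<omega> in M. x \<omega> \<in> range j1 \<inter> range j2"
  using assms(24) unfolding extinction_initial_value_def by auto
 note noise_x = noise_indep[OF assms(14,15,16) x(1)] noise_distr[OF assms(14,15,16) x(1)]
 note noise_z = noise_indep[OF assms(14,15,16,27)] noise_distr[OF assms(14,15,16,27)]
 let ?x = "noise \<beta> \<eta> x" and ?z = "noise \<beta> \<eta> xbar"
 have [measurable]: "?x m \<in> borel_measurable M" "?z m \<in> borel_measurable M" for m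
  using noise_x(1) noise_z(1) unfolding indep_vars_def by auto
 note [measurable] = sub_norm_measurable[OF assms(5)] sub_norm_measurable[OF assms(6)] range_embedding_borel[OF assms(5)] range_embedding_borel[OF assms(6)] \<Xi>(1)
 have \<eta>_m[measurable]: "\<eta> m \<in> borel_measurable M" and \<beta>_m[measurable]: "\<beta> m \<in> borel_measurable M" if "m \<ge> 1" for m
  using assms(14,15) that unfolding iid_seq_def indep_vars_def by auto
 have \<eta>_distr: "distr M borel (\<eta> m) = distr M borel (\<eta> 1)" if "m \<ge> 1" for m
  using assms(14) that unfolding iid_seq_def by blast
 have z_distr: "distr M borel (?z m) = distr M borel (\<eta> 1) \<Otimes>\<^sub>M distr M borel (\<beta> 1)" for m
  unfolding noise_z(2) using assms(26) \<eta>_distr[of m] by (cases "m = 0") simp_all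
 have x_distr: "distr M borel (?x m) = distr M borel (?z 0)" if "m \<ge> 1" for m
  unfolding noise_x(2) z_distr using that \<eta>_distr[OF that] by simp
 have z_iid: "iid M borel ?z" unfolding iid_def using noise_z(1) z_distr by simp
 have xbar_range: "AE \<omega> in M. xbar \<omega> \<in> range j1 \<inter> range j2"
 proof -
  have "AE v in distr M borel (\<eta> 1). v \<in> range j1 \<inter> range j2"
   using assms(18)[of 1] by (subst AE_distr_iff) auto
  then show ?thesis unfolding assms(26)[symmetric] using assms(25) by (subst (asm) AE_distr_iff) auto
 qed
 have good_noise: "AE \<omega> in M. \<forall>i. good (noise \<beta> \<eta> y i \<omega>)" if "AE \<omega> in M. y \<omega> \<in> range j1 \<inter> range j2" for y
 proof -
  have "AE \<omega> in M. \<forall>m. m \<ge> 1 \<longrightarrow> \<eta> m \<omega> \<in> range j1 \<inter> range j2"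
   unfolding AE_all_countable using assms(18) by (intro allI) (auto simp: AE_mp)
  with that AE_space show ?thesis
  proof eventually_elim
   case (elim \<omega>)
   have "0 < \<beta> (Suc i) \<omega>" for i by (rule assms(17)) (use elim in auto)
   then show ?case using elim by (auto simp: good_def noise_def)
  qed
 qed
 note good_x = good_noise[OF x(2)] and good_z = good_noise[OF xbar_range]
 \<comment> \<open>Moments are computed at index 1, where the entries are a given jump and waiting
   time; the entry at index 0 involves \<open>xbar\<close>, known only through its law, and receives
   the bounds by equality of distributions.\<close>
 have z1: "?z 1 \<omega> = (\<eta> 1 \<omega>, \<beta> 2 \<omega>)" for \<omega> by (simp add: noise_def numeral_2_eq_2)
 let ?q = "\<lambda>\<omega>. sub_norm j1 (\<eta> 1 \<omega>) powr \<rho>"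
 have q_int: "integrable M (\<lambda>\<omega>. ?q \<omega> ^ n)" if "n \<le> 11" for n
  by (rule integrable_power_of_powr[OF assms(1) _ _ _ assms(20) that])
    (use assms(21)[of 1] in \<open>auto simp: powr_powr\<close>)
 have \<beta>_int: "integrable M (\<lambda>\<omega>. \<beta> 2 \<omega> ^ n)" if "n \<le> 11" for n
  by (rule integrable_power_of_powr[OF assms(1) _ _ _ assms(20) that])
    (use assms(22)[of 2] assms(17)[of 2] in \<open>auto intro: less_imp_le\<close>)
 have drift1: "drift (?z 1 \<omega>) = ?q \<omega> - \<kappa> * \<beta> 2 \<omega>" for \<omega> unfolding z1 by (simp add: drift_def)
 have int1: "integrable M (\<lambda>\<omega>. drift (?z 1 \<omega>) ^ 10)"
 proof (rule Bochner_Integration.integrable_bound)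
  show "integrable M (\<lambda>\<omega>. ?q \<omega> ^ 10 + \<kappa> ^ 10 * \<beta> 2 \<omega> ^ 10)" using q_int[of 10] \<beta>_int[of 10] by simp
  show "AE \<omega> in M. norm (drift (?z 1 \<omega>) ^ 10) \<le> norm (?q \<omega> ^ 10 + \<kappa> ^ 10 * \<beta> 2 \<omega> ^ 10)"
  proof (rule AE_I2)
   fix \<omega> assume "\<omega> \<in> space M"
   then have "0 \<le> \<kappa> * \<beta> 2 \<omega>" using assms(9) assms(17)[of 2 \<omega>] by (simp add: less_imp_le)
   from power10_diff_le[OF _ this, of "?q \<omega>"]
   show "norm (drift (?z 1 \<omega>) ^ 10) \<le> norm (?q \<omega> ^ 10 + \<kappa> ^ 10 * \<beta> 2 \<omega> ^ 10)"
    unfolding drift1 by (simp add: power_mult_distrib)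
  qed
 qed measurable
 have mean1: "(LINT \<omega>|M. drift (?z 1 \<omega>)) < 0"
 proof -
  have d: "distr M borel (\<beta> 2) = distr M borel (\<beta> 1)" using assms(15) unfolding iid_seq_def by (metis one_le_numeral)
  have "(LINT \<omega>|M. \<beta> 2 \<omega>) = (LINT b|distr M borel (\<beta> 2). b)" by (rule integral_distr[symmetric]) auto
  also have "\<dots> = (LINT \<omega>|M. \<beta> 1 \<omega>)" unfolding d by (rule integral_distr) auto
  finally have e: "(LINT \<omega>|M. \<beta> 2 \<omega>) = (LINT \<omega>|M. \<beta> 1 \<omega>)" .
  have "(LINT \<omega>|M. drift (?z 1 \<omega>)) = (LINT \<omega>|M. ?q \<omega>) - \<kappa> * (LINT \<omega>|M. \<beta> 2 \<omega>)"
   unfolding drift1 using q_int[of 1] \<beta>_int[of 1] by simp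
  then show ?thesis using assms(23)[of 1] e by simp
 qed
 have int: "integrable M (\<lambda>\<omega>. drift (?z 0 \<omega>) ^ 10)"
  using iid_integrable[OF z_iid, of "\<lambda>e. drift e ^ 10" 1] int1 by simp
 have mean: "(LINT \<omega>|M. drift (?z 0 \<omega>)) < 0"
  using iid_integral[OF z_iid, of drift 1] mean1 by simp
 have dur4: "integrable M (\<lambda>\<omega>. snd (?z 0 \<omega>) ^ 4)"
  using iid_integrable[OF z_iid, of "\<lambda>e. snd e ^ 4" 1] \<beta>_int[of 4] by (simp add: z1[unfolded One_nat_def])
 have load4: "integrable M (\<lambda>\<omega>. sub_norm j2 (fst (?z 0 \<omega>)) ^ 4)"
  using iid_integrable[OF z_iid, of "\<lambda>e. sub_norm j2 (fst e) ^ 4" 1] assms(19)[of 1] by (simp add: z1[unfolded One_nat_def])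
 let ?I = "\<lambda>t \<omega>. LINT \<tau>:{0..t}|lborel. \<Xi> (process A \<beta> \<eta> x \<tau> \<omega>)"
 let ?e = "extinction_time A \<beta> \<eta> xbar"
 have I_m: "?I t \<in> borel_measurable M" for t
  by (rule process_integral_measurable[OF refl]) measurable
 have I_path: "AE \<omega> in M. \<forall>m t. durations (\<lambda>k. ?x k \<omega>) m \<le> t \<longrightarrow> t \<le> durations (\<lambda>k. ?x k \<omega>) (Suc m) \<longrightarrow>
     ?I t \<omega> = reward (\<lambda>k. ?x k \<omega>) m + flow_integral (state (\<lambda>k. ?x k \<omega>) m) (t - durations (\<lambda>k. ?x k \<omega>) m)"
  using good_x
 proof eventually_elim
  case (elim \<omega>)
  then show ?case using process_integral(2)[OF refl, of \<beta> \<eta> x \<omega>] by blast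
 qed
 \<comment> \<open>This comes before the use of \<open>ergodic_cycles\<close>, because rewriting
   \<open>\<nu>\<close> in terms of \<open>dur\<close> and \<open>rew\<close> presupposes that
   extinction occurs almost surely.\<close>
 have ret_z: "AE \<omega> in M. returns step (\<lambda>m. ?z m \<omega>)"
 proof (rule noise_returns[OF assms(1) noise_z(1) _ good_z])
  show "distr M borel (?z m) = distr M borel (\<eta> 1) \<Otimes>\<^sub>M distr M borel (\<beta> 1)" for m by (rule z_distr)
  have "integrable M (\<lambda>\<omega>. 2 * ((?q \<omega>)\<^sup>2 + \<kappa>\<^sup>2 * (\<beta> 2 \<omega>)\<^sup>2))" using q_int[of 2] \<beta>_int[of 2] by simp
  then show "integrable M (\<lambda>\<omega>. (drift (?z 1 \<omega>))\<^sup>2)"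
  proof (rule Bochner_Integration.integrable_bound)
   have "(u - v)\<^sup>2 \<le> 2 * (u\<^sup>2 + v\<^sup>2)" for u v :: real using sum_squares_bound[of u "-v"] by (simp add: power2_diff)
   from this[of "?q _" "\<kappa> * \<beta> 2 _"]
   show "AE \<omega> in M. norm ((drift (?z 1 \<omega>))\<^sup>2) \<le> norm (2 * ((?q \<omega>)\<^sup>2 + \<kappa>\<^sup>2 * (\<beta> 2 \<omega>)\<^sup>2))"
    unfolding drift1 by (simp add: power_mult_distrib)
  qed measurable
  show "(LINT \<omega>|M. drift (?z 1 \<omega>)) < 0" by (rule mean1)
 qed
 have zs: "(\<lambda>\<omega> m. ?z m \<omega>) \<in> M \<rightarrow>\<^sub>M seqs" by (rule measurable_seqsI) measurable
 note [measurable] = measurable_compose[OF zs cycle_quantities_measurable(1)] measurable_compose[OF zs cycle_quantities_measurable(2)]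
 have e_m[measurable]: "?e \<in> borel_measurable M" by (rule extinction_time_measurable[OF refl]) measurable
 have ext_m[measurable]: "(\<lambda>\<omega>. LINT \<tau>:{0..?e \<omega>}|lborel. g (process A \<beta> \<eta> xbar \<tau> \<omega>)) \<in> borel_measurable M"
  if [measurable]: "g \<in> borel_measurable borel" for g :: "'v \<Rightarrow> 'w"
  by (rule process_integral_measurable[OF refl]) measurable
 define \<mu> where "\<mu> = (LINT \<omega>|M. dur (\<lambda>m. ?z m \<omega>))"
 have \<mu>_e: "(LINT \<omega>|M. ?e \<omega>) = \<mu>" unfolding \<mu>_def
  using ret_z by (intro integral_cong_AE) (auto elim!: eventually_mono simp: first_extinction_eq(2)[OF refl])
 have rew_e: "(LINT \<omega>|M. (LINT \<tau>:{0..?e \<omega>}|lborel. \<Xi> (process A \<beta> \<eta> xbar \<tau> \<omega>))) = (LINT \<omega>|M. rew (\<lambda>m. ?z m \<omega>))"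
 proof (rule integral_cong_AE)
  show "AE \<omega> in M. (LINT \<tau>:{0..?e \<omega>}|lborel. \<Xi> (process A \<beta> \<eta> xbar \<tau> \<omega>)) = rew (\<lambda>m. ?z m \<omega>)"
   using good_z ret_z by eventually_elim (rule extinction_integral(1)[OF refl]; blast)
 qed measurable
 have \<nu>: "\<nu> = (1 / \<mu>) *\<^sub>R (LINT \<omega>|M. rew (\<lambda>m. ?z m \<omega>))" using nu unfolding \<mu>_e rew_e .
 note E = ergodic_cycles[OF assms(1) z_iid noise_x(1) x_distr good_x good_z int mean dur4 load4 \<nu>[unfolded \<mu>_def] I_m I_path, folded \<mu>_def]
 have mean_zero: "(LINT \<omega>|M. rew (\<lambda>m. ?z m \<omega>) - dur (\<lambda>m. ?z m \<omega>) *\<^sub>R \<nu>) = 0" by (rule E(2))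
 have slln: "AE \<omega> in M. ((\<lambda>t. (1 / t) *\<^sub>R (?I t \<omega> - t *\<^sub>R \<nu>)) \<longlongrightarrow> 0) at_top" by (rule E(3))
 have "AE \<omega> in M. ((\<lambda>t. (1 / t) *\<^sub>R ?I t \<omega>) \<longlongrightarrow> \<nu>) at_top"
  using slln
 proof eventually_elim
  case (elim \<omega>)
  have "((\<lambda>t. (1 / t) *\<^sub>R (?I t \<omega> - t *\<^sub>R \<nu>) + \<nu>) \<longlongrightarrow> \<nu>) at_top"
   using tendsto_add[OF elim tendsto_const[of \<nu>]] by simp
  moreover have "\<forall>\<^sub>F t in at_top. (1 / t) *\<^sub>R (?I t \<omega> - t *\<^sub>R \<nu>) + \<nu> = (1 / t) *\<^sub>R ?I t \<omega>"
   using eventually_gt_at_top[of "0::real"] by eventually_elim (simp add: scaleR_diff_right)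
  ultimately show ?case by (simp add: tendsto_cong)
 qed
 moreover have "\<exists>(N :: 'w measure) Z. prob_space N \<and> normal_rv N Z 0 Q \<and>
   converges_in_distr M (\<lambda>t \<omega>. (1 / sqrt t) *\<^sub>R (?I t \<omega> - t *\<^sub>R \<nu>)) N Z" if t2: "type_2 M TYPE('w)"
 proof -
  let ?Y = "\<lambda>\<omega>. sqrt (1 / \<mu>) *\<^sub>R (rew (\<lambda>m. ?z m \<omega>) - dur (\<lambda>m. ?z m \<omega>) *\<^sub>R \<nu>)"
  let ?C = "\<lambda>\<omega>. sqrt (1 / \<mu>) *\<^sub>R (LINT \<tau>:{0..?e \<omega>}|lborel. (\<Xi> (process A \<beta> \<eta> xbar \<tau> \<omega>) - \<nu>))"
  have C_m: "?C \<in> borel_measurable M" using ext_m[of "\<lambda>v. \<Xi> v - \<nu>"] by simp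
  have CY: "AE \<omega> in M. ?C \<omega> = ?Y \<omega>"
   using good_z ret_z by eventually_elim (subst extinction_integral(2)[OF refl]; blast)
  \<comment> \<open>By the choice of \<open>\<nu>\<close> the normalized cycle integral is centered,
    so its covariance reduces to a plain product moment.\<close>
  have "(LINT \<omega>|M. ?C \<omega>) = (LINT \<omega>|M. ?Y \<omega>)" by (rule integral_cong_AE[OF C_m _ CY]) measurable
  also have "\<dots> = 0" using mean_zero by simp
  finally have C0: "(LINT \<omega>|M. ?C \<omega>) = 0" .
  have cov: "Q \<psi>1 \<psi>2 = (LINT \<omega>|M. blinfun_apply \<psi>1 (?Y \<omega>) * blinfun_apply \<psi>2 (?Y \<omega>))" for \<psi>1 \<psi>2
  proof -
   have "Q \<psi>1 \<psi>2 = (LINT \<omega>|M. blinfun_apply \<psi>1 (?C \<omega>) * blinfun_apply \<psi>2 (?C \<omega>))"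
    unfolding Q \<mu>_e Cov_def C0 by simp
   also have "\<dots> = (LINT \<omega>|M. blinfun_apply \<psi>1 (?Y \<omega>) * blinfun_apply \<psi>2 (?Y \<omega>))"
   proof (rule integral_cong_AE)
    show "AE \<omega> in M. blinfun_apply \<psi>1 (?C \<omega>) * blinfun_apply \<psi>2 (?C \<omega>) = blinfun_apply \<psi>1 (?Y \<omega>) * blinfun_apply \<psi>2 (?Y \<omega>)"
     using CY by eventually_elim (simp only:)
   qed (use C_m in measurable)
   finally show ?thesis .
  qed
  have "\<exists>Z. Z \<in> borel_measurable gauss_seq \<and> integrable gauss_seq (\<lambda>x. (norm (Z x))\<^sup>2) \<and>
    (LINT x|gauss_seq. Z x) = 0 \<and> gaussian gauss_seq Z \<and>
    (\<forall>\<psi>1 \<psi>2 :: 'w \<Rightarrow>\<^sub>L real. (LINT x|gauss_seq. blinfun_apply \<psi>1 (Z x) * blinfun_apply \<psi>2 (Z x)) = Q \<psi>1 \<psi>2) \<and>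
    converges_in_distr M (\<lambda>t \<omega>. (1 / sqrt t) *\<^sub>R (?I t \<omega> - t *\<^sub>R \<nu>)) gauss_seq Z"
   unfolding cov by (rule E(4)[OF _ t2])
  then obtain Z where Z: "Z \<in> borel_measurable gauss_seq" "integrable gauss_seq (\<lambda>x. (norm (Z x))\<^sup>2)"
   "(LINT x|gauss_seq. Z x) = 0" "gaussian gauss_seq Z"
   "\<And>\<psi>1 \<psi>2 :: 'w \<Rightarrow>\<^sub>L real. (LINT x|gauss_seq. blinfun_apply \<psi>1 (Z x) * blinfun_apply \<psi>2 (Z x)) = Q \<psi>1 \<psi>2"
   "converges_in_distr M (\<lambda>t \<omega>. (1 / sqrt t) *\<^sub>R (?I t \<omega> - t *\<^sub>R \<nu>)) gauss_seq Z"
   by blast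
  have "prob_space (distr gauss_seq borel Z)" by (rule prob_space.prob_space_distr[OF prob_space_gauss_seq Z(1)])
  moreover note normal_rv_distr[OF prob_space_gauss_seq Z(1-4), of Q, OF Z(5)] converges_in_distr_distr[OF Z(6,1)]
  ultimately show ?thesis by blast
 qed
 ultimately show ?thesis by blast
qed

end
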